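(* Let $1<p<\infty$, $q,L>0$, $a\in(0,1)$ and let $u$ be a weak supersolution of $\partial_t(|u|^{q-1}u)+\mathcal{L}u=0$ in $\Omega\times(0,T)$. Assume that $\mu_-\le\operatorname*{ess\,inf}_{\mathbb{R}^n\times(0,T)}u$. Then there exists a constant $\theta>0$, depending only on $a,L,\mu_-$ and the data $n,p,q,s,\Lambda$, such that, if $t_0$ is a Lebesgue instant and $$u(\cdot,t_0)\ge\mu_-+L\quad\text{a.e. in }B_r(x_0),$$ then $$u\ge\mu_-+aL\quad\text{a.e. in }\mathcal{Q}^+\bigl(x_0,t_0;\tfrac{3r}{4},\theta\bigr).$$
   Context: Setting. $\Omega\subset\mathbb{R}^n$ is a bounded domain, $T>0$, $1<p<\infty$, $q>0$, $s\in(0,1)$, $\Lambda\ge 1$. The kernel $K(x,y,t)$ is measurable, symmetric in $x$ and $y$, and satisfies $\frac{\Lambda^{-1}}{|x-y|^{n+ps}}\le K(x,y,t)\le\frac{\Lambda}{|x-y|^{n+ps}}$ for almost every $x,y\in\mathbb{R}^n$, uniformly in $t\in(0,T)$. The operator is $\mathcal{L}u(x,t)=\mathrm{P.V.}\int_{\mathbb{R}^n}|u(x,t)-u(y,t)|^{p-2}(u(x,t)-u(y,t))K(x,y,t)\,dy$, where P.V. denotes the principal value. Write $\mathcal{A}(u(x,y,t))=|u(x,t)-u(y,t)|^{p-2}(u(x,t)-u(y,t))$ and $d\mu=K(x,y,t)\,dx\,dy$. Function spaces. For an open connected set $D\subset\mathbb{R}^n$, $W^{s,p}(D)$ is the space of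 $u\in L^p(D)$ with $\frac{|u(x)-u(y)|}{|x-y|^{n/p+s}}\in L^p(D\times D)$, with norm $\|u\|_{W^{s,p}(D)}=\big(\int_D|u|^p\,dx+\int_D\int_D\frac{|u(x)-u(y)|^p}{|x-y|^{n+ps}}\,dx\,dy\big)^{1/p}$, and $W_0^{s,p}(D)=\{u\in W^{s,p}(\mathbb{R}^n):u=0\text{ in }\mathbb{R}^n\setminus D\}$. $L^p(0,T;W^{s,p}(D))$ consists of measurable $u$ on $D\times(0,T)$ with $\int_0^T\|u(\cdot,t)\|_{W^{s,p}(D)}^p\,dt<\infty$; local versions require this on every $\Omega'\times[t_1,t_2]\Subset\Omega\times(0,T)$. Weak supersolution. A function $u:\mathbb{R}^n\times(0,T)\to\mathbb{R}$, $u\in L^\infty(0,T;L^\infty(\mathbb{R}^n))$, is a weak supersolution of $\partial_t(|u|^{q-1}u)+\mathcal{L}u=0$ in $\Omega\times(0,T)$ if $u\in L^{q+1}_{\mathrm{loc}}(0,T;L^{q+1}_{\mathrm{loc}}(\Omega))\cap L^p_{\mathrm{loc}}(0,T;W^{s,p}_{\mathrm{loc}}(\Omega))$ and for every $\Omega'\times[t_1,t_2]\Subset\Omega\times(0,T)$ and every nonnegative test function $\phi\in W^{1,q+1}_{\mathrm{loc}}(0,T;L^{q+1}(\Omega'))\cap L^p_{\mathrm{loc}}(0,T;W_0^{s,p}(\Omega'))$, $$\int_{t_1}^{t_2}\int_{\mathbb{R}^n}\int_{\mathbb{R}^n}\mathcal{A}(u(x,y,t))(\phi(x,t)-\phi(y,t))\,d\mu\,dt-\int_{t_1}^{t_2}\int_{\Omega'}|u|^{q-1}u\,\partial_t\phi\,dx\,dt+\int_{\Omega'}|u(x,t_2)|^{q-1}u(x,t_2)\phi(x,t_2)\,dx-\int_{\Omega'}|u(x,t_1)|^{q-1}u(x,t_1)\phi(x,t_1)\,dx\ge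 0.$$ The boundary terms at $t_1$ and $t_2$ are understood as $\lim_{h\to0}\frac1h\int_{t_1}^{t_1+h}\int_{\Omega'}|u|^{q-1}u\,\phi\,dx\,dt$ and $\lim_{h\to0}\frac1h\int_{t_2-h}^{t_2}\int_{\Omega'}|u|^{q-1}u\,\phi\,dx\,dt$, respectively. Cylinders. For $r,\theta>0$ and $(x_0,t_0)\in\mathbb{R}^n\times\mathbb{R}$, $\mathcal{Q}^+(x_0,t_0;r,\theta)=B_r(x_0)\times[t_0,t_0+\theta r^{sp})$, where $B_r(x_0)=\{x\in\mathbb{R}^n:|x-x_0|<r\}$. Lebesgue instant. $t_0\in(0,T)$ is a Lebesgue instant of $u$ if it is a Lebesgue point of the map $t\mapsto u(\cdot,t)$ with values in $L^1_{\mathrm{loc}}(\Omega)$, i.e. $\lim_{h\to0}\frac{1}{2h}\int_{t_0-h}^{t_0+h}\int_{\Omega'}|u(x,t)-u(x,t_0)|\,dx\,dt=0$ for every $\Omega'\Subset\Omega$.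
   Formalization: The ball B_r(x_0) is assumed to lie in Ω; without this the claim fails, e.g. u=1 in Ω and u dropping from 1 to 0 after t_0 outside Ω. The conclusion is asserted on the part of the cylinder with times in (0,T), where u is defined. *)

theory Defs
  imports "HOL-Analysis.Analysis" "HOL-Probability.Essential_Supremum"
begin

text \<open>
  Functions of space and time are curried, \<open>u x t\<close>. All measures are Lebesgue measures
  (not only their restrictions to Borel sets), and \<open>n = CARD('n)\<close>.
\<close>

subsection \<open>Domains, kernels\<close>

definition bounded_domain :: "(real^'n) set \<Rightarrow> bool" where
  "bounded_domain \<Omega> \<longleftrightarrow> open \<Omega> \<and> connected \<Omega> \<and> bounded \<Omega>"

definition compactly_inside :: "(real^'n) set \<Rightarrow> (real^'n) set \<Rightarrow> bool" where
  "compactly_inside D \<Omega> \<longleftrightarrow> open D \<and> compact (closure D) \<and> closure D \<subseteq> \<Omega>"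

definition admissible_kernel ::
    "real \<Rightarrow> real \<Rightarrow> real \<Rightarrow> real \<Rightarrow> (real^'n \<Rightarrow> real^'n \<Rightarrow> real \<Rightarrow> real) \<Rightarrow> bool" where
  "admissible_kernel p s \<Lambda> T K \<longleftrightarrow>
     (\<lambda>(x, y, t). K x y t) \<in> borel_measurable (lebesgue_on (UNIV \<times> UNIV \<times> {0<..<T})) \<and>
     (\<forall>t\<in>{0<..<T}. \<forall>x y. K x y t = K y x t) \<and>
     (\<forall>t\<in>{0<..<T}. AE (x, y) in lebesgue.
        inverse \<Lambda> / norm (x - y) powr (real CARD('n) + p * s) \<le> K x y t \<and>
        K x y t \<le> \<Lambda> / norm (x - y) powr (real CARD('n) + p * s))"


subsection \<open>Function spaces\<close>

text \<open>
  The \<open>p\<close>-th power of the \<open>W\<^sup>s\<^sup>,\<^sup>p(D)\<close> norm, with value \<open>\<infinity>\<close> allowed.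
\<close>

definition Wsp_norm_pow :: "real \<Rightarrow> real \<Rightarrow> (real^'n) set \<Rightarrow> (real^'n \<Rightarrow> real) \<Rightarrow> ennreal" where
  "Wsp_norm_pow s p D v =
     (\<integral>\<^sup>+ x. ennreal (\<bar>v x\<bar> powr p) \<partial>lebesgue_on D) +
     (\<integral>\<^sup>+ (x, y). ennreal (\<bar>v x - v y\<bar> powr p / norm (x - y) powr (real CARD('n) + p * s))
        \<partial>lebesgue_on (D \<times> D))"

definition Wsp :: "real \<Rightarrow> real \<Rightarrow> (real^'n) set \<Rightarrow> (real^'n \<Rightarrow> real) set" where
  "Wsp s p D = {v \<in> borel_measurable (lebesgue_on D). Wsp_norm_pow s p D v < \<infinity>}"

definition Wsp0 :: "real \<Rightarrow> real \<Rightarrow> (real^'n) set \<Rightarrow> (real^'n \<Rightarrow> real) set" where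
  "Wsp0 s p D = {v \<in> Wsp s p UNIV. AE x in lebesgue. x \<notin> D \<longrightarrow> v x = 0}"

text \<open>
  The spaces \<open>L\<^sup>r(I; L\<^sup>r(D)) = L\<^sup>r(D \<times> I)\<close>, \<open>L\<^sup>p(I; W\<^sup>s\<^sup>,\<^sup>p(D))\<close> and
  \<open>L\<^sup>p(I; W\<^sub>0\<^sup>s\<^sup>,\<^sup>p(D))\<close>. Elements of the last are functions on the whole space.
\<close>

definition LrLr :: "real \<Rightarrow> (real^'n) set \<Rightarrow> real set \<Rightarrow> (real^'n \<Rightarrow> real \<Rightarrow> real) set" where
  "LrLr r D I = {v. (\<lambda>(x, t). v x t) \<in> borel_measurable (lebesgue_on (D \<times> I)) \<and>
     (\<integral>\<^sup>+ (x, t). ennreal (\<bar>v x t\<bar> powr r) \<partial>lebesgue_on (D \<times> I)) < \<infinity>}"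

definition LpWsp :: "real \<Rightarrow> real \<Rightarrow> (real^'n) set \<Rightarrow> real set \<Rightarrow> (real^'n \<Rightarrow> real \<Rightarrow> real) set" where
  "LpWsp s p D I = {v. (\<lambda>(x, t). v x t) \<in> borel_measurable (lebesgue_on (D \<times> I)) \<and>
     (\<integral>\<^sup>+ t. Wsp_norm_pow s p D (\<lambda>x. v x t) \<partial>lebesgue_on I) < \<infinity>}"

definition LpWsp0 :: "real \<Rightarrow> real \<Rightarrow> (real^'n) set \<Rightarrow> real set \<Rightarrow> (real^'n \<Rightarrow> real \<Rightarrow> real) set" where
  "LpWsp0 s p D I = {v \<in> LpWsp s p UNIV I. AE t in lebesgue_on I. (\<lambda>x. v x t) \<in> Wsp0 s p D}"

text \<open>Smooth functions of one variable with compact support in \<open>(0, T)\<close>.\<close>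

definition Cc_infinity :: "real \<Rightarrow> (real \<Rightarrow> real) set" where
  "Cc_infinity T = {\<eta>. (\<forall>k t. ((deriv ^^ k) \<eta>) differentiable (at t)) \<and>
     (\<exists>a b. 0 < a \<and> b < T \<and> (\<forall>t. t \<notin> {a..b} \<longrightarrow> \<eta> t = 0))}"

text \<open>
  \<open>\<psi>\<close> is the weak derivative of \<open>\<phi>\<close>, both viewed as maps from \<open>(0, T)\<close> to functions on \<open>D\<close>.
  An equality of the vector-valued integrals is an equality almost everywhere in \<open>D\<close>.
\<close>

definition weak_time_deriv ::
    "(real^'n) set \<Rightarrow> real \<Rightarrow> (real^'n \<Rightarrow> real \<Rightarrow> real) \<Rightarrow> (real^'n \<Rightarrow> real \<Rightarrow> real) \<Rightarrow> bool" where
  "weak_time_deriv D T \<phi> \<psi> \<longleftrightarrow> (\<forall>\<eta>\<in>Cc_infinity T. AE x in lebesgue_on D.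
     (LINT t|lebesgue_on {0<..<T}. \<phi> x t * deriv \<eta> t) =
     - (LINT t|lebesgue_on {0<..<T}. \<psi> x t * \<eta> t))"

text \<open>
  \<open>\<phi> \<in> W\<^sup>1\<^sup>,\<^sup>q\<^sup>+\<^sup>1\<^sub>l\<^sub>o\<^sub>c(0, T; L\<^sup>q\<^sup>+\<^sup>1(D)) \<inter> L\<^sup>p\<^sub>l\<^sub>o\<^sub>c(0, T; W\<^sub>0\<^sup>s\<^sup>,\<^sup>p(D))\<close>,
  nonnegative, with weak time derivative \<open>\<psi>\<close>.
\<close>

definition test_function ::
    "real \<Rightarrow> real \<Rightarrow> real \<Rightarrow> (real^'n) set \<Rightarrow> real \<Rightarrow>
     (real^'n \<Rightarrow> real \<Rightarrow> real) \<Rightarrow> (real^'n \<Rightarrow> real \<Rightarrow> real) \<Rightarrow> bool" where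
  "test_function p q s D T \<phi> \<psi> \<longleftrightarrow>
     (\<forall>t1 t2. 0 < t1 \<longrightarrow> t1 < t2 \<longrightarrow> t2 < T \<longrightarrow>
        \<phi> \<in> LrLr (q + 1) D {t1..t2} \<and> \<psi> \<in> LrLr (q + 1) D {t1..t2} \<and>
        \<phi> \<in> LpWsp0 s p D {t1..t2}) \<and>
     weak_time_deriv D T \<phi> \<psi> \<and>
     (AE (x, t) in lebesgue_on (UNIV \<times> {0<..<T}). 0 \<le> \<phi> x t)"


subsection \<open>Weak supersolutions\<close>

text \<open>
  With \<open>0 powr \<alpha> = 0\<close> this is \<open>\<bar>z\<bar>\<^sup>\<alpha>\<^sup>-\<^sup>1 z\<close> for \<open>z \<noteq> 0\<close>, extended by \<open>0\<close>, for every real \<open>\<alpha>\<close>.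
\<close>

definition spow :: "real \<Rightarrow> real \<Rightarrow> real" where
  "spow \<alpha> z = \<bar>z\<bar> powr (\<alpha> - 1) * z"

text \<open>
  The triple integral is taken over the product. It converges absolutely for bounded \<open>u\<close> in
  \<open>L\<^sup>p\<^sub>l\<^sub>o\<^sub>c(W\<^sup>s\<^sup>,\<^sup>p\<^sub>l\<^sub>o\<^sub>c)\<close> and test functions \<open>\<phi>\<close> supported in \<open>D \<Subset> \<Omega>\<close>, so it is the iterated one.
\<close>

definition energy ::
    "real \<Rightarrow> (real^'n \<Rightarrow> real^'n \<Rightarrow> real \<Rightarrow> real) \<Rightarrow> (real^'n \<Rightarrow> real \<Rightarrow> real) \<Rightarrow>
     (real^'n \<Rightarrow> real \<Rightarrow> real) \<Rightarrow> real \<Rightarrow> real \<Rightarrow> real" where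
  "energy p K u \<phi> t1 t2 =
     (LINT (x, y, t)|lebesgue_on (UNIV \<times> UNIV \<times> {t1..t2}).
        spow (p - 1) (u x t - u y t) * (\<phi> x t - \<phi> y t) * K x y t)"

text \<open>
  \<open>b1\<close> and \<open>b2\<close> are the boundary terms at \<open>t1\<close> and \<open>t2\<close>, defined as limits of one-sided time
  averages. The existence of these limits is part of the definition.
\<close>

definition weak_supersolution ::
    "real \<Rightarrow> real \<Rightarrow> real \<Rightarrow> (real^'n) set \<Rightarrow> real \<Rightarrow>
     (real^'n \<Rightarrow> real^'n \<Rightarrow> real \<Rightarrow> real) \<Rightarrow> (real^'n \<Rightarrow> real \<Rightarrow> real) \<Rightarrow> bool" where
  "weak_supersolution p q s \<Omega> T K u \<longleftrightarrow>
     (\<lambda>(x, t). u x t) \<in> borel_measurable (lebesgue_on (UNIV \<times> {0<..<T})) \<and>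
     esssup (lebesgue_on (UNIV \<times> {0<..<T})) (\<lambda>(x, t). ereal \<bar>u x t\<bar>) < \<infinity> \<and>
     (\<forall>D t1 t2. compactly_inside D \<Omega> \<longrightarrow> connected D \<longrightarrow> 0 < t1 \<longrightarrow> t1 < t2 \<longrightarrow> t2 < T \<longrightarrow>
        u \<in> LrLr (q + 1) D {t1..t2} \<and> u \<in> LpWsp s p D {t1..t2} \<and>
        (\<forall>\<phi> \<psi>. test_function p q s D T \<phi> \<psi> \<longrightarrow>
          (\<exists>b1 b2.
             ((\<lambda>h. (1 / h) * (LINT (x, t)|lebesgue_on (D \<times> {t1..t1 + h}). spow q (u x t) * \<phi> x t))
                \<longlongrightarrow> b1) (at_right 0) \<and>
             ((\<lambda>h. (1 / h) * (LINT (x, t)|lebesgue_on (D \<times> {t2 - h..t2}). spow q (u x t) * \<phi> x t))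
                \<longlongrightarrow> b2) (at_right 0) \<and>
             energy p K u \<phi> t1 t2
               - (LINT (x, t)|lebesgue_on (D \<times> {t1..t2}). spow q (u x t) * \<psi> x t)
               + b2 - b1 \<ge> 0)))"


subsection \<open>Essential infimum, cylinders, Lebesgue instants\<close>

definition essinf :: "'a measure \<Rightarrow> ('a \<Rightarrow> ereal) \<Rightarrow> ereal" where
  "essinf M f = - esssup M (\<lambda>z. - f z)"

definition cylinder_plus ::
    "real \<Rightarrow> real \<Rightarrow> real^'n \<Rightarrow> real \<Rightarrow> real \<Rightarrow> real \<Rightarrow> ((real^'n) \<times> real) set" where
  "cylinder_plus s p x0 t0 r \<theta> = ball x0 r \<times> {t0..<t0 + \<theta> * r powr (s * p)}"

text \<open>
  Membership \<open>u(\<cdot>, t0) \<in> L\<^sup>1\<^sub>l\<^sub>o\<^sub>c(\<Omega>)\<close> has to be required explicitly: a single time slice of a measurable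
  function need not be measurable, and the Bochner integral of a nonintegrable function is \<open>0\<close>.
\<close>

definition lebesgue_instant ::
    "(real^'n) set \<Rightarrow> real \<Rightarrow> (real^'n \<Rightarrow> real \<Rightarrow> real) \<Rightarrow> real \<Rightarrow> bool" where
  "lebesgue_instant \<Omega> T u t0 \<longleftrightarrow> t0 \<in> {0<..<T} \<and>
     (\<forall>D. compactly_inside D \<Omega> \<longrightarrow>
        integrable (lebesgue_on D) (\<lambda>x. u x t0) \<and>
        ((\<lambda>h. (1 / (2 * h)) *
             (LINT (x, t)|lebesgue_on (D \<times> {t0 - h..t0 + h}). \<bar>u x t - u x t0\<bar>))
           \<longlongrightarrow> 0) (at_right 0))"

end

theory Submission
  imports Defs
begin

text \<open>
  De Giorgi iteration on \<open>U < k\<close> with the space-dependent levels \<open>k = \<mu> + L \<zeta> - \<delta>\<close>, where \<open>\<zeta>\<close> is a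
  Lipschitz cutoff equal to 1 on the smaller ball and \<open>\<delta>\<close> increases along the iteration. Because \<open>\<mu> \<le> U\<close> on
  the whole space, \<open>Z = max 0 (k - U)\<close> vanishes off the support of \<open>\<zeta>\<close>, so it is an admissible test function
  and the tail of \<open>U\<close> never enters: testing with \<open>Z\<close> bounds its Gagliardo energy by that of \<open>k\<close> on \<open>{U < k}\<close>.
  The time derivative is handled by testing with Steklov averages and the convexity of the excess, the
  primitive of \<open>Z\<close> as a function of \<open>spow q U\<close>; its initial value is zero because \<open>\<mu> + L \<le> U\<close> at time
  \<open>t0\<close>. A Faber-Krahn inequality on \<open>{Z > 0}\<close> replaces the Sobolev embedding and makes the measures of
  the sets \<open>{U < k}\<close> decay superlinearly, while their initial size is small when \<open>\<theta>\<close> is.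
  The equation is used for Borel representatives of \<open>u\<close> and \<open>K\<close>.
\<close>

section \<open>Signed powers and the excess function\<close>

text \<open>The constant \<theta> may depend on \<mu>, \<open>L\<close> and the data, but not on the
  upper bound \<open>M\<close> of \<open>U\<close>, although \<open>M\<close> enters finiteness,
  domination and the vanishing of the initial average. The quantitative steps look at
  \<open>U\<close> only where it lies below a level; there \<mu> \<le> \<open>U\<close> < \<mu> +
  \<open>L\<close>, so the lower bound of the excess needs only m = |\<mu>| + L.

  Since the excess starts from zero at \<open>t0\<close>, no cutoff in time remains after the limits
  and only the levels move. The gain comes from two drops of the level. Let Y_j be the space-time
  measure of {U < k_j}. The energy inequality bounds the excess at almost every time by a multiple
  of Y_j, so after one drop the spatial measure of {U < k_(j+1)} is at most a multiple of Y_j at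
  almost every time. Faber-Krahn on sets of that measure makes the second drop produce the factor
  Y_j^(p s / n) in front of Y_(j+1). Hence the recursion relates three consecutive levels, linearly
  in the middle one.\<close>

lemma spow_pos: "0 < z \<Longrightarrow> spow \<alpha> z = z powr \<alpha>"
  by (simp add: spow_def powr_diff)

lemma spow_0 [simp]: "spow \<alpha> 0 = 0"
  by (simp add: spow_def)

lemma spow_minus [simp]: "spow \<alpha> (- z) = - spow \<alpha> z"
  by (simp add: spow_def)

lemma abs_spow: "\<bar>spow \<alpha> z\<bar> = \<bar>z\<bar> powr \<alpha>"
  by (cases "z = 0") (auto simp: spow_def abs_mult powr_diff)

lemma spow_nonneg: "0 \<le> z \<Longrightarrow> 0 \<le> spow \<alpha> z"
  by (simp add: spow_def)

lemma spow_mono: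
  assumes "0 < \<alpha>" "x \<le> y" shows "spow \<alpha> x \<le> spow \<alpha> y"
proof -
  have pos: "spow \<alpha> x \<le> spow \<alpha> y" if "0 \<le> x" "x \<le> y" for x y :: real
    using that \<open>0 < \<alpha>\<close>
    by (cases "x = 0") (auto simp: spow_nonneg spow_pos intro: powr_mono2)
  consider "0 \<le> x" | "x < 0" "0 \<le> y" | "x < 0" "y < 0" by linarith
  then show ?thesis
  proof cases
    case 2
    then show ?thesis using spow_nonneg[of y \<alpha>] spow_nonneg[of "-x" \<alpha>] by simp
  next
    case 3
    then show ?thesis using pos[of "-y" "-x"] \<open>x \<le> y\<close> by simp
  qed (use pos assms in auto)
qed

lemma borel_measurable_spow [measurable]: "spow \<alpha> \<in> borel_measurable borel"
  unfolding spow_def by measurable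

text \<open>By monotonicity \<open>A\<close> may be replaced by B - D. If 2|B| \<le> D, then B - D
  \<le> -D/2 and the product is at most -(D/2)^(p-1) D = -2^(1-p) D^p. Otherwise D < 2|B|, and both
  the product and the missing term 2^(1-p) D^p are at most 2|B|^p, which together give the constant
  4.\<close>

lemma spow_truncated_le:
  assumes p: "1 < p" and D: "0 < D" and A: "A \<le> B - D"
  shows "spow (p - 1) A * D \<le> - (2 powr (1 - p)) * D powr p + 4 * \<bar>B\<bar> powr p"
proof -
  have Dp: "D powr (p - 1) * D = D powr p"
    using D by (simp add: powr_diff)
  have le: "spow (p - 1) A \<le> spow (p - 1) (B - D)"
    using spow_mono[OF _ A] p by simp
  show ?thesis
  proof (cases "2 * \<bar>B\<bar> \<le> D")
    case True
    have "spow (p - 1) (B - D) \<le> spow (p - 1) (- (D / 2))"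
      by (rule spow_mono) (use p True in auto)
    also have "\<dots> = - ((D / 2) powr (p - 1))"
      using D by (simp add: spow_pos)
    also have "(D / 2) powr (p - 1) = D powr (p - 1) * 2 powr (1 - p)"
      using D by (simp add: powr_divide powr_diff)
    finally have "spow (p - 1) A * D \<le> - (D powr (p - 1) * 2 powr (1 - p)) * D"
      using le D by (intro mult_right_mono) auto
    also have "\<dots> = - (2 powr (1 - p)) * D powr p"
      using Dp by (metis (no_types, opaque_lifting) mult.assoc mult.commute mult_minus_left)
    finally show ?thesis using powr_ge_zero[of "\<bar>B\<bar>" p] by linarith
  next
    case False
    then have B: "0 < \<bar>B\<bar>" and DB: "D \<le> 2 * \<bar>B\<bar>" using D by auto
    have "spow (p - 1) (B - D) \<le> spow (p - 1) \<bar>B\<bar>"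
      by (rule spow_mono) (use p D in auto)
    also have "\<dots> = \<bar>B\<bar> powr (p - 1)" using B by (simp add: spow_pos)
    finally have "spow (p - 1) A * D \<le> \<bar>B\<bar> powr (p - 1) * D"
      using le D by (intro mult_right_mono) auto
    also have "\<dots> \<le> \<bar>B\<bar> powr (p - 1) * (2 * \<bar>B\<bar>)"
      using DB by (intro mult_left_mono) auto
    also have "\<dots> = 2 * \<bar>B\<bar> powr p"
      using B by (simp add: powr_diff)
    finally have 1: "spow (p - 1) A * D \<le> 2 * \<bar>B\<bar> powr p" .
    have "2 powr (1 - p) * D powr p \<le> 2 powr (1 - p) * (2 * \<bar>B\<bar>) powr p"
      using DB D p by (intro mult_left_mono powr_mono2) auto
    also have "\<dots> = 2 * \<bar>B\<bar> powr p"
      by (simp add: powr_mult powr_diff)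
    finally show ?thesis using 1 by linarith
  qed
qed

text \<open>Suppose Zx > Zy. Then kx - ux = Zx while ky - uy \<le> Zy, hence ux - uy \<le> (kx - ky)
  - (Zx - Zy), which is the hypothesis of \<open>spow_truncated_le\<close> with D = Zx - Zy and B =
  kx - ky. The second point need not lie below its level: a large \<open>uy\<close> only makes the
  flux more negative, so no bound on it is involved. The opposite case follows by oddness.\<close>

lemma spow_diff_pos_part_le:
  fixes kx ky ux uy :: real
  assumes p: "1 < p"
  defines "Zx \<equiv> max 0 (kx - ux)" and "Zy \<equiv> max 0 (ky - uy)"
  shows "spow (p - 1) (ux - uy) * (Zx - Zy) \<le>
    - (2 powr (1 - p)) * \<bar>Zx - Zy\<bar> powr p + (if 0 < Zx \<or> 0 < Zy then 4 * \<bar>kx - ky\<bar> powr p else 0)"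
proof (cases Zx Zy rule: linorder_cases)
  case less
  have "spow (p - 1) (uy - ux) * (Zy - Zx) \<le> - (2 powr (1 - p)) * (Zy - Zx) powr p + 4 * \<bar>ky - kx\<bar> powr p"
    by (rule spow_truncated_le) (use p less in \<open>auto simp: Zx_def Zy_def max_def split: if_splits\<close>)
  moreover have "spow (p - 1) (uy - ux) = - spow (p - 1) (ux - uy)"
    using spow_minus[of "p - 1" "ux - uy"] by simp
  moreover have "0 < Zy" using less unfolding Zx_def Zy_def by simp
  ultimately show ?thesis using less by (simp add: abs_minus_commute algebra_simps)
next
  case equal
  then show ?thesis using p by simp
next
  case greater
  have "spow (p - 1) (ux - uy) * (Zx - Zy) \<le> - (2 powr (1 - p)) * (Zx - Zy) powr p + 4 * \<bar>kx - ky\<bar> powr p"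
    by (rule spow_truncated_le) (use p greater in \<open>auto simp: Zx_def Zy_def max_def split: if_splits\<close>)
  moreover have "0 < Zx" using greater unfolding Zx_def Zy_def by simp
  ultimately show ?thesis using greater by simp
qed

definition spow_primitive :: "real \<Rightarrow> real \<Rightarrow> real" where
  "spow_primitive q z = \<bar>z\<bar> powr (q + 1) / (q + 1)"

text \<open>
  \<open>excess q k u\<close> is the integral of \<open>spow q \<tau> - spow q u\<close> over \<open>\<tau> \<in> [u, k]\<close>. As a function of
  \<open>spow q u\<close> it is convex with slope \<open>- max 0 (k - u)\<close>.
\<close>

definition excess :: "real \<Rightarrow> real \<Rightarrow> real \<Rightarrow> real" where
  "excess q k u =
     (if u < k then spow_primitive q k - spow_primitive q u - spow q u * (k - u) else 0)"

lemma borel_measurable_excess [measurable]: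
  assumes "f \<in> borel_measurable M" "g \<in> borel_measurable M"
  shows "(\<lambda>x. excess q (f x) (g x)) \<in> borel_measurable M"
  using assms unfolding excess_def spow_primitive_def by measurable

text \<open>Subgradient inequality for the convex function |z|^(q+1)/(q+1), derived from Young's
  inequality so that no derivative at 0 is discussed. With q = p - 1 it is also the supporting line
  of |z|^p.\<close>

lemma spow_primitive_convex:
  assumes "0 < q"
  shows "spow q x * (y - x) \<le> spow_primitive q y - spow_primitive q x"
proof -
  have xx: "spow q x * x = \<bar>x\<bar> powr (q + 1)"
    by (cases "x = 0") (auto simp: spow_def powr_diff powr_add abs_if)
  have "spow q x * y \<le> \<bar>x\<bar> powr q * \<bar>y\<bar>"
    by (metis abs_ge_self abs_mult abs_spow)
  also have "\<dots> \<le> (q / (q + 1)) * \<bar>x\<bar> powr (q + 1) + (1 / (q + 1)) * \<bar>y\<bar> powr (q + 1)"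
  proof (cases "x = 0 \<or> y = 0")
    case False
    have "(\<bar>x\<bar> powr (q+1)) powr (q/(q+1)) * (\<bar>y\<bar> powr (q+1)) powr (1/(q+1)) \<le>
       (q/(q+1)) * \<bar>x\<bar> powr (q+1) + (1/(q+1)) * \<bar>y\<bar> powr (q+1)"
      by (rule Youngs_inequality_0) (use assms False in \<open>auto simp: field_simps\<close>)
    moreover have "(q + 1) * (q / (q + 1)) = q" "(q + 1) * (1 / (q + 1)) = 1"
      using assms by auto
    ultimately show ?thesis unfolding powr_powr by (simp only:) simp
  qed (use assms in auto)
  finally have "spow q x * y \<le> (q / (q + 1)) * \<bar>x\<bar> powr (q + 1) + spow_primitive q y"
    by (simp add: spow_primitive_def)
  moreover have "(q / (q + 1)) * \<bar>x\<bar> powr (q + 1) = \<bar>x\<bar> powr (q + 1) - spow_primitive q x"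
    using assms by (simp add: spow_primitive_def field_simps)
  ultimately show ?thesis using xx by (simp add: algebra_simps)
qed

lemma excess_nonneg: "0 < q \<Longrightarrow> 0 \<le> excess q k u"
  using spow_primitive_convex[of q u k] by (simp add: excess_def)

text \<open>If both values lie below \<open>k\<close>, the claim unfolds to the subgradient
  inequality of \<open>spow_primitive\<close> at \<open>u\<close>. If u \<ge> k,
  \<open>spow q u\<close> is first lowered to \<open>spow q k\<close>. The inequality replaces the
  chain rule for the time derivative: it compares two arbitrary times and therefore survives
  discretization.\<close>

lemma excess_diff_ge:
  assumes q: "0 < q"
  shows "max 0 (k - u') * (spow q u' - spow q u) \<le> excess q k u - excess q k u'"
proof (cases "u' < k")
  case True
  show ?thesis
  proof (cases "u < k")
    case True
    then show ?thesis
      using \<open>u' < k\<close> spow_primitive_convex[OF q, of u u'] by (simp add: excess_def algebra_simps)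
  next
    case False
    have "spow q u * (k - u') \<ge> spow q k * (k - u')"
      using False True spow_mono[OF q, of k u] by (intro mult_right_mono) auto
    then show ?thesis
      using \<open>u' < k\<close> False spow_primitive_convex[OF q, of k u']
      by (simp add: excess_def algebra_simps)
  qed
qed (use excess_nonneg[OF q] in \<open>simp add: excess_def\<close>)

text \<open>A crude linear bound is enough, as it serves only integrability and the vanishing of the
  initial average. Its constant involves a bound for |u| from above, so it must stay out of the
  iteration constants.\<close>

lemma excess_le:
  assumes q: "0 < q" and "\<bar>k\<bar> \<le> m" "\<bar>u\<bar> \<le> m"
  shows "excess q k u \<le> 2 * m powr q * max 0 (k - u)"
proof (cases "u < k")
  case True
  have "spow_primitive q k - spow_primitive q u \<le> spow q k * (k - u)"
    using spow_primitive_convex[OF q, of k u] by (simp add: algebra_simps)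
  then have "excess q k u \<le> (spow q k - spow q u) * (k - u)"
    using True by (simp add: excess_def algebra_simps)
  also have "\<dots> \<le> (2 * m powr q) * (k - u)"
  proof (rule mult_right_mono)
    have "\<bar>spow q k\<bar> \<le> m powr q" "\<bar>spow q u\<bar> \<le> m powr q"
      unfolding abs_spow using assms by (auto intro!: powr_mono2)
    then show "spow q k - spow q u \<le> 2 * m powr q" by linarith
  qed (use True in auto)
  finally show ?thesis using True by simp
qed (simp add: excess_def)

section \<open>Quantitative monotonicity of powers and the lower bound for the excess\<close>

lemma powr_diff_ge:
  fixes x y :: real
  assumes q: "0 < q" and "0 \<le> x" "x \<le> y" "0 < y"
  shows "min 1 q * y powr (q - 1) * (y - x) \<le> y powr q - x powr q"
proof -
  \<comment> \<open>Homogeneity reduces the claim to y = 1. For q \<ge> 1 it is r^q \<le> r, for q <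
    1 it is the tangent line of r^q at r = 1.\<close>
  define r where "r = x / y"
  have r: "0 \<le> r" "r \<le> 1" using assms by (auto simp: r_def)
  have "min 1 q * (1 - r) \<le> 1 - r powr q"
  proof (cases "1 \<le> q")
    case True
    then have "r powr q \<le> r" using r powr_mono'[of 1 q r] by (cases "r = 0") auto
    then show ?thesis using True r by simp
  next
    case False
    have "r powr q * 1 powr (1 - q) \<le> q * r + (1 - q) * 1"
      by (cases "r = 0", use q False in simp, rule Youngs_inequality_0) (use q False r in auto)
    then show ?thesis using False by (simp add: algebra_simps)
  qed
  then have "y powr q * (min 1 q * (1 - r)) \<le> y powr q * (1 - r powr q)"
    by (intro mult_left_mono) auto
  moreover have "y powr q * r powr q = x powr q"
    using assms by (simp add: r_def powr_divide)
  moreover have "y powr q * (1 - r) = y powr (q - 1) * (y - x)"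
    using \<open>0 < y\<close> by (simp add: r_def powr_diff field_simps)
  ultimately show ?thesis
    by (metis (no_types, opaque_lifting) mult.assoc mult.left_commute right_diff_distrib' mult.right_neutral)
qed

text \<open>The natural lower bound has order \<delta>^q for q \<ge> 1 and order m^(q-1) \<delta>
  for q < 1. Since \<delta> \<le> 2m, the single exponent q + 1 covers both at the price of a
  constant and keeps the later iteration free of case distinctions in \<open>q\<close>.\<close>

lemma spow_diff_ge:
  assumes q: "0 < q" and m: "0 < m"
  shows "\<exists>c>0. \<forall>x y \<delta>. \<bar>x\<bar> \<le> m \<longrightarrow> \<bar>y\<bar> \<le> m \<longrightarrow> 0 < \<delta> \<longrightarrow> \<delta> \<le> y - x \<longrightarrow>
    c * \<delta> powr (q + 1) \<le> spow q y - spow q x"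
proof -
  \<comment> \<open>The first entry is the constant of the case q < 1 below, the second that of the
    case q \<ge> 1.\<close>
  define c where "c = min (min 1 q * m powr (q-1) / 2 / (2*m) powr q) (min 1 q / 2 powr q / (2 * m))"
  have c: "0 < c" using q m by (simp add: c_def)
  have pos: "c * \<delta> powr (q + 1) \<le> spow q y - spow q x"
    if y: "\<delta> / 2 \<le> y" "y \<le> m" "- m \<le> x" and \<delta>: "0 < \<delta>" "\<delta> \<le> y - x" for x y \<delta>
  proof -
    define x' where "x' = max 0 x"
    have x': "0 \<le> x'" "x' \<le> y" "\<delta> / 2 \<le> y - x'" "0 < y" using y \<delta> by (auto simp: x'_def)
    have sx: "spow q x \<le> x' powr q"
    proof (cases "0 < x")
      case True then show ?thesis by (simp add: x'_def spow_pos)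
    next
      case False
      then have "spow q x \<le> 0" using spow_nonneg[of "-x" q] by simp
      then show ?thesis by (meson order_trans powr_ge_zero)
    qed
    have "min 1 q * y powr (q - 1) * (\<delta> / 2) \<le> min 1 q * y powr (q - 1) * (y - x')"
      using x' q by (intro mult_left_mono) auto
    also have "\<dots> \<le> y powr q - x' powr q"
      by (rule powr_diff_ge) (use x' q in auto)
    also have "\<dots> \<le> spow q y - spow q x" using sx x' by (simp add: spow_pos)
    finally have 1: "min 1 q * y powr (q - 1) * (\<delta> / 2) \<le> spow q y - spow q x" .
    have \<delta>m: "\<delta> \<le> 2 * m" using y \<delta> by simp
    have "c * \<delta> powr (q + 1) \<le> min 1 q * y powr (q - 1) * (\<delta> / 2)"
    proof (cases "1 \<le> q")
      case True
      have "c * \<delta> powr (q + 1) \<le> min 1 q / 2 powr q / (2 * m) * (\<delta> powr q * (2 * m))"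
        unfolding powr_add c_def using \<delta>m \<delta> q m by (intro mult_mono mult_left_mono) auto
      also have "\<dots> = min 1 q / 2 powr q * \<delta> powr q" using m by simp
      also have "\<dots> = min 1 q * (\<delta> / 2) powr (q - 1) * (\<delta> / 2)"
        using \<delta> by (simp add: powr_divide powr_diff)
      also have "\<dots> \<le> min 1 q * y powr (q - 1) * (\<delta> / 2)"
        using True \<delta> y by (intro mult_right_mono mult_left_mono powr_mono2) auto
      finally show ?thesis .
    next
      case False
      have "c * \<delta> powr (q + 1) \<le> min 1 q * m powr (q-1) / 2 / (2*m) powr q * ((2 * m) powr q * \<delta>)"
        unfolding powr_add c_def using \<delta>m \<delta> q m by (intro mult_mono powr_mono2) auto
      also have "\<dots> = min 1 q * m powr (q-1) * (\<delta> / 2)" using m by simp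
      also have "\<dots> \<le> min 1 q * y powr (q - 1) * (\<delta> / 2)"
        using False \<delta> y q x' by (intro mult_right_mono mult_left_mono powr_mono2') auto
      finally show ?thesis .
    qed
    with 1 show ?thesis by linarith
  qed
  have "c * \<delta> powr (q + 1) \<le> spow q y - spow q x"
    if "\<bar>x\<bar> \<le> m" "\<bar>y\<bar> \<le> m" "0 < \<delta>" "\<delta> \<le> y - x" for x y \<delta>
  \<comment> \<open>If y < \<delta>/2, then -x \<ge> \<delta> - y > \<delta>/2, and oddness of
    \<open>spow q\<close> exchanges the pair (x, y) with (-y, -x).\<close>
  proof (cases "\<delta> / 2 \<le> y")
    case True
    then show ?thesis using that by (intro pos) auto
  next
    case False
    have "c * \<delta> powr (q + 1) \<le> spow q (- x) - spow q (- y)"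
      using that False by (intro pos) auto
    then show ?thesis by simp
  qed
  with c show ?thesis by blast
qed

text \<open>The excess integrates spow q \<tau> - spow q u over [u, k]. On the upper half of this
  interval the integrand is at least its value at the midpoint \<open>w\<close>, which
  \<open>spow_diff_ge\<close> bounds from below; the length (k - u)/2 raises the exponent to q + 2.
  Thus every point that lies a height \<delta> below the level carries a definite amount of
  excess.\<close>

lemma excess_ge:
  assumes q: "0 < q" and m: "0 < m"
  shows "\<exists>c>0. \<forall>u k \<delta>. \<bar>u\<bar> \<le> m \<longrightarrow> \<bar>k\<bar> \<le> m \<longrightarrow> 0 < \<delta> \<longrightarrow> \<delta> \<le> k - u \<longrightarrow>
    c * \<delta> powr (q + 2) \<le> excess q k u"
proof -
  obtain c where c: "0 < c" and H: "\<And>x y \<delta>. \<bar>x\<bar> \<le> m \<Longrightarrow> \<bar>y\<bar> \<le> m \<Longrightarrow> 0 < \<delta> \<Longrightarrow> \<delta> \<le> y - x \<Longrightarrow>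
    c * \<delta> powr (q + 1) \<le> spow q y - spow q x"
    using spow_diff_ge[OF assms] by metis
  define c' where "c' = c / 2 powr (q + 2)"
  have "c' * \<delta> powr (q + 2) \<le> excess q k u"
    if "\<bar>u\<bar> \<le> m" "\<bar>k\<bar> \<le> m" "0 < \<delta>" "\<delta> \<le> k - u" for u k \<delta>
  proof -
    define w where "w = (u + k) / 2"
    have "c * (\<delta> / 2) powr (q + 1) \<le> spow q w - spow q u"
      by (rule H) (use that in \<open>auto simp: w_def\<close>)
    then have "c * (\<delta> / 2) powr (q + 1) * (\<delta> / 2) \<le> (spow q w - spow q u) * ((k - u) / 2)"
      using that spow_mono[OF q, of u w] by (intro mult_mono) (auto simp: w_def)
    also have "\<dots> \<le> excess q k u"
      using spow_primitive_convex[OF q, of w k] spow_primitive_convex[OF q, of u w] that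
      by (simp add: excess_def w_def field_simps)
    finally have "c * (\<delta> / 2) powr (q + 1) * (\<delta> / 2) \<le> excess q k u" .
    moreover have "c * (\<delta> / 2) powr (q + 1) * (\<delta> / 2) = c' * \<delta> powr (q + 2)"
      using that by (simp add: c'_def powr_divide powr_add power2_eq_square)
    ultimately show ?thesis by simp
  qed
  moreover have "0 < c'" using c by (simp add: c'_def)
  ultimately show ?thesis by blast
qed

text \<open>Choose \<kappa> with b \<kappa>^\<beta> = 1 and \<epsilon> with C \<epsilon>^\<beta> =
  \<kappa>. Then the recursion reproduces y_j \<le> \<epsilon> \<kappa>^j: the growth b^j is
  compensated by (\<kappa>^j)^\<beta>, and one factor \<kappa> is left for the next step. The
  induction carries two consecutive bounds because the recursion is linear in the middle term; y_0
  \<le> \<epsilon> \<kappa> together with monotonicity supplies both at the start.\<close>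

lemma fast_geometric_convergence:
  fixes C b \<beta> :: real
  assumes "0 < C" "1 < b" "0 < \<beta>"
  shows "\<exists>\<delta>>0. \<forall>y :: nat \<Rightarrow> real. (\<forall>j. 0 \<le> y j) \<longrightarrow> (\<forall>j. y (Suc j) \<le> y j) \<longrightarrow>
    (\<forall>j. y (Suc (Suc j)) \<le> C * b ^ j * y (Suc j) * y j powr \<beta>) \<longrightarrow> y 0 \<le> \<delta> \<longrightarrow> y \<longlonglongrightarrow> 0"
proof -
  define \<kappa> where "\<kappa> = b powr (- (1 / \<beta>))"
  have "\<kappa> powr \<beta> = inverse b"
    using assms unfolding \<kappa>_def powr_powr by (simp add: powr_minus)
  then have \<kappa>: "0 < \<kappa>" "\<kappa> < 1" "b * \<kappa> powr \<beta> = 1"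
    using assms by (auto simp: \<kappa>_def powr_minus_divide)
  define \<epsilon> where "\<epsilon> = (\<kappa> / C) powr (1 / \<beta>)"
  have \<epsilon>: "0 < \<epsilon>" "C * \<epsilon> powr \<beta> = \<kappa>"
    using assms \<kappa> by (auto simp: \<epsilon>_def powr_powr)
  have "y \<longlonglongrightarrow> 0"
    if y: "\<And>j. 0 \<le> y j" "\<And>j. y (Suc j) \<le> y j"
      "\<And>j. y (Suc (Suc j)) \<le> C * b ^ j * y (Suc j) * y j powr \<beta>" "y 0 \<le> \<epsilon> * \<kappa>"
    for y :: "nat \<Rightarrow> real"
  proof -
    have "y j \<le> \<epsilon> * \<kappa> ^ j \<and> y (Suc j) \<le> \<epsilon> * \<kappa> ^ Suc j" for j
    proof (induction j)
      case 0
      have "y 0 \<le> \<epsilon>" using y(4) \<kappa> \<epsilon> by (meson less_imp_le mult_left_le order_trans)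
      moreover have "y 1 \<le> \<epsilon> * \<kappa>" using y(2)[of 0] y(4) by simp
      ultimately show ?case by simp
    next
      case (Suc j)
      have "y (Suc (Suc j)) \<le> C * b ^ j * y (Suc j) * y j powr \<beta>" by (rule y)
      also have "\<dots> \<le> C * b ^ j * (\<epsilon> * \<kappa> ^ Suc j) * (\<epsilon> * \<kappa> ^ j) powr \<beta>"
        using assms Suc y \<epsilon> \<kappa> by (intro mult_mono powr_mono2) auto
      also have "(\<epsilon> * \<kappa> ^ j) powr \<beta> = \<epsilon> powr \<beta> * (\<kappa> powr \<beta>) ^ j"
        using \<epsilon> \<kappa> by (simp add: powr_mult powr_powr powr_realpow[symmetric] mult.commute)
      also have "C * b ^ j * (\<epsilon> * \<kappa> ^ Suc j) * (\<epsilon> powr \<beta> * (\<kappa> powr \<beta>) ^ j) =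
          (C * \<epsilon> powr \<beta>) * (b * \<kappa> powr \<beta>) ^ j * (\<epsilon> * \<kappa> ^ Suc j)"
        by (simp add: power_mult_distrib mult_ac)
      also have "\<dots> = \<epsilon> * \<kappa> ^ Suc (Suc j)" using \<kappa> \<epsilon> by simp
      finally show ?case using Suc by simp
    qed
    moreover have "(\<lambda>j. \<epsilon> * \<kappa> ^ j) \<longlonglongrightarrow> 0"
      using \<kappa> by (intro tendsto_mult_right_zero LIMSEQ_power_zero) auto
    ultimately show ?thesis
      using y(1) by (intro tendsto_sandwich[of "\<lambda>_. 0" y _ "\<lambda>j. \<epsilon> * \<kappa> ^ j"]) auto
  qed
  then show ?thesis using \<epsilon> \<kappa> by (intro exI[of _ "\<epsilon> * \<kappa>"]) auto
qed

section \<open>Translations and averages\<close>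

lemma integrable_shift:
  fixes f :: "real \<Rightarrow> real"
  assumes "integrable lborel f"
  shows "integrable lborel (\<lambda>t. f (t + c))" "(LINT t|lborel. f (t + c)) = (LINT t|lborel. f t)"
  using lborel_integrable_real_affine[OF assms, of 1 c] lborel_integral_real_affine[of 1 f c]
  by (simp_all add: add.commute)

text \<open>Passes from the translation modulus of an approximation \<open>g\<close> to that of
  \<open>f\<close>, with \<open>d\<close> in the role of |f - g|. The hypothesis in difference form
  is immediate pointwise for indicators of A \<subseteq> U with \<open>d\<close> the indicator of U
  - A.\<close>

lemma L1_translation_perturb:
  fixes f g d :: "real \<Rightarrow> real"
  assumes "integrable lborel f" "integrable lborel g" "integrable lborel d"
    and le: "\<And>s t. \<bar>f s - f t\<bar> \<le> \<bar>g s - g t\<bar> + d s + d t"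
  shows "(LINT t|lborel. \<bar>f (t + c) - f t\<bar>) \<le> (LINT t|lborel. \<bar>g (t + c) - g t\<bar>) + 2 * (LINT t|lborel. d t)"
proof -
  note I = assms(1-3) assms(1-3)[THEN integrable_shift(1), of c]
  have J: "integrable lborel (\<lambda>t. \<bar>f (t + c) - f t\<bar>)" "integrable lborel (\<lambda>t. \<bar>g (t + c) - g t\<bar>)"
    using I by (intro integrable_abs Bochner_Integration.integrable_diff; simp)+
  have "(LINT t|lborel. \<bar>f (t + c) - f t\<bar>) \<le> (LINT t|lborel. \<bar>g (t + c) - g t\<bar> + (d (t + c) + d t))"
    using le[of "t + c" t for t] I J
    by (intro integral_mono Bochner_Integration.integrable_add) (auto simp: add.assoc)
  also have "\<dots> = (LINT t|lborel. \<bar>g (t + c) - g t\<bar>) + ((LINT t|lborel. d (t + c)) + (LINT t|lborel. d t))"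
    using I J by simp
  also have "(LINT t|lborel. d (t + c)) = (LINT t|lborel. d t)"
    by (rule integrable_shift(2)[OF assms(3)])
  finally show ?thesis by simp
qed

text \<open>Continuity of translations in L^1, by induction over integrable functions. For an
  indicator, outer regularity replaces the set by an open \<open>U\<close>. For open
  \<open>U\<close> the loss max 0 (1_U(t) - 1_U(t + \<sigma>)) tends to 0 at every point and is
  dominated by 1_U. The gain may fail to converge at boundary points, but it has the same integral
  as the loss because translations preserve measure.\<close>

lemma L1_translation_limit:
  fixes f :: "real \<Rightarrow> real"
  assumes f: "integrable lborel f" and \<sigma>: "\<sigma> \<longlonglongrightarrow> 0"
  shows "(\<lambda>n. LINT t|lborel. \<bar>f (t + \<sigma> n) - f t\<bar>) \<longlonglongrightarrow> 0"
  using f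
proof (induction rule: integrable_induct)
  {
    case (base A c)
    then have A: "A \<in> sets borel" "emeasure lborel A < \<infinity>" by auto
    have ind: "(\<lambda>n. LINT t|lborel. \<bar>indicator A (t + \<sigma> n) - indicator A t :: real\<bar>) \<longlonglongrightarrow> 0"
    proof (rule LIMSEQ_I)
      fix r :: real assume "0 < r"
      then obtain U where U: "open U" "A \<subseteq> U" "emeasure lborel (U - A) < ennreal (r / 4)"
        using outer_regular_lborel[OF A(1), of "r / 4"] by auto
      have Um: "U \<in> sets borel" using U by auto
      have "emeasure lborel U \<le> emeasure lborel A + emeasure lborel (U - A)"
        using U A by (metis Un_Diff_cancel Un_absorb1 borel_open emeasure_subadditive sets.Diff sets_lborel)
      also have "\<dots> < \<infinity>" using A U by (simp add: order.strict_trans)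
      finally have Ufin: "emeasure lborel U < \<infinity>" .
      have intU: "integrable lborel (indicator U :: real \<Rightarrow> real)"
        and intA: "integrable lborel (indicator A :: real \<Rightarrow> real)"
        using Um Ufin A by (auto intro!: integrable_real_indicator)
      have dfin: "emeasure lborel (U - A) < \<infinity>" using U(3) by (simp add: order.strict_trans)
      have intD: "integrable lborel (indicator (U - A) :: real \<Rightarrow> real)"
        using Um A dfin by (auto intro!: integrable_real_indicator)
      have "ennreal (measure lborel (U - A)) < ennreal (r / 4)"
        using U(3) dfin by (simp add: emeasure_eq_ennreal_measure)
      then have D: "(LINT t|lborel. indicator (U - A) t) < r / 4"
        using \<open>0 < r\<close> by (simp add: ennreal_less_iff)
      have "(\<lambda>n. LINT t|lborel. max 0 (indicator U t - indicator U (t + \<sigma> n)) :: real) \<longlonglongrightarrow> (LINT t::real|lborel. 0::real)"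
      proof (rule integral_dominated_convergence[where w = "\<lambda>t::real. indicator U t"])
        show "AE t in lborel. (\<lambda>n. max 0 (indicator U t - indicator U (t + \<sigma> n)) :: real) \<longlonglongrightarrow> 0"
        proof (intro always_eventually allI)
          fix t
          show "(\<lambda>n. max 0 (indicator U t - indicator U (t + \<sigma> n)) :: real) \<longlonglongrightarrow> 0"
          proof (cases "t \<in> U")
            case True
            have "(\<lambda>n. t + \<sigma> n) \<longlonglongrightarrow> t" using tendsto_add[OF tendsto_const \<sigma>, of t] by simp
            then have "\<forall>\<^sub>F n in sequentially. t + \<sigma> n \<in> U"
              using U(1) True by (rule topological_tendstoD)
            then show ?thesis
              using True by (intro tendsto_eventually) (auto elim!: eventually_mono)
          qed (simp add: max_absorb1)
        qed
        show "integrable lborel (\<lambda>t::real. indicator U t :: real)" by (rule intU)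
      qed (use Um in \<open>auto simp: indicator_def\<close>)
      then have "\<forall>\<^sub>F n in sequentially. (LINT t|lborel. max 0 (indicator U t - indicator U (t + \<sigma> n)) :: real) < r / 4"
        using \<open>0 < r\<close> by (intro order_tendstoD(2)[of _ "0::real"]) auto
      moreover have "norm ((LINT t|lborel. \<bar>indicator A (t + \<sigma> n) - indicator A t :: real\<bar>) - 0) < r"
        if n: "(LINT t|lborel. max 0 (indicator U t - indicator U (t + \<sigma> n)) :: real) < r / 4" for n
      proof -
        note I = intU integrable_shift(1)[OF intU, of "\<sigma> n"]
        \<comment> \<open>Here |b - a| = 2 max 0 (a - b) + (b - a), and the last bracket integrates
          to zero.\<close>
        have Uabs: "(LINT t|lborel. \<bar>indicator U (t + \<sigma> n) - indicator U t :: real\<bar>) =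
            2 * (LINT t|lborel. max 0 (indicator U t - indicator U (t + \<sigma> n)) :: real)"
        proof -
          have "(LINT t|lborel. \<bar>indicator U (t + \<sigma> n) - indicator U t :: real\<bar>) =
            (LINT t|lborel. 2 * max 0 (indicator U t - indicator U (t + \<sigma> n)) + (indicator U (t + \<sigma> n) - indicator U t) :: real)"
            by (intro Bochner_Integration.integral_cong) (auto simp: indicator_def)
          also have "\<dots> = 2 * (LINT t|lborel. max 0 (indicator U t - indicator U (t + \<sigma> n)) :: real)
              + ((LINT t|lborel. indicator U (t + \<sigma> n)) - (LINT t|lborel. indicator U t))"
            using I by simp
          also have "(LINT t|lborel. indicator U (t + \<sigma> n)) = (LINT t|lborel. indicator U t :: real)"
            by (rule integrable_shift(2)[OF intU])
          finally show ?thesis by simp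
        qed
        have "(LINT t|lborel. \<bar>indicator A (t + \<sigma> n) - indicator A t :: real\<bar>) \<le>
          (LINT t|lborel. \<bar>indicator U (t + \<sigma> n) - indicator U t :: real\<bar>) + 2 * (LINT t|lborel. indicator (U - A) t)"
          by (rule L1_translation_perturb[OF intA intU intD]) (use U(2) in \<open>auto simp: indicator_def\<close>)
        then show ?thesis using Uabs n D by simp
      qed
      ultimately have "\<forall>\<^sub>F n in sequentially. norm ((LINT t|lborel. \<bar>indicator A (t + \<sigma> n) - indicator A t :: real\<bar>) - 0) < r"
        by (rule eventually_mono)
      then show "\<exists>no. \<forall>n\<ge>no. norm ((LINT t|lborel. \<bar>indicator A (t + \<sigma> n) - indicator A t :: real\<bar>) - 0) < r"
        unfolding eventually_sequentially .
    qed
    have "\<bar>indicator A (t + \<sigma> n) *\<^sub>R c - indicator A t *\<^sub>R c\<bar> =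
        \<bar>c\<bar> * \<bar>indicator A (t + \<sigma> n) - indicator A t :: real\<bar>" for n t
      by (auto simp: indicator_def)
    then show ?case using tendsto_mult_right_zero[OF ind, of "\<bar>c\<bar>"] by simp
  next
    case (add f g)
    have lim0: "(\<lambda>n. (LINT t|lborel. \<bar>f (t + \<sigma> n) - f t\<bar>) + (LINT t|lborel. \<bar>g (t + \<sigma> n) - g t\<bar>)) \<longlonglongrightarrow> 0"
      using tendsto_add[OF add.IH(1) add.IH(2)] by simp
    have le: "(LINT t|lborel. \<bar>f (t + \<sigma> n) + g (t + \<sigma> n) - (f t + g t)\<bar>) \<le>
      (LINT t|lborel. \<bar>f (t + \<sigma> n) - f t\<bar>) + (LINT t|lborel. \<bar>g (t + \<sigma> n) - g t\<bar>)" for n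
    proof -
      note I = add.hyps integrable_shift(1)[OF add.hyps(1), of "\<sigma> n"] integrable_shift(1)[OF add.hyps(2), of "\<sigma> n"]
      have "(LINT t|lborel. \<bar>f (t + \<sigma> n) + g (t + \<sigma> n) - (f t + g t)\<bar>) \<le>
          (LINT t|lborel. \<bar>f (t + \<sigma> n) - f t\<bar> + \<bar>g (t + \<sigma> n) - g t\<bar>)"
        using I by (intro integral_mono) auto
      also have "\<dots> = (LINT t|lborel. \<bar>f (t + \<sigma> n) - f t\<bar>) + (LINT t|lborel. \<bar>g (t + \<sigma> n) - g t\<bar>)"
        using I by (intro Bochner_Integration.integral_add) auto
      finally show ?thesis .
    qed
    show ?case
    proof (rule Lim_null_comparison[OF always_eventually lim0], rule allI)
      show "norm (LINT t|lborel. \<bar>f (t + \<sigma> n) + g (t + \<sigma> n) - (f t + g t)\<bar>) \<le>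
          (LINT t|lborel. \<bar>f (t + \<sigma> n) - f t\<bar>) + (LINT t|lborel. \<bar>g (t + \<sigma> n) - g t\<bar>)" for n
      proof -
        have "0 \<le> (LINT t|lborel. \<bar>f (t + \<sigma> n) + g (t + \<sigma> n) - (f t + g t)\<bar>)"
          by (rule Bochner_Integration.integral_nonneg) simp
        then show ?thesis using le[of n] by (simp only: real_norm_def abs_of_nonneg)
      qed
    qed
  next
    case (lim f s)
    have "(\<lambda>i. LINT t|lborel. \<bar>f t - s i t\<bar>) \<longlonglongrightarrow> (LINT t::real|lborel. 0::real)"
    proof (rule integral_dominated_convergence[where w = "\<lambda>t. 3 * \<bar>f t\<bar>"])
      have "(\<lambda>i. s i t) \<longlonglongrightarrow> f t" for t using lim.hyps(2) by simp
      then have "(\<lambda>i. \<bar>f t - s i t\<bar>) \<longlonglongrightarrow> \<bar>f t - f t\<bar>" for t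
        by (intro tendsto_intros)
      then show "AE t in lborel. (\<lambda>i. \<bar>f t - s i t\<bar>) \<longlonglongrightarrow> 0" by simp
      have "\<bar>f t - s i t\<bar> \<le> 3 * \<bar>f t\<bar>" for i t
        using lim.hyps(3)[of t i] by simp
      then show "\<And>i. AE t in lborel. norm \<bar>f t - s i t\<bar> \<le> 3 * \<bar>f t\<bar>" by simp
    qed (use lim.hyps(1,4) in auto)
    then have i0: "(\<lambda>i. LINT t|lborel. \<bar>f t - s i t\<bar>) \<longlonglongrightarrow> 0" by simp
    show ?case
    proof (rule LIMSEQ_I)
      fix r :: real assume "0 < r"
      then have "\<forall>\<^sub>F i in sequentially. (LINT t|lborel. \<bar>f t - s i t\<bar>) < r / 4"
        using order_tendstoD(2)[OF i0, of "r/4"] by auto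
      then obtain i where i: "(LINT t|lborel. \<bar>f t - s i t\<bar>) < r / 4"
        using eventually_happens by fastforce
      have fi: "integrable lborel f" "integrable lborel (s i)" by (rule lim.hyps(4), rule lim.hyps(1))
      have "(\<lambda>n. LINT t|lborel. \<bar>s i (t + \<sigma> n) - s i t\<bar>) \<longlonglongrightarrow> 0" by (rule lim.IH)
      then have "\<forall>\<^sub>F n in sequentially. (LINT t|lborel. \<bar>s i (t + \<sigma> n) - s i t\<bar>) < r / 4"
        using \<open>0 < r\<close> by (intro order_tendstoD(2)) auto
      moreover have "norm ((LINT t|lborel. \<bar>f (t + \<sigma> n) - f t\<bar>) - 0) < r"
        if n: "(LINT t|lborel. \<bar>s i (t + \<sigma> n) - s i t\<bar>) < r / 4" for n
      proof -
        have d: "integrable lborel (\<lambda>t. \<bar>f t - s i t\<bar>)" using fi by auto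
        have "(LINT t|lborel. \<bar>f (t + \<sigma> n) - f t\<bar>) \<le>
          (LINT t|lborel. \<bar>s i (t + \<sigma> n) - s i t\<bar>) + 2 * (LINT t|lborel. \<bar>f t - s i t\<bar>)"
          by (rule L1_translation_perturb[OF fi d]) arith
        then show ?thesis using n i \<open>0 < r\<close> by simp
      qed
      ultimately have "\<forall>\<^sub>F n in sequentially. norm ((LINT t|lborel. \<bar>f (t + \<sigma> n) - f t\<bar>) - 0) < r"
        by (rule eventually_mono)
      then show "\<exists>no. \<forall>n\<ge>no. norm ((LINT t|lborel. \<bar>f (t + \<sigma> n) - f t\<bar>) - 0) < r"
        unfolding eventually_sequentially .
    qed
  }
qed

text \<open>One-sided Lebesgue differentiation without maximal functions: the averages over
  [t, t + h] converge to \<open>f\<close> in L^1 by continuity of translations, so a subsequence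
  converges almost everywhere, which is enough for an inequality. It converts bounds for time
  averages into bounds at almost every time.\<close>

lemma AE_le_of_interval_integrals:
  fixes f :: "real \<Rightarrow> real"
  assumes f: "integrable lborel f"
    and le: "\<And>\<tau> h. a < \<tau> \<Longrightarrow> 0 < h \<Longrightarrow> \<tau> + h < b \<Longrightarrow> (LINT t|lborel. indicator {\<tau>..\<tau> + h} t * f t) \<le> h * C"
  shows "AE t in lborel. a < t \<and> t < b \<longrightarrow> f t \<le> C"
proof -
  have [measurable]: "f \<in> borel_measurable borel" using f by auto
  define h where "h n = inverse (real (Suc n))" for n
  have h: "0 < h n" "h n \<le> 1" for n by (auto simp: h_def inverse_le_1_iff)
  have h0: "h \<longlonglongrightarrow> 0" unfolding h_def by (rule LIMSEQ_inverse_real_of_nat)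
  \<comment> \<open>Written over the fixed interval [0, 1], the average minus \<open>f\<close>
    becomes an average over \<sigma> of translation differences, whose L^1 norms are the quantities
    I n \<sigma> below.\<close>
  define A where "A n t = (LINT \<sigma>|lborel. indicator {0..1} \<sigma> * f (t + h n * \<sigma>))" for n t
  have A_eq: "A n t = (LINT u|lborel. indicator {t..t + h n} u * f u) / h n" for n t
  proof -
    have "(LINT u|lborel. indicator {t..t + h n} u * f u) =
        h n * (LINT \<sigma>|lborel. indicator {t..t + h n} (t + h n * \<sigma>) * f (t + h n * \<sigma>))"
      using lborel_integral_real_affine[of "h n" "\<lambda>u. indicator {t..t + h n} u * f u" t] h(1)[of n] by simp
    also have "(LINT \<sigma>|lborel. indicator {t..t + h n} (t + h n * \<sigma>) * f (t + h n * \<sigma>)) = A n t"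
      unfolding A_def using h(1)[of n]
      by (intro Bochner_Integration.integral_cong) (auto simp: indicator_def mult_le_cancel_left1 zero_le_mult_iff)
    finally show ?thesis using h(1)[of n] by simp
  qed
  have shift: "integrable lborel (\<lambda>t. f (t + c))" for c
    by (rule integrable_shift(1)[OF f])
  have fshift: "(LINT t|lborel. \<bar>f (t + c)\<bar>) = (LINT t|lborel. \<bar>f t\<bar>)" for c
    using lborel_integral_real_affine[of 1 "\<lambda>t. \<bar>f t\<bar>" c] by (simp add: add.commute)
  define I where "I n \<sigma> = (LINT t|lborel. \<bar>f (t + h n * \<sigma>) - f t\<bar>)" for n \<sigma>
  have I_le: "I n \<sigma> \<le> 2 * (LINT t|lborel. \<bar>f t\<bar>)" for n \<sigma>
  proof -
    have "I n \<sigma> \<le> (LINT t|lborel. \<bar>f (t + h n * \<sigma>)\<bar> + \<bar>f t\<bar>)"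
      unfolding I_def using f shift by (intro integral_mono) auto
    also have "\<dots> = 2 * (LINT t|lborel. \<bar>f t\<bar>)"
      using f shift[of "h n * \<sigma>"] fshift[of "h n * \<sigma>"] by (subst Bochner_Integration.integral_add) auto
    finally show ?thesis .
  qed
  have I_nonneg: "0 \<le> I n \<sigma>" for n \<sigma> unfolding I_def by simp
  have [measurable]: "(\<lambda>(\<sigma>, t). f (t + h n * \<sigma>)) \<in> borel_measurable (lborel \<Otimes>\<^sub>M lborel)" for n by measurable
  have Im[measurable]: "I n \<in> borel_measurable lborel" for n
    unfolding I_def by measurable
  have I0: "(\<lambda>n. LINT \<sigma>|lborel. indicator {0..1} \<sigma> * I n \<sigma>) \<longlonglongrightarrow> (LINT \<sigma>::real|lborel. (0::real))"
  proof (rule integral_dominated_convergence[where w = "\<lambda>\<sigma>::real. indicator {0..1} \<sigma> * (2 * (LINT t|lborel. \<bar>f t\<bar>))"])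
    have "(\<lambda>n. I n \<sigma>) \<longlonglongrightarrow> 0" for \<sigma>
      unfolding I_def by (rule L1_translation_limit[OF f]) (use tendsto_mult_left_zero[OF h0] in simp)
    then show "AE \<sigma> in lborel. (\<lambda>n. indicator {0..1} \<sigma> * I n \<sigma>) \<longlonglongrightarrow> 0"
      by (auto intro!: tendsto_mult_right_zero)
    show "AE \<sigma> in lborel. norm (indicator {0..1} \<sigma> * I n \<sigma>) \<le> indicator {0..1} \<sigma> * (2 * (LINT t|lborel. \<bar>f t\<bar>))" for n
      using I_le I_nonneg by (auto simp: indicator_def)
  qed auto
  have int2: "integrable (lborel \<Otimes>\<^sub>M lborel) (\<lambda>(\<sigma>, t). indicator {0..1} \<sigma> * (f (t + h n * \<sigma>) - f t))" for n
  proof (rule lborel_pair.Fubini_integrable)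
    have "(LINT t|lborel. norm (indicator {0..1} \<sigma> * (f (t + h n * \<sigma>) - f t))) = indicator {0..1} \<sigma> * I n \<sigma>" for \<sigma>
      unfolding I_def by (auto simp: abs_mult)
    moreover have "integrable lborel (\<lambda>\<sigma>. indicator {0..1} \<sigma> * I n \<sigma>)"
    proof (rule Bochner_Integration.integrable_bound)
      show "integrable lborel (\<lambda>\<sigma>::real. indicator {0..1} \<sigma> * (2 * (LINT t|lborel. \<bar>f t\<bar>)))"
        by (intro integrable_mult_left) simp
      show "AE \<sigma> in lborel. norm (indicator {0..1} \<sigma> * I n \<sigma>) \<le> norm (indicator {0..1} \<sigma> * (2 * (LINT t|lborel. \<bar>f t\<bar>)))"
        using I_le I_nonneg by (intro always_eventually allI) (auto simp: indicator_def)
    qed auto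
    ultimately show "integrable lborel (\<lambda>\<sigma>. LINT t|lborel. norm (case (\<sigma>, t) of (\<sigma>, t) \<Rightarrow> indicator {0..1} \<sigma> * (f (t + h n * \<sigma>) - f t)))"
      by simp
    show "AE \<sigma> in lborel. integrable lborel (\<lambda>t. case (\<sigma>, t) of (\<sigma>, t) \<Rightarrow> indicator {0..1} \<sigma> * (f (t + h n * \<sigma>) - f t))"
      using f shift by auto
  qed measurable
  have [measurable]: "A n \<in> borel_measurable lborel" for n
    unfolding A_def by measurable
  have AE_int: "AE t in lborel. integrable lborel (\<lambda>\<sigma>. indicator {0..1} \<sigma> * (f (t + h n * \<sigma>) - f t))" for n
    using lborel_pair.AE_integrable_snd[OF int2[of n]] .
  have A_diff: "AE t in lborel. A n t - f t = (LINT \<sigma>|lborel. indicator {0..1} \<sigma> * (f (t + h n * \<sigma>) - f t))" for n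
    using AE_int[of n]
  proof eventually_elim
    case (elim t)
    have c: "integrable lborel (\<lambda>\<sigma>::real. indicator {0..1} \<sigma> * f t)"
      by (intro integrable_mult_left) simp
    have "A n t = (LINT \<sigma>|lborel. indicator {0..1} \<sigma> * (f (t + h n * \<sigma>) - f t) + indicator {0..1} \<sigma> * f t)"
      unfolding A_def by (intro Bochner_Integration.integral_cong) (auto simp: algebra_simps)
    also have "\<dots> = (LINT \<sigma>|lborel. indicator {0..1} \<sigma> * (f (t + h n * \<sigma>) - f t)) + (LINT \<sigma>::real|lborel. indicator {0..1} \<sigma> * f t)"
      using elim c by (intro Bochner_Integration.integral_add) simp_all
    also have "(LINT \<sigma>::real|lborel. indicator {0..1} \<sigma> * f t) = f t"
      by simp
    finally show ?case by simp
  qed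
  have intAf: "integrable lborel (\<lambda>t. A n t - f t)" for n
  proof -
    have i: "integrable lborel (\<lambda>t. LINT \<sigma>|lborel. indicator {0..1} \<sigma> * (f (t + h n * \<sigma>) - f t))"
      using lborel_pair.integrable_snd[OF int2[of n]] .
    show ?thesis
      by (rule integrable_cong_AE_imp[OF i]) (use A_diff[of n] in \<open>auto elim: eventually_mono\<close>)
  qed
  have Af_le: "(LINT t|lborel. \<bar>A n t - f t\<bar>) \<le> (LINT \<sigma>|lborel. indicator {0..1} \<sigma> * I n \<sigma>)" for n
  proof -
    have i3: "integrable (lborel \<Otimes>\<^sub>M lborel) (\<lambda>(\<sigma>, t). \<bar>indicator {0..1} \<sigma> * (f (t + h n * \<sigma>) - f t)\<bar>)"
      using integrable_abs[OF int2[of n]] by (simp add: case_prod_beta')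
    have "(LINT t|lborel. \<bar>A n t - f t\<bar>) \<le> (LINT t|lborel. LINT \<sigma>|lborel. \<bar>indicator {0..1} \<sigma> * (f (t + h n * \<sigma>) - f t)\<bar>)"
    proof (rule integral_mono_AE)
      show "integrable lborel (\<lambda>t. LINT \<sigma>|lborel. \<bar>indicator {0..1} \<sigma> * (f (t + h n * \<sigma>) - f t)\<bar>)"
        using lborel_pair.integrable_snd[OF i3] .
      show "AE t in lborel. \<bar>A n t - f t\<bar> \<le> (LINT \<sigma>|lborel. \<bar>indicator {0..1} \<sigma> * (f (t + h n * \<sigma>) - f t)\<bar>)"
        using A_diff[of n] by eventually_elim (metis integral_abs_bound)
    qed (use intAf in auto)
    also have "\<dots> = (LINT \<sigma>|lborel. LINT t|lborel. \<bar>indicator {0..1} \<sigma> * (f (t + h n * \<sigma>) - f t)\<bar>)"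
      by (rule lborel_pair.Fubini_integral[OF i3])
    also have "\<dots> = (LINT \<sigma>|lborel. indicator {0..1} \<sigma> * I n \<sigma>)"
      unfolding I_def by (simp add: abs_mult)
    finally show ?thesis .
  qed
  have L1: "(\<lambda>n. LINT t|lborel. norm (A n t - f t)) \<longlonglongrightarrow> 0"
    by (rule Lim_null_comparison[OF always_eventually I0[simplified]]) (use Af_le in simp)
  obtain r where r: "strict_mono r" "AE t in lborel. (\<lambda>n. A (r n) t - f t) \<longlonglongrightarrow> 0"
    using tendsto_L1_AE_subseq[OF intAf L1] by auto
  show ?thesis
    using r(2)
  proof eventually_elim
    case (elim t)
    show ?case
    proof
      assume t: "a < t \<and> t < b"
      have "(\<lambda>n. h (r n)) \<longlonglongrightarrow> 0" using LIMSEQ_subseq_LIMSEQ[OF h0 r(1)] by (simp add: o_def)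
      then have "\<forall>\<^sub>F n in sequentially. h (r n) < b - t"
        using t by (intro order_tendstoD(2)) auto
      then have ev: "\<forall>\<^sub>F n in sequentially. A (r n) t \<le> C"
      proof eventually_elim
        case (elim n)
        then show ?case unfolding A_eq using le[of t "h (r n)"] t h(1)[of "r n"] by (simp add: field_simps)
      qed
      have "(\<lambda>n. A (r n) t - f t + f t) \<longlonglongrightarrow> 0 + f t" using elim by (intro tendsto_intros)
      then show "f t \<le> C" using ev by (intro tendsto_upperbound[of "\<lambda>n. A (r n) t"]) auto
    qed
  qed
qed

section \<open>The fractional kernel and a Faber-Krahn inequality\<close>

lemma nn_integral_powr_annulus_le:
  fixes \<alpha> r :: real
  assumes r: "0 < r"
  shows "(\<integral>\<^sup>+(h::'a::euclidean_space). ennreal (1 / norm h powr \<alpha>) * indicator {h. r \<le> norm h \<and> norm h < 2 * r} h \<partial>lborel)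
    \<le> ennreal (2 powr \<bar>\<alpha>\<bar> * 2 ^ DIM('a) * measure lborel (ball (0::'a) 1) * r powr (real DIM('a) - \<alpha>))"
proof -
  have ptw: "1 / t powr \<alpha> \<le> 2 powr \<bar>\<alpha>\<bar> * r powr (- \<alpha>)" if t: "r \<le> t" "t < 2 * r" for t
  proof (cases "0 \<le> \<alpha>")
    case True
    have "1 / t powr \<alpha> \<le> 1 / r powr \<alpha>"
      using t r True by (intro divide_left_mono powr_mono2) auto
    also have "\<dots> \<le> 2 powr \<bar>\<alpha>\<bar> * r powr (- \<alpha>)"
      using True ge_one_powr_ge_zero[of 2 "\<bar>\<alpha>\<bar>"] mult_right_mono[of 1 "2 powr \<alpha>" "r powr (- \<alpha>)"]
      by (simp add: powr_minus_divide)
    finally show ?thesis .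
  next
    case False
    have "1 / t powr \<alpha> = t powr (- \<alpha>)" by (simp add: powr_minus_divide)
    also have "\<dots> \<le> (2 * r) powr (- \<alpha>)" using t r False by (intro powr_mono2) auto
    also have "\<dots> = 2 powr \<bar>\<alpha>\<bar> * r powr (- \<alpha>)" using False r by (simp add: powr_mult)
    finally show ?thesis .
  qed
  have "(\<integral>\<^sup>+(h::'a). ennreal (1 / norm h powr \<alpha>) * indicator {h. r \<le> norm h \<and> norm h < 2 * r} h \<partial>lborel)
      \<le> (\<integral>\<^sup>+(h::'a). ennreal (2 powr \<bar>\<alpha>\<bar> * r powr (- \<alpha>)) * indicator (ball 0 (2 * r)) h \<partial>lborel)"
    by (rule nn_integral_mono) (auto simp: indicator_def intro!: ennreal_leI ptw)
  also have "\<dots> = ennreal (2 powr \<bar>\<alpha>\<bar> * r powr (- \<alpha>)) * emeasure lborel (ball (0::'a) (2 * r))"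
    by (simp add: nn_integral_cmult_indicator)
  also have "emeasure lborel (ball (0::'a) (2 * r)) = ennreal ((2 * r) ^ DIM('a) * measure lborel (ball (0::'a) 1))"
    using emeasure_lborel_ball_finite[of "0::'a" "2 * r"] content_ball_conv_unit_ball[of "2 * r" "0::'a"] r
    by (simp add: emeasure_eq_ennreal_measure)
  also have "ennreal (2 powr \<bar>\<alpha>\<bar> * r powr (- \<alpha>)) * ennreal ((2 * r) ^ DIM('a) * measure lborel (ball (0::'a) 1)) =
      ennreal (2 powr \<bar>\<alpha>\<bar> * 2 ^ DIM('a) * measure lborel (ball (0::'a) 1) * r powr (real DIM('a) - \<alpha>))"
    using r by (subst ennreal_mult[symmetric]) (auto simp: powr_diff powr_minus_divide powr_realpow power_mult_distrib)
  finally show ?thesis .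
qed

text \<open>The annuli of inner radius \<rho> \<beta>^i cover \<open>S\<close> up to the origin, and
  their contributions form a geometric series of ratio \<beta>^(n - \<alpha>), where n is the
  dimension. The choice \<beta> = 2 handles the exterior of a ball for \<alpha> > n, the choice
  \<beta> = 1/2 the ball itself for \<alpha> < n.\<close>

lemma nn_integral_powr_dyadic_le:
  fixes \<alpha> \<beta> \<rho> :: real and S :: "'a::euclidean_space set"
  assumes \<rho>: "0 < \<rho>" and \<beta>: "0 < \<beta>" "\<beta> powr (real DIM('a) - \<alpha>) < 1"
    and S: "\<And>h. h \<in> S \<Longrightarrow> h \<noteq> 0 \<Longrightarrow> \<exists>i. \<rho> * \<beta> ^ i \<le> norm h \<and> norm h < 2 * (\<rho> * \<beta> ^ i)"
  shows "(\<integral>\<^sup>+h. ennreal (1 / norm h powr \<alpha>) * indicator S h \<partial>lborel)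
    \<le> ennreal (2 powr \<bar>\<alpha>\<bar> * 2 ^ DIM('a) * measure lborel (ball (0::'a) 1) / (1 - \<beta> powr (real DIM('a) - \<alpha>))
        * \<rho> powr (real DIM('a) - \<alpha>))"
proof -
  define A where "A i = {h::'a. \<rho> * \<beta> ^ i \<le> norm h \<and> norm h < 2 * (\<rho> * \<beta> ^ i)}" for i :: nat
  define c where "c = 2 powr \<bar>\<alpha>\<bar> * 2 ^ DIM('a) * measure lborel (ball (0::'a) 1)"
  have c: "0 \<le> c" by (simp add: c_def)
  define f where "f h = ennreal (1 / norm h powr \<alpha>)" for h :: 'a
  have [measurable]: "f \<in> borel_measurable borel" unfolding f_def by measurable
  have Am: "A i \<in> sets borel" for i unfolding A_def by measurable
  have "(\<integral>\<^sup>+h. f h * indicator S h \<partial>lborel) \<le> (\<integral>\<^sup>+h. (\<Sum>i. f h * indicator (A i) h) \<partial>lborel)"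
  proof (rule nn_integral_mono)
    fix h :: 'a
    show "f h * indicator S h \<le> (\<Sum>i. f h * indicator (A i) h)"
    proof (cases "h \<in> S \<and> h \<noteq> 0")
      case True
      then obtain i where "h \<in> A i" using S unfolding A_def by blast
      then have "f h * indicator S h \<le> (\<Sum>i\<in>{i}. f h * indicator (A i) h)"
        by (simp add: indicator_def)
      also have "\<dots> \<le> (\<Sum>i. f h * indicator (A i) h)"
        by (rule sum_le_suminf) auto
      finally show ?thesis .
    qed (auto simp: f_def)
  qed
  also have "\<dots> = (\<Sum>i. \<integral>\<^sup>+h. f h * indicator (A i) h \<partial>lborel)"
    using Am by (intro nn_integral_suminf) (auto intro!: borel_measurable_times_ennreal borel_measurable_indicator)
  also have "\<dots> \<le> (\<Sum>i. ennreal (c * \<rho> powr (real DIM('a) - \<alpha>) * (\<beta> powr (real DIM('a) - \<alpha>)) ^ i))"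
  proof (intro suminf_le summableI)
    fix i
    have "(\<integral>\<^sup>+h. f h * indicator (A i) h \<partial>lborel) \<le> ennreal (c * (\<rho> * \<beta> ^ i) powr (real DIM('a) - \<alpha>))"
      unfolding f_def A_def c_def by (rule nn_integral_powr_annulus_le) (use \<rho> \<beta> in auto)
    also have "(\<rho> * \<beta> ^ i) powr (real DIM('a) - \<alpha>) = \<rho> powr (real DIM('a) - \<alpha>) * (\<beta> powr (real DIM('a) - \<alpha>)) ^ i"
      using \<rho> \<beta> by (simp add: powr_mult powr_powr powr_realpow[symmetric] mult.commute)
    finally show "(\<integral>\<^sup>+h. f h * indicator (A i) h \<partial>lborel) \<le>
        ennreal (c * \<rho> powr (real DIM('a) - \<alpha>) * (\<beta> powr (real DIM('a) - \<alpha>)) ^ i)"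
      by (simp add: mult.assoc)
  qed
  also have "\<dots> = ennreal (\<Sum>i. c * \<rho> powr (real DIM('a) - \<alpha>) * (\<beta> powr (real DIM('a) - \<alpha>)) ^ i)"
    using c \<beta> by (intro suminf_ennreal2 summable_mult summable_geometric) auto
  also have "(\<Sum>i. c * \<rho> powr (real DIM('a) - \<alpha>) * (\<beta> powr (real DIM('a) - \<alpha>)) ^ i) =
      c / (1 - \<beta> powr (real DIM('a) - \<alpha>)) * \<rho> powr (real DIM('a) - \<alpha>)"
    using \<beta> by (subst suminf_mult) (auto simp: suminf_geometric intro!: summable_geometric)
  finally show ?thesis unfolding f_def c_def .
qed

lemma nn_integral_powr_outside_ball:
  fixes \<alpha> :: real
  assumes "real DIM('a::euclidean_space) < \<alpha>"
  shows "\<exists>C>0. \<forall>\<rho>>0. (\<integral>\<^sup>+(h::'a). ennreal (1 / norm h powr \<alpha>) * indicator {h. \<rho> \<le> norm h} h \<partial>lborel)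
    \<le> ennreal (C * \<rho> powr (real DIM('a) - \<alpha>))"
proof -
  have b: "2 powr (real DIM('a) - \<alpha>) < 1"
    using assms powr_less_mono[of "real DIM('a) - \<alpha>" 0 2] by simp
  have S: "\<exists>i. \<rho> * 2 ^ i \<le> norm h \<and> norm h < 2 * (\<rho> * 2 ^ i)" if "0 < \<rho>" "\<rho> \<le> norm h" for \<rho> and h :: 'a
  proof -
    obtain n where n: "norm h / \<rho> < 2 ^ n" using real_arch_pow[of 2 "norm h / \<rho>"] by auto
    define m where "m = (LEAST n. norm h / \<rho> < 2 ^ n)"
    have m: "norm h / \<rho> < 2 ^ m" unfolding m_def using n by (rule LeastI)
    have "m \<noteq> 0" using m that by (intro notI) (simp add: field_simps)
    then obtain i where i: "m = Suc i" by (cases m) auto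
    then have "\<not> norm h / \<rho> < 2 ^ i" using not_less_Least[of i "\<lambda>n. norm h / \<rho> < 2 ^ n"] by (simp add: m_def)
    then show ?thesis using m i that by (intro exI[of _ i]) (simp add: field_simps)
  qed
  define C where "C = 2 powr \<bar>\<alpha>\<bar> * 2 ^ DIM('a) * measure lborel (ball (0::'a) 1) / (1 - 2 powr (real DIM('a) - \<alpha>))"
  have "0 < C" unfolding C_def using b content_ball_pos[of 1 "0::'a"] by (intro divide_pos_pos mult_pos_pos) auto
  moreover have "(\<integral>\<^sup>+(h::'a). ennreal (1 / norm h powr \<alpha>) * indicator {h. \<rho> \<le> norm h} h \<partial>lborel)
      \<le> ennreal (C * \<rho> powr (real DIM('a) - \<alpha>))" if "0 < \<rho>" for \<rho>
    unfolding C_def by (rule nn_integral_powr_dyadic_le) (use b S that in auto)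
  ultimately show ?thesis by blast
qed

lemma nn_integral_powr_ball:
  fixes \<alpha> :: real
  assumes "\<alpha> < real DIM('a::euclidean_space)"
  shows "\<exists>C>0. \<forall>\<rho>>0. (\<integral>\<^sup>+(h::'a). ennreal (1 / norm h powr \<alpha>) * indicator {h. norm h < \<rho>} h \<partial>lborel)
    \<le> ennreal (C * \<rho> powr (real DIM('a) - \<alpha>))"
proof -
  have b: "(1/2) powr (real DIM('a) - \<alpha>) < 1"
    using assms by (simp add: powr_divide)
  have S: "\<exists>i. (\<rho>/2) * (1/2) ^ i \<le> norm h \<and> norm h < 2 * ((\<rho>/2) * (1/2) ^ i)"
    if "0 < \<rho>" "norm h < \<rho>" "h \<noteq> 0" for \<rho> and h :: 'a
  proof -
    have "0 < norm h / \<rho>" using that by simp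
    then obtain n where n: "(1/2) ^ n < norm h / \<rho>" using real_arch_pow_inv[of "norm h / \<rho>" "1/2"] by auto
    define m where "m = (LEAST n. (1/2) ^ n \<le> norm h / \<rho>)"
    have m: "(1/2) ^ m \<le> norm h / \<rho>" unfolding m_def by (rule LeastI[of _ n]) (use n in simp)
    have "m \<noteq> 0" using m that by (intro notI) (simp add: field_simps)
    then obtain i where i: "m = Suc i" by (cases m) auto
    then have "\<not> (1/2) ^ i \<le> norm h / \<rho>" using not_less_Least[of i "\<lambda>n. (1/2) ^ n \<le> norm h / \<rho>"] by (simp add: m_def)
    then show ?thesis using m i that by (intro exI[of _ i]) (simp add: field_simps)
  qed
  define C where "C = 2 powr \<bar>\<alpha>\<bar> * 2 ^ DIM('a) * measure lborel (ball (0::'a) 1) / (1 - (1/2) powr (real DIM('a) - \<alpha>))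
    * (1/2) powr (real DIM('a) - \<alpha>)"
  have "0 < C" unfolding C_def using b content_ball_pos[of 1 "0::'a"] by (intro divide_pos_pos mult_pos_pos) auto
  moreover have "(\<integral>\<^sup>+(h::'a). ennreal (1 / norm h powr \<alpha>) * indicator {h. norm h < \<rho>} h \<partial>lborel)
      \<le> ennreal (C * \<rho> powr (real DIM('a) - \<alpha>))" if "0 < \<rho>" for \<rho>
  proof -
    have "(\<integral>\<^sup>+(h::'a). ennreal (1 / norm h powr \<alpha>) * indicator {h. norm h < \<rho>} h \<partial>lborel)
      \<le> ennreal (2 powr \<bar>\<alpha>\<bar> * 2 ^ DIM('a) * measure lborel (ball (0::'a) 1) / (1 - (1/2) powr (real DIM('a) - \<alpha>))
        * (\<rho> / 2) powr (real DIM('a) - \<alpha>))"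
      by (rule nn_integral_powr_dyadic_le) (use b S that in auto)
    also have "(\<rho> / 2) powr (real DIM('a) - \<alpha>) = (1/2) powr (real DIM('a) - \<alpha>) * \<rho> powr (real DIM('a) - \<alpha>)"
      using that powr_mult[of "1/2" \<rho> "real DIM('a) - \<alpha>"] by simp
    finally show ?thesis unfolding C_def by (simp add: mult.assoc)
  qed
  ultimately show ?thesis by blast
qed

section \<open>The Gagliardo kernel and its integrals\<close>

lemma nn_integral_lborel_reflect:
  fixes f :: "'a::euclidean_space \<Rightarrow> ennreal"
  assumes [measurable]: "f \<in> borel_measurable borel"
  shows "(\<integral>\<^sup>+y. f (x - y) \<partial>lborel) = (\<integral>\<^sup>+h. f h \<partial>lborel)"
proof -
  have "(lborel :: 'a measure) = distr lborel borel (\<lambda>y. x - y)"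
    using lborel_affine[of "-1" x] by (simp add: density_1)
  then have "(\<integral>\<^sup>+h. f h \<partial>lborel) = (\<integral>\<^sup>+h. f h \<partial>distr lborel borel (\<lambda>y. x - y))"
    by simp
  then show ?thesis by (simp add: nn_integral_distr)
qed

text \<open>On the diagonal the convention 1/0 = 0 makes the kernel vanish, so it is a finite real
  everywhere and products with differences need no separate treatment at x = y.\<close>

definition gkernel :: "real \<Rightarrow> real \<Rightarrow> 'a::euclidean_space \<Rightarrow> 'a \<Rightarrow> real" where
  "gkernel p s x y = 1 / norm (x - y) powr (real DIM('a) + p * s)"

lemma gkernel_nonneg [simp]: "0 \<le> gkernel p s x y"
  by (simp add: gkernel_def)

lemma gkernel_commute: "gkernel p s x y = gkernel p s y x"
  by (simp add: gkernel_def norm_minus_commute)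

lemma borel_measurable_gkernel [measurable]:
  assumes "f \<in> borel_measurable M" "g \<in> borel_measurable M"
  shows "(\<lambda>z. gkernel p s (f z) (g z)) \<in> borel_measurable M"
  using assms unfolding gkernel_def by measurable

lemma gkernel_tail:
  fixes p s :: real
  assumes "0 < p" "0 < s"
  shows "\<exists>C>0. \<forall>\<rho>>0. \<forall>x::'a::euclidean_space.
    (\<integral>\<^sup>+y. ennreal (gkernel p s x y) * indicator {y. \<rho> \<le> norm (x - y)} y \<partial>lborel) \<le> ennreal (C * \<rho> powr (- (p * s)))"
proof -
  obtain C where C: "0 < C" "\<And>\<rho>. 0 < \<rho> \<Longrightarrow>
      (\<integral>\<^sup>+(h::'a). ennreal (1 / norm h powr (real DIM('a) + p * s)) * indicator {h. \<rho> \<le> norm h} h \<partial>lborel)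
        \<le> ennreal (C * \<rho> powr (real DIM('a) - (real DIM('a) + p * s)))"
    using nn_integral_powr_outside_ball[where 'a='a, of "real DIM('a) + p * s"] assms by auto
  have "(\<integral>\<^sup>+y. ennreal (gkernel p s x y) * indicator {y. \<rho> \<le> norm (x - y)} y \<partial>lborel) \<le> ennreal (C * \<rho> powr (- (p * s)))"
    if "0 < \<rho>" for \<rho> and x :: 'a
  proof -
    have "(\<integral>\<^sup>+y. ennreal (gkernel p s x y) * indicator {y. \<rho> \<le> norm (x - y)} y \<partial>lborel) =
        (\<integral>\<^sup>+y. (\<lambda>h. ennreal (1 / norm h powr (real DIM('a) + p * s)) * indicator {h. \<rho> \<le> norm h} h) (x - y) \<partial>lborel)"
      by (intro nn_integral_cong) (simp add: gkernel_def indicator_def)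
    also have "\<dots> = (\<integral>\<^sup>+(h::'a). ennreal (1 / norm h powr (real DIM('a) + p * s)) * indicator {h. \<rho> \<le> norm h} h \<partial>lborel)"
      by (rule nn_integral_lborel_reflect) measurable
    finally show ?thesis using C(2)[OF that] by simp
  qed
  with C(1) show ?thesis by blast
qed

text \<open>Split at |x - y| = \<rho>. Far away the oscillation bound \<open>l\<close> and the tail
  of the kernel give l^p \<rho>^(-p s). Nearby the Lipschitz bound leaves the power |x - y|^(p - n -
  p s), which is integrable because s < 1 and contributes the same power of \<rho>. The bound holds
  for each fixed \<open>x\<close>, so integrating it over a level set yields the measure of that
  set.\<close>

lemma gkernel_Lipschitz_energy:
  fixes p s :: real
  assumes p: "0 < p" and s: "0 < s" "s < 1"
  shows "\<exists>C>0. \<forall>\<rho>>0. \<forall>l\<ge>0. \<forall>k :: 'a::euclidean_space \<Rightarrow> real. \<forall>x. k \<in> borel_measurable borel \<longrightarrow>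
    (\<forall>y. \<bar>k x - k y\<bar> \<le> l * norm (x - y) / \<rho>) \<longrightarrow> (\<forall>y. \<bar>k x - k y\<bar> \<le> l) \<longrightarrow>
    (\<integral>\<^sup>+y. ennreal (\<bar>k x - k y\<bar> powr p * gkernel p s x y) \<partial>lborel) \<le> ennreal (C * l powr p * \<rho> powr (- (p * s)))"
proof -
  obtain C1 where C1: "0 < C1" "\<And>\<rho> x. 0 < \<rho> \<Longrightarrow>
      (\<integral>\<^sup>+(y::'a). ennreal (gkernel p s x y) * indicator {y. \<rho> \<le> norm (x - y)} y \<partial>lborel) \<le> ennreal (C1 * \<rho> powr (- (p * s)))"
    using gkernel_tail[where 'a='a, OF p s(1)] by auto
  define \<alpha> where "\<alpha> = real DIM('a) + p * s - p"
  have \<alpha>: "\<alpha> < real DIM('a)" using p s by (simp add: \<alpha>_def)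
  obtain C2 where C2: "0 < C2" "\<And>\<rho>. 0 < \<rho> \<Longrightarrow>
      (\<integral>\<^sup>+(h::'a). ennreal (1 / norm h powr \<alpha>) * indicator {h. norm h < \<rho>} h \<partial>lborel) \<le> ennreal (C2 * \<rho> powr (real DIM('a) - \<alpha>))"
    using nn_integral_powr_ball[OF \<alpha>] by auto
  have "(\<integral>\<^sup>+y. ennreal (\<bar>k x - k y\<bar> powr p * gkernel p s x y) \<partial>lborel) \<le> ennreal ((C1 + C2) * l powr p * \<rho> powr (- (p * s)))"
    if \<rho>: "0 < \<rho>" and l: "0 \<le> l" and [measurable]: "k \<in> borel_measurable borel"
      and k: "\<And>y. \<bar>k x - k y\<bar> \<le> l * norm (x - y) / \<rho>" "\<And>y. \<bar>k x - k y\<bar> \<le> l"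
    for \<rho> l and k :: "'a \<Rightarrow> real" and x
  proof -
    define near where "near h = ennreal (1 / norm h powr \<alpha>) * indicator {h. norm h < \<rho>} h" for h :: 'a
    have [measurable]: "near \<in> borel_measurable borel" unfolding near_def by measurable
    have "ennreal (\<bar>k x - k y\<bar> powr p * gkernel p s x y) \<le>
        ennreal (l powr p) * (ennreal (gkernel p s x y) * indicator {y. \<rho> \<le> norm (x - y)} y)
        + ennreal (l powr p * \<rho> powr (- p)) * near (x - y)" for y
    proof (cases "\<rho> \<le> norm (x - y)")
      case True
      have "\<bar>k x - k y\<bar> powr p * gkernel p s x y \<le> l powr p * gkernel p s x y"
        using k(2) p by (intro mult_right_mono powr_mono2) auto
      then show ?thesis
        using True by (simp add: ennreal_mult[symmetric] near_def)
    next
      case False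
      have "\<bar>k x - k y\<bar> powr p * gkernel p s x y \<le> (l * norm (x - y) / \<rho>) powr p * gkernel p s x y"
        using k(1) p by (intro mult_right_mono powr_mono2) auto
      also have "(l * norm (x - y) / \<rho>) powr p = l powr p * \<rho> powr (- p) * norm (x - y) powr p"
        using l \<rho> by (simp add: powr_mult powr_divide powr_minus_divide)
      also have "l powr p * \<rho> powr (- p) * norm (x - y) powr p * gkernel p s x y =
          l powr p * \<rho> powr (- p) * (1 / norm (x - y) powr \<alpha>)"
        unfolding gkernel_def \<alpha>_def by (simp add: powr_diff)
      finally show ?thesis
        using False by (simp add: ennreal_mult[symmetric] near_def)
    qed
    then have "(\<integral>\<^sup>+y. ennreal (\<bar>k x - k y\<bar> powr p * gkernel p s x y) \<partial>lborel) \<le>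
      (\<integral>\<^sup>+y. ennreal (l powr p) * (ennreal (gkernel p s x y) * indicator {y. \<rho> \<le> norm (x - y)} y)
        + ennreal (l powr p * \<rho> powr (- p)) * near (x - y) \<partial>lborel)"
      by (intro nn_integral_mono) auto
    also have "\<dots> = ennreal (l powr p) * (\<integral>\<^sup>+y. ennreal (gkernel p s x y) * indicator {y. \<rho> \<le> norm (x - y)} y \<partial>lborel)
        + ennreal (l powr p * \<rho> powr (- p)) * (\<integral>\<^sup>+y. near (x - y) \<partial>lborel)"
      by (simp add: nn_integral_add nn_integral_cmult)
    also have "(\<integral>\<^sup>+y. near (x - y) \<partial>lborel) = (\<integral>\<^sup>+h. near h \<partial>lborel)"
      by (rule nn_integral_lborel_reflect) measurable
    also have "ennreal (l powr p) * (\<integral>\<^sup>+y. ennreal (gkernel p s x y) * indicator {y. \<rho> \<le> norm (x - y)} y \<partial>lborel)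
        + ennreal (l powr p * \<rho> powr (- p)) * (\<integral>\<^sup>+h. near h \<partial>lborel) \<le>
        ennreal (l powr p) * ennreal (C1 * \<rho> powr (- (p * s)))
        + ennreal (l powr p * \<rho> powr (- p)) * ennreal (C2 * \<rho> powr (real DIM('a) - \<alpha>))"
      unfolding near_def by (intro add_mono mult_left_mono C1 C2 \<rho>) auto
    also have "\<dots> = ennreal (l powr p * (C1 * \<rho> powr (- (p * s))) + l powr p * \<rho> powr (- p) * (C2 * \<rho> powr (real DIM('a) - \<alpha>)))"
      using C1 C2 by (simp add: ennreal_mult[symmetric] ennreal_plus[symmetric] del: ennreal_plus)
    also have "l powr p * (C1 * \<rho> powr (- (p * s))) + l powr p * \<rho> powr (- p) * (C2 * \<rho> powr (real DIM('a) - \<alpha>)) =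
        (C1 + C2) * l powr p * \<rho> powr (- (p * s))"
    proof -
      have "\<rho> powr (- p) * \<rho> powr (real DIM('a) - \<alpha>) = \<rho> powr (- (p * s))"
        using \<rho> by (simp add: powr_add[symmetric] \<alpha>_def)
      then show ?thesis by (simp add: algebra_simps flip: mult.assoc)
    qed
    finally show ?thesis .
  qed
  moreover have "0 < C1 + C2" using C1 C2 by simp
  ultimately show ?thesis by (intro exI[of _ "C1 + C2"]) blast
qed

text \<open>Around a point \<open>x\<close> with Z x > 0 take the ball of measure 2N. Since {Z > 0}
  has measure at most \<open>N\<close>, \<open>Z\<close> vanishes on a part of this ball of measure
  at least \<open>N\<close>, and there the integrand is at least Z x^p / R^(n + p s). As R^n is
  proportional to \<open>N\<close>, the inner integral controls Z x^p / N^(p s / n). The argument is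
  the same whatever the relation between p s and n.\<close>

lemma gkernel_Faber_Krahn:
  fixes p s :: real
  assumes p: "0 < p" and s: "0 < s"
  shows "\<exists>C>0. \<forall>N>0. \<forall>Z :: 'a::euclidean_space \<Rightarrow> real. Z \<in> borel_measurable borel \<longrightarrow> (\<forall>x. 0 \<le> Z x) \<longrightarrow>
    emeasure lborel {x. 0 < Z x} \<le> ennreal N \<longrightarrow>
    (\<integral>\<^sup>+x. ennreal (Z x powr p) \<partial>lborel) \<le> ennreal (C * N powr (p * s / real DIM('a))) *
      (\<integral>\<^sup>+x. \<integral>\<^sup>+y. ennreal (\<bar>Z x - Z y\<bar> powr p * gkernel p s x y) \<partial>lborel \<partial>lborel)"
proof -
  define \<omega> where "\<omega> = measure lborel (ball (0::'a) 1)"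
  have \<omega>: "0 < \<omega>" unfolding \<omega>_def using content_ball_pos[of 1 "0::'a"] by simp
  define n where "n = real DIM('a)"
  have n: "0 < n" unfolding n_def by simp
  define C' where "C' = 2 powr (1 + p * s / n) / \<omega> powr (1 + p * s / n)"
  have "0 < C'" using \<omega> by (simp add: C'_def)
  have "(\<integral>\<^sup>+x. ennreal (Z x powr p) \<partial>lborel) \<le> ennreal (C' * N powr (p * s / n)) *
      (\<integral>\<^sup>+x. \<integral>\<^sup>+y. ennreal (\<bar>Z x - Z y\<bar> powr p * gkernel p s x y) \<partial>lborel \<partial>lborel)"
    if N: "0 < N" and [measurable]: "Z \<in> borel_measurable borel" and Z: "\<And>x. 0 \<le> Z x"
      and A: "emeasure lborel {x. 0 < Z x} \<le> ennreal N" for N and Z :: "'a \<Rightarrow> real"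
  proof -
    define R where "R = (2 * N / \<omega>) powr (1 / n)"
    have R: "0 < R" using N \<omega> by (simp add: R_def)
    have Rn: "R ^ DIM('a) * \<omega> = 2 * N"
    proof -
      have "R ^ DIM('a) = R powr n" using R by (simp add: n_def powr_realpow)
      also have "\<dots> = 2 * N / \<omega>" using N \<omega> n unfolding R_def by (simp add: powr_powr)
      finally show ?thesis using \<omega> by simp
    qed
    have Rns: "R powr (n + p * s) = C' * N powr (p * s / n) * N"
    proof -
      have "R powr (n + p * s) = (2 * N / \<omega>) powr (1 + p * s / n)"
        using n unfolding R_def powr_powr by (simp add: field_simps)
      also have "\<dots> = C' * N powr (1 + p * s / n)"
        using N \<omega> by (simp add: C'_def powr_mult powr_divide)
      finally show ?thesis using N by (simp add: powr_add)
    qed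
    have inner: "ennreal (Z x powr p) \<le> ennreal (C' * N powr (p * s / n)) *
        (\<integral>\<^sup>+y. ennreal (\<bar>Z x - Z y\<bar> powr p * gkernel p s x y) \<partial>lborel)" for x
    proof (cases "0 < Z x")
      case True
      have ball: "emeasure lborel (ball x R) = ennreal (2 * N)"
        using emeasure_lborel_ball_finite[of x R] content_ball_conv_unit_ball[of R x] R Rn
        by (simp add: emeasure_eq_ennreal_measure \<omega>_def)
      have "ennreal (2 * N) \<le> emeasure lborel (ball x R - {x. 0 < Z x}) + emeasure lborel {x. 0 < Z x}"
        unfolding ball[symmetric]
        by (rule order_trans[OF emeasure_mono emeasure_subadditive]) auto
      also have "\<dots> \<le> emeasure lborel (ball x R - {x. 0 < Z x}) + ennreal N"
        by (intro add_left_mono A)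
      finally have "ennreal N + ennreal N \<le> emeasure lborel (ball x R - {x. 0 < Z x}) + ennreal N"
        using N by (simp add: ennreal_plus[symmetric] del: ennreal_plus)
      then have big: "ennreal N \<le> emeasure lborel (ball x R - {x. 0 < Z x})"
        by (simp add: ennreal_add_left_cancel_le add.commute)
      have "ennreal (Z x powr p / R powr (n + p * s)) * ennreal N \<le>
          ennreal (Z x powr p / R powr (n + p * s)) * emeasure lborel (ball x R - {x. 0 < Z x})"
        by (intro mult_left_mono big) auto
      also have "\<dots> = (\<integral>\<^sup>+y. ennreal (Z x powr p / R powr (n + p * s)) * indicator (ball x R - {x. 0 < Z x}) y \<partial>lborel)"
        by (subst nn_integral_cmult_indicator) auto
      also have "\<dots> \<le> (\<integral>\<^sup>+y. ennreal (\<bar>Z x - Z y\<bar> powr p * gkernel p s x y) \<partial>lborel)"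
      proof (rule nn_integral_mono)
        fix y
        show "ennreal (Z x powr p / R powr (n + p * s)) * indicator (ball x R - {x. 0 < Z x}) y \<le>
            ennreal (\<bar>Z x - Z y\<bar> powr p * gkernel p s x y)"
        proof (cases "y \<in> ball x R - {x. 0 < Z x}")
          case in_ball: True
          then have "Z y = 0" "y \<noteq> x" "norm (x - y) < R"
            using Z[of y] True by (auto simp: dist_norm)
          moreover have "norm (x - y) powr (n + p * s) \<le> R powr (n + p * s)"
            using \<open>norm (x - y) < R\<close> n p s by (intro powr_mono2) auto
          moreover have "0 < norm (x - y) powr (n + p * s)"
            using \<open>y \<noteq> x\<close> by simp
          ultimately have "Z x powr p / R powr (n + p * s) \<le> \<bar>Z x - Z y\<bar> powr p * gkernel p s x y"
            using Z[of x] unfolding gkernel_def n_def[symmetric] by (simp add: frac_le)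
          then show ?thesis using in_ball by (simp add: ennreal_leI)
        qed simp
      qed
      finally have 1: "ennreal (Z x powr p / R powr (n + p * s)) * ennreal N \<le>
          (\<integral>\<^sup>+y. ennreal (\<bar>Z x - Z y\<bar> powr p * gkernel p s x y) \<partial>lborel)" .
      have pos: "0 < C' * N powr (p * s / n)" using \<open>0 < C'\<close> N by simp
      have "ennreal (Z x powr p) = ennreal (C' * N powr (p * s / n)) * (ennreal (Z x powr p / R powr (n + p * s)) * ennreal N)"
        using N pos \<open>0 < C'\<close> unfolding Rns by (simp add: ennreal_mult[symmetric])
      also have "\<dots> \<le> ennreal (C' * N powr (p * s / n)) *
        (\<integral>\<^sup>+y. ennreal (\<bar>Z x - Z y\<bar> powr p * gkernel p s x y) \<partial>lborel)"
        by (intro mult_left_mono 1) simp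
      finally show ?thesis .
    next
      case False
      then have "Z x = 0" using Z[of x] by simp
      then show ?thesis by simp
    qed
    have "(\<integral>\<^sup>+x. ennreal (Z x powr p) \<partial>lborel) \<le> (\<integral>\<^sup>+x. ennreal (C' * N powr (p * s / n)) *
        (\<integral>\<^sup>+y. ennreal (\<bar>Z x - Z y\<bar> powr p * gkernel p s x y) \<partial>lborel) \<partial>lborel)"
      by (rule nn_integral_mono) (rule inner)
    also have "\<dots> = ennreal (C' * N powr (p * s / n)) *
      (\<integral>\<^sup>+x. \<integral>\<^sup>+y. ennreal (\<bar>Z x - Z y\<bar> powr p * gkernel p s x y) \<partial>lborel \<partial>lborel)"
      by (intro nn_integral_cmult) measurable
    finally show ?thesis .
  qed
  with \<open>0 < C'\<close> show ?thesis unfolding n_def by blast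
qed

section \<open>Steklov averages in time\<close>

lemma integrable_mult_bounded:
  fixes f e :: "'a \<Rightarrow> real"
  assumes "integrable M f" "e \<in> borel_measurable M" "\<And>x. \<bar>e x\<bar> \<le> B"
  shows "integrable M (\<lambda>x. f x * e x)"
proof (rule Bochner_Integration.integrable_bound)
  show "integrable M (\<lambda>x. f x * B)" using assms(1) by simp
  show "AE x in M. norm (f x * e x) \<le> norm (f x * B)"
  proof (intro always_eventually allI)
    fix x
    have "\<bar>e x\<bar> \<le> \<bar>B\<bar>" using assms(3)[of x] by linarith
    then show "norm (f x * e x) \<le> norm (f x * B)" by (simp add: abs_mult mult_left_mono)
  qed
qed (use assms in measurable)

lemma integrable_unit_interval:
  fixes w :: "real \<Rightarrow> real"
  assumes "w \<in> borel_measurable borel" "\<And>t. \<bar>w t\<bar> \<le> B"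
  shows "integrable lborel (\<lambda>\<sigma>. indicator {0..1} \<sigma> * w (t + h * \<sigma>))"
  by (rule integrable_mult_bounded) (use assms in \<open>auto\<close>)

lemma integrable_bounded_support:
  fixes w :: "real \<Rightarrow> real"
  assumes "w \<in> borel_measurable borel" "\<And>t. \<bar>w t\<bar> \<le> B" "\<And>t. t \<notin> {c..d} \<Longrightarrow> w t = 0"
  shows "integrable lborel w"
proof -
  have "integrable lborel (indicator {c..d} :: real \<Rightarrow> real)"
    by (rule integrable_real_indicator) (auto simp: emeasure_lborel_Icc_eq)
  then have "integrable lborel (\<lambda>t. indicator {c..d} t * w t)"
    by (rule integrable_mult_bounded) (use assms in auto)
  moreover have "(\<lambda>t. indicator {c..d} t * w t) = w"
    using assms(3) by (intro ext) (case_tac "t \<in> {c..d}", auto)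
  ultimately show ?thesis by simp
qed

text \<open>Integrates the supporting line of |z|^p at the mean \<open>m\<close>, which is
  \<open>spow_primitive_convex\<close> with q = p - 1.\<close>

lemma Jensen_powr_unit_interval:
  fixes f :: "real \<Rightarrow> real"
  assumes p: "1 < p" and [measurable]: "f \<in> borel_measurable borel" and B: "\<And>\<sigma>. \<bar>f \<sigma>\<bar> \<le> B"
  shows "ennreal (\<bar>LINT \<sigma>|lborel. indicator {0..1} \<sigma> * f \<sigma>\<bar> powr p) \<le>
    (\<integral>\<^sup>+\<sigma>. ennreal (\<bar>f \<sigma>\<bar> powr p) * indicator {0..1} \<sigma> \<partial>lborel)"
proof -
  define m where "m = (LINT \<sigma>|lborel. indicator {0..1} \<sigma> * f \<sigma>)"
  have i1: "integrable lborel (\<lambda>\<sigma>::real. indicator {0..1} \<sigma> :: real)" by simp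
  have bdd: "integrable lborel (\<lambda>\<sigma>. indicator {0..1} \<sigma> * g \<sigma>)"
    if "g \<in> borel_measurable borel" and "\<And>\<sigma>. \<bar>g \<sigma>\<bar> \<le> C" for g :: "real \<Rightarrow> real" and C
    using integrable_unit_interval[OF that, of 0 1] by simp
  have if1: "integrable lborel (\<lambda>\<sigma>. indicator {0..1} \<sigma> * f \<sigma>)"
    by (rule bdd[OF assms(2) B])
  have ifp: "integrable lborel (\<lambda>\<sigma>. indicator {0..1} \<sigma> * \<bar>f \<sigma>\<bar> powr p)"
    by (rule bdd[of _ "B powr p"]) (use B p in \<open>auto intro!: powr_mono2\<close>)
  have ptw: "\<bar>m\<bar> powr p + p * (spow (p - 1) m * (f \<sigma> - m)) \<le> \<bar>f \<sigma>\<bar> powr p" for \<sigma>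
    using spow_primitive_convex[of "p - 1" m "f \<sigma>"] p by (simp add: spow_primitive_def field_simps)
  have "(LINT \<sigma>|lborel. indicator {0..1} \<sigma> * (\<bar>m\<bar> powr p - p * (spow (p - 1) m * m)) + (p * spow (p - 1) m) * (indicator {0..1} \<sigma> * f \<sigma>)) \<le>
      (LINT \<sigma>|lborel. indicator {0..1} \<sigma> * \<bar>f \<sigma>\<bar> powr p)"
  proof (rule integral_mono[OF _ ifp])
    show "integrable lborel (\<lambda>\<sigma>. indicator {0..1} \<sigma> * (\<bar>m\<bar> powr p - p * (spow (p - 1) m * m)) + (p * spow (p - 1) m) * (indicator {0..1} \<sigma> * f \<sigma>))"
      by (intro Bochner_Integration.integrable_add integrable_mult_right integrable_mult_left if1 i1; simp?)
    show "indicator {0..1} \<sigma> * (\<bar>m\<bar> powr p - p * (spow (p - 1) m * m)) + (p * spow (p - 1) m) * (indicator {0..1} \<sigma> * f \<sigma>)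
        \<le> indicator {0..1} \<sigma> * \<bar>f \<sigma>\<bar> powr p" for \<sigma>
      using ptw[of \<sigma>] by (simp add: indicator_def algebra_simps)
  qed
  also have "(LINT \<sigma>|lborel. indicator {0..1} \<sigma> * (\<bar>m\<bar> powr p - p * (spow (p - 1) m * m)) + (p * spow (p - 1) m) * (indicator {0..1} \<sigma> * f \<sigma>)) =
      (LINT \<sigma>::real|lborel. indicator {0..1} \<sigma> * (\<bar>m\<bar> powr p - p * (spow (p - 1) m * m))) + (LINT \<sigma>|lborel. (p * spow (p - 1) m) * (indicator {0..1} \<sigma> * f \<sigma>))"
    by (intro Bochner_Integration.integral_add integrable_mult_right integrable_mult_left if1 i1; simp?)
  also have "\<dots> = \<bar>m\<bar> powr p" unfolding m_def[symmetric] by (simp add: m_def[symmetric])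
  finally have "ennreal (\<bar>m\<bar> powr p) \<le> ennreal (LINT \<sigma>|lborel. indicator {0..1} \<sigma> * \<bar>f \<sigma>\<bar> powr p)"
    by (rule ennreal_leI)
  also have "\<dots> = (\<integral>\<^sup>+\<sigma>. ennreal (indicator {0..1} \<sigma> * \<bar>f \<sigma>\<bar> powr p) \<partial>lborel)"
    by (rule nn_integral_eq_integral[symmetric, OF ifp]) simp
  also have "\<dots> = (\<integral>\<^sup>+\<sigma>. ennreal (\<bar>f \<sigma>\<bar> powr p) * indicator {0..1} \<sigma> \<partial>lborel)"
    by (intro nn_integral_cong) (simp add: indicator_def)
  finally show ?thesis unfolding m_def .
qed

text \<open>The forward average over [t, t + h] for h > 0. Over the fixed interval [0, 1] the step
  \<open>h\<close> is a mere parameter of the integrand, and negative steps make sense as well: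
  backward averages appear when duality moves the averaging to the other factor.\<close>

definition steklov :: "real \<Rightarrow> (real \<Rightarrow> real) \<Rightarrow> real \<Rightarrow> real" where
  "steklov h w t = (LINT \<sigma>|lborel. indicator {0..1} \<sigma> * w (t + h * \<sigma>))"

lemma borel_measurable_steklov:
  assumes "(\<lambda>(x, t). w x t) \<in> borel_measurable (M \<Otimes>\<^sub>M borel)"
    and f: "f \<in> borel_measurable N" and g: "g \<in> measurable N M"
  shows "(\<lambda>x. steklov h (w (g x)) (f x)) \<in> borel_measurable N"
proof -
  have "(\<lambda>(x, \<sigma>). indicator {0..1} \<sigma> * w (g x) (f x + h * \<sigma>)) =
      (\<lambda>z. indicator {0..1} (snd z) * (\<lambda>(x, t). w x t) (g (fst z), f (fst z) + h * snd z))"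
    by auto
  moreover have "(\<lambda>z. indicator {0..1} (snd z) * (\<lambda>(x, t). w x t) (g (fst z), f (fst z) + h * snd z))
      \<in> borel_measurable (N \<Otimes>\<^sub>M lborel)"
    using assms by measurable
  ultimately have "(\<lambda>(x, \<sigma>). indicator {0..1} \<sigma> * w (g x) (f x + h * \<sigma>)) \<in> borel_measurable (N \<Otimes>\<^sub>M lborel)"
    by simp
  then show ?thesis
    unfolding steklov_def by (rule lborel.borel_measurable_lebesgue_integral)
qed

lemma abs_steklov_le:
  assumes [measurable]: "w \<in> borel_measurable borel" and B: "\<And>t. \<bar>w t\<bar> \<le> B"
  shows "\<bar>steklov h w t\<bar> \<le> B"
proof -
  have "\<bar>steklov h w t\<bar> \<le> (LINT \<sigma>|lborel. \<bar>indicator {0..1} \<sigma> * w (t + h * \<sigma>)\<bar>)"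
    unfolding steklov_def by (rule integral_abs_bound)
  also have "\<dots> \<le> (LINT \<sigma>::real|lborel. indicator {0..1} \<sigma> * B)"
  proof (rule integral_mono)
    show "integrable lborel (\<lambda>\<sigma>. \<bar>indicator {0..1} \<sigma> * w (t + h * \<sigma>)\<bar>)"
      by (intro integrable_abs integrable_unit_interval[OF assms])
    show "\<bar>indicator {0..1} \<sigma> * w (t + h * \<sigma>)\<bar> \<le> indicator {0..1} \<sigma> * B" for \<sigma> :: real
      using B by (simp add: indicator_def)
  qed (intro integrable_mult_left, simp)
  finally show ?thesis by simp
qed

lemma steklov_diff:
  assumes "v \<in> borel_measurable borel" "\<And>t. \<bar>v t\<bar> \<le> B" "w \<in> borel_measurable borel" "\<And>t. \<bar>w t\<bar> \<le> B"
  shows "steklov h v t - steklov h w t = steklov h (\<lambda>t. v t - w t) t"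
proof -
  have "steklov h v t - steklov h w t = (LINT \<sigma>|lborel. indicator {0..1} \<sigma> * v (t + h * \<sigma>) - indicator {0..1} \<sigma> * w (t + h * \<sigma>))"
    unfolding steklov_def
    by (rule Bochner_Integration.integral_diff[symmetric]) (rule integrable_unit_interval[OF assms(1,2)], rule integrable_unit_interval[OF assms(3,4)])
  then show ?thesis unfolding steklov_def by (simp add: right_diff_distrib)
qed

text \<open>Turns the pairing with an average into an average of pairings with translates, the form
  to which translation invariance and L^1 continuity apply.\<close>

lemma steklov_Fubini:
  fixes f e :: "real \<Rightarrow> real"
  assumes f: "integrable lborel f" and e[measurable]: "e \<in> borel_measurable borel" and B: "\<And>t. \<bar>e t\<bar> \<le> B"
  shows "(LINT t|lborel. f t * steklov h e t) =
    (LINT \<sigma>|lborel. indicator {0..1} \<sigma> * (LINT t|lborel. f t * e (t + h * \<sigma>)))"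
    and "integrable lborel (\<lambda>\<sigma>. indicator {0..1} \<sigma> * (LINT t|lborel. f t * e (t + h * \<sigma>)))"
proof -
  have [measurable]: "f \<in> borel_measurable borel" using f by auto
  have fe: "integrable lborel (\<lambda>t. f t * e (t + h * \<sigma>))" for \<sigma>
    by (rule integrable_mult_bounded[OF f]) (use B in auto)
  have "integrable (lborel \<Otimes>\<^sub>M lborel) (\<lambda>(\<sigma>::real, t). indicator {0..1} \<sigma> * f t)"
  proof (rule lborel_pair.Fubini_integrable)
    have eq: "(LINT t|lborel. norm (case (\<sigma>, t) of (\<sigma>, t) \<Rightarrow> indicator {0..1} \<sigma> * f t)) = indicator {0..1} \<sigma> * (LINT t|lborel. \<bar>f t\<bar>)"
      for \<sigma> :: real by (simp add: abs_mult)
    show "integrable lborel (\<lambda>\<sigma>::real. LINT t|lborel. norm (case (\<sigma>, t) of (\<sigma>, t) \<Rightarrow> indicator {0..1} \<sigma> * f t))"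
      unfolding eq by (intro integrable_mult_left) simp
  qed (use f in auto)
  from integrable_mult_bounded[OF this, of "\<lambda>(\<sigma>, t). e (t + h * \<sigma>)" B]
  have int: "integrable (lborel \<Otimes>\<^sub>M lborel) (\<lambda>(\<sigma>, t). indicator {0..1} \<sigma> * f t * e (t + h * \<sigma>))"
    using B by (simp add: case_prod_beta')
  have "(LINT t|lborel. f t * steklov h e t) = (LINT t|lborel. LINT \<sigma>|lborel. indicator {0..1} \<sigma> * f t * e (t + h * \<sigma>))"
    unfolding steklov_def by (subst integral_mult_right_zero[symmetric]) (simp add: ac_simps)
  also have "\<dots> = (LINT \<sigma>|lborel. LINT t|lborel. indicator {0..1} \<sigma> * f t * e (t + h * \<sigma>))"
    by (rule lborel_pair.Fubini_integral[OF int])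
  also have "\<dots> = (LINT \<sigma>|lborel. indicator {0..1} \<sigma> * (LINT t|lborel. f t * e (t + h * \<sigma>)))"
    by (simp add: mult.assoc)
  finally show "(LINT t|lborel. f t * steklov h e t) =
    (LINT \<sigma>|lborel. indicator {0..1} \<sigma> * (LINT t|lborel. f t * e (t + h * \<sigma>)))" .
  show "integrable lborel (\<lambda>\<sigma>. indicator {0..1} \<sigma> * (LINT t|lborel. f t * e (t + h * \<sigma>)))"
    using lborel_pair.integrable_fst[OF int] by (simp add: mult.assoc)
qed

text \<open>The factor \<open>e\<close> is merely bounded and measurable. Its translation is
  therefore moved onto the integrable factor \<open>f\<close>, where translations are continuous in
  L^1.\<close>

lemma steklov_pairing_limit:
  fixes f e :: "real \<Rightarrow> real"
  assumes f: "integrable lborel f" and e[measurable]: "e \<in> borel_measurable borel" and B: "\<And>t. \<bar>e t\<bar> \<le> B"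
    and h: "h \<longlonglongrightarrow> 0"
  shows "(\<lambda>n. LINT t|lborel. f t * steklov (h n) e t) \<longlonglongrightarrow> (LINT t|lborel. f t * e t)"
proof -
  have [measurable]: "f \<in> borel_measurable borel" using f by auto
  have B0: "0 \<le> B" using B[of 0] by linarith
  have fe: "integrable lborel (\<lambda>t. f t * e (t + c))" for c
    by (rule integrable_mult_bounded[OF f]) (use B in auto)
  have pt: "(\<lambda>n. LINT t|lborel. f t * e (t + \<tau> n)) \<longlonglongrightarrow> (LINT t|lborel. f t * e t)" if \<tau>: "\<tau> \<longlonglongrightarrow> 0" for \<tau> :: "nat \<Rightarrow> real"
  proof -
    have eq: "(LINT t|lborel. f t * e (t + \<tau> n)) = (LINT t|lborel. f (t + - \<tau> n) * e t)" for n
      using integrable_shift(2)[OF fe[of "\<tau> n"], of "- \<tau> n"] by simp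
    have fe': "integrable lborel (\<lambda>t. f (t + c) * e t)" for c
      by (rule integrable_mult_bounded[OF integrable_shift(1)[OF f]]) (use B in auto)
    have lim: "(\<lambda>n. B * (LINT t|lborel. \<bar>f (t + - \<tau> n) - f t\<bar>)) \<longlonglongrightarrow> 0"
      using L1_translation_limit[OF f tendsto_minus[OF \<tau>, simplified]] by (rule tendsto_mult_right_zero)
    have "norm ((LINT t|lborel. f t * e (t + \<tau> n)) - (LINT t|lborel. f t * e t)) \<le> B * (LINT t|lborel. \<bar>f (t + - \<tau> n) - f t\<bar>)" for n
    proof -
      have "(LINT t|lborel. f t * e (t + \<tau> n)) - (LINT t|lborel. f t * e t) = (LINT t|lborel. f (t + - \<tau> n) * e t - f t * e t)"
        unfolding eq using fe'[of "- \<tau> n"] fe'[of 0] by (intro Bochner_Integration.integral_diff[symmetric]) simp_all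
      also have "\<bar>\<dots>\<bar> \<le> (LINT t|lborel. \<bar>f (t + - \<tau> n) * e t - f t * e t\<bar>)"
        by (rule integral_abs_bound)
      also have "\<dots> \<le> (LINT t|lborel. B * \<bar>f (t + - \<tau> n) - f t\<bar>)"
      proof (rule integral_mono)
        show "integrable lborel (\<lambda>t. \<bar>f (t + - \<tau> n) * e t - f t * e t\<bar>)"
          using fe'[of "- \<tau> n"] fe'[of 0] by (intro integrable_abs Bochner_Integration.integrable_diff) simp_all
        show "integrable lborel (\<lambda>t. B * \<bar>f (t + - \<tau> n) - f t\<bar>)"
          by (intro integrable_mult_right integrable_abs Bochner_Integration.integrable_diff integrable_shift(1)[OF f] f)
        have "f (t + - \<tau> n) * e t - f t * e t = e t * (f (t + - \<tau> n) - f t)" for t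
          by (simp add: algebra_simps)
        then show "\<bar>f (t + - \<tau> n) * e t - f t * e t\<bar> \<le> B * \<bar>f (t + - \<tau> n) - f t\<bar>" for t
          using B[of t] by (simp add: abs_mult mult_right_mono)
      qed
      finally show ?thesis by simp
    qed
    then have "(\<lambda>n. (LINT t|lborel. f t * e (t + \<tau> n)) - (LINT t|lborel. f t * e t)) \<longlonglongrightarrow> 0"
      by (intro Lim_null_comparison[OF always_eventually lim] allI)
    then show ?thesis by (simp add: LIM_zero_iff)
  qed
  have "(\<lambda>n. LINT \<sigma>|lborel. indicator {0..1} \<sigma> * (LINT t|lborel. f t * e (t + h n * \<sigma>))) \<longlonglongrightarrow>
      (LINT \<sigma>::real|lborel. indicator {0..1} \<sigma> * (LINT t|lborel. f t * e t))"
  proof (rule integral_dominated_convergence)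
    show "integrable lborel (\<lambda>\<sigma>::real. indicator {0..1} \<sigma> * (B * (LINT t|lborel. \<bar>f t\<bar>)))"
      by (intro integrable_mult_left) simp
    show "AE \<sigma> in lborel. (\<lambda>n. indicator {0..1} \<sigma> * (LINT t|lborel. f t * e (t + h n * \<sigma>))) \<longlonglongrightarrow>
        indicator {0..1} \<sigma> * (LINT t|lborel. f t * e t)"
      using tendsto_mult_left_zero[OF h] by (intro always_eventually allI tendsto_mult tendsto_const pt)
    show "AE \<sigma> in lborel. norm (indicator {0..1} \<sigma> * (LINT t|lborel. f t * e (t + h n * \<sigma>)))
        \<le> indicator {0..1} \<sigma> * (B * (LINT t|lborel. \<bar>f t\<bar>))" for n
    proof (intro always_eventually allI)
      fix \<sigma> :: real
      have "\<bar>LINT t|lborel. f t * e (t + h n * \<sigma>)\<bar> \<le> (LINT t|lborel. \<bar>f t * e (t + h n * \<sigma>)\<bar>)"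
        by (rule integral_abs_bound)
      also have "\<dots> \<le> (LINT t|lborel. B * \<bar>f t\<bar>)"
      proof (rule integral_mono)
        show "\<bar>f t * e (t + h n * \<sigma>)\<bar> \<le> B * \<bar>f t\<bar>" for t
          using mult_left_mono[OF B[of "t + h n * \<sigma>"], of "\<bar>f t\<bar>"] by (simp add: abs_mult mult.commute)
      qed (use fe f in \<open>auto intro: integrable_abs\<close>)
      also have "\<dots> = B * (LINT t|lborel. \<bar>f t\<bar>)" by simp
      finally show "norm (indicator {0..1} \<sigma> * (LINT t|lborel. f t * e (t + h n * \<sigma>))) \<le>
          indicator {0..1} \<sigma> * (B * (LINT t|lborel. \<bar>f t\<bar>))"
        by (simp add: indicator_def)
    qed
    show "(\<lambda>\<sigma>. indicator {0..1} \<sigma> * (LINT t|lborel. f t * e (t + h n * \<sigma>))) \<in> borel_measurable lborel" for n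
      using steklov_Fubini(2)[OF f e B, of "h n"] by (rule borel_measurable_integrable)
  qed simp
  then show ?thesis unfolding steklov_Fubini(1)[OF f e B] by simp
qed


text \<open>The average evaluates \<open>E\<close> at a time t' different from the time t of
  \<open>F\<close>, so the domination has to separate the two times. After integration in t and over
  the averaging parameter, translation invariance turns it into the bound A z, which does not depend
  on the step. Dominated convergence is then needed in \<open>z\<close> only, with
  \<open>steklov_pairing_limit\<close> for each fixed \<open>z\<close>.\<close>

lemma steklov_energy_limit:
  fixes F E :: "'a::euclidean_space \<Rightarrow> real \<Rightarrow> real" and a b :: "'a \<Rightarrow> real \<Rightarrow> ennreal"
  assumes Fm: "(\<lambda>(z, t). F z t) \<in> borel_measurable borel" and Em: "(\<lambda>(z, t). E z t) \<in> borel_measurable borel"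
    and Fi: "\<And>z. integrable lborel (F z)" and B: "\<And>z t. \<bar>E z t\<bar> \<le> B"
    and am: "(\<lambda>(z, t). a z t) \<in> borel_measurable borel" and bm: "(\<lambda>(z, t). b z t) \<in> borel_measurable borel"
    and dom: "\<And>z t t'. ennreal \<bar>F z t * E z t'\<bar> \<le> a z t + b z t'"
    and fin: "(\<integral>\<^sup>+z. \<integral>\<^sup>+t. a z t \<partial>lborel \<partial>lborel) < \<infinity>" "(\<integral>\<^sup>+z. \<integral>\<^sup>+t. b z t \<partial>lborel \<partial>lborel) < \<infinity>"
    and h: "h \<longlonglongrightarrow> 0"
  shows "integrable lborel (\<lambda>(z, t). F z t * steklov \<tau> (E z) t)"
    and "integrable lborel (\<lambda>(z, t). F z t * E z t)"
    and "(\<lambda>n. LINT (z, t)|lborel. F z t * steklov (h n) (E z) t) \<longlonglongrightarrow> (LINT (z, t)|lborel. F z t * E z t)"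
proof -
  have [measurable]: "(\<lambda>(z, t). F z t) \<in> borel_measurable (borel \<Otimes>\<^sub>M borel)"
    "(\<lambda>(z, t). E z t) \<in> borel_measurable (borel \<Otimes>\<^sub>M borel)"
    "(\<lambda>(z, t). a z t) \<in> borel_measurable (borel \<Otimes>\<^sub>M borel)"
    "(\<lambda>(z, t). b z t) \<in> borel_measurable (borel \<Otimes>\<^sub>M borel)"
    using Fm Em am bm unfolding borel_prod by auto
  have Fz[measurable]: "F z \<in> borel_measurable borel" and Ez[measurable]: "E z \<in> borel_measurable borel"
    and az[measurable]: "a z \<in> borel_measurable borel" and bz[measurable]: "b z \<in> borel_measurable borel" for z
    by measurable
  have Sm[measurable]: "(\<lambda>(z, t). steklov \<tau> (E z) t) \<in> borel_measurable (borel \<Otimes>\<^sub>M borel)" for \<tau>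
    unfolding case_prod_beta' by (rule borel_measurable_steklov[where M = borel]) measurable
  have Sz[measurable]: "steklov \<tau> (E z) \<in> borel_measurable borel" for z \<tau>
    using measurable_Pair2[OF Sm[of \<tau>], of z] by simp
  define A where "A z = (\<integral>\<^sup>+t. a z t \<partial>lborel) + (\<integral>\<^sup>+t. b z t \<partial>lborel)" for z
  have Am[measurable]: "A \<in> borel_measurable borel" unfolding A_def by measurable
  have Afin: "(\<integral>\<^sup>+z. A z \<partial>lborel) < \<infinity>"
    unfolding A_def using fin by (subst nn_integral_add) auto
  have bshift: "(\<integral>\<^sup>+t. b z (t + c) \<partial>lborel) = (\<integral>\<^sup>+t. b z t \<partial>lborel)" for z c
    using nn_integral_real_affine[of "b z" 1 c] by (simp add: add.commute)
  have inner: "(\<integral>\<^sup>+t. ennreal \<bar>F z t * steklov \<tau> (E z) t\<bar> \<partial>lborel) \<le> A z" for z \<tau>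
  proof -
    have "ennreal \<bar>F z t * steklov \<tau> (E z) t\<bar> \<le> (\<integral>\<^sup>+\<sigma>. indicator {0..1} \<sigma> * (a z t + b z (t + \<tau> * \<sigma>)) \<partial>lborel)" for t
    proof -
      have i: "integrable lborel (\<lambda>\<sigma>. F z t * (indicator {0..1} \<sigma> * E z (t + \<tau> * \<sigma>)))"
        by (intro integrable_mult_right integrable_unit_interval[OF Ez B])
      have "F z t * steklov \<tau> (E z) t = (LINT \<sigma>|lborel. F z t * (indicator {0..1} \<sigma> * E z (t + \<tau> * \<sigma>)))"
        unfolding steklov_def by simp
      then have "ennreal \<bar>F z t * steklov \<tau> (E z) t\<bar> \<le> (\<integral>\<^sup>+\<sigma>. ennreal (norm (F z t * (indicator {0..1} \<sigma> * E z (t + \<tau> * \<sigma>)))) \<partial>lborel)"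
        using integral_norm_bound_ennreal[OF i] by (simp only: real_norm_def)
      also have "\<dots> \<le> (\<integral>\<^sup>+\<sigma>. indicator {0..1} \<sigma> * (a z t + b z (t + \<tau> * \<sigma>)) \<partial>lborel)"
        using dom by (intro nn_integral_mono) (simp add: indicator_def)
      finally show ?thesis .
    qed
    then have "(\<integral>\<^sup>+t. ennreal \<bar>F z t * steklov \<tau> (E z) t\<bar> \<partial>lborel) \<le>
        (\<integral>\<^sup>+t. \<integral>\<^sup>+\<sigma>. indicator {0..1} \<sigma> * (a z t + b z (t + \<tau> * \<sigma>)) \<partial>lborel \<partial>lborel)"
      by (rule nn_integral_mono)
    also have "\<dots> = (\<integral>\<^sup>+\<sigma>. \<integral>\<^sup>+t. indicator {0..1} \<sigma> * (a z t + b z (t + \<tau> * \<sigma>)) \<partial>lborel \<partial>lborel)"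
      by (rule lborel_pair.Fubini') measurable
    also have "\<dots> = (\<integral>\<^sup>+\<sigma>. indicator {0..1::real} \<sigma> * A z \<partial>lborel)"
      unfolding A_def by (simp add: nn_integral_cmult nn_integral_add bshift)
    also have "\<dots> = A z" by (subst nn_integral_multc) auto
    finally show ?thesis .
  qed
  have fst: "(\<integral>\<^sup>+w. f w \<partial>lborel) = (\<integral>\<^sup>+z. \<integral>\<^sup>+t. f (z, t) \<partial>lborel \<partial>lborel)"
    if "f \<in> borel_measurable (borel \<Otimes>\<^sub>M borel)" for f :: "'a \<times> real \<Rightarrow> ennreal"
    unfolding lborel_prod[symmetric] by (rule lborel.nn_integral_fst[symmetric]) (use that in measurable)
  show int1: "integrable lborel (\<lambda>(z, t). F z t * steklov \<tau> (E z) t)" for \<tau>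
  proof (rule integrableI_bounded)
    show "(\<lambda>(z, t). F z t * steklov \<tau> (E z) t) \<in> borel_measurable lborel"
      unfolding lborel_prod[symmetric] by measurable
    have "(\<integral>\<^sup>+w. ennreal (norm (case w of (z, t) \<Rightarrow> F z t * steklov \<tau> (E z) t)) \<partial>lborel) =
      (\<integral>\<^sup>+z. \<integral>\<^sup>+t. ennreal \<bar>F z t * steklov \<tau> (E z) t\<bar> \<partial>lborel \<partial>lborel)"
      by (subst fst) simp_all
    also have "\<dots> \<le> (\<integral>\<^sup>+z. A z \<partial>lborel)" by (intro nn_integral_mono inner)
    finally show "(\<integral>\<^sup>+w. ennreal (norm (case w of (z, t) \<Rightarrow> F z t * steklov \<tau> (E z) t)) \<partial>lborel) < \<infinity>"
      using Afin by simp
  qed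
  show int2: "integrable lborel (\<lambda>(z, t). F z t * E z t)"
  proof (rule integrableI_bounded)
    show "(\<lambda>(z, t). F z t * E z t) \<in> borel_measurable lborel"
      unfolding lborel_prod[symmetric] by measurable
    have "(\<integral>\<^sup>+w. ennreal (norm (case w of (z, t) \<Rightarrow> F z t * E z t)) \<partial>lborel) =
      (\<integral>\<^sup>+z. \<integral>\<^sup>+t. ennreal \<bar>F z t * E z t\<bar> \<partial>lborel \<partial>lborel)"
      by (subst fst) simp_all
    also have "\<dots> \<le> (\<integral>\<^sup>+z. \<integral>\<^sup>+t. a z t + b z t \<partial>lborel \<partial>lborel)" by (intro nn_integral_mono dom)
    also have "\<dots> = (\<integral>\<^sup>+z. A z \<partial>lborel)" unfolding A_def by (simp add: nn_integral_add)
    finally show "(\<integral>\<^sup>+w. ennreal (norm (case w of (z, t) \<Rightarrow> F z t * E z t)) \<partial>lborel) < \<infinity>"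
      using Afin by simp
  qed
  have Sbd: "\<bar>steklov \<tau> (E z) t\<bar> \<le> B" for \<tau> z t by (rule abs_steklov_le[OF Ez B])
  have A_AE: "AE z in lborel. A z \<noteq> \<infinity>"
    by (rule nn_integral_PInf_AE) (use Afin in auto)
  have "(\<lambda>n. LINT z|lborel. LINT t|lborel. F z t * steklov (h n) (E z) t) \<longlonglongrightarrow> (LINT z|lborel. LINT t|lborel. F z t * E z t)"
  proof (rule integral_dominated_convergence)
    show "integrable lborel (\<lambda>z. enn2real (A z))"
    proof (rule integrableI_bounded)
      have "(\<integral>\<^sup>+z. ennreal (norm (enn2real (A z))) \<partial>lborel) \<le> (\<integral>\<^sup>+z. A z \<partial>lborel)"
        by (intro nn_integral_mono) (simp add: ennreal_enn2real_if)
      then show "(\<integral>\<^sup>+z. ennreal (norm (enn2real (A z))) \<partial>lborel) < \<infinity>"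
        using Afin by simp
    qed measurable
    show "AE z in lborel. (\<lambda>n. LINT t|lborel. F z t * steklov (h n) (E z) t) \<longlonglongrightarrow> (LINT t|lborel. F z t * E z t)"
      by (intro always_eventually allI steklov_pairing_limit[OF Fi Ez B h])
    show "AE z in lborel. norm (LINT t|lborel. F z t * steklov (h n) (E z) t) \<le> enn2real (A z)" for n
      using A_AE
    proof eventually_elim
      case (elim z)
      have "ennreal (norm (LINT t|lborel. F z t * steklov (h n) (E z) t)) \<le>
          (\<integral>\<^sup>+t. ennreal (norm (F z t * steklov (h n) (E z) t)) \<partial>lborel)"
        by (rule integral_norm_bound_ennreal, rule integrable_mult_bounded[OF Fi _ Sbd]) measurable
      also have "\<dots> \<le> A z" using inner[of z "h n"] by simp
      finally have "ennreal (norm (LINT t|lborel. F z t * steklov (h n) (E z) t)) \<le> A z" .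
      then show ?case using elim
        by (metis enn2real_ennreal enn2real_mono infinity_ennreal_def norm_ge_zero top.not_eq_extremum)
    qed
  qed measurable
  moreover have "(LINT z|lborel. LINT t|lborel. F z t * steklov \<tau> (E z) t) = (LINT (z, t)|lborel. F z t * steklov \<tau> (E z) t)" for \<tau>
    using lborel_pair.integral_fst[of "\<lambda>z t. F z t * steklov \<tau> (E z) t"] int1[of \<tau>] by (simp add: lborel_prod)
  moreover have "(LINT z|lborel. LINT t|lborel. F z t * E z t) = (LINT (z, t)|lborel. F z t * E z t)"
    using lborel_pair.integral_fst[of "\<lambda>z t. F z t * E z t"] int2 by (simp add: lborel_prod)
  ultimately show "(\<lambda>n. LINT (z, t)|lborel. F z t * steklov (h n) (E z) t) \<longlonglongrightarrow> (LINT (z, t)|lborel. F z t * E z t)"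
    by simp
qed

section \<open>Weak time derivatives and discrete integration by parts\<close>

lemma Cc_infinity_props:
  assumes "\<eta> \<in> Cc_infinity T"
  shows "\<And>t. DERIV \<eta> t :> deriv \<eta> t" "continuous_on UNIV (deriv \<eta>)" "continuous_on UNIV \<eta>"
    "\<exists>B. \<forall>t. \<bar>deriv \<eta> t\<bar> \<le> B" "\<exists>B. \<forall>t. \<bar>\<eta> t\<bar> \<le> B" "\<And>t. t \<le> 0 \<or> T \<le> t \<Longrightarrow> \<eta> t = 0"
    "integrable lborel (deriv \<eta>)"
proof -
  have diff: "((deriv ^^ k) \<eta>) differentiable (at t)" for k t using assms unfolding Cc_infinity_def by blast
  obtain a b where ab: "0 < a" "b < T" "\<And>t. t \<notin> {a..b} \<Longrightarrow> \<eta> t = 0"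
    using assms unfolding Cc_infinity_def by blast
  show d: "DERIV \<eta> t :> deriv \<eta> t" for t
    using diff[of 0 t] by (simp add: DERIV_deriv_iff_real_differentiable)
  have "isCont (deriv \<eta>) t" for t
    using differentiable_imp_continuous_within[OF diff[of 1 t]] by simp
  then show c1: "continuous_on UNIV (deriv \<eta>)" by (simp add: continuous_at_imp_continuous_on)
  have "isCont \<eta> t" for t using d DERIV_isCont by blast
  then show c0: "continuous_on UNIV \<eta>" by (simp add: continuous_at_imp_continuous_on)
  have z: "deriv \<eta> t = 0" if "t \<notin> {a..b}" for t
  proof -
    have "open (- {a..b})" by (simp add: open_Compl)
    then have "\<forall>\<^sub>F s in nhds t. s \<in> - {a..b}" using that by (intro eventually_nhds_in_open) auto
    then have "\<forall>\<^sub>F s in nhds t. \<eta> s = (\<lambda>_. 0) s" by eventually_elim (use ab in auto)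
    then have "deriv \<eta> t = deriv (\<lambda>_. 0) t" by (rule deriv_cong_ev) simp
    then show ?thesis by simp
  qed
  have bd: "\<exists>B. \<forall>t. \<bar>f t\<bar> \<le> B" if "continuous_on UNIV f" "\<And>t. t \<notin> {a..b} \<Longrightarrow> f t = 0" for f :: "real \<Rightarrow> real"
  proof -
    have "compact (f ` {a..b})" using that by (intro compact_continuous_image continuous_on_subset[OF that(1)]) auto
    then obtain B where "\<forall>y\<in>f ` {a..b}. norm y \<le> B" using compact_imp_bounded bounded_iff by blast
    then have "\<bar>f t\<bar> \<le> max B 0" for t using that(2)[of t] by (cases "t \<in> {a..b}") (auto simp: le_max_iff_disj)
    then show ?thesis by blast
  qed
  show "\<exists>B. \<forall>t. \<bar>deriv \<eta> t\<bar> \<le> B" by (rule bd[OF c1 z])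
  then obtain B where B: "\<And>t. \<bar>deriv \<eta> t\<bar> \<le> B" by blast
  show "\<exists>B. \<forall>t. \<bar>\<eta> t\<bar> \<le> B" by (rule bd[OF c0 ab(3)])
  show "\<eta> t = 0" if "t \<le> 0 \<or> T \<le> t" for t using ab that by auto
  have [measurable]: "deriv \<eta> \<in> borel_measurable borel" using c1 by (rule borel_measurable_continuous_onI)
  show "integrable lborel (deriv \<eta>)"
    by (rule integrable_bounded_support[OF _ B z]) measurable
qed

lemma integral_lebesgue_on_lborel:
  fixes f :: "'a::euclidean_space \<Rightarrow> real"
  assumes "S \<in> sets borel" "f \<in> borel_measurable borel"
  shows "(LINT x|lebesgue_on S. f x) = (LINT x|lborel. indicator S x * f x)"
proof -
  have "(LINT x|lebesgue_on S. f x) = (LINT x|lebesgue. indicator S x *\<^sub>R f x)"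
    using assms by (intro integral_restrict_space) auto
  also have "\<dots> = (LINT x|lborel. indicator S x *\<^sub>R f x)"
    using assms by (intro integral_completion) auto
  finally show ?thesis by simp
qed

text \<open>Duality moves the forward average of \<open>w\<close> to a backward average of
  \<open>deriv \<eta>\<close>, which the fundamental theorem of calculus evaluates as (\<eta> t -
  \<eta> (t - h)) / h; a translation then carries the difference quotient back to \<open>w\<close>.
  The average of \<open>w\<close> lives on [c - h, d], and h < c together with d < T keeps this
  inside (0, T), so the integrals may be taken over the whole line.\<close>

lemma steklov_weak_derivative:
  assumes w[measurable]: "w \<in> borel_measurable borel" and B: "\<And>t. \<bar>w t\<bar> \<le> B"
    and supp: "\<And>t. t \<notin> {c..d} \<Longrightarrow> w t = 0" and h: "0 < h" "h < c" "d < T" and \<eta>: "\<eta> \<in> Cc_infinity T"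
  shows "(LINT t|lebesgue_on {0<..<T}. steklov h w t * deriv \<eta> t) =
    - (LINT t|lebesgue_on {0<..<T}. (w (t + h) - w t) / h * \<eta> t)"
proof -
  note \<eta>p = Cc_infinity_props[OF \<eta>]
  obtain B1 B0 where B1: "\<And>t. \<bar>deriv \<eta> t\<bar> \<le> B1" and B0: "\<And>t. \<bar>\<eta> t\<bar> \<le> B0" using \<eta>p(4,5) by blast
  have m[measurable]: "deriv \<eta> \<in> borel_measurable borel" "\<eta> \<in> borel_measurable borel"
    using \<eta>p(2,3) by (auto intro: borel_measurable_continuous_onI)
  have sm[measurable]: "steklov h w \<in> borel_measurable borel"
    by (rule borel_measurable_steklov[where M = borel and w = "\<lambda>_. w" and g = "\<lambda>_. 0"]) measurable
  have wi: "integrable lborel w"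
    by (rule integrable_bounded_support[OF w B supp])
  have s0: "steklov h w t = 0" if "t \<notin> {0<..<T}" for t
  proof -
    have "indicator {0..1} \<sigma> * w (t + h * \<sigma>) = 0" for \<sigma> :: real
    proof (cases "\<sigma> \<in> {0..1}")
      case True
      then have "0 \<le> h * \<sigma>" "h * \<sigma> \<le> h" using h by (auto simp: mult_left_le)
      moreover have "t \<le> 0 \<or> T \<le> t" using that by auto
      ultimately have "t + h * \<sigma> < c \<or> d < t + h * \<sigma>" using h by linarith
      then have "t + h * \<sigma> \<notin> {c..d}" unfolding atLeastAtMost_iff by linarith
      then show ?thesis using supp by simp
    qed simp
    then show ?thesis unfolding steklov_def by (simp only: Bochner_Integration.integral_zero)
  qed
  have "(LINT t|lebesgue_on {0<..<T}. steklov h w t * deriv \<eta> t) = (LINT t|lborel. indicator {0<..<T} t * (steklov h w t * deriv \<eta> t))"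
    by (rule integral_lebesgue_on_lborel) measurable
  also have "\<dots> = (LINT t|lborel. deriv \<eta> t * steklov h w t)"
    using s0 by (intro Bochner_Integration.integral_cong) (auto simp: indicator_def)
  also have "\<dots> = (LINT \<sigma>|lborel. indicator {0..1} \<sigma> * (LINT t|lborel. deriv \<eta> t * w (t + h * \<sigma>)))"
    by (rule steklov_Fubini(1)[OF \<eta>p(7) w B])
  also have "\<dots> = (LINT \<sigma>|lborel. indicator {0..1} \<sigma> * (LINT t|lborel. w t * deriv \<eta> (t + - h * \<sigma>)))"
  proof -
    have "integrable lborel (\<lambda>t. w t * deriv \<eta> (t - r))" for r
      by (rule integrable_mult_bounded[OF wi], measurable) (rule B1)
    then have "(LINT t|lborel. w (t + r) * deriv \<eta> (t + r - r)) = (LINT t|lborel. w t * deriv \<eta> (t - r))" for r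
      by (rule integrable_shift(2))
    then have "(LINT t|lborel. deriv \<eta> t * w (t + r)) = (LINT t|lborel. w t * deriv \<eta> (t - r))" for r
      by (simp only: mult.commute[of "deriv \<eta> _"] add_diff_cancel_right')
    then show ?thesis by simp
  qed
  also have "\<dots> = (LINT t|lborel. w t * steklov (- h) (deriv \<eta>) t)"
    by (rule steklov_Fubini(1)[OF wi m(1) B1, symmetric])
  also have "\<dots> = (LINT t|lborel. (w t * \<eta> t - w t * \<eta> (t - h)) / h)"
  proof (intro Bochner_Integration.integral_cong refl)
    fix t
    have "((\<lambda>\<sigma>. - \<eta> (t + - h * \<sigma>) / h) has_vector_derivative deriv \<eta> (t + - h * \<sigma>)) (at \<sigma> within {0..1})" for \<sigma>
    proof -
      have "((\<lambda>\<sigma>. t + - h * \<sigma>) has_real_derivative - h) (at \<sigma> within {0..1})"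
        by (auto intro!: derivative_eq_intros)
      from DERIV_chain2[OF \<eta>p(1) this]
      have "((\<lambda>\<sigma>. - \<eta> (t + - h * \<sigma>) / h) has_real_derivative - (deriv \<eta> (t + - h * \<sigma>) * - h) / h) (at \<sigma> within {0..1})"
        by (intro DERIV_cdivide DERIV_minus)
      moreover have "- (deriv \<eta> (t + - h * \<sigma>) * - h) / h = deriv \<eta> (t + - h * \<sigma>)"
        using h by simp
      ultimately have "((\<lambda>\<sigma>. - \<eta> (t + - h * \<sigma>) / h) has_real_derivative deriv \<eta> (t + - h * \<sigma>)) (at \<sigma> within {0..1})"
        by (simp only:)
      then show ?thesis by (simp only: has_real_derivative_iff_has_vector_derivative)
    qed
    moreover have "continuous_on {0..1} (\<lambda>\<sigma>. deriv \<eta> (t + - h * \<sigma>))"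
      by (intro continuous_on_compose2[OF \<eta>p(2)] continuous_intros) auto
    ultimately have "(LBINT \<sigma>. indicator {0..1} \<sigma> *\<^sub>R deriv \<eta> (t + - h * \<sigma>)) = - \<eta> (t + - h * 1) / h - - \<eta> (t + - h * 0) / h"
      by (intro integral_FTC_atLeastAtMost) simp_all
    then have "steklov (- h) (deriv \<eta>) t = (\<eta> t - \<eta> (t - h)) / h"
      unfolding steklov_def real_scaleR_def by (simp only:) (simp add: diff_divide_distrib)
    then show "w t * steklov (- h) (deriv \<eta>) t = (w t * \<eta> t - w t * \<eta> (t - h)) / h"
      by (simp add: right_diff_distrib)
  qed
  also have "\<dots> = ((LINT t|lborel. w t * \<eta> t) - (LINT t|lborel. w t * \<eta> (t - h))) / h"
  proof -
    have i1: "integrable lborel (\<lambda>t. w t * \<eta> t)"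
      by (rule integrable_mult_bounded[OF wi _ B0]) measurable
    have i2: "integrable lborel (\<lambda>t. w t * \<eta> (t - h))"
      by (rule integrable_mult_bounded[OF wi], measurable) (rule B0)
    have "(LINT t|lborel. (w t * \<eta> t - w t * \<eta> (t - h)) / h) = (LINT t|lborel. w t * \<eta> t - w t * \<eta> (t - h)) / h"
      by (rule integral_divide_zero)
    then show ?thesis by (simp only: Bochner_Integration.integral_diff[OF i1 i2])
  qed
  also have "(LINT t|lborel. w t * \<eta> (t - h)) = (LINT t|lborel. w (t + h) * \<eta> t)"
  proof -
    have "integrable lborel (\<lambda>t. w t * \<eta> (t - h))"
      by (rule integrable_mult_bounded[OF wi], measurable) (rule B0)
    from integrable_shift(2)[OF this, of h] show ?thesis by simp
  qed
  also have "((LINT t|lborel. w t * \<eta> t) - (LINT t|lborel. w (t + h) * \<eta> t)) / h =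
      - (LINT t|lborel. (w (t + h) - w t) / h * \<eta> t)"
  proof -
    have i1: "integrable lborel (\<lambda>t. w t * \<eta> t)"
      by (rule integrable_mult_bounded[OF wi _ B0]) measurable
    have i2: "integrable lborel (\<lambda>t. w (t + h) * \<eta> t)"
      by (rule integrable_mult_bounded[OF integrable_shift(1)[OF wi] _ B0]) measurable
    have "(LINT t|lborel. (w (t + h) - w t) / h * \<eta> t) = (LINT t|lborel. (w (t + h) * \<eta> t - w t * \<eta> t) / h)"
      by (intro Bochner_Integration.integral_cong) (auto simp: left_diff_distrib)
    also have "\<dots> = (LINT t|lborel. w (t + h) * \<eta> t - w t * \<eta> t) / h"
      by (rule integral_divide_zero)
    also have "(LINT t|lborel. w (t + h) * \<eta> t - w t * \<eta> t) = (LINT t|lborel. w (t + h) * \<eta> t) - (LINT t|lborel. w t * \<eta> t)"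
      by (rule Bochner_Integration.integral_diff[OF i2 i1])
    finally show ?thesis by (simp only: minus_divide_left minus_diff_eq)
  qed
  also have "(LINT t|lborel. (w (t + h) - w t) / h * \<eta> t) = (LINT t|lborel. indicator {0<..<T} t * ((w (t + h) - w t) / h * \<eta> t))"
  proof (intro Bochner_Integration.integral_cong refl)
    show "(w (t + h) - w t) / h * \<eta> t = indicator {0<..<T} t * ((w (t + h) - w t) / h * \<eta> t)" for t
      using \<eta>p(6)[of t] by (cases "t \<in> {0<..<T}") (auto simp: not_less)
  qed
  also have "\<dots> = (LINT t|lebesgue_on {0<..<T}. (w (t + h) - w t) / h * \<eta> t)"
    by (rule integral_lebesgue_on_lborel[symmetric]) measurable
  finally show ?thesis .
qed

text \<open>Summation by parts: the left side equals the integral of \<xi> t * Z t * (\<beta> t -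
  \<beta> (t - h)) / h. By \<open>convex\<close> the integrand is at most \<xi> t * (g (t - h) - g
  t) / h, and a shift puts the difference quotient onto \<xi>. The forward quotient of the test
  function is what leaves \<open>Z\<close> at the later of the two times, and there the convexity
  inequality has the sign wanted for supersolutions.\<close>

lemma steklov_time_inequality:
  fixes \<beta> g \<xi> Z :: "real \<Rightarrow> real"
  assumes [measurable]: "\<beta> \<in> borel_measurable borel" "g \<in> borel_measurable borel" "\<xi> \<in> borel_measurable borel" "Z \<in> borel_measurable borel"
    and B: "\<And>t. \<bar>\<beta> t\<bar> \<le> B" "\<And>t. \<bar>g t\<bar> \<le> B" "\<And>t. \<bar>\<xi> t\<bar> \<le> B" "\<And>t. \<bar>Z t\<bar> \<le> B"
    and \<xi>: "\<And>t. 0 \<le> \<xi> t" "\<And>t. t \<notin> {c..d} \<Longrightarrow> \<xi> t = 0"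
    and convex: "\<And>s t. Z t * (\<beta> t - \<beta> s) \<le> g s - g t" and h: "0 < h"
  shows "- (LINT t|lborel. \<beta> t * ((\<xi> (t + h) * Z (t + h) - \<xi> t * Z t) / h)) \<le>
    (LINT t|lborel. g t * ((\<xi> (t + h) - \<xi> t) / h))"
proof -
  have \<xi>i: "integrable lborel \<xi>"
    by (rule integrable_bounded_support[OF _ B(3) \<xi>(2)]) measurable
  define W where "W t = \<xi> t * Z t" for t
  have Wi: "integrable lborel W" unfolding W_def by (rule integrable_mult_bounded[OF \<xi>i _ B(4)]) measurable
  have I1: "integrable lborel (\<lambda>t. W t * \<beta> (t + r))" for r
    by (rule integrable_mult_bounded[OF Wi], measurable) (rule B(1))
  have I2: "integrable lborel (\<lambda>t. W (t + r) * \<beta> t)" for r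
    by (rule integrable_mult_bounded[OF integrable_shift(1)[OF Wi] _ B(1)]) measurable
  have I3: "integrable lborel (\<lambda>t. \<xi> t * g (t + r))" for r
    by (rule integrable_mult_bounded[OF \<xi>i], measurable) (rule B(2))
  have I4: "integrable lborel (\<lambda>t. \<xi> (t + r) * g t)" for r
    by (rule integrable_mult_bounded[OF integrable_shift(1)[OF \<xi>i] _ B(2)]) measurable
  have sh1: "(LINT t|lborel. W (t + h) * \<beta> t) = (LINT t|lborel. W t * \<beta> (t + - h))"
    using integrable_shift(2)[OF I1[of "- h"], of h] by simp
  have sh2: "(LINT t|lborel. \<xi> (t + h) * g t) = (LINT t|lborel. \<xi> t * g (t + - h))"
    using integrable_shift(2)[OF I3[of "- h"], of h] by simp
  have "(LINT t|lborel. \<beta> t * ((\<xi> (t + h) * Z (t + h) - \<xi> t * Z t) / h)) =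
      (LINT t|lborel. (W (t + h) * \<beta> t - W t * \<beta> t) / h)"
    by (intro Bochner_Integration.integral_cong) (auto simp: W_def algebra_simps)
  also have "\<dots> = ((LINT t|lborel. W t * \<beta> (t + - h)) - (LINT t|lborel. W t * \<beta> t)) / h"
  proof -
    have "(LINT t|lborel. (W (t + h) * \<beta> t - W t * \<beta> t) / h) = (LINT t|lborel. W (t + h) * \<beta> t - W t * \<beta> t) / h"
      by (rule integral_divide_zero)
    also have "(LINT t|lborel. W (t + h) * \<beta> t - W t * \<beta> t) = (LINT t|lborel. W (t + h) * \<beta> t) - (LINT t|lborel. W t * \<beta> t)"
      by (rule Bochner_Integration.integral_diff[OF I2 I1[of 0, simplified]])
    finally show ?thesis by (simp only: sh1)
  qed
  finally have lhs: "- (LINT t|lborel. \<beta> t * ((\<xi> (t + h) * Z (t + h) - \<xi> t * Z t) / h)) =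
     ((LINT t|lborel. W t * \<beta> t) - (LINT t|lborel. W t * \<beta> (t + - h))) / h"
    by (simp only: minus_divide_left minus_diff_eq)
  have "(LINT t|lborel. g t * ((\<xi> (t + h) - \<xi> t) / h)) = (LINT t|lborel. (\<xi> (t + h) * g t - \<xi> t * g t) / h)"
    by (intro Bochner_Integration.integral_cong) (auto simp: algebra_simps)
  also have "\<dots> = ((LINT t|lborel. \<xi> t * g (t + - h)) - (LINT t|lborel. \<xi> t * g t)) / h"
  proof -
    have "(LINT t|lborel. (\<xi> (t + h) * g t - \<xi> t * g t) / h) = (LINT t|lborel. \<xi> (t + h) * g t - \<xi> t * g t) / h"
      by (rule integral_divide_zero)
    also have "(LINT t|lborel. \<xi> (t + h) * g t - \<xi> t * g t) = (LINT t|lborel. \<xi> (t + h) * g t) - (LINT t|lborel. \<xi> t * g t)"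
      by (rule Bochner_Integration.integral_diff[OF I4 I3[of 0, simplified]])
    finally show ?thesis by (simp only: sh2)
  qed
  finally have rhs: "(LINT t|lborel. g t * ((\<xi> (t + h) - \<xi> t) / h)) = \<dots>" .
  have "(LINT t|lborel. W t * \<beta> t) - (LINT t|lborel. W t * \<beta> (t + - h)) =
      (LINT t|lborel. W t * \<beta> t - W t * \<beta> (t + - h))"
    using I1[of 0] I1[of "- h"] by (intro Bochner_Integration.integral_diff[symmetric]) simp_all
  also have "\<dots> \<le> (LINT t|lborel. \<xi> t * g (t + - h) - \<xi> t * g t)"
  proof (rule integral_mono)
    show "integrable lborel (\<lambda>t. W t * \<beta> t - W t * \<beta> (t + - h))"
      using I1[of 0] I1[of "- h"] by (intro Bochner_Integration.integrable_diff) simp_all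
    show "integrable lborel (\<lambda>t. \<xi> t * g (t + - h) - \<xi> t * g t)"
      using I3[of 0] I3[of "- h"] by (intro Bochner_Integration.integrable_diff) simp_all
    show "W t * \<beta> t - W t * \<beta> (t + - h) \<le> \<xi> t * g (t + - h) - \<xi> t * g t" for t
      using mult_left_mono[OF convex[of t "t + - h"] \<xi>(1)[of t]] by (simp add: W_def algebra_simps)
  qed
  also have "\<dots> = (LINT t|lborel. \<xi> t * g (t + - h)) - (LINT t|lborel. \<xi> t * g t)"
    using I3[of 0] I3[of "- h"] by (intro Bochner_Integration.integral_diff) simp_all
  finally have fin: "(LINT t|lborel. W t * \<beta> t) - (LINT t|lborel. W t * \<beta> (t + - h)) \<le>
      (LINT t|lborel. \<xi> t * g (t + - h)) - (LINT t|lborel. \<xi> t * g t)" .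
  show ?thesis unfolding lhs rhs by (rule divide_right_mono[OF fin less_imp_le[OF h]])
qed

section \<open>Truncated supersolutions as test functions\<close>

text \<open>A pair meets \<open>S\<close> in its first or in its second entry; by symmetry both
  contributions are equal, which gives the factor 2.\<close>

lemma nn_integral_symmetric_le:
  fixes f :: "'a::euclidean_space \<times> 'a \<Rightarrow> ennreal"
  assumes f[measurable]: "f \<in> borel_measurable borel" and sym: "\<And>x y. f (x, y) = f (y, x)"
    and S[measurable]: "S \<in> sets borel" and C: "\<And>x. x \<in> S \<Longrightarrow> (\<integral>\<^sup>+y. f (x, y) \<partial>lborel) \<le> C"
  shows "(\<integral>\<^sup>+z. f z * indicator {z. fst z \<in> S \<or> snd z \<in> S} z \<partial>lborel) \<le> 2 * (C * emeasure lborel S)"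
proof -
  have m[measurable]: "f \<in> borel_measurable (borel \<Otimes>\<^sub>M borel)" using f unfolding borel_prod .
  have half: "(\<integral>\<^sup>+x. \<integral>\<^sup>+y. f (x, y) * indicator S x \<partial>lborel \<partial>lborel) \<le> C * emeasure lborel S"
  proof -
    have "(\<integral>\<^sup>+x. \<integral>\<^sup>+y. f (x, y) * indicator S x \<partial>lborel \<partial>lborel) \<le> (\<integral>\<^sup>+x. C * indicator S x \<partial>lborel)"
    proof (rule nn_integral_mono)
      fix x
      show "(\<integral>\<^sup>+y. f (x, y) * indicator S x \<partial>lborel) \<le> C * indicator S x"
        using C[of x] by (cases "x \<in> S") simp_all
    qed
    also have "\<dots> = C * emeasure lborel S" by (simp add: nn_integral_cmult_indicator)
    finally show ?thesis .
  qed
  have "(\<integral>\<^sup>+z. f z * indicator {z. fst z \<in> S \<or> snd z \<in> S} z \<partial>lborel) \<le>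
      (\<integral>\<^sup>+z. f z * indicator S (fst z) + f z * indicator S (snd z) \<partial>lborel)"
    by (rule nn_integral_mono) (auto simp: indicator_def)
  also have "\<dots> = (\<integral>\<^sup>+z. f z * indicator S (fst z) \<partial>lborel) + (\<integral>\<^sup>+z. f z * indicator S (snd z) \<partial>lborel)"
    unfolding lborel_prod[symmetric] by (rule nn_integral_add) measurable
  also have "(\<integral>\<^sup>+z. f z * indicator S (fst z) \<partial>lborel) = (\<integral>\<^sup>+x. \<integral>\<^sup>+y. f (x, y) * indicator S x \<partial>lborel \<partial>lborel)"
    unfolding lborel_prod[symmetric] by (subst lborel.nn_integral_fst[symmetric]) simp_all
  also have "(\<integral>\<^sup>+z. f z * indicator S (snd z) \<partial>lborel) = (\<integral>\<^sup>+y. \<integral>\<^sup>+x. f (x, y) * indicator S y \<partial>lborel \<partial>lborel)"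
    unfolding lborel_prod[symmetric] by (subst lborel_pair.nn_integral_snd[symmetric]) simp_all
  also have "\<dots> = (\<integral>\<^sup>+x. \<integral>\<^sup>+y. f (x, y) * indicator S x \<partial>lborel \<partial>lborel)"
    by (simp add: sym)
  finally show ?thesis using half add_mono[OF half half] by (simp add: mult_2[symmetric] order_trans)
qed

lemma integrable_bounded_finite_support:
  fixes f :: "'a \<Rightarrow> real"
  assumes "f \<in> borel_measurable M" "\<And>x. \<bar>f x\<bar> \<le> B" "\<And>x. x \<notin> S \<Longrightarrow> f x = 0"
    "S \<in> sets M" "emeasure M S < \<infinity>"
  shows "integrable M f"
proof -
  have "integrable M (indicator S :: 'a \<Rightarrow> real)"
    using assms(4,5) by (rule integrable_real_indicator)
  then have "integrable M (\<lambda>x. indicator S x * f x)"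
    by (rule integrable_mult_bounded) (use assms in auto)
  moreover have "(\<lambda>x. indicator S x * f x) = f"
  proof
    show "indicator S x * f x = f x" for x using assms(3)[of x] by (cases "x \<in> S") simp_all
  qed
  ultimately show ?thesis by simp
qed

lemma measurable_lborel_restrict:
  assumes "f \<in> borel_measurable borel"
  shows "f \<in> borel_measurable (lebesgue_on S)"
  using assms by (intro measurable_restrict_space1 measurable_completion) simp

lemma bounded_imp_LrLr:
  fixes v :: "real^'n \<Rightarrow> real \<Rightarrow> real"
  assumes v: "(\<lambda>(x, t). v x t) \<in> borel_measurable borel" and B: "\<And>x t. \<bar>v x t\<bar> \<le> B"
    and D: "D \<in> sets borel" "bounded D" and r: "0 < r"
  shows "v \<in> LrLr r D {t1..t2}"
proof -
  have S: "D \<times> {t1..t2} \<in> sets borel"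
    unfolding borel_prod[symmetric] using D(1) by (intro pair_measureI) auto
  have bS: "bounded (D \<times> {t1..t2})" using D(2) by (intro bounded_Times) auto
  have "(\<integral>\<^sup>+(x, t). ennreal (\<bar>v x t\<bar> powr r) \<partial>lebesgue_on (D \<times> {t1..t2})) \<le>
      (\<integral>\<^sup>+_. ennreal (B powr r) \<partial>lebesgue_on (D \<times> {t1..t2}))"
    using B r by (intro nn_integral_mono) (auto intro!: ennreal_leI powr_mono2)
  also have "\<dots> = ennreal (B powr r) * emeasure lborel (D \<times> {t1..t2})"
    using S by (simp add: emeasure_restrict_space)
  also have "\<dots> < \<infinity>"
    using emeasure_bounded_finite[OF bS] by (simp add: ennreal_mult_less_top)
  finally show ?thesis
    unfolding LrLr_def using measurable_lborel_restrict[OF v] by simp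
qed

lemma Wsp_norm_pow_UNIV:
  fixes v :: "real^'n \<Rightarrow> real"
  shows "Wsp_norm_pow s p UNIV v = (\<integral>\<^sup>+x. ennreal (\<bar>v x\<bar> powr p) \<partial>lborel) +
    (\<integral>\<^sup>+z. ennreal (\<bar>v (fst z) - v (snd z)\<bar> powr p * gkernel p s (fst z) (snd z)) \<partial>lborel)"
  unfolding Wsp_norm_pow_def UNIV_Times_UNIV lebesgue_on_UNIV_eq nn_integral_completion
  by (simp add: gkernel_def case_prod_beta')

text \<open>The Borel algebra of a pair type equals a product of Borel algebras, but not
  syntactically. These rules let \<open>measurable\<close> reach the points x and y inside the first
  component of ((x, y), t).\<close>

lemma measurable_components [measurable]:
  "(\<lambda>w. fst (fst w)) \<in> borel_measurable ((borel :: ('a::second_countable_topology \<times> 'b::second_countable_topology) measure)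
    \<Otimes>\<^sub>M (borel :: 'c::second_countable_topology measure))"
  "(\<lambda>w. snd (fst w)) \<in> borel_measurable ((borel :: ('a \<times> 'b) measure) \<Otimes>\<^sub>M (borel :: 'c measure))"
proof -
  have "(fst :: 'a \<times> 'b \<Rightarrow> 'a) \<in> borel_measurable borel" "(snd :: 'a \<times> 'b \<Rightarrow> 'b) \<in> borel_measurable borel"
    unfolding borel_prod[symmetric] by simp_all
  then show "(\<lambda>w. fst (fst w)) \<in> borel_measurable ((borel :: ('a \<times> 'b) measure) \<Otimes>\<^sub>M (borel :: 'c measure))"
    "(\<lambda>w. snd (fst w)) \<in> borel_measurable ((borel :: ('a \<times> 'b) measure) \<Otimes>\<^sub>M (borel :: 'c measure))"
    by (auto intro: measurable_compose[OF measurable_fst])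
qed

text \<open>What is kept after the passage to Borel representatives. The bounds hold everywhere
  instead of almost everywhere, so sets such as {U < k} and slices in time can be treated pointwise.
  The inequality \<open>weak\<close> has no boundary terms, because its test functions vanish
  outside a compact interval of times; initial values enter only later, through a cutoff in time.
  Triples are grouped as ((x, y), t), with z = (x, y), to suit Fubini.\<close>

locale borel_supersolution =
  fixes p q s \<Lambda> T \<mu> M :: real and D :: "(real^'n) set" and U :: "real^'n \<Rightarrow> real \<Rightarrow> real"
    and \<kappa> :: "real^'n \<Rightarrow> real^'n \<Rightarrow> real \<Rightarrow> real"
  assumes p: "1 < p" and q: "0 < q" and s: "0 < s" and \<Lambda>: "1 \<le> \<Lambda>"
    and D: "open D" "bounded D"
    and U_borel: "(\<lambda>(x, t). U x t) \<in> borel_measurable borel"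
    and U_bounds: "\<And>x t. \<mu> \<le> U x t" "\<And>x t. U x t \<le> M"
    and \<kappa>_borel: "(\<lambda>(z, t). \<kappa> (fst z) (snd z) t) \<in> borel_measurable borel"
    and \<kappa>_bounds: "\<And>x y t. gkernel p s x y / \<Lambda> \<le> \<kappa> x y t" "\<And>x y t. \<kappa> x y t \<le> \<Lambda> * gkernel p s x y"
    and U_energy: "\<And>c d. 0 < c \<Longrightarrow> c < d \<Longrightarrow> d < T \<Longrightarrow>
      (\<integral>\<^sup>+z. \<integral>\<^sup>+t. ennreal (\<bar>U (fst z) t - U (snd z) t\<bar> powr p * gkernel p s (fst z) (snd z)) *
        indicator (D \<times> D) z * indicator {c..d} t \<partial>lborel \<partial>lborel) < \<infinity>"
    and weak: "\<And>\<phi> \<psi> c d. test_function p q s D T \<phi> \<psi> \<Longrightarrow>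
      (\<lambda>(x, t). \<phi> x t) \<in> borel_measurable borel \<Longrightarrow> (\<lambda>(x, t). \<psi> x t) \<in> borel_measurable borel \<Longrightarrow>
      0 < c \<Longrightarrow> c < d \<Longrightarrow> d < T \<Longrightarrow> (\<And>x t. t \<notin> {c..d} \<Longrightarrow> \<phi> x t = 0 \<and> \<psi> x t = 0) \<Longrightarrow>
      0 \<le> (LINT (z, t)|lborel. spow (p - 1) (U (fst z) t - U (snd z) t) * (\<phi> (fst z) t - \<phi> (snd z) t) * \<kappa> (fst z) (snd z) t)
        - (LINT (x, t)|lborel. indicator D x * (spow q (U x t) * \<psi> x t))"
begin

lemma measurable_U [measurable]:
  assumes "f \<in> borel_measurable N" "g \<in> borel_measurable N"
  shows "(\<lambda>w. U (f w) (g w)) \<in> borel_measurable N"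
proof -
  have "(\<lambda>w. (\<lambda>(x, t). U x t) (f w, g w)) \<in> borel_measurable N"
    using assms U_borel by (intro measurable_compose[OF _ U_borel] borel_measurable_Pair)
  then show ?thesis by simp
qed

lemma measurable_\<kappa> [measurable]:
  assumes "f \<in> borel_measurable N" "g \<in> borel_measurable N" "h \<in> borel_measurable N"
  shows "(\<lambda>w. \<kappa> (f w) (g w) (h w)) \<in> borel_measurable N"
proof -
  have "(\<lambda>w. (\<lambda>(z, t). \<kappa> (fst z) (snd z) t) ((f w, g w), h w)) \<in> borel_measurable N"
    using assms by (intro measurable_compose[OF _ \<kappa>_borel] borel_measurable_Pair)
  then show ?thesis by simp
qed

lemma \<kappa>_nonneg: "0 \<le> \<kappa> x y t"
  using \<kappa>_bounds(1)[of x y t] \<Lambda> by (meson divide_nonneg_nonneg gkernel_nonneg order_trans zero_le_one)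

lemma D_borel [measurable]: "D \<in> sets borel"
  using D(1) by simp

lemma abs_U_diff: "\<bar>U x t - U y t\<bar> \<le> M - \<mu>"
  using U_bounds[of x t] U_bounds[of y t] by (simp add: abs_le_iff)

lemma abs_U: "\<bar>U x t\<bar> \<le> \<bar>\<mu>\<bar> + \<bar>M\<bar>"
  using U_bounds[of x t] by linarith

end

text \<open>Below \<mu> a level cuts nothing off, so the truncation is supported in
  \<open>B'\<close> at every time. The gap \<rho> between \<open>B'\<close> and the complement of
  \<open>D\<close> keeps the pairs that leave \<open>D\<close> away from the diagonal. The bound
  \<open>Ck\<close> for the energy density of \<open>k\<close> is uniform in \<open>x\<close>, and
  it is the factor that will multiply the measure of {U < k}.\<close>

locale level = borel_supersolution +
  fixes k :: "real^'n \<Rightarrow> real" and B' :: "(real^'n) set" and \<rho> m Ck :: real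
  assumes k_borel [measurable]: "k \<in> borel_measurable borel" and k_bound: "\<And>x. \<bar>k x\<bar> \<le> m"
    and k_outside: "\<And>x. x \<notin> B' \<Longrightarrow> k x \<le> \<mu>"
    and B'_borel [measurable]: "B' \<in> sets borel" and B'_sub: "B' \<subseteq> D"
    and \<rho>: "0 < \<rho>" and sep: "\<And>x y. x \<in> B' \<Longrightarrow> y \<notin> D \<Longrightarrow> \<rho> \<le> norm (x - y)"
    and Ck: "0 \<le> Ck" "\<And>x. (\<integral>\<^sup>+y. ennreal (\<bar>k x - k y\<bar> powr p * gkernel p s x y) \<partial>lborel) \<le> ennreal Ck"
begin

definition Z :: "real^'n \<Rightarrow> real \<Rightarrow> real" where "Z x t = max 0 (k x - U x t)"

definition N :: "((real^'n) \<times> (real^'n)) set" where "N = {z. fst z \<in> B' \<or> snd z \<in> B'}"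

lemma measurable_Z [measurable]:
  assumes [measurable]: "f \<in> borel_measurable N'" "g \<in> borel_measurable N'"
  shows "(\<lambda>w. Z (f w) (g w)) \<in> borel_measurable N'"
  unfolding Z_def by measurable

lemma N_borel [measurable]: "N \<in> sets borel"
proof -
  have "N = (B' \<times> UNIV) \<union> (UNIV \<times> B')" unfolding N_def by auto
  also have "\<dots> \<in> sets (borel \<Otimes>\<^sub>M borel)" by (intro sets.Un pair_measureI) auto
  finally show ?thesis unfolding borel_prod .
qed

lemma Z_nonneg [simp]: "0 \<le> Z x t" by (simp add: Z_def)

lemma Z_le: "Z x t \<le> m + \<bar>\<mu>\<bar>"
  using k_bound[of x] U_bounds(1)[of x t] by (auto simp: Z_def abs_if split: if_splits)

lemma Z_outside: "x \<notin> B' \<Longrightarrow> Z x t = 0"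
  using k_outside[of x] U_bounds(1)[of x t] by (simp add: Z_def)

lemma emeasure_D: "emeasure lborel D < \<infinity>"
  by (rule emeasure_bounded_finite[OF D(2)])

lemma emeasure_B': "emeasure lborel B' < \<infinity>"
  using emeasure_mono[OF B'_sub, of lborel] emeasure_D by (auto simp: order.strict_trans1)

lemma abs_Z_diff: "\<bar>Z x t - Z y t\<bar> \<le> \<bar>k x - k y\<bar> + \<bar>U x t - U y t\<bar>"
  unfolding Z_def by linarith

lemma Z_diff_outside: "z \<notin> N \<Longrightarrow> Z (fst z) t = 0 \<and> Z (snd z) t = 0"
  unfolding N_def using Z_outside by auto

lemma k_energy_finite:
  "(\<integral>\<^sup>+z. ennreal (\<bar>k (fst z) - k (snd z)\<bar> powr p * gkernel p s (fst z) (snd z)) * indicator N z \<partial>lborel) < \<infinity>"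
proof -
  have "(\<integral>\<^sup>+z. ennreal (\<bar>k (fst z) - k (snd z)\<bar> powr p * gkernel p s (fst z) (snd z)) * indicator N z \<partial>lborel)
      \<le> 2 * (ennreal Ck * emeasure lborel B')"
    unfolding N_def
  proof (rule nn_integral_symmetric_le)
    show "(\<lambda>z. ennreal (\<bar>k (fst z) - k (snd z)\<bar> powr p * gkernel p s (fst z) (snd z))) \<in> borel_measurable borel"
      unfolding borel_prod[symmetric] by measurable
  qed (use Ck in \<open>auto simp: abs_minus_commute gkernel_commute\<close>)
  also have "\<dots> < \<infinity>" using emeasure_B' by (simp add: ennreal_mult_less_top)
  finally show ?thesis .
qed

text \<open>The energy of \<open>U\<close> is known to be finite only on D \<times> D. A pair in
  \<open>N\<close> outside D \<times> D has one point in \<open>B'\<close> and the other outside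
  \<open>D\<close>, hence its points are at distance at least \<rho>; on such pairs \<open>U\<close>
  is bounded and the kernel has a finite tail.\<close>

lemma U_energy_finite:
  assumes cd: "0 < c" "c < d" "d < T"
  shows "(\<integral>\<^sup>+z. \<integral>\<^sup>+t. ennreal (\<bar>U (fst z) t - U (snd z) t\<bar> powr p * gkernel p s (fst z) (snd z)) *
    indicator N z * indicator {c..d} t \<partial>lborel \<partial>lborel) < \<infinity>"
proof -
  obtain C where C: "0 < C" "\<And>x. (\<integral>\<^sup>+y. ennreal (gkernel p s x y) * indicator {y. \<rho> \<le> norm (x - y)} y \<partial>(lborel :: (real^'n) measure))
      \<le> ennreal (C * \<rho> powr (- (p * s)))"
    using gkernel_tail[where 'a = "real^'n", of p s] p s \<rho> by auto
  define far where "far z = ennreal (gkernel p s (fst z) (snd z)) * indicator {z. \<rho> \<le> norm (fst z - snd z)} z"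
    for z :: "(real^'n) \<times> (real^'n)"
  have far[measurable]: "far \<in> borel_measurable borel"
    unfolding far_def borel_prod[symmetric] by measurable
  have far_fin: "(\<integral>\<^sup>+z. far z * indicator N z \<partial>lborel) < \<infinity>"
  proof -
    have "(\<integral>\<^sup>+z. far z * indicator N z \<partial>lborel) \<le> 2 * (ennreal (C * \<rho> powr (- (p * s))) * emeasure lborel B')"
      unfolding N_def
    proof (rule nn_integral_symmetric_le[OF far])
      show "far (x, y) = far (y, x)" for x y
        unfolding far_def by (simp add: gkernel_commute norm_minus_commute indicator_def)
      show "(\<integral>\<^sup>+y. far (x, y) \<partial>lborel) \<le> ennreal (C * \<rho> powr (- (p * s)))" for x
        using C(2)[of x] unfolding far_def by (simp add: indicator_def)
    qed simp
    also have "\<dots> < \<infinity>" using emeasure_B' by (simp add: ennreal_mult_less_top)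
    finally show ?thesis .
  qed
  define g where "g z = far z * indicator N z" for z
  define f where "f z t = ennreal (\<bar>U (fst z) t - U (snd z) t\<bar> powr p * gkernel p s (fst z) (snd z)) * indicator (D \<times> D) z * indicator {c..d} t" for z t
  have DD: "D \<times> D \<in> sets borel"
    unfolding borel_prod[symmetric] by (intro pair_measureI) auto
  have gm[measurable]: "g \<in> borel_measurable borel" unfolding g_def using N_borel far by (rule borel_measurable_times_ennreal[rotated, OF borel_measurable_indicator])
  have fm[measurable]: "(\<lambda>t. f z t) \<in> borel_measurable borel" for z unfolding f_def by measurable
  have fm2[measurable]: "(\<lambda>(z, t). f z t) \<in> borel_measurable (borel \<Otimes>\<^sub>M borel)"
    unfolding f_def case_prod_beta' using DD by measurable
  have ptw: "ennreal (\<bar>U (fst z) t - U (snd z) t\<bar> powr p * gkernel p s (fst z) (snd z)) * indicator N z * indicator {c..d} t \<le>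
      ennreal ((M - \<mu>) powr p) * (g z * indicator {c..d} t) + f z t" for z t
  proof (cases "z \<in> N \<and> z \<notin> D \<times> D")
    case True
    have "\<rho> \<le> norm (fst z - snd z)"
    proof (cases "fst z \<in> B'")
      case b: True
      then have "fst z \<in> D" using B'_sub by blast
      then have "snd z \<notin> D" using True by (metis SigmaI prod.collapse)
      then show ?thesis using sep[OF b] by blast
    next
      case False
      then have b: "snd z \<in> B'" using True unfolding N_def by blast
      then have "snd z \<in> D" using B'_sub by blast
      then have "fst z \<notin> D" using True by (metis SigmaI prod.collapse)
      then show ?thesis using sep[OF b] norm_minus_commute[of "fst z" "snd z"] by simp
    qed
    moreover have "\<bar>U (fst z) t - U (snd z) t\<bar> powr p * gkernel p s (fst z) (snd z) \<le> (M - \<mu>) powr p * gkernel p s (fst z) (snd z)"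
      using abs_U_diff p by (intro mult_right_mono powr_mono2) auto
    then have "ennreal (\<bar>U (fst z) t - U (snd z) t\<bar> powr p * gkernel p s (fst z) (snd z)) \<le>
        ennreal ((M - \<mu>) powr p) * ennreal (gkernel p s (fst z) (snd z))"
      by (simp add: ennreal_mult[symmetric] ennreal_leI)
    ultimately show ?thesis
      using True unfolding g_def f_def far_def by (simp add: indicator_def)
  next
    case False
    then consider "z \<notin> N" | "z \<in> D \<times> D" by blast
    then show ?thesis
    proof cases
      case 2
      have "indicator N z \<le> (1 :: ennreal)" by (simp add: indicator_def)
      then have "ennreal (\<bar>U (fst z) t - U (snd z) t\<bar> powr p * gkernel p s (fst z) (snd z)) * indicator N z * indicator {c..d} t \<le> f z t"
        using 2 unfolding f_def by (intro mult_right_mono mult_left_mono) simp_all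
      then show ?thesis by (rule add_increasing[OF zero_le])
    qed simp
  qed
  have "(\<integral>\<^sup>+z. \<integral>\<^sup>+t. ennreal (\<bar>U (fst z) t - U (snd z) t\<bar> powr p * gkernel p s (fst z) (snd z)) * indicator N z * indicator {c..d} t \<partial>lborel \<partial>lborel)
      \<le> (\<integral>\<^sup>+z. \<integral>\<^sup>+t. ennreal ((M - \<mu>) powr p) * (g z * indicator {c..d} t) + f z t \<partial>lborel \<partial>lborel)"
    by (intro nn_integral_mono ptw)
  also have "\<dots> = (\<integral>\<^sup>+z. ennreal ((M - \<mu>) powr p) * (g z * ennreal (d - c)) + (\<integral>\<^sup>+t. f z t \<partial>lborel) \<partial>lborel)"
    using cd by (intro nn_integral_cong) (simp add: nn_integral_add nn_integral_cmult)
  also have "\<dots> = (\<integral>\<^sup>+z. ennreal ((M - \<mu>) powr p) * (g z * ennreal (d - c)) \<partial>lborel) + (\<integral>\<^sup>+z. \<integral>\<^sup>+t. f z t \<partial>lborel \<partial>lborel)"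
    by (rule nn_integral_add) measurable
  also have "(\<integral>\<^sup>+z. ennreal ((M - \<mu>) powr p) * (g z * ennreal (d - c)) \<partial>lborel) =
      ennreal ((M - \<mu>) powr p) * (\<integral>\<^sup>+z. g z * ennreal (d - c) \<partial>lborel)"
    by (rule nn_integral_cmult) measurable
  also have "(\<integral>\<^sup>+z. g z * ennreal (d - c) \<partial>lborel) = (\<integral>\<^sup>+z. g z \<partial>lborel) * ennreal (d - c)"
    by (rule nn_integral_multc) measurable
  also have "ennreal ((M - \<mu>) powr p) * ((\<integral>\<^sup>+z. g z \<partial>lborel) * ennreal (d - c)) + (\<integral>\<^sup>+z. \<integral>\<^sup>+t. f z t \<partial>lborel \<partial>lborel) < \<infinity>"
    using U_energy[OF cd] far_fin unfolding f_def g_def by (simp add: ennreal_mult_less_top)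
  finally show ?thesis .
qed

lemma powr_add_le: "0 \<le> a \<Longrightarrow> 0 \<le> b \<Longrightarrow> (a + b) powr p \<le> 2 powr p * (a powr p + b powr p)"
proof -
  assume ab: "0 \<le> a" "0 \<le> b"
  have "(a + b) powr p \<le> (2 * max a b) powr p" using ab p by (intro powr_mono2) auto
  also have "\<dots> = 2 powr p * max a b powr p" using ab by (simp add: powr_mult)
  also have "\<dots> \<le> 2 powr p * (a powr p + b powr p)"
    by (intro mult_left_mono) (auto simp: max_def)
  finally show ?thesis .
qed

lemma Z_energy_finite:
  assumes cd: "0 < c" "c < d" "d < T"
  shows "(\<integral>\<^sup>+z. \<integral>\<^sup>+t. ennreal (\<bar>Z (fst z) t - Z (snd z) t\<bar> powr p * gkernel p s (fst z) (snd z)) *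
    indicator {c..d} t \<partial>lborel \<partial>lborel) < \<infinity>"
proof -
  define g where "g z = ennreal (\<bar>k (fst z) - k (snd z)\<bar> powr p * gkernel p s (fst z) (snd z)) * indicator N z" for z
  define f where "f z t = ennreal (\<bar>U (fst z) t - U (snd z) t\<bar> powr p * gkernel p s (fst z) (snd z)) * indicator N z * indicator {c..d} t" for z t
  have [measurable]: "g \<in> borel_measurable (borel \<Otimes>\<^sub>M borel)" unfolding g_def
    using N_borel unfolding borel_prod[symmetric] by measurable
  then have gm[measurable]: "g \<in> borel_measurable borel" unfolding borel_prod .
  have fm[measurable]: "(\<lambda>t. f z t) \<in> borel_measurable borel" for z unfolding f_def by measurable
  have fm2[measurable]: "(\<lambda>(z, t). f z t) \<in> borel_measurable (borel \<Otimes>\<^sub>M borel)"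
    unfolding f_def case_prod_beta' by measurable
  have ptw: "ennreal (\<bar>Z (fst z) t - Z (snd z) t\<bar> powr p * gkernel p s (fst z) (snd z)) * indicator {c..d} t \<le>
      ennreal (2 powr p) * (g z * indicator {c..d} t + f z t)" for z t
  proof (cases "z \<in> N \<and> t \<in> {c..d}")
    case True
    have "\<bar>Z (fst z) t - Z (snd z) t\<bar> powr p \<le> (\<bar>k (fst z) - k (snd z)\<bar> + \<bar>U (fst z) t - U (snd z) t\<bar>) powr p"
      using abs_Z_diff p by (intro powr_mono2) auto
    also have "\<dots> \<le> 2 powr p * (\<bar>k (fst z) - k (snd z)\<bar> powr p + \<bar>U (fst z) t - U (snd z) t\<bar> powr p)"
      by (rule powr_add_le) auto
    finally have "\<bar>Z (fst z) t - Z (snd z) t\<bar> powr p * gkernel p s (fst z) (snd z) \<le>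
      2 powr p * (\<bar>k (fst z) - k (snd z)\<bar> powr p + \<bar>U (fst z) t - U (snd z) t\<bar> powr p) * gkernel p s (fst z) (snd z)"
      by (rule mult_right_mono) simp
    then have "ennreal (\<bar>Z (fst z) t - Z (snd z) t\<bar> powr p * gkernel p s (fst z) (snd z)) \<le>
      ennreal (2 powr p * (\<bar>k (fst z) - k (snd z)\<bar> powr p * gkernel p s (fst z) (snd z) + \<bar>U (fst z) t - U (snd z) t\<bar> powr p * gkernel p s (fst z) (snd z)))"
      by (intro ennreal_leI) (simp add: algebra_simps)
    then show ?thesis using True unfolding g_def f_def by (simp add: ennreal_mult)
  next
    case False
    then show ?thesis using Z_diff_outside[of z t] p by auto
  qed
  have "(\<integral>\<^sup>+z. \<integral>\<^sup>+t. ennreal (\<bar>Z (fst z) t - Z (snd z) t\<bar> powr p * gkernel p s (fst z) (snd z)) * indicator {c..d} t \<partial>lborel \<partial>lborel)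
      \<le> (\<integral>\<^sup>+z. \<integral>\<^sup>+t. ennreal (2 powr p) * (g z * indicator {c..d} t + f z t) \<partial>lborel \<partial>lborel)"
    by (intro nn_integral_mono ptw)
  also have "\<dots> = (\<integral>\<^sup>+z. ennreal (2 powr p) * (g z * ennreal (d - c) + (\<integral>\<^sup>+t. f z t \<partial>lborel)) \<partial>lborel)"
    using cd by (intro nn_integral_cong) (simp add: nn_integral_add nn_integral_cmult)
  also have "\<dots> = ennreal (2 powr p) * (\<integral>\<^sup>+z. g z * ennreal (d - c) + (\<integral>\<^sup>+t. f z t \<partial>lborel) \<partial>lborel)"
    by (rule nn_integral_cmult) measurable
  also have "(\<integral>\<^sup>+z. g z * ennreal (d - c) + (\<integral>\<^sup>+t. f z t \<partial>lborel) \<partial>lborel) =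
      (\<integral>\<^sup>+z. g z * ennreal (d - c) \<partial>lborel) + (\<integral>\<^sup>+z. \<integral>\<^sup>+t. f z t \<partial>lborel \<partial>lborel)"
    by (rule nn_integral_add) measurable
  also have "(\<integral>\<^sup>+z. g z * ennreal (d - c) \<partial>lborel) = (\<integral>\<^sup>+z. g z \<partial>lborel) * ennreal (d - c)"
    by (rule nn_integral_multc) measurable
  also have "ennreal (2 powr p) * ((\<integral>\<^sup>+z. g z \<partial>lborel) * ennreal (d - c) + (\<integral>\<^sup>+z. \<integral>\<^sup>+t. f z t \<partial>lborel \<partial>lborel)) < \<infinity>"
    using k_energy_finite U_energy_finite[OF cd] unfolding g_def f_def by (simp add: ennreal_mult_less_top)
  finally show ?thesis .
qed

end

lemma integral_lborel_Times:
  fixes f :: "'a::euclidean_space \<Rightarrow> 'b::euclidean_space \<Rightarrow> real"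
  assumes "integrable lborel (\<lambda>(x, t). f x t)"
  shows "(LINT (x, t)|lborel. f x t) = (LINT x|lborel. LINT t|lborel. f x t)"
    and "(LINT (x, t)|lborel. f x t) = (LINT t|lborel. LINT x|lborel. f x t)"
    and "integrable lborel (\<lambda>x. LINT t|lborel. f x t)"
    and "integrable lborel (\<lambda>t. LINT x|lborel. f x t)"
proof -
  have i: "integrable (lborel \<Otimes>\<^sub>M lborel) (\<lambda>(x, t). f x t)" using assms by (simp only: lborel_prod)
  show "(LINT (x, t)|lborel. f x t) = (LINT x|lborel. LINT t|lborel. f x t)"
    using lborel_pair.integral_fst[OF i] by (simp only: lborel_prod)
  show "(LINT (x, t)|lborel. f x t) = (LINT t|lborel. LINT x|lborel. f x t)"
    using lborel_pair.integral_snd[OF i] by (simp only: lborel_prod)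
  show "integrable lborel (\<lambda>x. LINT t|lborel. f x t)" by (rule lborel_pair.integrable_fst[OF i])
  show "integrable lborel (\<lambda>t. LINT x|lborel. f x t)" by (rule lborel_pair.integrable_snd[OF i])
qed

lemma nn_integral_lborel_Times:
  fixes f :: "'a::euclidean_space \<Rightarrow> 'b::euclidean_space \<Rightarrow> ennreal"
  assumes "(\<lambda>(x, t). f x t) \<in> borel_measurable borel"
  shows "(\<integral>\<^sup>+w. f (fst w) (snd w) \<partial>lborel) = (\<integral>\<^sup>+x. \<integral>\<^sup>+t. f x t \<partial>lborel \<partial>lborel)"
    and "(\<integral>\<^sup>+w. f (fst w) (snd w) \<partial>lborel) = (\<integral>\<^sup>+t. \<integral>\<^sup>+x. f x t \<partial>lborel \<partial>lborel)"
proof -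
  have m: "(\<lambda>(x, t). f x t) \<in> borel_measurable (lborel \<Otimes>\<^sub>M lborel)"
    using assms by (simp add: lborel_prod)
  show "(\<integral>\<^sup>+w. f (fst w) (snd w) \<partial>lborel) = (\<integral>\<^sup>+x. \<integral>\<^sup>+t. f x t \<partial>lborel \<partial>lborel)"
    using lborel.nn_integral_fst[OF m] by (simp add: lborel_prod case_prod_beta')
  show "(\<integral>\<^sup>+w. f (fst w) (snd w) \<partial>lborel) = (\<integral>\<^sup>+t. \<integral>\<^sup>+x. f x t \<partial>lborel \<partial>lborel)"
    using lborel_pair.nn_integral_snd[OF m] by (simp add: lborel_prod case_prod_beta')
qed

section \<open>The excess of a supersolution below a level\<close>

context level
begin

definition G where "G x t = excess q (k x) (U x t)"

text \<open>A bound for \<open>G\<close> that involves \<open>M\<close>. It is used for domination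
  and integrability only and does not reach \<theta>.\<close>

definition Bg :: real where "Bg = 2 * (max m (\<bar>\<mu>\<bar> + \<bar>M\<bar>)) powr q * (m + \<bar>\<mu>\<bar>)"

lemma measurable_G [measurable]:
  assumes [measurable]: "f \<in> borel_measurable N'" "g \<in> borel_measurable N'"
  shows "(\<lambda>w. G (f w) (g w)) \<in> borel_measurable N'"
  unfolding G_def by measurable

lemma G_nonneg [simp]: "0 \<le> G x t"
  unfolding G_def by (rule excess_nonneg[OF q])

lemma G_outside: "x \<notin> B' \<Longrightarrow> G x t = 0"
  using k_outside[of x] U_bounds(1)[of x t] by (simp add: G_def excess_def)

lemma G_le_Z: "G x t \<le> 2 * (max m (\<bar>\<mu>\<bar> + \<bar>M\<bar>)) powr q * Z x t"
  unfolding G_def Z_def using k_bound[of x] abs_U[of x t] by (intro excess_le[OF q]) auto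

lemma G_le: "G x t \<le> Bg"
  unfolding Bg_def using G_le_Z[of x t] Z_le[of x t] by (elim order_trans) (intro mult_left_mono, auto)

lemma Bg_nonneg: "0 \<le> Bg"
  using G_le[of undefined undefined] G_nonneg[of undefined undefined] by linarith

end

section \<open>Cutoffs in time and averaged truncations as test functions\<close>

locale level_cutoff = level +
  fixes \<xi> :: "real \<Rightarrow> real" and c d :: real
  assumes \<xi>_borel [measurable]: "\<xi> \<in> borel_measurable borel"
    and \<xi>_bounds: "\<And>t. 0 \<le> \<xi> t" "\<And>t. \<xi> t \<le> 1"
    and \<xi>_support: "\<And>t. t \<notin> {c..d} \<Longrightarrow> \<xi> t = 0"
    and cd: "0 < c" "c < d" "d < T"
begin

definition W where "W x t = \<xi> t * Z x t"

lemma measurable_W [measurable]: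
  assumes [measurable]: "f \<in> borel_measurable N'" "g \<in> borel_measurable N'"
  shows "(\<lambda>w. W (f w) (g w)) \<in> borel_measurable N'"
  unfolding W_def by measurable

lemma W_nonneg [simp]: "0 \<le> W x t"
  using \<xi>_bounds(1) by (simp add: W_def)

lemma W_le_Z: "W x t \<le> Z x t"
  unfolding W_def using \<xi>_bounds by (intro mult_left_le_one_le) auto

lemma abs_W_le: "\<bar>W x t\<bar> \<le> m + \<bar>\<mu>\<bar>"
  using W_le_Z[of x t] Z_le[of x t] by simp

lemma W_outside: "x \<notin> B' \<Longrightarrow> W x t = 0"
  by (simp add: W_def Z_outside)

lemma W_support: "t \<notin> {c..d} \<Longrightarrow> W x t = 0"
  by (simp add: W_def \<xi>_support)

lemma abs_W_diff: "\<bar>W x t - W y t\<bar> \<le> \<bar>Z x t - Z y t\<bar>"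
proof -
  have "W x t - W y t = \<xi> t * (Z x t - Z y t)" by (simp add: W_def algebra_simps)
  then show ?thesis
    using \<xi>_bounds[of t] by (simp add: abs_mult mult_left_le_one_le)
qed

lemma abs_W_diff_bound: "\<bar>W x t - W y t\<bar> \<le> m + \<bar>\<mu>\<bar>"
  using abs_W_le[of x t] abs_W_le[of y t] W_nonneg[of x t] W_nonneg[of y t] unfolding abs_le_iff by linarith

lemma W_energy_finite:
  "(\<integral>\<^sup>+z. \<integral>\<^sup>+t. ennreal (\<bar>W (fst z) t - W (snd z) t\<bar> powr p * gkernel p s (fst z) (snd z)) \<partial>lborel \<partial>lborel) < \<infinity>"
proof -
  have "ennreal (\<bar>W (fst z) t - W (snd z) t\<bar> powr p * gkernel p s (fst z) (snd z)) \<le>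
      ennreal (\<bar>Z (fst z) t - Z (snd z) t\<bar> powr p * gkernel p s (fst z) (snd z)) * indicator {c..d} t" for z t
  proof (cases "t \<in> {c..d}")
    case True
    have "\<bar>W (fst z) t - W (snd z) t\<bar> powr p * gkernel p s (fst z) (snd z) \<le>
        \<bar>Z (fst z) t - Z (snd z) t\<bar> powr p * gkernel p s (fst z) (snd z)"
      using abs_W_diff p by (intro mult_right_mono powr_mono2) auto
    then show ?thesis using True by (simp add: ennreal_leI)
  next
    case False
    then show ?thesis using W_support p by simp
  qed
  then have "(\<integral>\<^sup>+z. \<integral>\<^sup>+t. ennreal (\<bar>W (fst z) t - W (snd z) t\<bar> powr p * gkernel p s (fst z) (snd z)) \<partial>lborel \<partial>lborel) \<le>
      (\<integral>\<^sup>+z. \<integral>\<^sup>+t. ennreal (\<bar>Z (fst z) t - Z (snd z) t\<bar> powr p * gkernel p s (fst z) (snd z)) * indicator {c..d} t \<partial>lborel \<partial>lborel)"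
    by (intro nn_integral_mono)
  then show ?thesis using Z_energy_finite[OF cd] by (rule order.strict_trans1)
qed

lemma steklov_W_borel:
  assumes [measurable]: "f \<in> borel_measurable N'" "g \<in> borel_measurable N'"
  shows "(\<lambda>w. steklov h (W (f w)) (g w)) \<in> borel_measurable N'"
  by (rule borel_measurable_steklov[where M = borel and w = W]) measurable

lemma steklov_W_outside: "x \<notin> B' \<Longrightarrow> steklov h (W x) t = 0"
  by (simp add: steklov_def W_outside)

lemma steklov_W_nonneg: "0 \<le> steklov h (W x) t"
  unfolding steklov_def by (intro Bochner_Integration.integral_nonneg) simp

lemma abs_steklov_W_le: "\<bar>steklov h (W x) t\<bar> \<le> m + \<bar>\<mu>\<bar>"
  by (rule abs_steklov_le[OF _ abs_W_le]) measurable

lemma steklov_W_diff: "steklov h (W x) t - steklov h (W y) t = steklov h (\<lambda>t. W x t - W y t) t"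
  by (rule steklov_diff[OF _ abs_W_le _ abs_W_le]) measurable

lemma steklov_eq_0:
  assumes "\<And>t. t \<notin> {c..d} \<Longrightarrow> w t = 0" and h: "0 < h" and t: "t \<notin> {c - h..d}"
  shows "steklov h w t = 0"
proof -
  have "indicator {0..1} \<sigma> * w (t + h * \<sigma>) = 0" for \<sigma> :: real
  proof (cases "\<sigma> \<in> {0..1}")
    case True
    then have "0 \<le> h * \<sigma>" "h * \<sigma> \<le> h" using h by (auto simp: mult_left_le)
    moreover have "t < c - h \<or> d < t" using t by auto
    ultimately have "t + h * \<sigma> < c \<or> d < t + h * \<sigma>" by linarith
    then have "t + h * \<sigma> \<notin> {c..d}" unfolding atLeastAtMost_iff by linarith
    then show ?thesis using assms(1) by simp
  qed simp
  then show ?thesis unfolding steklov_def by (simp only: Bochner_Integration.integral_zero)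
qed

text \<open>By Jensen in the averaging variable, the seminorm of the average at any time t is at
  most 1/h times the whole space-time energy of \<open>W\<close>. This gives a bound at every time,
  whereas for \<open>W\<close> itself only the time integral of the seminorm is known to be
  finite.\<close>

lemma steklov_W_norm_finite:
  assumes h: "0 < h"
  shows "\<exists>C<\<infinity>. \<forall>t. Wsp_norm_pow s p UNIV (\<lambda>x. steklov h (W x) t) \<le> C"
proof -
  define J where "J = (\<integral>\<^sup>+z. \<integral>\<^sup>+t. ennreal (\<bar>W (fst z) t - W (snd z) t\<bar> powr p * gkernel p s (fst z) (snd z)) \<partial>lborel \<partial>lborel)"
  define C where "C = ennreal ((m + \<bar>\<mu>\<bar>) powr p) * emeasure lborel B' + ennreal (1 / h) * J"
  have "C < \<infinity>"
    unfolding C_def using emeasure_B' W_energy_finite by (simp add: J_def ennreal_mult_less_top)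
  moreover have "Wsp_norm_pow s p UNIV (\<lambda>x. steklov h (W x) t) \<le> C" for t
  proof -
    have "(\<integral>\<^sup>+x. ennreal (\<bar>steklov h (W x) t\<bar> powr p) \<partial>lborel) \<le> (\<integral>\<^sup>+x. ennreal ((m + \<bar>\<mu>\<bar>) powr p) * indicator B' x \<partial>lborel)"
    proof (rule nn_integral_mono)
      fix x
      show "ennreal (\<bar>steklov h (W x) t\<bar> powr p) \<le> ennreal ((m + \<bar>\<mu>\<bar>) powr p) * indicator B' x"
        using p abs_steklov_W_le[of h x t] steklov_W_outside[of x h t]
        by (cases "x \<in> B'") (auto intro!: ennreal_leI powr_mono2)
    qed
    also have "\<dots> = ennreal ((m + \<bar>\<mu>\<bar>) powr p) * emeasure lborel B'" by (simp add: nn_integral_cmult_indicator)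
    finally have 1: "(\<integral>\<^sup>+x. ennreal (\<bar>steklov h (W x) t\<bar> powr p) \<partial>lborel) \<le> ennreal ((m + \<bar>\<mu>\<bar>) powr p) * emeasure lborel B'" .
    have "ennreal (\<bar>steklov h (W (fst z)) t - steklov h (W (snd z)) t\<bar> powr p * gkernel p s (fst z) (snd z)) \<le>
        ennreal (1 / h) * (\<integral>\<^sup>+r. ennreal (\<bar>W (fst z) r - W (snd z) r\<bar> powr p * gkernel p s (fst z) (snd z)) \<partial>lborel)" for z
    proof -
      define E where "E r = W (fst z) r - W (snd z) r" for r
      define e where "e = gkernel p s (fst z) (snd z)"
      have e: "0 \<le> e" by (simp add: e_def)
      have Em[measurable]: "E \<in> borel_measurable borel" unfolding E_def by measurable
      have Eb: "\<bar>E r\<bar> \<le> m + \<bar>\<mu>\<bar>" for r unfolding E_def by (rule abs_W_diff_bound)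
      have "ennreal (\<bar>steklov h E t\<bar> powr p) \<le> (\<integral>\<^sup>+\<sigma>. ennreal (\<bar>E (t + h * \<sigma>)\<bar> powr p) * indicator {0..1} \<sigma> \<partial>lborel)"
        unfolding steklov_def by (rule Jensen_powr_unit_interval[OF p _ Eb]) measurable
      also have "\<dots> \<le> (\<integral>\<^sup>+\<sigma>. ennreal (\<bar>E (t + h * \<sigma>)\<bar> powr p) \<partial>lborel)"
        by (rule nn_integral_mono) (simp add: indicator_def)
      also have "\<dots> = ennreal (1 / h) * (\<integral>\<^sup>+r. ennreal (\<bar>E r\<bar> powr p) \<partial>lborel)"
      proof -
        have "(\<integral>\<^sup>+r. ennreal (\<bar>E r\<bar> powr p) \<partial>lborel) = ennreal h * (\<integral>\<^sup>+\<sigma>. ennreal (\<bar>E (t + h * \<sigma>)\<bar> powr p) \<partial>lborel)"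
          using h by (subst nn_integral_real_affine[where c = h and t = t]) auto
        then show ?thesis using h by (simp add: mult.assoc[symmetric] ennreal_mult[symmetric])
      qed
      finally have "ennreal (\<bar>steklov h E t\<bar> powr p) * ennreal e \<le> ennreal (1 / h) * (\<integral>\<^sup>+r. ennreal (\<bar>E r\<bar> powr p) \<partial>lborel) * ennreal e"
        by (rule mult_right_mono) simp
      also have "\<dots> = ennreal (1 / h) * (\<integral>\<^sup>+r. ennreal (\<bar>E r\<bar> powr p) * ennreal e \<partial>lborel)"
        by (subst nn_integral_multc) (auto simp: mult.assoc)
      finally show ?thesis
        unfolding steklov_W_diff using e by (simp add: ennreal_mult E_def[symmetric] e_def[symmetric])
    qed
    then have "(\<integral>\<^sup>+z. ennreal (\<bar>steklov h (W (fst z)) t - steklov h (W (snd z)) t\<bar> powr p * gkernel p s (fst z) (snd z)) \<partial>lborel) \<le>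
        (\<integral>\<^sup>+z. ennreal (1 / h) * (\<integral>\<^sup>+r. ennreal (\<bar>W (fst z) r - W (snd z) r\<bar> powr p * gkernel p s (fst z) (snd z)) \<partial>lborel) \<partial>lborel)"
      by (intro nn_integral_mono)
    also have "\<dots> = ennreal (1 / h) * J"
    proof -
      have "(\<lambda>(z, r). ennreal (\<bar>W (fst z) r - W (snd z) r\<bar> powr p * gkernel p s (fst z) (snd z))) \<in> borel_measurable (borel \<Otimes>\<^sub>M borel)"
        unfolding case_prod_beta' by measurable
      then have "(\<lambda>z. \<integral>\<^sup>+r. ennreal (\<bar>W (fst z) r - W (snd z) r\<bar> powr p * gkernel p s (fst z) (snd z)) \<partial>lborel) \<in> borel_measurable borel"
        by (intro lborel.borel_measurable_nn_integral) simp
      then show ?thesis unfolding J_def by (intro nn_integral_cmult) simp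
    qed
    finally have 2: "(\<integral>\<^sup>+z. ennreal (\<bar>steklov h (W (fst z)) t - steklov h (W (snd z)) t\<bar> powr p * gkernel p s (fst z) (snd z)) \<partial>lborel) \<le> ennreal (1 / h) * J" .
    show ?thesis unfolding Wsp_norm_pow_UNIV C_def by (rule add_mono[OF 1 2])
  qed
  ultimately show ?thesis by blast
qed

text \<open>No time derivative is available for \<open>W\<close>. Its forward average has the
  bounded weak derivative (W x (t + h) - W x t) / h, and it inherits the support in
  \<open>B'\<close> and a finite spatial energy.\<close>

lemma steklov_test_function:
  assumes h: "0 < h" "h < c"
  shows "test_function p q s D T (\<lambda>x t. steklov h (W x) t) (\<lambda>x t. (W x (t + h) - W x t) / h)"
proof -
  have \<phi>m: "(\<lambda>(x, t). steklov h (W x) t) \<in> borel_measurable borel"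
    unfolding borel_prod[symmetric] case_prod_beta' by (rule steklov_W_borel) measurable
  have \<psi>m: "(\<lambda>(x, t). (W x (t + h) - W x t) / h) \<in> borel_measurable borel"
    unfolding borel_prod[symmetric] case_prod_beta' by measurable
  have \<psi>b: "\<bar>(W x (t + h) - W x t) / h\<bar> \<le> (m + \<bar>\<mu>\<bar>) / h" for x t
  proof -
    have "\<bar>W x (t + h) - W x t\<bar> \<le> m + \<bar>\<mu>\<bar>"
      using abs_W_le[of x t] abs_W_le[of x "t + h"] W_nonneg[of x t] W_nonneg[of x "t + h"]
      unfolding abs_le_iff by linarith
    then show ?thesis using h by (simp add: divide_right_mono)
  qed
  obtain C where C: "C < \<infinity>" "\<And>t. Wsp_norm_pow s p UNIV (\<lambda>x. steklov h (W x) t) \<le> C"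
    using steklov_W_norm_finite[OF h(1)] by blast
  have slice: "(\<lambda>x. steklov h (W x) t) \<in> borel_measurable borel" for t
    by (rule steklov_W_borel) measurable
  have LpWsp: "(\<lambda>x t. steklov h (W x) t) \<in> LpWsp s p UNIV {t1..t2}" for t1 t2
  proof -
    have "(\<integral>\<^sup>+t. Wsp_norm_pow s p UNIV (\<lambda>x. steklov h (W x) t) \<partial>lebesgue_on {t1..t2}) \<le> (\<integral>\<^sup>+t. C \<partial>lebesgue_on {t1..t2})"
      by (intro nn_integral_mono C)
    also have "\<dots> = C * emeasure lborel {t1..t2}" by (simp add: emeasure_restrict_space)
    also have "\<dots> < \<infinity>" using C(1) by (simp add: ennreal_mult_less_top emeasure_lborel_Icc_eq)
    finally show ?thesis
      unfolding LpWsp_def using measurable_lborel_restrict[OF \<phi>m] by simp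
  qed
  have "(\<lambda>x. steklov h (W x) t) \<in> Wsp0 s p D" for t
  proof -
    have "Wsp_norm_pow s p UNIV (\<lambda>x. steklov h (W x) t) < \<infinity>" using C by (meson order.strict_trans1)
    moreover have "steklov h (W x) t = 0" if "x \<notin> D" for x
      using that B'_sub by (intro steklov_W_outside) auto
    ultimately show ?thesis
      unfolding Wsp0_def Wsp_def using measurable_lborel_restrict[OF slice] by simp
  qed
  then have LpWsp0: "(\<lambda>x t. steklov h (W x) t) \<in> LpWsp0 s p D {t1..t2}" for t1 t2
    unfolding LpWsp0_def using LpWsp by simp
  have "weak_time_deriv D T (\<lambda>x t. steklov h (W x) t) (\<lambda>x t. (W x (t + h) - W x t) / h)"
    unfolding weak_time_deriv_def
  proof (intro ballI always_eventually allI)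
    fix \<eta> x assume \<eta>: "\<eta> \<in> Cc_infinity T"
    have "W x \<in> borel_measurable borel" by measurable
    then show "(LINT t|lebesgue_on {0<..<T}. steklov h (W x) t * deriv \<eta> t) =
        - (LINT t|lebesgue_on {0<..<T}. (W x (t + h) - W x t) / h * \<eta> t)"
      by (rule steklov_weak_derivative[OF _ abs_W_le W_support h cd(3) \<eta>])
  qed
  moreover have "(\<lambda>x t. steklov h (W x) t) \<in> LrLr (q + 1) D {t1..t2}" for t1 t2
    by (rule bounded_imp_LrLr[OF \<phi>m abs_steklov_W_le D_borel D(2)]) (use q in simp)
  moreover have "(\<lambda>x t. (W x (t + h) - W x t) / h) \<in> LrLr (q + 1) D {t1..t2}" for t1 t2
    by (rule bounded_imp_LrLr[OF \<psi>m \<psi>b D_borel D(2)]) (use q in simp)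
  ultimately show ?thesis
    unfolding test_function_def case_prod_beta'
    by (intro conjI allI impI LpWsp0 always_eventually steklov_W_nonneg)
qed

lemma powr_Young: "0 \<le> x \<Longrightarrow> 0 \<le> y \<Longrightarrow> x powr (p - 1) * y \<le> x powr p + y powr p"
proof -
  assume xy: "0 \<le> x" "0 \<le> y"
  show ?thesis
  proof (cases "y \<le> x")
    case True
    have "x powr (p - 1) * y \<le> x powr (p - 1) * x" using True by (intro mult_left_mono) auto
    also have "\<dots> = x powr p" using xy p by (cases "x = 0") (simp_all add: powr_diff)
    finally show ?thesis using powr_ge_zero[of y p] by linarith
  next
    case False
    have "x powr (p - 1) * y \<le> y powr (p - 1) * y" using False xy p by (intro mult_right_mono powr_mono2) auto
    also have "\<dots> = y powr p" using xy p False by (simp add: powr_diff)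
    finally show ?thesis using powr_ge_zero[of x p] by linarith
  qed
qed

text \<open>Steps of at most c/2: the averages and difference quotients of functions supported in
  [c, d] then vanish outside [c/2, d], a compact part of (0, T) that does not depend on n.\<close>

definition h where "h n = c / 2 * inverse (real (Suc n))"

lemma h_bounds: "0 < h n" "h n \<le> c / 2" "h n < c"
proof -
  show "0 < h n" using cd by (simp add: h_def)
  have "c / 2 * inverse (real (Suc n)) \<le> c / 2 * 1"
    using cd by (intro mult_left_mono) (auto simp: inverse_le_1_iff)
  then show 2: "h n \<le> c / 2" by (simp only: h_def mult_1_right)
  show "h n < c" using 2 cd by linarith
qed

lemma h_limit: "h \<longlonglongrightarrow> 0"
  unfolding h_def by (rule tendsto_mult_right_zero[OF LIMSEQ_inverse_real_of_nat])

abbreviation Ud where "Ud z t \<equiv> U (fst z) t - U (snd z) t"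
abbreviation Wd where "Wd z t \<equiv> W (fst z) t - W (snd z) t"
abbreviation gk where "gk z \<equiv> gkernel p s (fst z) (snd z)"

text \<open>The indicators in \<open>F\<close> change neither integral, since \<open>W\<close> and
  its averages vanish outside \<open>N\<close> and [c/2, d]. They make F z integrable in time and
  bring in the finite energy of \<open>U\<close> on \<open>N\<close>. Young's inequality separates
  \<open>U\<close> at one time from \<open>W\<close> at another, as
  \<open>steklov_energy_limit\<close> demands.\<close>

lemma energy_limit:
  shows "integrable lborel (\<lambda>(z, t). spow (p - 1) (Ud z t) * Wd z t * \<kappa> (fst z) (snd z) t)"
    and "(\<lambda>n. LINT (z, t)|lborel. spow (p - 1) (Ud z t) * (steklov (h n) (W (fst z)) t - steklov (h n) (W (snd z)) t) * \<kappa> (fst z) (snd z) t)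
      \<longlonglongrightarrow> (LINT (z, t)|lborel. spow (p - 1) (Ud z t) * Wd z t * \<kappa> (fst z) (snd z) t)"
proof -
  define F where "F z t = spow (p - 1) (Ud z t) * \<kappa> (fst z) (snd z) t * indicator N z * indicator {c/2..d} t" for z t
  define a where "a z t = ennreal \<Lambda> * (ennreal (\<bar>Ud z t\<bar> powr p * gk z) * indicator N z * indicator {c/2..d} t)" for z t
  define b where "b z t = ennreal \<Lambda> * ennreal (\<bar>Wd z t\<bar> powr p * gk z)" for z t
  have Fm: "(\<lambda>(z, t). F z t) \<in> borel_measurable borel"
    unfolding F_def case_prod_beta' borel_prod[symmetric, where 'b = real] by measurable
  have Em: "(\<lambda>(z, t). Wd z t) \<in> borel_measurable borel"
    unfolding case_prod_beta' borel_prod[symmetric, where 'b = real] by measurable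
  have am: "(\<lambda>(z, t). a z t) \<in> borel_measurable borel"
    unfolding a_def case_prod_beta' borel_prod[symmetric, where 'b = real] by measurable
  have bm: "(\<lambda>(z, t). b z t) \<in> borel_measurable borel"
    unfolding b_def case_prod_beta' borel_prod[symmetric, where 'b = real] by measurable
  have F_abs: "\<bar>F z t\<bar> \<le> \<Lambda> * gk z * \<bar>Ud z t\<bar> powr (p - 1)" for z t
  proof -
    have "\<bar>F z t\<bar> \<le> \<bar>Ud z t\<bar> powr (p - 1) * \<kappa> (fst z) (snd z) t"
      unfolding F_def abs_mult abs_spow using \<kappa>_nonneg by (simp add: indicator_def)
    also have "\<dots> \<le> \<bar>Ud z t\<bar> powr (p - 1) * (\<Lambda> * gk z)"
      by (intro mult_left_mono \<kappa>_bounds) simp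
    finally show ?thesis by (simp add: ac_simps)
  qed
  have Fi: "integrable lborel (F z)" for z
  proof (rule integrable_bounded_support)
    show "F z \<in> borel_measurable borel" unfolding F_def by measurable
    show "\<bar>F z t\<bar> \<le> \<Lambda> * gk z * (M - \<mu>) powr (p - 1)" for t
      using F_abs[of z t] abs_U_diff[of "fst z" t "snd z"] p \<Lambda>
      by (elim order_trans) (auto intro!: mult_left_mono powr_mono2)
    show "F z t = 0" if "t \<notin> {c/2..d}" for t using that unfolding F_def by simp
  qed
  have Eb: "\<bar>Wd z t\<bar> \<le> m + \<bar>\<mu>\<bar>" for z t by (rule abs_W_diff_bound)
  have dom: "ennreal \<bar>F z t * Wd z t'\<bar> \<le> a z t + b z t'" for z t t'
  proof (cases "z \<in> N \<and> t \<in> {c/2..d}")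
    case True
    have "\<bar>F z t * Wd z t'\<bar> \<le> \<Lambda> * gk z * \<bar>Ud z t\<bar> powr (p - 1) * \<bar>Wd z t'\<bar>"
      unfolding abs_mult by (intro mult_right_mono F_abs) simp
    also have "\<dots> = \<Lambda> * gk z * (\<bar>Ud z t\<bar> powr (p - 1) * \<bar>Wd z t'\<bar>)" by simp
    also have "\<dots> \<le> \<Lambda> * gk z * (\<bar>Ud z t\<bar> powr p + \<bar>Wd z t'\<bar> powr p)"
      using \<Lambda> by (intro mult_left_mono powr_Young mult_nonneg_nonneg) auto
    also have "\<dots> = \<Lambda> * (\<bar>Ud z t\<bar> powr p * gk z) + \<Lambda> * (\<bar>Wd z t'\<bar> powr p * gk z)"
      by (simp add: algebra_simps)
    finally have "ennreal \<bar>F z t * Wd z t'\<bar> \<le> ennreal (\<Lambda> * (\<bar>Ud z t\<bar> powr p * gk z) + \<Lambda> * (\<bar>Wd z t'\<bar> powr p * gk z))"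
      by (rule ennreal_leI)
    also have "\<dots> = a z t + b z t'"
      using True \<Lambda> unfolding a_def b_def by (simp add: ennreal_mult ennreal_plus)
    finally show ?thesis .
  next
    case False
    then have "F z t = 0" unfolding F_def by auto
    then show ?thesis by simp
  qed
  have fina: "(\<integral>\<^sup>+z. \<integral>\<^sup>+t. a z t \<partial>lborel \<partial>lborel) < \<infinity>"
  proof -
    have "(\<lambda>(z, t). ennreal (\<bar>Ud z t\<bar> powr p * gk z) * indicator N z * indicator {c/2..d} t) \<in> borel_measurable (borel \<Otimes>\<^sub>M borel)"
      unfolding case_prod_beta' by measurable
    then have "(\<lambda>z. \<integral>\<^sup>+t. ennreal (\<bar>Ud z t\<bar> powr p * gk z) * indicator N z * indicator {c/2..d} t \<partial>lborel) \<in> borel_measurable borel"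
      by (intro lborel.borel_measurable_nn_integral) simp
    moreover have "(\<integral>\<^sup>+t. a z t \<partial>lborel) = ennreal \<Lambda> * (\<integral>\<^sup>+t. ennreal (\<bar>Ud z t\<bar> powr p * gk z) * indicator N z * indicator {c/2..d} t \<partial>lborel)" for z
      unfolding a_def by (rule nn_integral_cmult) measurable
    ultimately have "(\<integral>\<^sup>+z. \<integral>\<^sup>+t. a z t \<partial>lborel \<partial>lborel) =
      ennreal \<Lambda> * (\<integral>\<^sup>+z. \<integral>\<^sup>+t. ennreal (\<bar>Ud z t\<bar> powr p * gk z) * indicator N z * indicator {c/2..d} t \<partial>lborel \<partial>lborel)"
      by (simp only:) (rule nn_integral_cmult, simp)
    also have "\<dots> < \<infinity>"
      using U_energy_finite[of "c/2" d] cd by (simp add: ennreal_mult_less_top)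
    finally show ?thesis .
  qed
  have finb: "(\<integral>\<^sup>+z. \<integral>\<^sup>+t. b z t \<partial>lborel \<partial>lborel) < \<infinity>"
  proof -
    have "(\<lambda>(z, t). ennreal (\<bar>Wd z t\<bar> powr p * gk z)) \<in> borel_measurable (borel \<Otimes>\<^sub>M borel)"
      unfolding case_prod_beta' by measurable
    then have "(\<lambda>z. \<integral>\<^sup>+t. ennreal (\<bar>Wd z t\<bar> powr p * gk z) \<partial>lborel) \<in> borel_measurable borel"
      by (intro lborel.borel_measurable_nn_integral) simp
    moreover have "(\<integral>\<^sup>+t. b z t \<partial>lborel) = ennreal \<Lambda> * (\<integral>\<^sup>+t. ennreal (\<bar>Wd z t\<bar> powr p * gk z) \<partial>lborel)" for z
      unfolding b_def by (rule nn_integral_cmult) measurable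
    ultimately have "(\<integral>\<^sup>+z. \<integral>\<^sup>+t. b z t \<partial>lborel \<partial>lborel) = ennreal \<Lambda> * (\<integral>\<^sup>+z. \<integral>\<^sup>+t. ennreal (\<bar>Wd z t\<bar> powr p * gk z) \<partial>lborel \<partial>lborel)"
      by (simp only:) (rule nn_integral_cmult, simp)
    also have "\<dots> < \<infinity>" using W_energy_finite by (simp add: ennreal_mult_less_top)
    finally show ?thesis .
  qed
  note lim = steklov_energy_limit[OF Fm Em Fi Eb am bm dom fina finb h_limit]
  have eq1: "F z t * Wd z t = spow (p - 1) (Ud z t) * Wd z t * \<kappa> (fst z) (snd z) t" for z t
  proof (cases "z \<in> N \<and> t \<in> {c/2..d}")
    case True then show ?thesis unfolding F_def by simp
  next
    case False
    then have "Wd z t = 0"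
      using W_support[of t] W_outside cd unfolding N_def by auto
    then show ?thesis by simp
  qed
  have eq2: "F z t * steklov (h n) (Wd z) t =
      spow (p - 1) (Ud z t) * (steklov (h n) (W (fst z)) t - steklov (h n) (W (snd z)) t) * \<kappa> (fst z) (snd z) t" for z t n
  proof (cases "z \<in> N \<and> t \<in> {c/2..d}")
    case True then show ?thesis unfolding F_def steklov_W_diff by simp
  next
    case False
    then consider "z \<notin> N" | "t \<notin> {c/2..d}" by blast
    then have "steklov (h n) (W (fst z)) t - steklov (h n) (W (snd z)) t = 0"
    proof cases
      case 1
      then show ?thesis unfolding N_def by (simp add: steklov_W_outside)
    next
      case 2
      then have "t \<notin> {c - h n..d}" using h_bounds(2)[of n] by auto
      then show ?thesis using steklov_eq_0[OF W_support h_bounds(1)] by simp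
    qed
    then show ?thesis by (simp add: steklov_W_diff)
  qed
  show "integrable lborel (\<lambda>(z, t). spow (p - 1) (Ud z t) * Wd z t * \<kappa> (fst z) (snd z) t)"
    using lim(2) unfolding eq1 .
  show "(\<lambda>n. LINT (z, t)|lborel. spow (p - 1) (Ud z t) * (steklov (h n) (W (fst z)) t - steklov (h n) (W (snd z)) t) * \<kappa> (fst z) (snd z) t)
      \<longlonglongrightarrow> (LINT (z, t)|lborel. spow (p - 1) (Ud z t) * Wd z t * \<kappa> (fst z) (snd z) t)"
    using lim(3) unfolding eq1 eq2 .
qed

lemma integrable_spacetime:
  fixes f :: "_ \<Rightarrow> real \<Rightarrow> real"
  assumes "(\<lambda>(x, t). f x t) \<in> borel_measurable borel" "\<And>x t. \<bar>f x t\<bar> \<le> B"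
    and "\<And>x t. x \<notin> D \<or> t \<notin> {c/2..d} \<Longrightarrow> f x t = 0"
  shows "integrable lborel (\<lambda>(x, t). f x t)"
proof (rule integrable_bounded_finite_support)
  show "emeasure lborel (D \<times> {c/2..d}) < \<infinity>"
    using D(2) by (intro emeasure_bounded_finite bounded_Times) auto
  show "D \<times> {c/2..d} \<in> sets lborel"
    unfolding sets_lborel borel_prod[symmetric] by (intro pair_measureI) auto
  show "(case w of (x, t) \<Rightarrow> f x t) = 0" if "w \<notin> D \<times> {c/2..d}" for w
    using that assms(3) by (cases w) auto
  show "\<bar>case w of (x, t) \<Rightarrow> f x t\<bar> \<le> B" for w using assms(2) by (cases w) auto
qed (use assms(1) in simp)

text \<open>For each step the averaged truncation is admissible, and its time term is estimated by
  difference quotients of \<xi> against \<open>G\<close> before the step tends to zero. No time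
  derivative of \<open>U\<close> is ever formed. In the limit the quotients of \<xi> are bounded by
  the Lipschitz constant \<open>l\<close> and converge off the finite set \<open>S\<close>.\<close>

lemma weak_limit:
  assumes lip: "\<And>r t. \<bar>\<xi> r - \<xi> t\<bar> \<le> l * \<bar>r - t\<bar>" and S: "finite S"
    and der: "\<And>t. t \<notin> S \<Longrightarrow> (\<xi> has_real_derivative \<xi>' t) (at t)"
    and \<xi>'m [measurable]: "\<xi>' \<in> borel_measurable borel"
  shows "0 \<le> (LINT (z, t)|lborel. spow (p - 1) (Ud z t) * Wd z t * \<kappa> (fst z) (snd z) t)
    + (LINT (x, t)|lborel. indicator D x * (G x t * \<xi>' t))"
proof -
  have l: "0 \<le> l" using lip[of 1 0] by simp
  define \<xi>q where "\<xi>q n t = (\<xi> (t + h n) - \<xi> t) / h n" for n t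
  have \<xi>qm[measurable]: "\<xi>q n \<in> borel_measurable borel" for n unfolding \<xi>q_def by measurable
  have \<xi>q_le: "\<bar>\<xi>q n t\<bar> \<le> l" for n t
    using lip[of "t + h n" t] h_bounds(1)[of n] unfolding \<xi>q_def by (simp add: abs_divide field_simps)
  have \<xi>q_0: "\<xi>q n t = 0" if "t \<notin> {c/2..d}" for n t
  proof -
    have "t \<notin> {c..d}" using that cd by auto
    moreover have "t + h n \<notin> {c..d}" using that h_bounds(1,2)[of n] cd by auto
    ultimately show ?thesis unfolding \<xi>q_def using \<xi>_support by simp
  qed
  define En where "En n = (LINT (z, t)|lborel. spow (p - 1) (Ud z t) * (steklov (h n) (W (fst z)) t - steklov (h n) (W (snd z)) t) * \<kappa> (fst z) (snd z) t)" for n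
  define Tn where "Tn n = (LINT (x, t)|lborel. indicator D x * (G x t * \<xi>q n t))" for n
  have GI: "integrable lborel (\<lambda>(x, t). indicator D x * (G x t * \<xi>q n t))" for n
  proof (rule integrable_spacetime)
    show "(\<lambda>(x, t). indicator D x * (G x t * \<xi>q n t)) \<in> borel_measurable borel"
      unfolding case_prod_beta' borel_prod[symmetric] by measurable
    show "\<bar>indicator D x * (G x t * \<xi>q n t)\<bar> \<le> Bg * l" for x t
    proof -
      have "\<bar>indicator D x * (G x t * \<xi>q n t)\<bar> \<le> G x t * \<bar>\<xi>q n t\<bar>"
        by (simp add: abs_mult indicator_def)
      also have "\<dots> \<le> Bg * l" by (intro mult_mono G_le \<xi>q_le Bg_nonneg) simp
      finally show ?thesis .
    qed
    show "indicator D x * (G x t * \<xi>q n t) = 0" if "x \<notin> D \<or> t \<notin> {c/2..d}" for x t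
      using that \<xi>q_0 by auto
  qed
  have T_lim: "Tn \<longlonglongrightarrow> (LINT (x, t)|lborel. indicator D x * (G x t * \<xi>' t))"
    unfolding Tn_def
  proof (rule integral_dominated_convergence)
    show "integrable lborel (\<lambda>(x, t). indicator D x * (indicator {c/2..d} t * (Bg * l)))"
    proof (rule integrable_spacetime)
      show "(\<lambda>(x, t). indicator D x * (indicator {c/2..d} t * (Bg * l))) \<in> borel_measurable borel"
        unfolding case_prod_beta' borel_prod[symmetric] by measurable
      show "\<bar>indicator D x * (indicator {c/2..d} t * (Bg * l))\<bar> \<le> Bg * l" for x and t :: real
        using Bg_nonneg l by (simp add: indicator_def)
    qed auto
    \<comment> \<open>The finitely many corners of \<xi> occupy a null set of space-time.\<close>
    have "AE w in lborel. snd w \<notin> S"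
    proof -
      have "AE x in (lborel :: 'b::euclidean_space measure). AE t in (lborel :: real measure). t \<notin> S"
        using finite_imp_null_set_lborel[OF S] by (intro always_eventually allI AE_not_in) auto
      then have "AE w in (lborel :: 'b::euclidean_space measure) \<Otimes>\<^sub>M (lborel :: real measure). snd w \<notin> S"
      proof (intro lborel_pair.AE_pair_measure)
        have [measurable]: "S \<in> sets borel" using S by (intro borel_closed finite_imp_closed)
        show "{w \<in> space ((lborel :: 'b measure) \<Otimes>\<^sub>M (lborel :: real measure)). snd w \<notin> S} \<in> sets (lborel \<Otimes>\<^sub>M lborel)"
          by measurable
      qed simp
      then show ?thesis unfolding lborel_prod .
    qed
    then show "AE w in lborel. (\<lambda>n. case w of (x, t) \<Rightarrow> indicator D x * (G x t * \<xi>q n t)) \<longlonglongrightarrow> (case w of (x, t) \<Rightarrow> indicator D x * (G x t * \<xi>' t))"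
    proof eventually_elim
      case (elim w)
      have "filterlim h (at 0) sequentially"
        using h_limit h_bounds(1) by (intro filterlim_atI) (auto simp: less_imp_neq[symmetric])
      from filterlim_compose[OF DERIV_D[OF der[OF elim]] this]
      have "(\<lambda>n. \<xi>q n (snd w)) \<longlonglongrightarrow> \<xi>' (snd w)" unfolding \<xi>q_def .
      then show ?case unfolding case_prod_beta' by (intro tendsto_intros)
    qed
    show "AE w in lborel. norm (case w of (x, t) \<Rightarrow> indicator D x * (G x t * \<xi>q n t)) \<le>
        (case w of (x, t) \<Rightarrow> indicator D x * (indicator {c/2..d} t * (Bg * l)))" for n
    proof (intro always_eventually allI)
      fix w
      have "\<bar>G (fst w) (snd w) * \<xi>q n (snd w)\<bar> \<le> indicator {c/2..d} (snd w) * (Bg * l)"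
      proof (cases "snd w \<in> {c/2..d}")
        case True
        have "\<bar>G (fst w) (snd w) * \<xi>q n (snd w)\<bar> \<le> Bg * l"
          unfolding abs_mult using G_le Bg_nonneg \<xi>q_le by (intro mult_mono) auto
        then show ?thesis using True by simp
      next
        case False
        then show ?thesis using \<xi>q_0 by simp
      qed
      then show "norm (case w of (x, t) \<Rightarrow> indicator D x * (G x t * \<xi>q n t)) \<le>
        (case w of (x, t) \<Rightarrow> indicator D x * (indicator {c/2..d} t * (Bg * l)))"
        unfolding case_prod_beta' real_norm_def abs_mult[of "indicator D _"]
        by (simp add: mult_left_mono)
    qed
    show "(\<lambda>(x, t). indicator D x * (G x t * \<xi>' t)) \<in> borel_measurable lborel"
      unfolding case_prod_beta' lborel_prod[symmetric] by measurable
    show "(\<lambda>(x, t). indicator D x * (G x t * \<xi>q n t)) \<in> borel_measurable lborel" for n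
      using GI[of n] by (rule borel_measurable_integrable)
  qed
  have main: "0 \<le> En n + Tn n" for n
  proof -
    define \<psi> where "\<psi> x t = (W x (t + h n) - W x t) / h n" for x t
    have \<psi>m: "(\<lambda>(x, t). \<psi> x t) \<in> borel_measurable borel"
      unfolding \<psi>_def borel_prod[symmetric] case_prod_beta' by measurable
    have \<phi>m: "(\<lambda>(x, t). steklov (h n) (W x) t) \<in> borel_measurable borel"
      unfolding borel_prod[symmetric] case_prod_beta' by (rule steklov_W_borel) measurable
    have \<psi>0: "\<psi> x t = 0" if "t \<notin> {c/2..d}" for x t
    proof -
      have "t \<notin> {c..d}" using that cd by auto
      moreover have "t + h n \<notin> {c..d}" using that h_bounds(1,2)[of n] cd by auto
      ultimately show ?thesis unfolding \<psi>_def using W_support by simp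
    qed
    have \<phi>0: "steklov (h n) (W x) t = 0" if "t \<notin> {c/2..d}" for x t
      using that h_bounds(2)[of n] by (intro steklov_eq_0[OF W_support h_bounds(1)]) auto
    have "0 \<le> En n - (LINT (x, t)|lborel. indicator D x * (spow q (U x t) * \<psi> x t))"
      unfolding En_def
    proof (rule weak[OF _ \<phi>m \<psi>m])
      show "test_function p q s D T (\<lambda>x t. steklov (h n) (W x) t) (\<lambda>x t. \<psi> x t)"
        unfolding \<psi>_def by (rule steklov_test_function[OF h_bounds(1,3)])
      show "0 < c / 2" "c / 2 < d" "d < T" using cd by auto
      show "steklov (h n) (W x) t = 0 \<and> \<psi> x t = 0" if "t \<notin> {c/2..d}" for x t
        using \<phi>0[OF that] \<psi>0[OF that] by blast
    qed
    moreover have "- (LINT (x, t)|lborel. indicator D x * (spow q (U x t) * \<psi> x t)) \<le> Tn n"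
    proof -
      have \<psi>b: "\<bar>\<psi> x t\<bar> \<le> (m + \<bar>\<mu>\<bar>) / h n" for x t
      proof -
        have "\<bar>W x (t + h n) - W x t\<bar> \<le> m + \<bar>\<mu>\<bar>"
          using abs_W_le[of x t] abs_W_le[of x "t + h n"] W_nonneg[of x t] W_nonneg[of x "t + h n"]
          unfolding abs_le_iff by linarith
        then show ?thesis unfolding \<psi>_def using h_bounds(1)[of n] by (simp add: divide_right_mono)
      qed
      have Ub: "\<bar>spow q (U x t)\<bar> \<le> (\<bar>\<mu>\<bar> + \<bar>M\<bar>) powr q" for x t
        unfolding abs_spow using abs_U q by (intro powr_mono2) auto
      have UI: "integrable lborel (\<lambda>(x, t). indicator D x * (spow q (U x t) * \<psi> x t))"
      proof (rule integrable_spacetime)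
        show "(\<lambda>(x, t). indicator D x * (spow q (U x t) * \<psi> x t)) \<in> borel_measurable borel"
          unfolding \<psi>_def case_prod_beta' borel_prod[symmetric] by measurable
        show "\<bar>indicator D x * (spow q (U x t) * \<psi> x t)\<bar> \<le> (\<bar>\<mu>\<bar> + \<bar>M\<bar>) powr q * ((m + \<bar>\<mu>\<bar>) / h n)" for x t
        proof -
          have "\<bar>indicator D x * (spow q (U x t) * \<psi> x t)\<bar> \<le> \<bar>spow q (U x t)\<bar> * \<bar>\<psi> x t\<bar>"
            by (simp add: abs_mult indicator_def)
          also have "\<dots> \<le> (\<bar>\<mu>\<bar> + \<bar>M\<bar>) powr q * ((m + \<bar>\<mu>\<bar>) / h n)" by (intro mult_mono Ub \<psi>b) auto
          finally show ?thesis .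
        qed
        show "indicator D x * (spow q (U x t) * \<psi> x t) = 0" if "x \<notin> D \<or> t \<notin> {c/2..d}" for x t
          using that \<psi>0 by auto
      qed
      \<comment> \<open>A common bound, because \<open>steklov_time_inequality\<close> uses the same
        constant for all four functions of time; the entry 1 is for \<xi>.\<close>
      define X where "X = max (max ((\<bar>\<mu>\<bar> + \<bar>M\<bar>) powr q) Bg) (max 1 (m + \<bar>\<mu>\<bar>))"
      have slice: "- (LINT t|lborel. spow q (U x t) * \<psi> x t) \<le> (LINT t|lborel. G x t * \<xi>q n t)" for x
        unfolding \<psi>_def \<xi>q_def W_def
      proof (rule steklov_time_inequality)
        have X: "(\<bar>\<mu>\<bar> + \<bar>M\<bar>) powr q \<le> X" "Bg \<le> X" "1 \<le> X" "m + \<bar>\<mu>\<bar> \<le> X"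
          unfolding X_def by (simp_all add: le_max_iff_disj)
        show "\<bar>spow q (U x t)\<bar> \<le> X" for t using Ub X(1) by (rule order_trans)
        show "\<bar>G x t\<bar> \<le> X" for t using G_le[of x t] G_nonneg[of x t] X(2) by linarith
        show "\<bar>\<xi> t\<bar> \<le> X" for t using \<xi>_bounds[of t] X(3) by linarith
        show "\<bar>Z x t\<bar> \<le> X" for t using Z_le[of x t] Z_nonneg[of x t] X(4) by linarith
        show "Z x t * (spow q (U x t) - spow q (U x r)) \<le> G x r - G x t" for r t
          unfolding Z_def G_def by (rule excess_diff_ge[OF q])
      qed (use \<xi>_bounds \<xi>_support h_bounds in auto)
      have "- (LINT (x, t)|lborel. indicator D x * (spow q (U x t) * \<psi> x t)) =
          (LINT x|lborel. - (LINT t|lborel. indicator D x * (spow q (U x t) * \<psi> x t)))"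
        by (simp only: integral_lborel_Times(1)[OF UI] Bochner_Integration.integral_minus)
      also have "\<dots> \<le> (LINT x|lborel. LINT t|lborel. indicator D x * (G x t * \<xi>q n t))"
      proof (rule integral_mono)
        show "integrable lborel (\<lambda>x. - (LINT t|lborel. indicator D x * (spow q (U x t) * \<psi> x t)))"
          by (rule Bochner_Integration.integrable_minus[OF integral_lborel_Times(3)[OF UI]])
        show "integrable lborel (\<lambda>x. LINT t|lborel. indicator D x * (G x t * \<xi>q n t))"
          by (rule integral_lborel_Times(3)[OF GI])
        show "- (LINT t|lborel. indicator D x * (spow q (U x t) * \<psi> x t)) \<le> (LINT t|lborel. indicator D x * (G x t * \<xi>q n t))" for x
          using slice[of x] by (cases "x \<in> D") simp_all
      qed
      also have "\<dots> = Tn n" unfolding Tn_def by (rule integral_lborel_Times(1)[OF GI, symmetric])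
      finally show ?thesis .
    qed
    ultimately show ?thesis by linarith
  qed
  have "(\<lambda>n. En n + Tn n) \<longlonglongrightarrow> (LINT (z, t)|lborel. spow (p - 1) (Ud z t) * Wd z t * \<kappa> (fst z) (snd z) t)
    + (LINT (x, t)|lborel. indicator D x * (G x t * \<xi>' t))"
    using energy_limit(2) T_lim unfolding En_def by (rule tendsto_add)
  then show ?thesis using main by (intro LIMSEQ_le_const) auto
qed

end

section \<open>The energy inequality\<close>

definition ramp :: "real \<Rightarrow> real \<Rightarrow> real \<Rightarrow> real" where
  "ramp a \<epsilon> t = min 1 (max 0 ((t - a) / \<epsilon>))"

lemma ramp_bounds: "0 \<le> ramp a \<epsilon> t" "ramp a \<epsilon> t \<le> 1"
  by (simp_all add: ramp_def)

lemma ramp_eq_0: "0 < \<epsilon> \<Longrightarrow> t \<le> a \<Longrightarrow> ramp a \<epsilon> t = 0"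
  by (simp add: ramp_def max_absorb1 divide_nonpos_pos)

lemma ramp_eq_1: "0 < \<epsilon> \<Longrightarrow> a + \<epsilon> \<le> t \<Longrightarrow> ramp a \<epsilon> t = 1"
  by (simp add: ramp_def field_simps)

lemma ramp_antimono: "0 < \<epsilon> \<Longrightarrow> 0 < \<epsilon>' \<Longrightarrow> a + \<epsilon> \<le> b \<Longrightarrow> ramp b \<epsilon>' t \<le> ramp a \<epsilon> t"
  by (cases "t \<le> b") (simp_all add: ramp_eq_0 ramp_eq_1 ramp_bounds)

lemma borel_measurable_ramp [measurable]: "ramp a \<epsilon> \<in> borel_measurable borel"
  unfolding ramp_def by measurable

lemma ramp_Lipschitz:
  assumes "0 < \<epsilon>" shows "\<bar>ramp a \<epsilon> r - ramp a \<epsilon> t\<bar> \<le> (1 / \<epsilon>) * \<bar>r - t\<bar>"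
proof -
  have "\<bar>ramp a \<epsilon> r - ramp a \<epsilon> t\<bar> \<le> \<bar>(r - a) / \<epsilon> - (t - a) / \<epsilon>\<bar>"
    unfolding ramp_def by linarith
  also have "(r - a) / \<epsilon> - (t - a) / \<epsilon> = (r - t) / \<epsilon>"
    by (simp add: diff_divide_distrib)
  also have "\<bar>(r - t) / \<epsilon>\<bar> = (1 / \<epsilon>) * \<bar>r - t\<bar>" using assms by (simp add: abs_divide)
  finally show ?thesis .
qed

lemma ramp_has_derivative:
  assumes \<epsilon>: "0 < \<epsilon>" and t: "t \<noteq> a" "t \<noteq> a + \<epsilon>"
  shows "(ramp a \<epsilon> has_real_derivative indicator {a..a + \<epsilon>} t / \<epsilon>) (at t)"
proof -
  consider "t < a" | "a < t" "t < a + \<epsilon>" | "a + \<epsilon> < t" using t by linarith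
  then show ?thesis
  proof cases
    case 1
    have "((\<lambda>_. 0) has_real_derivative 0) (at t)" by simp
    then have "(ramp a \<epsilon> has_real_derivative 0) (at t)"
      by (rule has_field_derivative_transform_within_open[where S = "{..<a}"]) (use 1 \<epsilon> in \<open>auto simp: ramp_eq_0\<close>)
    then show ?thesis using 1 by simp
  next
    case 2
    have "((\<lambda>t. (t - a) / \<epsilon>) has_real_derivative 1 / \<epsilon>) (at t)"
      by (intro DERIV_cdivide) (auto intro!: derivative_eq_intros)
    then have "(ramp a \<epsilon> has_real_derivative 1 / \<epsilon>) (at t)"
      by (rule has_field_derivative_transform_within_open[where S = "{a<..<a + \<epsilon>}"])
        (use 2 \<epsilon> in \<open>auto simp: ramp_def field_simps\<close>)
    then show ?thesis using 2 by simp
  next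
    case 3
    have "((\<lambda>_. 1) has_real_derivative 0) (at t)" by simp
    then have "(ramp a \<epsilon> has_real_derivative 0) (at t)"
      by (rule has_field_derivative_transform_within_open[where S = "{a + \<epsilon><..}"]) (use 3 \<epsilon> in \<open>auto simp: ramp_eq_1\<close>)
    then show ?thesis using 3 by simp
  qed
qed

context level_cutoff
begin

abbreviation Zd where "Zd z t \<equiv> Z (fst z) t - Z (snd z) t"
abbreviation kd where "kd z \<equiv> k (fst z) - k (snd z)"

text \<open>Multiply \<open>spow_diff_pos_part_le\<close> by \<xi> and by the kernel; the negative
  term takes the lower bound of the kernel, the positive one the upper bound. The error is confined
  to pairs with at least one point below the level, which is what later brings in the measure of {U
  < k}.\<close>

lemma flux_le:
  "spow (p - 1) (Ud z t) * Wd z t * \<kappa> (fst z) (snd z) t \<le>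
    - (2 powr (1 - p) / \<Lambda>) * (\<xi> t * (\<bar>Zd z t\<bar> powr p * gk z))
    + 4 * \<Lambda> * (\<xi> t * (\<bar>kd z\<bar> powr p * gk z * indicator {z. 0 < Z (fst z) t \<or> 0 < Z (snd z) t} z))"
proof -
  define I where "I = (indicator {z. 0 < Z (fst z) t \<or> 0 < Z (snd z) t} z :: real)"
  have I: "0 \<le> I" by (simp add: I_def)
  have "spow (p - 1) (Ud z t) * Zd z t \<le> - (2 powr (1 - p)) * \<bar>Zd z t\<bar> powr p + 4 * \<bar>kd z\<bar> powr p * I"
  proof -
    have "4 * \<bar>kd z\<bar> powr p * I = (if 0 < Z (fst z) t \<or> 0 < Z (snd z) t then 4 * \<bar>kd z\<bar> powr p else 0)"
      by (simp add: I_def indicator_def)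
    then show ?thesis
      using spow_diff_pos_part_le[OF p, where ux = "U (fst z) t" and uy = "U (snd z) t" and kx = "k (fst z)" and ky = "k (snd z)"]
      unfolding Z_def[symmetric] by (simp only:)
  qed
  then have "spow (p - 1) (Ud z t) * Zd z t * \<kappa> (fst z) (snd z) t \<le>
      (- (2 powr (1 - p)) * \<bar>Zd z t\<bar> powr p + 4 * \<bar>kd z\<bar> powr p * I) * \<kappa> (fst z) (snd z) t"
    by (rule mult_right_mono[OF _ \<kappa>_nonneg])
  also have "\<dots> = - (2 powr (1 - p) * \<bar>Zd z t\<bar> powr p * \<kappa> (fst z) (snd z) t) + 4 * \<bar>kd z\<bar> powr p * I * \<kappa> (fst z) (snd z) t"
    by (simp add: algebra_simps)
  also have "\<dots> \<le> - (2 powr (1 - p) * \<bar>Zd z t\<bar> powr p * (gk z / \<Lambda>)) + 4 * \<bar>kd z\<bar> powr p * I * (\<Lambda> * gk z)"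
    using \<kappa>_bounds[of "fst z" "snd z" t] I
    by (intro add_mono le_imp_neg_le mult_left_mono) auto
  finally have "\<xi> t * (spow (p - 1) (Ud z t) * Zd z t * \<kappa> (fst z) (snd z) t) \<le>
      \<xi> t * (- (2 powr (1 - p) * \<bar>Zd z t\<bar> powr p * (gk z / \<Lambda>)) + 4 * \<bar>kd z\<bar> powr p * I * (\<Lambda> * gk z))"
    by (rule mult_left_mono[OF _ \<xi>_bounds(1)])
  moreover have "spow (p - 1) (Ud z t) * Wd z t * \<kappa> (fst z) (snd z) t = \<xi> t * (spow (p - 1) (Ud z t) * Zd z t * \<kappa> (fst z) (snd z) t)"
    by (simp add: W_def algebra_simps)
  moreover have "\<xi> t * (- (2 powr (1 - p) * \<bar>Zd z t\<bar> powr p * (gk z / \<Lambda>)) + 4 * \<bar>kd z\<bar> powr p * I * (\<Lambda> * gk z)) =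
      - (2 powr (1 - p) / \<Lambda>) * (\<xi> t * (\<bar>Zd z t\<bar> powr p * gk z)) + 4 * \<Lambda> * (\<xi> t * (\<bar>kd z\<bar> powr p * gk z * I))"
    by (simp add: algebra_simps)
  ultimately show ?thesis unfolding I_def by (simp only:)
qed

lemma measurable_spacetime_pairs:
  "(\<lambda>(z, t). ennreal (\<xi> t * (\<bar>Zd z t\<bar> powr p * gk z))) \<in> borel_measurable borel"
  "(\<lambda>(z, t). ennreal (\<xi> t * (\<bar>kd z\<bar> powr p * gk z * indicator {z. 0 < Z (fst z) t \<or> 0 < Z (snd z) t} z))) \<in> borel_measurable borel"
proof -
  show "(\<lambda>(z, t). ennreal (\<xi> t * (\<bar>Zd z t\<bar> powr p * gk z))) \<in> borel_measurable borel"
    unfolding case_prod_beta' borel_prod[symmetric, where 'b = real] by measurable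
  have "(\<lambda>w. indicator {z. 0 < Z (fst z) (snd w) \<or> 0 < Z (snd z) (snd w)} (fst w) :: real) =
      (\<lambda>w. if 0 < Z (fst (fst w)) (snd w) \<or> 0 < Z (snd (fst w)) (snd w) then 1 else 0)"
    by (auto simp: indicator_def)
  moreover have "(\<lambda>w. if 0 < Z (fst (fst w)) (snd w) \<or> 0 < Z (snd (fst w)) (snd w) then 1 else 0 :: real)
      \<in> borel_measurable (borel \<Otimes>\<^sub>M borel)"
    by measurable
  ultimately have [measurable]: "(\<lambda>w. indicator {z. 0 < Z (fst z) (snd w) \<or> 0 < Z (snd z) (snd w)} (fst w) :: real)
      \<in> borel_measurable (borel \<Otimes>\<^sub>M borel)" by simp
  show "(\<lambda>(z, t). ennreal (\<xi> t * (\<bar>kd z\<bar> powr p * gk z * indicator {z. 0 < Z (fst z) t \<or> 0 < Z (snd z) t} z))) \<in> borel_measurable borel"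
    unfolding case_prod_beta' borel_prod[symmetric, where 'b = real] by measurable
qed

text \<open>The flux is signed, whereas its two bounds are integrals of nonnegative functions with
  values in \<open>ennreal\<close>. They are extracted as the reals \<open>P\<close> and
  \<open>Q\<close>, after both have been shown finite, so that one can be moved across the
  inequality. For \<open>Q\<close>, integrating the energy density of \<open>k\<close> in the other
  variable gives \<open>Ck\<close>, and a pair may touch {U < k} at either point, whence 2 *
  Ck.\<close>

lemma energy_estimate:
  assumes lip: "\<And>r t. \<bar>\<xi> r - \<xi> t\<bar> \<le> l * \<bar>r - t\<bar>" and S: "finite S"
    and der: "\<And>t. t \<notin> S \<Longrightarrow> (\<xi> has_real_derivative \<xi>' t) (at t)"
    and \<xi>'m: "\<xi>' \<in> borel_measurable borel"
  shows "\<exists>P Q. 0 \<le> P \<and> 0 \<le> Q \<and>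
    (\<integral>\<^sup>+t. \<integral>\<^sup>+z. ennreal (\<xi> t * (\<bar>Zd z t\<bar> powr p * gk z)) \<partial>lborel \<partial>lborel) = ennreal P \<and>
    ennreal Q \<le> ennreal (2 * Ck) * (\<integral>\<^sup>+t. emeasure lborel {x. U x t < k x} * indicator {c..d} t \<partial>lborel) \<and>
    2 powr (1 - p) / \<Lambda> * P \<le> 4 * \<Lambda> * Q + (LINT (x, t)|lborel. indicator D x * (G x t * \<xi>' t))"
proof -
  define fP where "fP z t = \<xi> t * (\<bar>Zd z t\<bar> powr p * gk z)" for z t
  define fQ where "fQ z t = \<xi> t * (\<bar>kd z\<bar> powr p * gk z * indicator {z. 0 < Z (fst z) t \<or> 0 < Z (snd z) t} z)" for z t
  have fP0: "0 \<le> fP z t" and fQ0: "0 \<le> fQ z t" for z t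
    unfolding fP_def fQ_def using \<xi>_bounds(1) by (auto intro!: mult_nonneg_nonneg)
  note m = measurable_spacetime_pairs[folded fP_def fQ_def]
  have fPm: "(\<lambda>(z, t). fP z t) \<in> borel_measurable borel" and fQm: "(\<lambda>(z, t). fQ z t) \<in> borel_measurable borel"
    using borel_measurable_enn2real[OF m(1)] borel_measurable_enn2real[OF m(2)] fP0 fQ0
    by (simp_all add: case_prod_beta')
  have Pfin: "(\<integral>\<^sup>+z. \<integral>\<^sup>+t. ennreal (fP z t) \<partial>lborel \<partial>lborel) < \<infinity>"
  proof -
    have "ennreal (fP z t) \<le> ennreal (\<bar>Zd z t\<bar> powr p * gk z) * indicator {c..d} t" for z t
    proof (cases "t \<in> {c..d}")
      case True
      have "fP z t \<le> \<bar>Zd z t\<bar> powr p * gk z"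
        unfolding fP_def using \<xi>_bounds by (intro mult_left_le_one_le) auto
      then show ?thesis using True by (simp add: ennreal_leI)
    qed (simp add: fP_def \<xi>_support)
    then have "(\<integral>\<^sup>+z. \<integral>\<^sup>+t. ennreal (fP z t) \<partial>lborel \<partial>lborel) \<le>
      (\<integral>\<^sup>+z. \<integral>\<^sup>+t. ennreal (\<bar>Zd z t\<bar> powr p * gk z) * indicator {c..d} t \<partial>lborel \<partial>lborel)"
      by (intro nn_integral_mono)
    then show ?thesis using Z_energy_finite[OF cd] by (rule order.strict_trans1)
  qed
  have level_set: "{x. 0 < Z x t} = {x. U x t < k x}" for t unfolding Z_def by auto
  have lm: "{x. U x t < k x} \<in> sets borel" for t by measurable
  have lm2: "(\<lambda>t. emeasure lborel {x. U x t < k x}) \<in> borel_measurable borel"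
  proof -
    have "{w \<in> space (borel \<Otimes>\<^sub>M borel). U (snd w) (fst w) < k (snd w)} \<in> sets (borel \<Otimes>\<^sub>M borel)"
      by measurable
    then have "{w. U (snd w) (fst w) < k (snd w)} \<in> sets (borel \<Otimes>\<^sub>M lborel)"
      by (simp add: space_pair_measure)
    from lborel.measurable_emeasure_Pair[OF this] show ?thesis
      by (simp add: vimage_def)
  qed
  have Qle: "(\<integral>\<^sup>+t. \<integral>\<^sup>+z. ennreal (fQ z t) \<partial>lborel \<partial>lborel) \<le>
      ennreal (2 * Ck) * (\<integral>\<^sup>+t. emeasure lborel {x. U x t < k x} * indicator {c..d} t \<partial>lborel)"
  proof -
    have "(\<integral>\<^sup>+z. ennreal (fQ z t) \<partial>lborel) \<le> ennreal (2 * Ck) * (emeasure lborel {x. U x t < k x} * indicator {c..d} t)" for t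
    proof (cases "t \<in> {c..d}")
      case True
      define E where "E z = ennreal (\<bar>kd z\<bar> powr p * gk z)" for z
      have "(\<integral>\<^sup>+z. ennreal (fQ z t) \<partial>lborel) \<le> (\<integral>\<^sup>+z. E z * indicator {z. fst z \<in> {x. U x t < k x} \<or> snd z \<in> {x. U x t < k x}} z \<partial>lborel)"
      proof (rule nn_integral_mono)
        fix z
        have "fQ z t \<le> \<bar>kd z\<bar> powr p * gk z * indicator {z. 0 < Z (fst z) t \<or> 0 < Z (snd z) t} z"
          unfolding fQ_def using \<xi>_bounds by (intro mult_left_le_one_le) auto
        then have "ennreal (fQ z t) \<le> ennreal (\<bar>kd z\<bar> powr p * gk z * indicator {z. 0 < Z (fst z) t \<or> 0 < Z (snd z) t} z)"
          by (rule ennreal_leI)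
        also have "\<dots> = E z * indicator {z. fst z \<in> {x. U x t < k x} \<or> snd z \<in> {x. U x t < k x}} z"
          unfolding E_def level_set[symmetric] mem_Collect_eq by (cases "0 < Z (fst z) t \<or> 0 < Z (snd z) t") simp_all
        finally show "ennreal (fQ z t) \<le> E z * indicator {z. fst z \<in> {x. U x t < k x} \<or> snd z \<in> {x. U x t < k x}} z" .
      qed
      also have "\<dots> \<le> 2 * (ennreal Ck * emeasure lborel {x. U x t < k x})"
      proof (rule nn_integral_symmetric_le[OF _ _ lm])
        show "E \<in> borel_measurable borel" unfolding E_def borel_prod[symmetric] by measurable
        show "E (x, y) = E (y, x)" for x y unfolding E_def by (simp add: abs_minus_commute gkernel_commute)
        show "(\<integral>\<^sup>+y. E (x, y) \<partial>lborel) \<le> ennreal Ck" for x unfolding E_def using Ck(2)[of x] by simp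
      qed
      also have "\<dots> = ennreal (2 * Ck) * (emeasure lborel {x. U x t < k x} * indicator {c..d} t)"
        using True Ck(1) by (simp add: ennreal_mult mult.assoc)
      finally show ?thesis .
    qed (simp add: fQ_def \<xi>_support)
    then have "(\<integral>\<^sup>+t. \<integral>\<^sup>+z. ennreal (fQ z t) \<partial>lborel \<partial>lborel) \<le>
      (\<integral>\<^sup>+t. ennreal (2 * Ck) * (emeasure lborel {x. U x t < k x} * indicator {c..d} t) \<partial>lborel)"
      by (rule nn_integral_mono)
    also have "\<dots> = ennreal (2 * Ck) * (\<integral>\<^sup>+t. emeasure lborel {x. U x t < k x} * indicator {c..d} t \<partial>lborel)"
      by (rule nn_integral_cmult) (intro borel_measurable_times_ennreal borel_measurable_indicator, use lm2 in simp_all)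
    finally show ?thesis .
  qed
  have Qfin: "(\<integral>\<^sup>+t. emeasure lborel {x. U x t < k x} * indicator {c..d} t \<partial>lborel) < \<infinity>"
  proof -
    have "(\<integral>\<^sup>+t. emeasure lborel {x. U x t < k x} * indicator {c..d} t \<partial>lborel) \<le> (\<integral>\<^sup>+t. emeasure lborel B' * indicator {c..d} t \<partial>lborel)"
    proof (intro nn_integral_mono mult_right_mono emeasure_mono)
      show "{x. U x t < k x} \<subseteq> B'" for t
      proof
        fix x assume "x \<in> {x. U x t < k x}"
        then have "\<not> k x \<le> \<mu>" using U_bounds(1)[of x t] by simp
        then show "x \<in> B'" using k_outside[of x] by blast
      qed
    qed auto
    also have "\<dots> = emeasure lborel B' * ennreal (d - c)" using cd by (simp add: nn_integral_cmult_indicator)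
    also have "\<dots> < \<infinity>" using emeasure_B' by (simp add: ennreal_mult_less_top)
    finally show ?thesis .
  qed
  have Pint: "integrable lborel (\<lambda>(z, t). fP z t)"
  proof (rule integrableI_nonneg)
    show "(\<integral>\<^sup>+w. ennreal (case w of (z, t) \<Rightarrow> fP z t) \<partial>lborel) < \<infinity>"
      using Pfin nn_integral_lborel_Times(1)[OF m(1)] by (simp add: case_prod_beta')
  qed (use fPm fP0 in \<open>auto simp: case_prod_beta'\<close>)
  have Qint: "integrable lborel (\<lambda>(z, t). fQ z t)"
  proof (rule integrableI_nonneg)
    have "(\<integral>\<^sup>+t. \<integral>\<^sup>+z. ennreal (fQ z t) \<partial>lborel \<partial>lborel) < \<infinity>"
      using Qle by (rule order.strict_trans1) (use Qfin in \<open>simp add: ennreal_mult_less_top\<close>)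
    then show "(\<integral>\<^sup>+w. ennreal (case w of (z, t) \<Rightarrow> fQ z t) \<partial>lborel) < \<infinity>"
      using nn_integral_lborel_Times(2)[OF m(2)] by (simp add: case_prod_beta')
  qed (use fQm fQ0 in \<open>auto simp: case_prod_beta'\<close>)
  define P where "P = (LINT (z, t)|lborel. fP z t)"
  define Q where "Q = (LINT (z, t)|lborel. fQ z t)"
  have P: "ennreal P = (\<integral>\<^sup>+t. \<integral>\<^sup>+z. ennreal (fP z t) \<partial>lborel \<partial>lborel)"
    using nn_integral_eq_integral[OF Pint] fP0 nn_integral_lborel_Times(2)[OF m(1)]
    by (simp add: P_def case_prod_beta')
  have Q: "ennreal Q = (\<integral>\<^sup>+t. \<integral>\<^sup>+z. ennreal (fQ z t) \<partial>lborel \<partial>lborel)"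
    using nn_integral_eq_integral[OF Qint] fQ0 nn_integral_lborel_Times(2)[OF m(2)]
    by (simp add: Q_def case_prod_beta')
  have PQ0: "0 \<le> P" "0 \<le> Q"
    unfolding P_def Q_def using fP0 fQ0 by (auto intro!: Bochner_Integration.integral_nonneg simp: case_prod_beta')
  have "(LINT (z, t)|lborel. spow (p - 1) (Ud z t) * Wd z t * \<kappa> (fst z) (snd z) t) \<le>
      (LINT w|lborel. - (2 powr (1 - p) / \<Lambda>) * (case w of (z, t) \<Rightarrow> fP z t) + 4 * \<Lambda> * (case w of (z, t) \<Rightarrow> fQ z t))"
  proof (rule integral_mono[OF energy_limit(1)])
    show "integrable lborel (\<lambda>w. - (2 powr (1 - p) / \<Lambda>) * (case w of (z, t) \<Rightarrow> fP z t) + 4 * \<Lambda> * (case w of (z, t) \<Rightarrow> fQ z t))"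
      by (intro Bochner_Integration.integrable_add integrable_mult_right Pint Qint)
    show "(case w of (z, t) \<Rightarrow> spow (p - 1) (Ud z t) * Wd z t * \<kappa> (fst z) (snd z) t) \<le>
      - (2 powr (1 - p) / \<Lambda>) * (case w of (z, t) \<Rightarrow> fP z t) + 4 * \<Lambda> * (case w of (z, t) \<Rightarrow> fQ z t)" for w
      unfolding case_prod_beta' fP_def fQ_def by (rule flux_le)
  qed
  also have "\<dots> = (LINT w|lborel. - (2 powr (1 - p) / \<Lambda>) * (case w of (z, t) \<Rightarrow> fP z t)) + (LINT w|lborel. 4 * \<Lambda> * (case w of (z, t) \<Rightarrow> fQ z t))"
    by (intro Bochner_Integration.integral_add integrable_mult_right Pint Qint)
  also have "\<dots> = - (2 powr (1 - p) / \<Lambda>) * P + 4 * \<Lambda> * Q"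
    unfolding P_def Q_def by (simp only: integral_mult_right_zero)
  finally have "2 powr (1 - p) / \<Lambda> * P \<le> 4 * \<Lambda> * Q + (LINT (x, t)|lborel. indicator D x * (G x t * \<xi>' t))"
    using weak_limit[OF lip S der \<xi>'m] by linarith
  then show ?thesis
    using PQ0 P Q Qle unfolding fP_def by (intro exI[of _ P] exI[of _ Q]) auto
qed

end

section \<open>The energy inequality between two times\<close>

context level
begin

definition g where "g t = (LINT x|lborel. G x t)"

definition A where "A t = emeasure lborel {x. U x t < k x}"

lemma G_integrable: "integrable lborel (\<lambda>x. G x t)"
  by (rule integrable_bounded_finite_support[where B = Bg and S = B']) (use G_le G_outside emeasure_B' in auto)

lemma g_borel [measurable]: "g \<in> borel_measurable borel"
proof -
  have "(\<lambda>(t, x). G x t) \<in> borel_measurable (borel \<Otimes>\<^sub>M lborel)"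
    unfolding case_prod_beta' by measurable
  from lborel.borel_measurable_lebesgue_integral[OF this] show ?thesis unfolding g_def by simp
qed

lemma g_nonneg [simp]: "0 \<le> g t"
  unfolding g_def by (rule Bochner_Integration.integral_nonneg) simp

lemma g_le: "g t \<le> Bg * measure lborel B'"
proof -
  have "g t \<le> (LINT x|lborel. Bg * indicator B' x)"
    unfolding g_def
  proof (rule integral_mono[OF G_integrable])
    show "integrable lborel (\<lambda>x. Bg * indicator B' x)"
      by (intro integrable_mult_right integrable_real_indicator) (use emeasure_B' in simp_all)
    show "G x t \<le> Bg * indicator B' x" for x
      using G_le[of x t] G_outside[of x t] by (cases "x \<in> B'") simp_all
  qed
  also have "\<dots> = Bg * measure lborel B'" by simp
  finally show ?thesis .
qed

lemma g_integrable: "integrable lborel (\<lambda>t. indicator {a..b} t * g t)"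
  by (rule integrable_bounded_support[where B = "Bg * measure lborel B'"])
    (use g_le Bg_nonneg in \<open>auto simp: indicator_def\<close>)

text \<open>The cutoff in time is a trapezoid, rising on [c, c + \<epsilon>1] and falling on
  [d - \<epsilon>2, d]; its derivative turns the excess into averages of \<open>g\<close> over the
  two end intervals, the final one with the sign that puts it on the left. Averages are kept because
  \<open>g\<close> is not known to be continuous in time, and the two ends are sent to their limits
  by different arguments. The constant 8 is 4 from the flux times 2 from the two positions in a
  pair.\<close>

lemma energy_inequality:
  assumes c: "0 < c" and \<epsilon>: "0 < \<epsilon>1" "0 < \<epsilon>2" and gap: "c + \<epsilon>1 \<le> d - \<epsilon>2" and d: "d < T"
  shows "ennreal (2 powr (1 - p) / \<Lambda>) * (\<integral>\<^sup>+t. (\<integral>\<^sup>+z. ennreal (\<bar>Z (fst z) t - Z (snd z) t\<bar> powr p * gkernel p s (fst z) (snd z)) \<partial>lborel)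
        * indicator {c + \<epsilon>1..d - \<epsilon>2} t \<partial>lborel)
      + ennreal ((LINT t|lborel. indicator {d - \<epsilon>2..d} t * g t) / \<epsilon>2)
    \<le> ennreal (8 * \<Lambda> * Ck) * (\<integral>\<^sup>+t. A t * indicator {c..d} t \<partial>lborel)
      + ennreal ((LINT t|lborel. indicator {c..c + \<epsilon>1} t * g t) / \<epsilon>1)"
proof -
  define \<xi> where "\<xi> t = ramp c \<epsilon>1 t - ramp (d - \<epsilon>2) \<epsilon>2 t" for t
  define \<xi>' where "\<xi>' t = indicator {c..c + \<epsilon>1} t / \<epsilon>1 - indicator {d - \<epsilon>2..d} t / \<epsilon>2" for t
  interpret level_cutoff p q s \<Lambda> T \<mu> M D U \<kappa> k B' \<rho> m Ck \<xi> c d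
  proof
    show "\<xi> \<in> borel_measurable borel" unfolding \<xi>_def by measurable
    \<comment> \<open>By \<open>gap\<close> the first ramp is complete before the second one starts,
      so the difference stays nonnegative.\<close>
    show "0 \<le> \<xi> t" for t unfolding \<xi>_def using ramp_antimono[OF \<epsilon> gap, of t] by simp
    show "\<xi> t \<le> 1" for t
      unfolding \<xi>_def using ramp_bounds(2)[of c \<epsilon>1 t] ramp_bounds(1)[of "d - \<epsilon>2" \<epsilon>2 t] by linarith
    show "\<xi> t = 0" if "t \<notin> {c..d}" for t
    proof -
      consider "t < c" | "d < t" using \<open>t \<notin> {c..d}\<close> by fastforce
      then show ?thesis
        by cases (use \<epsilon> gap in \<open>simp_all add: \<xi>_def ramp_eq_0 ramp_eq_1\<close>)
    qed
  qed (use c \<epsilon> gap d in auto)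
  have lip: "\<bar>\<xi> r - \<xi> t\<bar> \<le> (1 / \<epsilon>1 + 1 / \<epsilon>2) * \<bar>r - t\<bar>" for r t
  proof -
    have "\<bar>\<xi> r - \<xi> t\<bar> \<le> \<bar>ramp c \<epsilon>1 r - ramp c \<epsilon>1 t\<bar> + \<bar>ramp (d - \<epsilon>2) \<epsilon>2 r - ramp (d - \<epsilon>2) \<epsilon>2 t\<bar>"
      unfolding \<xi>_def by linarith
    then show ?thesis
      using ramp_Lipschitz[OF \<epsilon>(1), of c r t] ramp_Lipschitz[OF \<epsilon>(2), of "d - \<epsilon>2" r t]
      unfolding distrib_right by linarith
  qed
  have der: "(\<xi> has_real_derivative \<xi>' t) (at t)" if "t \<notin> {c, c + \<epsilon>1, d - \<epsilon>2, d}" for t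
  proof -
    have "(ramp c \<epsilon>1 has_real_derivative indicator {c..c + \<epsilon>1} t / \<epsilon>1) (at t)"
      using that by (intro ramp_has_derivative \<epsilon>) auto
    moreover have "(ramp (d - \<epsilon>2) \<epsilon>2 has_real_derivative indicator {d - \<epsilon>2..d} t / \<epsilon>2) (at t)"
      using ramp_has_derivative[OF \<epsilon>(2), of t "d - \<epsilon>2"] that by simp
    ultimately show ?thesis unfolding \<xi>_def[abs_def] \<xi>'_def by (rule DERIV_diff)
  qed
  have \<xi>'m[measurable]: "\<xi>' \<in> borel_measurable borel" unfolding \<xi>'_def by measurable
  have fin: "finite {c, c + \<epsilon>1, d - \<epsilon>2, d}" by simp
  obtain P Q where PQ: "0 \<le> P" "0 \<le> Q"
    "(\<integral>\<^sup>+t. \<integral>\<^sup>+z. ennreal (\<xi> t * (\<bar>Z (fst z) t - Z (snd z) t\<bar> powr p * gkernel p s (fst z) (snd z))) \<partial>lborel \<partial>lborel) = ennreal P"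
    "ennreal Q \<le> ennreal (2 * Ck) * (\<integral>\<^sup>+t. emeasure lborel {x. U x t < k x} * indicator {c..d} t \<partial>lborel)"
    "2 powr (1 - p) / \<Lambda> * P \<le> 4 * \<Lambda> * Q + (LINT (x, t)|lborel. indicator D x * (G x t * \<xi>' t))"
    using energy_estimate[OF lip fin der \<xi>'m] by blast
  define g1 where "g1 = (LINT t|lborel. indicator {c..c + \<epsilon>1} t * g t) / \<epsilon>1"
  define g2 where "g2 = (LINT t|lborel. indicator {d - \<epsilon>2..d} t * g t) / \<epsilon>2"
  have g12: "0 \<le> g1" "0 \<le> g2"
    unfolding g1_def g2_def using \<epsilon> by (auto intro!: divide_nonneg_pos Bochner_Integration.integral_nonneg)
  have "(LINT (x, t)|lborel. indicator D x * (G x t * \<xi>' t)) = g1 - g2"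
  proof -
    have "integrable lborel (\<lambda>(x, t). indicator D x * (G x t * \<xi>' t))"
    proof (rule integrable_spacetime)
      show "(\<lambda>(x, t). indicator D x * (G x t * \<xi>' t)) \<in> borel_measurable borel"
        unfolding case_prod_beta' borel_prod[symmetric] by measurable
      have "\<bar>\<xi>' t\<bar> \<le> 1 / \<epsilon>1 + 1 / \<epsilon>2" for t
        unfolding \<xi>'_def using \<epsilon> by (simp add: indicator_def abs_if)
      then show "\<bar>indicator D x * (G x t * \<xi>' t)\<bar> \<le> Bg * (1 / \<epsilon>1 + 1 / \<epsilon>2)" for x t
      proof -
        have "\<bar>indicator D x * (G x t * \<xi>' t)\<bar> \<le> G x t * \<bar>\<xi>' t\<bar>" by (simp add: abs_mult indicator_def)
        also have "\<dots> \<le> Bg * (1 / \<epsilon>1 + 1 / \<epsilon>2)" by (intro mult_mono G_le Bg_nonneg) (use \<open>\<And>t. \<bar>\<xi>' t\<bar> \<le> 1 / \<epsilon>1 + 1 / \<epsilon>2\<close> in auto)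
        finally show ?thesis .
      qed
      show "indicator D x * (G x t * \<xi>' t) = 0" if "x \<notin> D \<or> t \<notin> {c/2..d}" for x t
      proof (cases "x \<in> D")
        case True
        then have "t \<notin> {c..c + \<epsilon>1}" "t \<notin> {d - \<epsilon>2..d}" using that c gap \<epsilon> by auto
        then show ?thesis by (simp add: \<xi>'_def)
      qed simp
    qed
    then have "(LINT (x, t)|lborel. indicator D x * (G x t * \<xi>' t)) = (LINT t|lborel. LINT x|lborel. indicator D x * (G x t * \<xi>' t))"
      by (rule integral_lborel_Times(2))
    also have "\<dots> = (LINT t|lborel. (indicator {c..c + \<epsilon>1} t * g t) / \<epsilon>1 - (indicator {d - \<epsilon>2..d} t * g t) / \<epsilon>2)"
    proof (intro Bochner_Integration.integral_cong refl)
      fix t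
      have "indicator D x * (G x t * \<xi>' t) = G x t * \<xi>' t" for x
        using G_outside[of x t] B'_sub by (cases "x \<in> D") auto
      then have "(LINT x|lborel. indicator D x * (G x t * \<xi>' t)) = g t * \<xi>' t"
        unfolding g_def by (simp only: integral_mult_left_zero)
      then show "(LINT x|lborel. indicator D x * (G x t * \<xi>' t)) = (indicator {c..c + \<epsilon>1} t * g t) / \<epsilon>1 - (indicator {d - \<epsilon>2..d} t * g t) / \<epsilon>2"
        unfolding \<xi>'_def by (simp add: algebra_simps)
    qed
    also have "\<dots> = (LINT t|lborel. (indicator {c..c + \<epsilon>1} t * g t) / \<epsilon>1) - (LINT t|lborel. (indicator {d - \<epsilon>2..d} t * g t) / \<epsilon>2)"
      by (intro Bochner_Integration.integral_diff integrable_divide_zero g_integrable)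
    also have "\<dots> = g1 - g2" unfolding g1_def g2_def by (simp only: integral_divide_zero)
    finally show ?thesis .
  qed
  with PQ(5) have real: "2 powr (1 - p) / \<Lambda> * P + g2 \<le> 4 * \<Lambda> * Q + g1" by linarith
  have "(\<integral>\<^sup>+t. (\<integral>\<^sup>+z. ennreal (\<bar>Z (fst z) t - Z (snd z) t\<bar> powr p * gkernel p s (fst z) (snd z)) \<partial>lborel)
        * indicator {c + \<epsilon>1..d - \<epsilon>2} t \<partial>lborel) \<le> ennreal P"
    unfolding PQ(3)[symmetric]
  proof (rule nn_integral_mono)
    fix t
    show "(\<integral>\<^sup>+z. ennreal (\<bar>Z (fst z) t - Z (snd z) t\<bar> powr p * gkernel p s (fst z) (snd z)) \<partial>lborel) * indicator {c + \<epsilon>1..d - \<epsilon>2} t \<le>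
      (\<integral>\<^sup>+z. ennreal (\<xi> t * (\<bar>Z (fst z) t - Z (snd z) t\<bar> powr p * gkernel p s (fst z) (snd z))) \<partial>lborel)"
    proof (cases "t \<in> {c + \<epsilon>1..d - \<epsilon>2}")
      case True
      then have "\<xi> t = 1" using \<epsilon> by (simp add: \<xi>_def ramp_eq_0 ramp_eq_1)
      then show ?thesis using True by simp
    qed simp
  qed
  then have "ennreal (2 powr (1 - p) / \<Lambda>) * (\<integral>\<^sup>+t. (\<integral>\<^sup>+z. ennreal (\<bar>Z (fst z) t - Z (snd z) t\<bar> powr p * gkernel p s (fst z) (snd z)) \<partial>lborel)
        * indicator {c + \<epsilon>1..d - \<epsilon>2} t \<partial>lborel) + ennreal g2 \<le> ennreal (2 powr (1 - p) / \<Lambda>) * ennreal P + ennreal g2"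
    by (intro add_right_mono mult_left_mono) auto
  also have "\<dots> = ennreal (2 powr (1 - p) / \<Lambda> * P + g2)"
  proof -
    have "0 \<le> 2 powr (1 - p) / \<Lambda>" using \<Lambda> by simp
    from ennreal_mult[OF this PQ(1)] ennreal_plus[OF mult_nonneg_nonneg[OF this PQ(1)] g12(2)]
    show ?thesis by (simp only:)
  qed
  also have "\<dots> \<le> ennreal (4 * \<Lambda> * Q + g1)" by (rule ennreal_leI[OF real])
  also have "\<dots> = ennreal (4 * \<Lambda>) * ennreal Q + ennreal g1"
    using PQ g12 \<Lambda> by (simp add: ennreal_mult ennreal_plus)
  also have "\<dots> \<le> ennreal (4 * \<Lambda>) * (ennreal (2 * Ck) * (\<integral>\<^sup>+t. emeasure lborel {x. U x t < k x} * indicator {c..d} t \<partial>lborel)) + ennreal g1"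
    by (intro add_right_mono mult_left_mono PQ(4)) simp
  also have "\<dots> = ennreal (8 * \<Lambda> * Ck) * (\<integral>\<^sup>+t. A t * indicator {c..d} t \<partial>lborel) + ennreal g1"
    using \<Lambda> Ck(1) unfolding A_def by (simp add: mult.assoc[symmetric] ennreal_mult[symmetric])
  finally show ?thesis unfolding g1_def g2_def .
qed

section \<open>De Giorgi iteration\<close>

definition J where
  "J t = (\<integral>\<^sup>+z. ennreal (\<bar>Z (fst z) t - Z (snd z) t\<bar> powr p * gkernel p s (fst z) (snd z)) \<partial>lborel)"

lemma J_double: "J t = (\<integral>\<^sup>+x. \<integral>\<^sup>+y. ennreal (\<bar>Z x t - Z y t\<bar> powr p * gkernel p s x y) \<partial>lborel \<partial>lborel)"
proof -
  have "(\<lambda>(x, y). ennreal (\<bar>Z x t - Z y t\<bar> powr p * gkernel p s x y)) \<in> borel_measurable borel"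
    unfolding case_prod_beta' borel_prod[symmetric] by measurable
  from nn_integral_lborel_Times(1)[OF this] show ?thesis unfolding J_def .
qed

lemma J_borel [measurable]: "J \<in> borel_measurable borel"
  unfolding J_double[abs_def] by measurable

lemma A_le: "A t \<le> emeasure lborel B'"
  unfolding A_def
proof (rule emeasure_mono)
  show "{x. U x t < k x} \<subseteq> B'"
  proof
    fix x assume "x \<in> {x. U x t < k x}"
    then have "\<not> k x \<le> \<mu>" using U_bounds(1)[of x t] by simp
    then show "x \<in> B'" using k_outside[of x] by blast
  qed
qed simp

definition Y where "Y t0 t1 = (\<integral>\<^sup>+t. A t * indicator {t0<..<t1} t \<partial>lborel)"

text \<open>Smallness enters the iteration here: every sublevel set lies in \<open>B'\<close>, so a
  short time interval makes the first measure small.\<close>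

lemma Y_le: "t0 \<le> t1 \<Longrightarrow> Y t0 t1 \<le> emeasure lborel B' * ennreal (t1 - t0)"
proof -
  assume t: "t0 \<le> t1"
  have "Y t0 t1 \<le> (\<integral>\<^sup>+t. emeasure lborel B' * indicator {t0<..<t1} t \<partial>lborel)"
    unfolding Y_def by (intro nn_integral_mono mult_right_mono A_le) simp
  also have "\<dots> = emeasure lborel B' * ennreal (t1 - t0)"
    using t by (simp add: nn_integral_cmult_indicator)
  finally show ?thesis .
qed

text \<open>The trapezoid starts at \<open>t0\<close> and its rise time e tends to zero. The
  interval [c1, d - \<epsilon>] lies in [t0 + e, d - \<epsilon>] once e < c1 - t0, and by
  \<open>init\<close> the initial average disappears in the limit. Only the measure of the sublevel
  set remains on the right.\<close>

lemma energy_from_initial_time: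
  assumes t0: "0 < t0" "t0 < c1" "c1 \<le> d - \<epsilon>" "0 < \<epsilon>" "d < t1" "t1 \<le> T"
    and init: "((\<lambda>e. (LINT t|lborel. indicator {t0..t0 + e} t * g t) / e) \<longlongrightarrow> 0) (at_right 0)"
  shows "ennreal (2 powr (1 - p) / \<Lambda>) * (\<integral>\<^sup>+t. J t * indicator {c1..d - \<epsilon>} t \<partial>lborel)
      + ennreal ((LINT t|lborel. indicator {d - \<epsilon>..d} t * g t) / \<epsilon>)
    \<le> ennreal (8 * \<Lambda> * Ck) * Y t0 t1" (is "?lhs \<le> ?rhs")
proof -
  have "Y t0 t1 < \<infinity>"
    using Y_le[of t0 t1] t0 emeasure_B' by (auto simp: ennreal_mult_less_top elim!: order.strict_trans1)
  then have "?rhs < \<infinity>" by (simp add: ennreal_mult_less_top)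
  then obtain R where R: "0 \<le> R" "?rhs = ennreal R" by (cases ?rhs) auto
  have A0: "(\<integral>\<^sup>+t. A t * indicator {t0..d} t \<partial>lborel) \<le> Y t0 t1"
    unfolding Y_def
  proof (rule nn_integral_mono_AE)
    show "AE t in lborel. A t * indicator {t0..d} t \<le> A t * indicator {t0<..<t1} t"
      using AE_lborel_singleton[of t0]
    proof eventually_elim
      case (elim t)
      then show ?case using t0 by (auto simp: indicator_def)
    qed
  qed
  have "\<forall>\<^sub>F e in at_right 0. ?lhs \<le> ennreal (R + (LINT t|lborel. indicator {t0..t0 + e} t * g t) / e)"
  proof -
    have "\<forall>\<^sub>F e in at_right (0::real). e \<in> {0<..<c1 - t0}"
      using t0 by (intro eventually_at_right_real) auto
    then show ?thesis
    proof eventually_elim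
      case (elim e)
      have "?lhs \<le> ennreal (2 powr (1 - p) / \<Lambda>) * (\<integral>\<^sup>+t. J t * indicator {t0 + e..d - \<epsilon>} t \<partial>lborel)
          + ennreal ((LINT t|lborel. indicator {d - \<epsilon>..d} t * g t) / \<epsilon>)"
        using elim by (intro add_right_mono mult_left_mono nn_integral_mono) (auto simp: indicator_def)
      also have "\<dots> \<le> ennreal (8 * \<Lambda> * Ck) * (\<integral>\<^sup>+t. A t * indicator {t0..d} t \<partial>lborel)
          + ennreal ((LINT t|lborel. indicator {t0..t0 + e} t * g t) / e)"
        unfolding J_def by (rule energy_inequality) (use elim t0 in auto)
      also have "\<dots> \<le> ?rhs + ennreal ((LINT t|lborel. indicator {t0..t0 + e} t * g t) / e)"
        by (intro add_right_mono mult_left_mono A0) simp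
      also have "\<dots> = ennreal (R + (LINT t|lborel. indicator {t0..t0 + e} t * g t) / e)"
        unfolding R(2) using R(1) elim
        by (intro ennreal_plus[symmetric] divide_nonneg_pos Bochner_Integration.integral_nonneg) auto
      finally show ?case .
    qed
  qed
  moreover have "((\<lambda>e. ennreal (R + (LINT t|lborel. indicator {t0..t0 + e} t * g t) / e)) \<longlongrightarrow> ennreal (R + 0)) (at_right 0)"
    by (intro tendsto_ennrealI tendsto_add tendsto_const init)
  ultimately have "?lhs \<le> ennreal (R + 0)"
    by (intro tendsto_lowerbound) (auto simp: trivial_limit_at_right_real)
  then show ?thesis using R(2) by simp
qed

text \<open>Putting the falling ramp on [\<tau>, \<tau> + h] and dropping the energy bounds the
  average of \<open>g\<close> over every short interval by the same \<open>R\<close>;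
  differentiation of the integral then reaches almost every time.\<close>

lemma g_AE_le:
  assumes t0: "0 < t0" "t0 < t1" "t1 \<le> T"
    and init: "((\<lambda>e. (LINT t|lborel. indicator {t0..t0 + e} t * g t) / e) \<longlongrightarrow> 0) (at_right 0)"
  shows "AE t in lborel. t0 < t \<and> t < t1 \<longrightarrow> ennreal (g t) \<le> ennreal (8 * \<Lambda> * Ck) * Y t0 t1"
proof -
  have "Y t0 t1 < \<infinity>"
    using Y_le[of t0 t1] t0 emeasure_B' by (auto simp: ennreal_mult_less_top elim!: order.strict_trans1)
  then have "ennreal (8 * \<Lambda> * Ck) * Y t0 t1 < \<infinity>" by (simp add: ennreal_mult_less_top)
  then obtain R where R: "0 \<le> R" "ennreal (8 * \<Lambda> * Ck) * Y t0 t1 = ennreal R"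
    by (cases "ennreal (8 * \<Lambda> * Ck) * Y t0 t1") auto
  have "AE t in lborel. t0 < t \<and> t < t1 \<longrightarrow> indicator {t0..t1} t * g t \<le> R"
  proof (rule AE_le_of_interval_integrals[OF g_integrable])
    fix \<tau> h :: real assume \<tau>: "t0 < \<tau>" "0 < h" "\<tau> + h < t1"
    have "(LINT t|lborel. indicator {\<tau>..\<tau> + h} t * (indicator {t0..t1} t * g t)) = (LINT t|lborel. indicator {\<tau>..\<tau> + h} t * g t)"
      using \<tau> by (intro Bochner_Integration.integral_cong) (auto simp: indicator_def)
    moreover have "ennreal ((LINT t|lborel. indicator {\<tau>..\<tau> + h} t * g t) / h) \<le> ennreal R"
    proof -
      have "ennreal ((LINT t|lborel. indicator {(\<tau> + h) - h..\<tau> + h} t * g t) / h) \<le>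
        ennreal (2 powr (1 - p) / \<Lambda>) * (\<integral>\<^sup>+t. J t * indicator {\<tau>..(\<tau> + h) - h} t \<partial>lborel)
      + ennreal ((LINT t|lborel. indicator {(\<tau> + h) - h..\<tau> + h} t * g t) / h)"
        by simp
      also have "\<dots> \<le> ennreal (8 * \<Lambda> * Ck) * Y t0 t1"
        by (rule energy_from_initial_time[OF _ _ _ _ _ _ init]) (use \<tau> t0 in auto)
      finally show ?thesis unfolding R(2) by simp
    qed
    ultimately show "(LINT t|lborel. indicator {\<tau>..\<tau> + h} t * (indicator {t0..t1} t * g t)) \<le> h * R"
      using R(1) \<tau> by (simp add: ennreal_le_iff pos_divide_le_eq mult.commute)
  qed
  then show ?thesis
  proof eventually_elim
    case (elim t)
    then show ?case unfolding R(2) by (auto intro!: ennreal_leI)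
  qed
qed

text \<open>Here the excess is dropped, and (t0, t1) is exhausted by the intervals
  [t0 + e n, t1 - 2 e n]. Two steps are spent at the right end, one to stay strictly below
  \<open>t1\<close> and one for the falling ramp; the factor 1/4 in \<open>e\<close> keeps the
  intervals nonempty.\<close>

lemma dirichlet_le:
  assumes t0: "0 < t0" "t0 < t1" "t1 \<le> T"
    and init: "((\<lambda>e. (LINT t|lborel. indicator {t0..t0 + e} t * g t) / e) \<longlongrightarrow> 0) (at_right 0)"
  shows "ennreal (2 powr (1 - p) / \<Lambda>) * (\<integral>\<^sup>+t. J t * indicator {t0<..<t1} t \<partial>lborel) \<le> ennreal (8 * \<Lambda> * Ck) * Y t0 t1"
proof -
  define e where "e n = (t1 - t0) / 4 * inverse (real (Suc n))" for n
  have e: "0 < e n" "e n \<le> (t1 - t0) / 4" for n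
  proof -
    show "0 < e n" using t0 by (simp add: e_def)
    have "(t1 - t0) / 4 * inverse (real (Suc n)) \<le> (t1 - t0) / 4 * 1"
      using t0 by (intro mult_left_mono) (auto simp: inverse_le_1_iff)
    then show "e n \<le> (t1 - t0) / 4" by (simp only: e_def mult_1_right)
  qed
  have e0: "e \<longlonglongrightarrow> 0"
    unfolding e_def by (rule tendsto_mult_right_zero[OF LIMSEQ_inverse_real_of_nat])
  have mono_e: "e n \<le> e m" if "m \<le> n" for m n
    unfolding e_def using that t0 by (intro mult_left_mono le_imp_inverse_le) auto
  define I where "I n t = J t * indicator {t0 + e n..(t1 - e n) - e n} t" for n t
  have Im: "I n \<in> borel_measurable lborel" for n unfolding I_def by measurable
  have bound: "ennreal (2 powr (1 - p) / \<Lambda>) * (\<integral>\<^sup>+t. I n t \<partial>lborel) \<le> ennreal (8 * \<Lambda> * Ck) * Y t0 t1" for n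
  proof -
    have "ennreal (2 powr (1 - p) / \<Lambda>) * (\<integral>\<^sup>+t. I n t \<partial>lborel) \<le> ennreal (2 powr (1 - p) / \<Lambda>) * (\<integral>\<^sup>+t. I n t \<partial>lborel)
      + ennreal ((LINT t|lborel. indicator {(t1 - e n) - e n..t1 - e n} t * g t) / e n)" by simp
    also have "\<dots> \<le> ennreal (8 * \<Lambda> * Ck) * Y t0 t1"
      unfolding I_def by (rule energy_from_initial_time[OF _ _ _ _ _ _ init]) (use e[of n] t0 in auto)
    finally show ?thesis .
  qed
  have inc: "incseq I"
  proof (intro incseq_SucI le_funI)
    fix n t
    show "I n t \<le> I (Suc n) t" unfolding I_def using mono_e[of n "Suc n"] by (intro mult_left_mono) (auto simp: indicator_def)
  qed
  have sup: "(SUP n. I n t) = J t * indicator {t0<..<t1} t" for t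
  proof (cases "t \<in> {t0<..<t1}")
    case True
    then have "0 < min (t - t0) ((t1 - t) / 2)" by simp
    then have "\<forall>\<^sub>F n in sequentially. e n < min (t - t0) ((t1 - t) / 2)" using order_tendstoD(2)[OF e0] by blast
    then obtain n where "e n < min (t - t0) ((t1 - t) / 2)" using eventually_happens by fastforce
    then have n: "I n t = J t" unfolding I_def by (simp add: indicator_def)
    have "I m t \<le> J t" for m unfolding I_def by (simp add: indicator_def)
    then have "(SUP n. I n t) = J t" using SUP_upper[of n UNIV "\<lambda>n. I n t"] n by (intro antisym SUP_least) simp_all
    then show ?thesis using True by simp
  next
    case False
    then have "I n t = 0" for n using e[of n] unfolding I_def by (auto simp: indicator_def)
    then show ?thesis using False by simp
  qed
  have "(\<integral>\<^sup>+t. J t * indicator {t0<..<t1} t \<partial>lborel) = (\<integral>\<^sup>+t. (SUP n. I n t) \<partial>lborel)"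
    by (simp only: sup)
  also have "\<dots> = (SUP n. \<integral>\<^sup>+t. I n t \<partial>lborel)"
    by (rule nn_integral_monotone_convergence_SUP[OF inc Im])
  finally have "ennreal (2 powr (1 - p) / \<Lambda>) * (\<integral>\<^sup>+t. J t * indicator {t0<..<t1} t \<partial>lborel) =
      (SUP n. ennreal (2 powr (1 - p) / \<Lambda>) * (\<integral>\<^sup>+t. I n t \<partial>lborel))"
    by (simp add: SUP_mult_left_ennreal)
  then show ?thesis using bound by (simp add: SUP_least)
qed

lemma g_ge_superlevel:
  assumes S: "S \<in> sets borel" and c: "0 \<le> c" "\<And>x. x \<in> S \<Longrightarrow> c \<le> G x t"
  shows "ennreal c * emeasure lborel S \<le> ennreal (g t)"
proof -
  have "ennreal c * emeasure lborel S = (\<integral>\<^sup>+x. ennreal c * indicator S x \<partial>lborel)"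
    using S by (simp add: nn_integral_cmult_indicator)
  also have "\<dots> \<le> (\<integral>\<^sup>+x. ennreal (G x t) \<partial>lborel)"
    using c by (intro nn_integral_mono) (auto simp: indicator_def intro!: ennreal_leI)
  also have "\<dots> = ennreal (g t)" unfolding g_def by (rule nn_integral_eq_integral[OF G_integrable]) simp
  finally show ?thesis .
qed

lemma Z_positive_iff: "0 < Z x t \<longleftrightarrow> U x t < k x"
  by (simp add: Z_def less_max_iff_disj)

text \<open>Since k \<le> L0, the excess is at most a multiple of max 0 (L0 - U), so one initial
  condition at the top level serves every level of the iteration. The multiple depends on
  \<open>M\<close>, which is harmless because the limit is zero.\<close>

lemma initial_average:
  fixes L0 :: real
  assumes kL: "\<And>x. k x \<le> L0" and t0: "0 < t0"
    and init: "((\<lambda>e. (LINT t|lborel. indicator {t0..t0 + e} t * (LINT x|lborel. indicator D x * max 0 (L0 - U x t))) / e) \<longlongrightarrow> 0) (at_right 0)"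
  shows "((\<lambda>e. (LINT t|lborel. indicator {t0..t0 + e} t * g t) / e) \<longlongrightarrow> 0) (at_right 0)"
proof -
  define K where "K = 2 * (max m (\<bar>\<mu>\<bar> + \<bar>M\<bar>)) powr q"
  have K: "0 \<le> K" by (simp add: K_def)
  define w where "w t = (LINT x|lborel. indicator D x * max 0 (L0 - U x t))" for t
  have int: "integrable lborel (\<lambda>x. indicator D x * max 0 (L0 - U x t))" for t
  proof (rule integrable_bounded_finite_support[where B = "\<bar>L0\<bar> + (\<bar>\<mu>\<bar> + \<bar>M\<bar>)" and S = D])
    show "\<bar>indicator D x * max 0 (L0 - U x t)\<bar> \<le> \<bar>L0\<bar> + (\<bar>\<mu>\<bar> + \<bar>M\<bar>)" for x
      using abs_U[of x t] by (auto simp: indicator_def max_def)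
  qed (use emeasure_D in auto)
  have wm[measurable]: "w \<in> borel_measurable borel"
  proof -
    have "(\<lambda>(t, x). indicator D x * max 0 (L0 - U x t)) \<in> borel_measurable (borel \<Otimes>\<^sub>M lborel)"
      unfolding case_prod_beta' by measurable
    from lborel.borel_measurable_lebesgue_integral[OF this] show ?thesis unfolding w_def by simp
  qed
  have w0: "0 \<le> w t" for t unfolding w_def by (rule Bochner_Integration.integral_nonneg) simp
  have gw: "g t \<le> K * w t" for t
  proof -
    have "g t \<le> (LINT x|lborel. K * (indicator D x * max 0 (L0 - U x t)))"
      unfolding g_def
    proof (rule integral_mono[OF G_integrable integrable_mult_right[OF int]])
      fix x
      show "G x t \<le> K * (indicator D x * max 0 (L0 - U x t))"
      proof (cases "x \<in> D")
        case True
        have "G x t \<le> K * Z x t" unfolding K_def by (rule G_le_Z)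
        also have "\<dots> \<le> K * max 0 (L0 - U x t)"
          using K kL[of x] by (intro mult_left_mono) (auto simp: Z_def)
        finally show ?thesis using True by simp
      next
        case False
        then have "x \<notin> B'" using B'_sub by blast
        then show ?thesis using False by (simp add: G_outside)
      qed
    qed
    also have "\<dots> = K * w t" unfolding w_def by (rule integral_mult_right_zero)
    finally show ?thesis .
  qed
  have wb: "w t \<le> (\<bar>L0\<bar> + (\<bar>\<mu>\<bar> + \<bar>M\<bar>)) * measure lborel D" for t
  proof -
    have "w t \<le> (LINT x|lborel. (\<bar>L0\<bar> + (\<bar>\<mu>\<bar> + \<bar>M\<bar>)) * indicator D x)"
      unfolding w_def
    proof (rule integral_mono[OF int])
      show "integrable lborel (\<lambda>x. (\<bar>L0\<bar> + (\<bar>\<mu>\<bar> + \<bar>M\<bar>)) * indicator D x)"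
        by (intro integrable_mult_right integrable_real_indicator) (use emeasure_D in simp_all)
      show "indicator D x * max 0 (L0 - U x t) \<le> (\<bar>L0\<bar> + (\<bar>\<mu>\<bar> + \<bar>M\<bar>)) * indicator D x" for x
        using abs_U[of x t] by (auto simp: indicator_def max_def)
    qed
    then show ?thesis by simp
  qed
  have wi: "integrable lborel (\<lambda>t. indicator {a..b} t * w t)" for a b
  proof (rule integrable_bounded_support[where B = "(\<bar>L0\<bar> + (\<bar>\<mu>\<bar> + \<bar>M\<bar>)) * measure lborel D" and c = a and d = b])
    show "\<bar>indicator {a..b} t * w t\<bar> \<le> (\<bar>L0\<bar> + (\<bar>\<mu>\<bar> + \<bar>M\<bar>)) * measure lborel D" for t
      using w0[of t] wb[of t] by (simp add: indicator_def)
  qed auto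
  have "((\<lambda>e. K * ((LINT t|lborel. indicator {t0..t0 + e} t * w t) / e)) \<longlongrightarrow> 0) (at_right 0)"
    using tendsto_mult_right_zero[OF init[folded w_def]] .
  moreover have "\<forall>\<^sub>F e in at_right 0. norm ((LINT t|lborel. indicator {t0..t0 + e} t * g t) / e) \<le> K * ((LINT t|lborel. indicator {t0..t0 + e} t * w t) / e)"
    using eventually_at_right_less[of "0::real"]
  proof eventually_elim
    case (elim e)
    have 0: "0 \<le> (LINT t|lborel. indicator {t0..t0 + e} t * g t)"
      by (rule Bochner_Integration.integral_nonneg) simp
    have "(LINT t|lborel. indicator {t0..t0 + e} t * g t) \<le> (LINT t|lborel. K * (indicator {t0..t0 + e} t * w t))"
    proof (rule integral_mono[OF g_integrable integrable_mult_right[OF wi]])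
      show "indicator {t0..t0 + e} t * g t \<le> K * (indicator {t0..t0 + e} t * w t)" for t
        using gw[of t] by (simp add: indicator_def)
    qed
    also have "\<dots> = K * (LINT t|lborel. indicator {t0..t0 + e} t * w t)" by (rule integral_mult_right_zero)
    finally have "(LINT t|lborel. indicator {t0..t0 + e} t * g t) / e \<le> K * (LINT t|lborel. indicator {t0..t0 + e} t * w t) / e"
      using elim by (intro divide_right_mono) auto
    then show ?case using 0 elim by simp
  qed
  ultimately show ?thesis by (rule Lim_null_comparison[rotated])
qed

lemma Y_finite: "t0 \<le> t1 \<Longrightarrow> Y t0 t1 < \<infinity>"
  using Y_le[of t0 t1] emeasure_B' by (auto simp: ennreal_mult_less_top elim!: order.strict_trans1)

text \<open>Chebyshev for the excess: wherever U < k' the excess below \<open>k\<close> is at least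
  \<gamma>, so the space-time measure at level \<open>k\<close> bounds the spatial measure at level
  k' for almost every time. This first drop of the level trades an integral over time for a bound at
  almost every time.\<close>

lemma superlevel_AE_le:
  assumes t0: "0 < t0" "t0 < t1" "t1 \<le> T"
    and init: "((\<lambda>e. (LINT t|lborel. indicator {t0..t0 + e} t * g t) / e) \<longlongrightarrow> 0) (at_right 0)"
    and k' [measurable]: "k' \<in> borel_measurable borel" and \<gamma>: "0 < \<gamma>" "\<And>x t. U x t < k' x \<Longrightarrow> \<gamma> \<le> G x t"
  shows "AE t in lborel. t0 < t \<and> t < t1 \<longrightarrow>
    emeasure lborel {x. U x t < k' x} \<le> ennreal (8 * \<Lambda> * Ck * enn2real (Y t0 t1) / \<gamma>)"
  using g_AE_le[OF t0 init]
proof eventually_elim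
  case (elim t)
  show ?case
  proof
    assume "t0 < t \<and> t < t1"
    have "ennreal \<gamma> * emeasure lborel {x. U x t < k' x} \<le> ennreal (g t)"
      by (rule g_ge_superlevel) (use \<gamma> in \<open>auto intro: less_imp_le\<close>)
    also have "\<dots> \<le> ennreal (8 * \<Lambda> * Ck) * Y t0 t1" using elim \<open>t0 < t \<and> t < t1\<close> by blast
    also have "\<dots> = ennreal (8 * \<Lambda> * Ck * enn2real (Y t0 t1))"
      using Y_finite[of t0 t1] t0 \<Lambda> Ck(1) by (simp add: ennreal_mult less_top)
    finally have le: "ennreal \<gamma> * emeasure lborel {x. U x t < k' x} \<le> ennreal (8 * \<Lambda> * Ck * enn2real (Y t0 t1))" .
    show "emeasure lborel {x. U x t < k' x} \<le> ennreal (8 * \<Lambda> * Ck * enn2real (Y t0 t1) / \<gamma>)"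
    proof (cases "emeasure lborel {x. U x t < k' x}")
      case (real b)
      have "\<gamma> * b \<le> 8 * \<Lambda> * Ck * enn2real (Y t0 t1)"
        using le \<gamma>(1) real \<Lambda> Ck(1) by (simp add: ennreal_mult[symmetric] ennreal_le_iff)
      then show ?thesis using real \<gamma>(1) by (simp add: ennreal_leI pos_le_divide_eq mult.commute)
    next
      case top
      then show ?thesis using le \<gamma>(1) by (simp add: ennreal_mult_top top_unique)
    qed
  qed
qed

text \<open>Chebyshev for \<open>Z\<close> on {U < k'}, then Faber-Krahn on {Z > 0}, whose measure
  is at most \<open>b\<close> at almost every time, and integration in time against the bound for
  the energy. The power of \<open>b\<close> is hidden in \<open>F\<close>, so the estimate is linear
  in \<open>Y\<close> at this point; superlinearity appears when \<open>b\<close> is supplied from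
  the previous level.\<close>

lemma level_iteration:
  assumes t0: "0 < t0" "t0 < t1" "t1 \<le> T"
    and init: "((\<lambda>e. (LINT t|lborel. indicator {t0..t0 + e} t * g t) / e) \<longlongrightarrow> 0) (at_right 0)"
    and FK: "\<And>Z :: real^'n \<Rightarrow> real. Z \<in> borel_measurable borel \<Longrightarrow> (\<And>x. 0 \<le> Z x) \<Longrightarrow> emeasure lborel {x. 0 < Z x} \<le> ennreal b \<Longrightarrow>
      (\<integral>\<^sup>+x. ennreal (Z x powr p) \<partial>lborel) \<le> ennreal F *
        (\<integral>\<^sup>+x. \<integral>\<^sup>+y. ennreal (\<bar>Z x - Z y\<bar> powr p * gkernel p s x y) \<partial>lborel \<partial>lborel)"
    and F: "0 \<le> F"
    and bound: "AE t in lborel. t0 < t \<and> t < t1 \<longrightarrow> A t \<le> ennreal b"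
    and k' [measurable]: "k' \<in> borel_measurable borel" and \<eta>: "0 < \<eta>" "\<And>x t. U x t < k' x \<Longrightarrow> \<eta> \<le> Z x t"
  shows "\<eta> powr p * enn2real (\<integral>\<^sup>+t. emeasure lborel {x. U x t < k' x} * indicator {t0<..<t1} t \<partial>lborel) \<le>
    F * (\<Lambda> * 2 powr (p - 1)) * (8 * \<Lambda> * Ck) * enn2real (Y t0 t1)"
proof -
  define X where "X = (\<integral>\<^sup>+t. emeasure lborel {x. U x t < k' x} * indicator {t0<..<t1} t \<partial>lborel)"
  define E where "E = (\<integral>\<^sup>+t. J t * indicator {t0<..<t1} t \<partial>lborel)"
  have Em: "(\<lambda>t. emeasure lborel {x. U x t < k' x}) \<in> borel_measurable borel"
  proof -
    have "{w \<in> space (borel \<Otimes>\<^sub>M borel). U (snd w) (fst w) < k' (snd w)} \<in> sets (borel \<Otimes>\<^sub>M borel)"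
      by measurable
    then have "{w. U (snd w) (fst w) < k' (snd w)} \<in> sets (borel \<Otimes>\<^sub>M lborel)"
      by (simp add: space_pair_measure)
    from lborel.measurable_emeasure_Pair[OF this] show ?thesis by (simp add: vimage_def)
  qed
  have "ennreal (\<eta> powr p) * X = (\<integral>\<^sup>+t. ennreal (\<eta> powr p) * (emeasure lborel {x. U x t < k' x} * indicator {t0<..<t1} t) \<partial>lborel)"
    unfolding X_def by (rule nn_integral_cmult[symmetric])
      (intro borel_measurable_times_ennreal borel_measurable_indicator, use Em in simp_all)
  also have "\<dots> \<le> (\<integral>\<^sup>+t. ennreal F * (J t * indicator {t0<..<t1} t) \<partial>lborel)"
  proof (rule nn_integral_mono_AE)
    show "AE t in lborel. ennreal (\<eta> powr p) * (emeasure lborel {x. U x t < k' x} * indicator {t0<..<t1} t) \<le> ennreal F * (J t * indicator {t0<..<t1} t)"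
      using bound
    proof eventually_elim
      case (elim t)
      show ?case
      proof (cases "t \<in> {t0<..<t1}")
        case True
        have "{x. U x t < k' x} \<in> sets lborel" by measurable
        then have "ennreal (\<eta> powr p) * emeasure lborel {x. U x t < k' x} = (\<integral>\<^sup>+x. ennreal (\<eta> powr p) * indicator {x. U x t < k' x} x \<partial>lborel)"
          by (rule nn_integral_cmult_indicator[symmetric])
        also have "\<dots> \<le> (\<integral>\<^sup>+x. ennreal (Z x t powr p) \<partial>lborel)"
        proof (rule nn_integral_mono)
          show "ennreal (\<eta> powr p) * indicator {x. U x t < k' x} x \<le> ennreal (Z x t powr p)" for x
            using \<eta> p by (cases "U x t < k' x") (auto intro!: ennreal_leI powr_mono2)
        qed
        also have "\<dots> \<le> ennreal F * J t"
          unfolding J_double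
        proof (rule FK)
          show "emeasure lborel {x. 0 < Z x t} \<le> ennreal b"
            using elim True unfolding Z_positive_iff A_def by simp
        qed simp_all
        finally show ?thesis using True by simp
      qed simp
    qed
  qed
  also have "\<dots> = ennreal F * E" unfolding E_def by (rule nn_integral_cmult) measurable
  finally have 1: "ennreal (\<eta> powr p) * X \<le> ennreal F * E" .
  have "E = ennreal (\<Lambda> * 2 powr (p - 1)) * (ennreal (2 powr (1 - p) / \<Lambda>) * E)"
  proof -
    have "2 powr (p - 1) * 2 powr (1 - p) = (1 :: real)" by (simp add: powr_add[symmetric])
    then have "\<Lambda> * 2 powr (p - 1) * (2 powr (1 - p) / \<Lambda>) = 1" using \<Lambda> by (simp add: field_simps)
    then have "ennreal (\<Lambda> * 2 powr (p - 1)) * ennreal (2 powr (1 - p) / \<Lambda>) = 1"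
      using \<Lambda> by (subst ennreal_mult[symmetric]) simp_all
    then show ?thesis by (simp add: mult.assoc[symmetric])
  qed
  also have "\<dots> \<le> ennreal (\<Lambda> * 2 powr (p - 1)) * (ennreal (8 * \<Lambda> * Ck) * Y t0 t1)"
    unfolding E_def by (intro mult_left_mono dirichlet_le[OF t0 init]) simp
  finally have 2: "ennreal F * E \<le> ennreal F * (ennreal (\<Lambda> * 2 powr (p - 1)) * (ennreal (8 * \<Lambda> * Ck) * Y t0 t1))"
    by (rule mult_left_mono) simp
  have "enn2real (ennreal (\<eta> powr p) * X) \<le> enn2real (ennreal F * (ennreal (\<Lambda> * 2 powr (p - 1)) * (ennreal (8 * \<Lambda> * Ck) * Y t0 t1)))"
    using order_trans[OF 1 2] Y_finite[of t0 t1] t0 by (intro enn2real_mono) (auto simp: ennreal_mult_less_top)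
  then show ?thesis
    using F \<Lambda> Ck(1) unfolding X_def[symmetric] by (simp add: enn2real_mult mult.assoc)
qed

end

section \<open>Expansion of positivity for Borel supersolutions\<close>

text \<open>Equal to 1 up to distance 12r/16 = 3r/4 and to 0 from 13r/16 on, with slope 16/r. The
  equation is used in the ball of radius 14r/16 = 7r/8, which leaves the margin r/16 between the
  support and the complement of that ball.\<close>

definition cutoff :: "'a::metric_space \<Rightarrow> real \<Rightarrow> 'a \<Rightarrow> real" where
  "cutoff x0 r x = max 0 (min 1 (13 - 16 * dist x x0 / r))"

lemma cutoff_bounds: "0 \<le> cutoff x0 r x" "cutoff x0 r x \<le> 1"
  by (simp_all add: cutoff_def)

lemma cutoff_eq_1: "0 < r \<Longrightarrow> x \<in> ball x0 (3 * r / 4) \<Longrightarrow> cutoff x0 r x = 1"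
  by (simp add: cutoff_def dist_commute field_simps)

lemma cutoff_eq_0: "0 < r \<Longrightarrow> x \<notin> ball x0 (13 * r / 16) \<Longrightarrow> cutoff x0 r x = 0"
  by (simp add: cutoff_def dist_commute field_simps)

lemma cutoff_Lipschitz:
  assumes "0 < r" shows "\<bar>cutoff x0 r x - cutoff x0 r y\<bar> \<le> dist x y / (r / 16)"
proof -
  have "\<bar>cutoff x0 r x - cutoff x0 r y\<bar> \<le> \<bar>16 * dist x x0 / r - 16 * dist y x0 / r\<bar>"
    unfolding cutoff_def by linarith
  also have "16 * dist x x0 / r - 16 * dist y x0 / r = (dist x x0 - dist y x0) / (r / 16)"
    using assms by (simp add: field_simps)
  also have "\<bar>(dist x x0 - dist y x0) / (r / 16)\<bar> = \<bar>dist x x0 - dist y x0\<bar> / (r / 16)"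
  proof -
    have "\<bar>r / 16\<bar> = r / 16" using assms by simp
    then show ?thesis by (simp only: abs_divide)
  qed
  also have "\<dots> \<le> dist x y / (r / 16)"
    using assms dist_triangle[of x x0 y] dist_triangle[of y x0 x]
    by (intro divide_right_mono) (auto simp: dist_commute abs_le_iff)
  finally show ?thesis .
qed

lemma borel_measurable_cutoff [measurable]:
  "cutoff (x0 :: 'a::euclidean_space) r \<in> borel_measurable borel"
  unfolding cutoff_def by measurable

text \<open>The factor \<open>r powr (n + p * s)\<close> makes the iterated quantity \<open>y\<close> scale invariant.\<close>

lemma iteration_rescaled:
  fixes r n ps \<beta> E :: real
  assumes r: "0 < r" and n: "0 < n" and \<beta>: "\<beta> = ps / n" and E: "0 < E" and c0: "0 < c0" and K0: "0 < K0" and \<Lambda>: "0 < \<Lambda>" and F: "0 < F"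
    and y: "0 \<le> y0" "0 \<le> y1" "0 \<le> y2"
    and N: "N = 8 * \<Lambda> * (K0 * r powr (- ps)) * (y0 * r powr (n + ps)) / (c0 * (E * (1/2) ^ j) powr e)"
    and step: "(E / 2 * (1/2) ^ j) powr p * (y2 * r powr (n + ps)) \<le>
      F * N powr \<beta> * P * (8 * \<Lambda> * (K0 * r powr (- ps))) * (y1 * r powr (n + ps))"
  shows "y2 \<le> F * (8 * \<Lambda> * K0 / c0) powr \<beta> * P * (8 * \<Lambda> * K0) / ((E / 2) powr p * E powr (e * \<beta>)) *
    (2 powr p * 2 powr (e * \<beta>)) ^ j * y1 * y0 powr \<beta>"
proof -
  define R where "R = r powr (n + ps)"
  have R: "0 < R" using r by (simp add: R_def)
  have rr: "r powr (- ps) * R = r powr n" "r powr (- ps) * r powr ps = 1"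
    using r unfolding R_def by (simp_all add: powr_add[symmetric])
  have half: "((1/2 :: real) ^ j) powr a = 1 / (2 powr a) ^ j" for a
    by (simp add: powr_realpow[symmetric] powr_powr powr_divide mult.commute power_one_over[symmetric] powr_minus_divide)
  define H where "H = (8 * \<Lambda> * K0 / c0)"
  have H: "0 < H" using \<Lambda> K0 c0 by (simp add: H_def)
  have "N = H * y0 * (r powr (- ps) * R) / (E * (1/2) ^ j) powr e"
    unfolding N H_def R_def using c0 by (simp add: field_simps)
  then have N': "N = H * y0 * r powr n / (E * (1/2) ^ j) powr e" unfolding rr(1) .
  have "N powr \<beta> = H powr \<beta> * y0 powr \<beta> * r powr (n * \<beta>) / (E * (1/2) ^ j) powr (e * \<beta>)"
    unfolding N' using H y E r by (simp add: powr_mult powr_divide powr_powr)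
  \<comment> \<open>This cancellation dictates \<beta>: the measure bound contributes r^(n \<beta>),
    which must offset the r^(-p s) in the energy constant of the level.\<close>
  also have "n * \<beta> = ps" using n by (simp add: \<beta>)
  also have "(E * (1/2) ^ j) powr (e * \<beta>) = E powr (e * \<beta>) / (2 powr (e * \<beta>)) ^ j"
    using E by (simp add: powr_mult half)
  finally have Nb: "N powr \<beta> = H powr \<beta> * y0 powr \<beta> * r powr ps * (2 powr (e * \<beta>)) ^ j / E powr (e * \<beta>)"
    by simp
  have Ep: "(E / 2 * (1/2) ^ j) powr p = (E / 2) powr p / (2 powr p) ^ j"
    using E by (subst powr_mult) (simp_all add: half)
  have "F * N powr \<beta> * P * (8 * \<Lambda> * (K0 * r powr (- ps))) * (y1 * R) =
    F * (H powr \<beta> * y0 powr \<beta> * (2 powr (e * \<beta>)) ^ j / E powr (e * \<beta>)) * P * (8 * \<Lambda> * K0) * y1 * R * (r powr (- ps) * r powr ps)"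
    unfolding Nb by (simp add: field_simps)
  then have rhs: "F * N powr \<beta> * P * (8 * \<Lambda> * (K0 * r powr (- ps))) * (y1 * R) =
    F * (H powr \<beta> * y0 powr \<beta> * (2 powr (e * \<beta>)) ^ j / E powr (e * \<beta>)) * P * (8 * \<Lambda> * K0) * y1 * R"
    unfolding rr(2) by simp
  have "((E / 2) powr p / (2 powr p) ^ j * y2) * R \<le> (F * (H powr \<beta> * y0 powr \<beta> * (2 powr (e * \<beta>)) ^ j / E powr (e * \<beta>)) * P * (8 * \<Lambda> * K0) * y1) * R"
    using step unfolding R_def[symmetric] rhs Ep by (simp only: mult.assoc)
  then have le: "(E / 2) powr p / (2 powr p) ^ j * y2 \<le> F * (H powr \<beta> * y0 powr \<beta> * (2 powr (e * \<beta>)) ^ j / E powr (e * \<beta>)) * P * (8 * \<Lambda> * K0) * y1"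
    using R by (rule mult_right_le_imp_le)
  have pos: "0 < (2 powr p) ^ j / (E / 2) powr p" using E by simp
  have "y2 = ((2 powr p) ^ j / (E / 2) powr p) * ((E / 2) powr p / (2 powr p) ^ j * y2)"
    using E by simp
  also have "\<dots> \<le> ((2 powr p) ^ j / (E / 2) powr p) * (F * (H powr \<beta> * y0 powr \<beta> * (2 powr (e * \<beta>)) ^ j / E powr (e * \<beta>)) * P * (8 * \<Lambda> * K0) * y1)"
    by (rule mult_left_mono[OF le less_imp_le[OF pos]])
  also have "\<dots> = F * H powr \<beta> * P * (8 * \<Lambda> * K0) / ((E / 2) powr p * E powr (e * \<beta>)) *
    (2 powr p * 2 powr (e * \<beta>)) ^ j * y1 * y0 powr \<beta>"
    by (simp add: power_mult_distrib)
  finally show ?thesis unfolding H_def .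
qed

text \<open>All constants, including \<theta>, are fixed before \<open>T\<close>, \<open>M\<close>,
  the cylinder, \<open>U\<close> and the kernel appear. The part of the smaller cylinder where U <
  \<mu> + a L is contained in every set {U < k_j}, and fast geometric convergence sends the
  space-time measure of these sets to zero.\<close>

theorem expansion_of_positivity_borel:
  fixes p q s \<Lambda> L a \<mu> :: real
  assumes p: "1 < p" and q: "0 < q" and s: "0 < s" "s < 1" and \<Lambda>: "1 \<le> \<Lambda>" and L: "0 < L" and a: "0 < a" "a < 1"
  shows "\<exists>\<theta>>0. \<forall>T M (x0 :: real^'n) r t0 U \<kappa>. 0 < r \<longrightarrow> 0 < t0 \<longrightarrow> t0 < T \<longrightarrow>
    borel_supersolution p q s \<Lambda> T \<mu> M (ball x0 (7 * r / 8)) U \<kappa> \<longrightarrow>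
    ((\<lambda>e. (LINT t|lborel. indicator {t0..t0 + e} t *
        (LINT x|lborel. indicator (ball x0 (7 * r / 8)) x * max 0 (\<mu> + L - U x t))) / e) \<longlongrightarrow> 0) (at_right 0) \<longrightarrow>
    (AE w in lborel. fst w \<in> ball x0 (3 * r / 4) \<and> t0 < snd w \<and> snd w < t0 + \<theta> * r powr (s * p) \<and> snd w < T \<longrightarrow>
      \<mu> + a * L \<le> U (fst w) (snd w))"
proof -
  define n where "n = real DIM(real^'n)"
  have n: "0 < n" by (simp add: n_def)
  define \<beta> where "\<beta> = p * s / n"
  have \<beta>: "0 < \<beta>" using p s n by (simp add: \<beta>_def)
  have p0: "0 < p" using p by simp
  obtain C1 where C1: "0 < C1" and Lip: "\<forall>\<rho>>0. \<forall>l\<ge>0. \<forall>k :: real^'n \<Rightarrow> real. \<forall>x. k \<in> borel_measurable borel \<longrightarrow>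
    (\<forall>y. \<bar>k x - k y\<bar> \<le> l * norm (x - y) / \<rho>) \<longrightarrow> (\<forall>y. \<bar>k x - k y\<bar> \<le> l) \<longrightarrow>
    (\<integral>\<^sup>+y. ennreal (\<bar>k x - k y\<bar> powr p * gkernel p s x y) \<partial>lborel) \<le> ennreal (C1 * l powr p * \<rho> powr (- (p * s)))"
    using gkernel_Lipschitz_energy[where 'a = "real^'n", OF p0 s] by (elim exE conjE)
  \<comment> \<open>The Lipschitz energy bound with l = L and \<rho> = r/16, with the power of
    \<open>r\<close> split off.\<close>
  define K0 where "K0 = C1 * L powr p * (1/16) powr (- (p * s))"
  have K0: "0 < K0" using C1 L by (simp add: K0_def)
  obtain F where F: "0 < F" and FK: "\<forall>b>0. \<forall>Z :: real^'n \<Rightarrow> real. Z \<in> borel_measurable borel \<longrightarrow> (\<forall>x. 0 \<le> Z x) \<longrightarrow>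
    emeasure lborel {x. 0 < Z x} \<le> ennreal b \<longrightarrow>
    (\<integral>\<^sup>+x. ennreal (Z x powr p) \<partial>lborel) \<le> ennreal (F * b powr \<beta>) *
      (\<integral>\<^sup>+x. \<integral>\<^sup>+y. ennreal (\<bar>Z x - Z y\<bar> powr p * gkernel p s x y) \<partial>lborel \<partial>lborel)"
    using gkernel_Faber_Krahn[where 'a = "real^'n", OF p0 s(1)] unfolding \<beta>_def n_def by (elim exE conjE)
  \<comment> \<open>Bounds |k| everywhere, and |U| at the points below some level, where \<mu> \<le>
    \<open>U\<close> < \<mu> + \<open>L\<close>. With this choice \<open>c0\<close> is independent
    of \<open>M\<close>.\<close>
  define m where "m = \<bar>\<mu>\<bar> + L"
  have m: "0 < m" using L by (simp add: m_def)
  obtain c0 where c0: "0 < c0" and exc: "\<forall>u k \<delta>. \<bar>u\<bar> \<le> m \<longrightarrow> \<bar>k\<bar> \<le> m \<longrightarrow> 0 < \<delta> \<longrightarrow> \<delta> \<le> k - u \<longrightarrow> c0 * \<delta> powr (q + 2) \<le> excess q k u"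
    using excess_ge[OF q m] by (elim exE conjE)
  \<comment> \<open>The first drop of the level. The drops are E / 2^j and sum to (1 - a) L.\<close>
  define E where "E = (1 - a) * L / 2"
  have E: "0 < E" using a L by (simp add: E_def)
  \<comment> \<open>The exponent of the height in \<open>excess_ge\<close>. The constant
    \<open>P\<close> in the next line undoes the factor 2^(1-p) / \<Lambda> in front of the
    energy.\<close>
  define e where "e = q + 2"
  define P where "P = \<Lambda> * 2 powr (p - 1)"
  define C where "C = F * (8 * \<Lambda> * K0 / c0) powr \<beta> * P * (8 * \<Lambda> * K0) / ((E / 2) powr p * E powr (e * \<beta>))"
  have C: "0 < C" unfolding C_def P_def using F \<Lambda> K0 c0 E by (intro divide_pos_pos mult_pos_pos) auto
  define b where "b = 2 powr p * 2 powr (e * \<beta>)"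
  have "1 < 2 powr p" "1 < 2 powr (e * \<beta>)" using p q \<beta> powr_less_mono[of 0 p 2] powr_less_mono[of 0 "e * \<beta>" 2] by (simp_all add: e_def)
  then have b: "1 < b" unfolding b_def by (rule less_1_mult)
  obtain \<delta> where \<delta>: "0 < \<delta>" and conv: "\<forall>y :: nat \<Rightarrow> real. (\<forall>j. 0 \<le> y j) \<longrightarrow> (\<forall>j. y (Suc j) \<le> y j) \<longrightarrow>
    (\<forall>j. y (Suc (Suc j)) \<le> C * b ^ j * y (Suc j) * y j powr \<beta>) \<longrightarrow> y 0 \<le> \<delta> \<longrightarrow> y \<longlonglongrightarrow> 0"
    using fast_geometric_convergence[OF C b \<beta>] by (elim exE conjE)
  define \<omega> where "\<omega> = measure lborel (ball (0 :: real^'n) 1)"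
  have \<omega>: "0 < \<omega>" unfolding \<omega>_def using content_ball_pos[of 1 "0 :: real^'n"] by simp
  \<comment> \<open>The first sublevel set lies in a cylinder of measure at most \<omega> r^n *
    \<theta> r^(s p); after division by r^(n + p s) this is \<omega> \<theta> = \<delta>, the
    smallness that the convergence lemma asks for.\<close>
  define \<theta> where "\<theta> = \<delta> / \<omega>"
  have \<theta>: "0 < \<theta>" using \<delta> \<omega> by (simp add: \<theta>_def)
  show ?thesis
  proof (intro exI[of _ \<theta>] conjI \<theta> allI impI)
    fix T M r t0 :: real and x0 :: "real^'n" and U \<kappa>
    assume r: "0 < r" and t0: "0 < t0" "t0 < T"
      and super: "borel_supersolution p q s \<Lambda> T \<mu> M (ball x0 (7 * r / 8)) U \<kappa>"
      and init: "((\<lambda>e. (LINT t|lborel. indicator {t0..t0 + e} t *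
        (LINT x|lborel. indicator (ball x0 (7 * r / 8)) x * max 0 (\<mu> + L - U x t))) / e) \<longlongrightarrow> 0) (at_right 0)"
    interpret S: borel_supersolution p q s \<Lambda> T \<mu> M "ball x0 (7 * r / 8)" U \<kappa> by (rule super)
    \<comment> \<open>The equation is available up to \<open>T\<close> only.\<close>
    define t1 where "t1 = min (t0 + \<theta> * r powr (s * p)) T"
    have t1: "t0 < t1" "t1 \<le> T" using \<theta> r t0 by (auto simp: t1_def)
    \<comment> \<open>Increases to (1 - a) L, so on the smaller ball the levels decrease towards
      \<mu> + a L and never fall below it.\<close>
    define \<delta>j where "\<delta>j j = (1 - a) * L * (1 - (1/2) ^ j)" for j :: nat
    have \<delta>j: "0 \<le> \<delta>j j" "\<delta>j j \<le> (1 - a) * L" "\<delta>j j \<le> L" for j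
    proof -
      have "(1/2 :: real) ^ j \<le> 1" by (simp add: power_le_one)
      then show "0 \<le> \<delta>j j" using a L by (simp add: \<delta>j_def)
      show 1: "\<delta>j j \<le> (1 - a) * L" using a L unfolding \<delta>j_def by (intro mult_left_le) auto
      have "(1 - a) * L \<le> L" using a L by (simp add: algebra_simps)
      with 1 show "\<delta>j j \<le> L" by linarith
    qed
    have \<delta>j_Suc: "\<delta>j (Suc j) = \<delta>j j + E * (1/2) ^ j" for j
      by (simp add: \<delta>j_def E_def field_simps)
    define k where "k j x = \<mu> + L * cutoff x0 r x - \<delta>j j" for j x
    have km[measurable]: "k j \<in> borel_measurable borel" for j unfolding k_def by measurable
    have Lc: "0 \<le> L * cutoff x0 r x" "L * cutoff x0 r x \<le> L" for x
      using L cutoff_bounds[of x0 r x] by (auto simp: mult_left_le)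
    have k_le: "k j x \<le> \<mu> + L" for j x unfolding k_def using Lc[of x] \<delta>j(1)[of j] by linarith
    have k_abs: "\<bar>k j x\<bar> \<le> m" for j x
      using k_le[of j x] Lc(1)[of x] \<delta>j(3)[of j] unfolding m_def k_def by linarith
    have k_Suc: "k (Suc j) x = k j x - E * (1/2) ^ j" for j x unfolding k_def \<delta>j_Suc by simp
    define Ck where "Ck = K0 * r powr (- (p * s))"
    have Ck: "0 < Ck" using K0 r by (simp add: Ck_def)
    \<comment> \<open>The shift \<delta>j is constant in space and drops out of the differences of
      \<open>k j\<close>, so all levels share one energy constant \<open>Ck\<close>.\<close>
    have lv: "level p q s \<Lambda> T \<mu> M (ball x0 (7 * r / 8)) U \<kappa> (k j) (ball x0 (13 * r / 16)) (r / 16) m Ck" for j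
    proof
      show "k j x \<le> \<mu>" if "x \<notin> ball x0 (13 * r / 16)" for x
        using cutoff_eq_0[OF r that] \<delta>j(1)[of j] by (simp add: k_def)
      show "ball x0 (13 * r / 16) \<subseteq> ball x0 (7 * r / 8)" using r by (intro subset_ball) simp
      show "r / 16 \<le> norm (x - y)" if "x \<in> ball x0 (13 * r / 16)" "y \<notin> ball x0 (7 * r / 8)" for x y
        using that dist_triangle[of x0 y x] by (simp add: dist_norm[symmetric])
      show "(\<integral>\<^sup>+y. ennreal (\<bar>k j x - k j y\<bar> powr p * gkernel p s x y) \<partial>lborel) \<le> ennreal Ck" for x
      proof -
        have diff: "k j x - k j y = L * (cutoff x0 r x - cutoff x0 r y)" for y
          unfolding k_def by (simp add: algebra_simps)
        have "(\<integral>\<^sup>+y. ennreal (\<bar>k j x - k j y\<bar> powr p * gkernel p s x y) \<partial>lborel) \<le> ennreal (C1 * L powr p * (r / 16) powr (- (p * s)))"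
        proof (rule Lip[rule_format])
          show "\<bar>k j x - k j y\<bar> \<le> L * norm (x - y) / (r / 16)" for y
            using mult_left_mono[OF cutoff_Lipschitz[OF r, of x0 x y], of L] L
            unfolding diff abs_mult by (simp add: dist_norm)
          show "\<bar>k j x - k j y\<bar> \<le> L" for y
            using L cutoff_bounds[of x0 r x] cutoff_bounds[of x0 r y]
            unfolding diff abs_mult by (simp add: mult_left_le abs_le_iff)
        qed (use r L in auto)
        also have "(r / 16) powr (- (p * s)) = (1/16) powr (- (p * s)) * r powr (- (p * s))"
          using r powr_mult[of "1/16" r "- (p * s)"] by simp
        finally show ?thesis unfolding Ck_def K0_def by (simp add: mult.assoc)
      qed
    qed (use r Ck k_abs in auto)
    define Y where "Y j = (\<integral>\<^sup>+t. emeasure lborel {x. U x t < k j x} * indicator {t0<..<t1} t \<partial>lborel)" for j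
    have Y_eq: "level.Y U (k j) t0 t1 = Y j" for j
      unfolding level.Y_def[OF lv] level.A_def[OF lv] Y_def ..
    have Yfin: "Y j < \<infinity>" for j
      using level.Y_finite[OF lv, of t0 t1 j] t1 unfolding Y_eq by simp
    have initj: "((\<lambda>e. (LINT t|lborel. indicator {t0..t0 + e} t * level.g q U (k j) t) / e) \<longlongrightarrow> 0) (at_right 0)" for j
      by (rule level.initial_average[OF lv k_le t0(1) init])
    define R where "R = r powr (n + p * s)"
    have R: "0 < R" using r by (simp add: R_def)
    define y where "y j = enn2real (Y j) / R" for j
    have yR: "enn2real (Y j) = y j * R" for j using R by (simp add: y_def)
    have y0: "0 \<le> y j" for j using R by (simp add: y_def)
    have Y_mono: "Y (Suc j) \<le> Y j" for j
      unfolding Y_def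
    proof (intro nn_integral_mono mult_right_mono emeasure_mono)
      show "{x. U x t < k (Suc j) x} \<subseteq> {x. U x t < k j x}" for t
        using E unfolding k_Suc by (auto intro: less_le_trans)
    qed auto
    have y_dec: "y (Suc j) \<le> y j" for j
      unfolding y_def using R Y_mono[of j] Yfin[of j] by (intro divide_right_mono enn2real_mono) auto
    \<comment> \<open>The drop from level j to j + 1 is spent on the excess and yields the measure
      bound \<open>N\<close> at almost every time; the drop from j + 1 to j + 2 is spent on the
      height of \<open>Z\<close>. The case y j = 0 is separate because Faber-Krahn is applied with a
      positive \<open>N\<close>.\<close>
    have y_step: "y (Suc (Suc j)) \<le> C * b ^ j * y (Suc j) * y j powr \<beta>" for j
    proof (cases "y j = 0")
      case True
      then have "y (Suc (Suc j)) = 0" "y (Suc j) = 0" using y_dec[of j] y_dec[of "Suc j"] y0[of "Suc j"] y0[of "Suc (Suc j)"] by simp_all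
      then show ?thesis by simp
    next
      case False
      then have yj: "0 < y j" using y0[of j] by simp
      define \<eta> where "\<eta> = E * (1/2) ^ j"
      have \<eta>: "0 < \<eta>" using E by (simp add: \<eta>_def)
      define N where "N = 8 * \<Lambda> * Ck * enn2real (Y j) / (c0 * \<eta> powr e)"
      have N: "0 < N" unfolding N_def yR using \<Lambda> Ck yj R c0 \<eta> by (intro divide_pos_pos mult_pos_pos) auto
      have A_bound: "AE t in lborel. t0 < t \<and> t < t1 \<longrightarrow> emeasure lborel {x. U x t < k (Suc j) x} \<le> ennreal N"
        unfolding N_def Y_eq[symmetric]
      proof (rule level.superlevel_AE_le[OF lv t0(1) t1 initj km])
        show "0 < c0 * \<eta> powr e" using c0 \<eta> by simp
        fix x t assume "U x t < k (Suc j) x"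
        then have gap: "\<eta> \<le> k j x - U x t" unfolding k_Suc \<eta>_def by simp
        \<comment> \<open>Here \<open>M\<close> is avoided: at a point below the level,
          \<open>U\<close> lies between \<mu> and \<mu> + \<open>L\<close>.\<close>
        have "\<bar>U x t\<bar> \<le> m"
          using S.U_bounds(1)[of x t] gap \<eta> k_le[of j x] L unfolding m_def by linarith
        then show "c0 * \<eta> powr e \<le> level.G q U (k j) x t"
          unfolding level.G_def[OF lv] e_def by (rule exc[rule_format, OF _ k_abs \<eta> gap])
      qed
      have "(E / 2 * (1/2) ^ j) powr p * enn2real (\<integral>\<^sup>+t. emeasure lborel {x. U x t < k (Suc (Suc j)) x} * indicator {t0<..<t1} t \<partial>lborel) \<le>
          (F * N powr \<beta>) * (\<Lambda> * 2 powr (p - 1)) * (8 * \<Lambda> * Ck) * enn2real (level.Y U (k (Suc j)) t0 t1)"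
      proof (rule level.level_iteration[OF lv t0(1) t1 initj FK[rule_format, OF N]])
        show "AE t in lborel. t0 < t \<and> t < t1 \<longrightarrow> level.A U (k (Suc j)) t \<le> ennreal N"
          unfolding level.A_def[OF lv] by (rule A_bound)
        show "E / 2 * (1/2) ^ j \<le> level.Z U (k (Suc j)) x t" if "U x t < k (Suc (Suc j)) x" for x t
        proof -
          have "E / 2 * (1/2) ^ j \<le> k (Suc j) x - U x t" using that unfolding k_Suc[of "Suc j"] by simp
          then show ?thesis unfolding level.Z_def[OF lv] by (simp add: le_max_iff_disj)
        qed
      qed (use F E in auto)
      then have "(E / 2 * (1/2) ^ j) powr p * (y (Suc (Suc j)) * R) \<le>
          F * N powr \<beta> * P * (8 * \<Lambda> * Ck) * (y (Suc j) * R)"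
        unfolding Y_eq Y_def[symmetric] yR P_def .
      then show ?thesis
        unfolding C_def b_def
        by (intro iteration_rescaled[where r = r and n = n and ps = "p * s" and N = N])
          (use r n E c0 K0 \<Lambda> F y0 in \<open>simp_all add: \<beta>_def N_def yR Ck_def R_def \<eta>_def\<close>)
    qed
    have "y 0 \<le> \<delta>"
    proof -
      have "Y 0 \<le> emeasure lborel (ball x0 (13 * r / 16)) * ennreal (t1 - t0)"
        using level.Y_le[OF lv, of t0 t1 0] t1 unfolding Y_eq by simp
      also have "\<dots> \<le> emeasure lborel (ball x0 r) * ennreal (t1 - t0)"
        using r by (intro mult_right_mono emeasure_mono subset_ball) auto
      also have "emeasure lborel (ball x0 r) = ennreal (r powr n * \<omega>)"
        using emeasure_lborel_ball_finite[of x0 r] content_ball_conv_unit_ball[of r x0] r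
        by (simp add: emeasure_eq_ennreal_measure \<omega>_def n_def powr_realpow)
      also have "ennreal (r powr n * \<omega>) * ennreal (t1 - t0) \<le> ennreal (r powr n * \<omega>) * ennreal (\<theta> * r powr (s * p))"
        by (intro mult_left_mono ennreal_leI) (auto simp: t1_def)
      also have "\<dots> = ennreal (\<delta> * R)"
      proof -
        have "(r powr n * \<omega>) * (\<theta> * r powr (s * p)) = \<delta> * R"
          using \<omega> by (simp add: R_def powr_add \<theta>_def mult_ac)
        moreover have "ennreal (r powr n * \<omega>) * ennreal (\<theta> * r powr (s * p)) = ennreal ((r powr n * \<omega>) * (\<theta> * r powr (s * p)))"
          by (rule ennreal_mult[symmetric]) (use \<omega> \<theta> in auto)
        ultimately show ?thesis by (simp only:)
      qed
      finally have "enn2real (Y 0) \<le> \<delta> * R"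
        using \<delta> R by (intro enn2real_leI) auto
      then show ?thesis unfolding y_def using R by (simp add: pos_divide_le_eq)
    qed
    then have "y \<longlonglongrightarrow> 0" using y0 y_dec y_step by (intro conv[rule_format])
    then have "(\<lambda>j. y j * R) \<longlonglongrightarrow> 0" by (rule tendsto_mult_left_zero)
    then have "(\<lambda>j. ennreal (enn2real (Y j))) \<longlonglongrightarrow> ennreal 0"
      unfolding yR by (rule tendsto_ennrealI)
    then have Y0: "Y \<longlonglongrightarrow> 0" using Yfin by (simp add: less_top)
    define f where "f x t = (indicator {w. fst w \<in> ball x0 (3 * r / 4) \<and> t0 < snd w \<and> snd w < t1 \<and> U (fst w) (snd w) < \<mu> + a * L} (x, t) :: ennreal)"
      for x t
    have set_m: "{w. fst w \<in> ball x0 (3 * r / 4) \<and> t0 < snd w \<and> snd w < t1 \<and> U (fst w) (snd w) < \<mu> + a * L} \<in> sets borel"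
    proof -
      have "{w \<in> space (borel \<Otimes>\<^sub>M borel). fst w \<in> ball x0 (3 * r / 4) \<and> t0 < snd w \<and> snd w < t1 \<and> U (fst w) (snd w) < \<mu> + a * L} \<in> sets (borel \<Otimes>\<^sub>M borel)"
      proof -
        have [measurable]: "ball x0 (3 * r / 4) \<in> sets borel" by simp
        show ?thesis by measurable
      qed
      then show ?thesis unfolding borel_prod by simp
    qed
    have "emeasure lborel {w. fst w \<in> ball x0 (3 * r / 4) \<and> t0 < snd w \<and> snd w < t1 \<and> U (fst w) (snd w) < \<mu> + a * L} \<le> Y j" for j
    proof -
      have fm: "(\<lambda>(x, t). f x t) \<in> borel_measurable borel"
        unfolding f_def case_prod_beta' prod.collapse using set_m by (intro borel_measurable_indicator) simp
      have "emeasure lborel {w. fst w \<in> ball x0 (3 * r / 4) \<and> t0 < snd w \<and> snd w < t1 \<and> U (fst w) (snd w) < \<mu> + a * L} = (\<integral>\<^sup>+w. f (fst w) (snd w) \<partial>lborel)"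
        unfolding f_def prod.collapse using set_m by (intro nn_integral_indicator[symmetric]) simp
      also have "\<dots> = (\<integral>\<^sup>+t. \<integral>\<^sup>+x. f x t \<partial>lborel \<partial>lborel)" by (rule nn_integral_lborel_Times(2)[OF fm])
      also have "\<dots> \<le> Y j"
        unfolding Y_def
      proof (rule nn_integral_mono)
        fix t
        have "(\<integral>\<^sup>+x. f x t \<partial>lborel) \<le> (\<integral>\<^sup>+x. indicator {t0<..<t1} t * indicator {x. U x t < k j x} x \<partial>lborel)"
        proof (rule nn_integral_mono)
          fix x
          \<comment> \<open>On the smaller ball the cutoff is 1, so k j x = \<mu> + L - \<delta>j j
            \<ge> \<mu> + a L.\<close>
          have "U x t < k j x" if "x \<in> ball x0 (3 * r / 4)" "U x t < \<mu> + a * L"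
            using cutoff_eq_1[OF r that(1)] that(2) \<delta>j(2)[of j] by (simp add: k_def algebra_simps)
          then show "f x t \<le> indicator {t0<..<t1} t * indicator {x. U x t < k j x} x"
            unfolding f_def by (auto simp: indicator_def)
        qed
        also have "\<dots> = emeasure lborel {x. U x t < k j x} * indicator {t0<..<t1} t"
          by (subst nn_integral_cmult_indicator) (auto simp: mult.commute)
        finally show "(\<integral>\<^sup>+x. f x t \<partial>lborel) \<le> emeasure lborel {x. U x t < k j x} * indicator {t0<..<t1} t" .
      qed
      finally show ?thesis .
    qed
    then have "emeasure lborel {w. fst w \<in> ball x0 (3 * r / 4) \<and> t0 < snd w \<and> snd w < t1 \<and> U (fst w) (snd w) < \<mu> + a * L} \<le> 0"
      by (intro LIMSEQ_le_const[OF Y0]) auto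
    then have "{w. fst w \<in> ball x0 (3 * r / 4) \<and> t0 < snd w \<and> snd w < t1 \<and> U (fst w) (snd w) < \<mu> + a * L} \<in> null_sets lborel"
      using set_m by (intro null_setsI) auto
    from AE_not_in[OF this]
    show "AE w in lborel. fst w \<in> ball x0 (3 * r / 4) \<and> t0 < snd w \<and> snd w < t0 + \<theta> * r powr (s * p) \<and> snd w < T \<longrightarrow>
      \<mu> + a * L \<le> U (fst w) (snd w)"
      by eventually_elim (auto simp: t1_def not_less)
  qed
qed

section \<open>Borel representatives\<close>

lemma AE_lebesgue_on_iff:
  assumes "S \<in> sets borel"
  shows "(AE x in lebesgue_on S. P x) \<longleftrightarrow> (AE x in lborel. x \<in> S \<longrightarrow> P x)"
  using assms by (subst AE_restrict_space_iff) (auto simp: AE_completion_iff)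

lemma AE_pair_swap_lborel:
  fixes P :: "'a::euclidean_space \<Rightarrow> 'b::euclidean_space \<Rightarrow> bool"
  assumes "{w \<in> space (borel \<Otimes>\<^sub>M borel). P (fst w) (snd w)} \<in> sets (borel \<Otimes>\<^sub>M borel)"
  shows "(AE w in lborel. P (fst w) (snd w)) \<longleftrightarrow> (AE y in lborel. AE x in lborel. P x y)"
proof -
  have m: "{w \<in> space (lborel \<Otimes>\<^sub>M lborel). P (fst w) (snd w)} \<in> sets (lborel \<Otimes>\<^sub>M lborel)"
    using assms by (simp add: space_pair_measure)
  show ?thesis
    unfolding lborel_prod[symmetric] using lborel_pair.AE_pair_iff[OF m] lborel_pair.AE_commute[OF m] by simp
qed

lemma AE_lborel_null_cover:
  assumes "AE x in lborel. P x"
  shows "\<exists>N. N \<in> null_sets lborel \<and> (\<forall>x. x \<notin> N \<longrightarrow> P x)"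
proof -
  obtain N where "{x \<in> space lborel. \<not> P x} \<subseteq> N" "emeasure lborel N = 0" "N \<in> sets lborel"
    using assms by (rule AE_E)
  then have "N \<in> null_sets lborel \<and> (\<forall>x. x \<notin> N \<longrightarrow> P x)" by auto
  then show ?thesis ..
qed

lemma AE_lborel_fst:
  assumes "AE x in (lborel :: 'a::euclidean_space measure). P x"
  shows "AE w in (lborel :: ('a \<times> 'b::euclidean_space) measure). P (fst w)"
proof -
  obtain N where N: "N \<in> null_sets lborel" "\<And>x. x \<notin> N \<Longrightarrow> P x" using AE_lborel_null_cover[OF assms] by blast
  have "emeasure (lborel \<Otimes>\<^sub>M lborel) (N \<times> (UNIV :: 'b set)) = emeasure lborel N * emeasure lborel (UNIV :: 'b set)"
    using N(1) by (intro lborel.emeasure_pair_measure_Times) auto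
  then have "emeasure lborel (N \<times> (UNIV :: 'b set)) = 0" using null_setsD1[OF N(1)] by (simp add: lborel_prod)
  moreover have "N \<times> (UNIV :: 'b set) \<in> sets lborel"
    using N(1) unfolding sets_lborel borel_prod[symmetric] by (intro pair_measureI) auto
  ultimately have "N \<times> (UNIV :: 'b set) \<in> null_sets lborel" by (intro null_setsI)
  from AE_not_in[OF this] show ?thesis by eventually_elim (use N(2) in \<open>auto simp: mem_Times_iff\<close>)
qed

lemma AE_lborel_snd:
  assumes "AE x in (lborel :: 'b::euclidean_space measure). P x"
  shows "AE w in (lborel :: ('a::euclidean_space \<times> 'b) measure). P (snd w)"
proof -
  obtain N where N: "N \<in> null_sets lborel" "\<And>x. x \<notin> N \<Longrightarrow> P x" using AE_lborel_null_cover[OF assms] by blast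
  have "emeasure (lborel \<Otimes>\<^sub>M lborel) ((UNIV :: 'a set) \<times> N) = emeasure lborel (UNIV :: 'a set) * emeasure lborel N"
    using N(1) by (intro lborel.emeasure_pair_measure_Times) auto
  then have "emeasure lborel ((UNIV :: 'a set) \<times> N) = 0" using null_setsD1[OF N(1)] by (simp add: lborel_prod)
  moreover have "(UNIV :: 'a set) \<times> N \<in> sets lborel"
    using N(1) unfolding sets_lborel borel_prod[symmetric] by (intro pair_measureI) auto
  ultimately have "(UNIV :: 'a set) \<times> N \<in> null_sets lborel" by (intro null_setsI)
  from AE_not_in[OF this] show ?thesis by eventually_elim (use N(2) in \<open>auto simp: mem_Times_iff\<close>)
qed

text \<open>The property need not define a measurable set, so it is replaced by membership in the
  complement of a Borel null set before Fubini is applied.\<close>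

lemma AE_lborel_slices:
  fixes P :: "'a::euclidean_space \<Rightarrow> 'b::euclidean_space \<Rightarrow> bool"
  assumes "AE w in lborel. P (fst w) (snd w)"
  shows "AE t in lborel. AE x in lborel. P x t"
proof -
  obtain N where N: "N \<in> null_sets lborel" "\<And>w. w \<notin> N \<Longrightarrow> P (fst w) (snd w)" using AE_lborel_null_cover[OF assms] by blast
  have "{w \<in> space (borel \<Otimes>\<^sub>M borel). (fst w, snd w) \<notin> N} = - N" by (auto simp: space_pair_measure)
  moreover have "- N \<in> sets (borel \<Otimes>\<^sub>M borel)" using N(1) unfolding borel_prod by auto
  ultimately have m: "{w \<in> space (borel \<Otimes>\<^sub>M borel). (fst w, snd w) \<notin> N} \<in> sets (borel \<Otimes>\<^sub>M borel)" by simp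
  have "AE w in lborel. (fst w, snd w) \<notin> N" using AE_not_in[OF N(1)] by simp
  then have "AE t in lborel. AE x in lborel. (x, t) \<notin> N" using AE_pair_swap_lborel[OF m] by simp
  then show ?thesis
  proof eventually_elim
    case (elim t)
    then show ?case by eventually_elim (use N(2) in force)
  qed
qed

text \<open>The flux evaluates \<open>u\<close> at two points at the same time. An exceptional null
  set in (x, t) has null slices at almost every time, and the product of a null set with the whole
  space is null; hence it can be avoided at both points of a pair simultaneously.\<close>

lemma AE_lborel_pair_slices:
  fixes P :: "'a::euclidean_space \<Rightarrow> 'c::euclidean_space \<Rightarrow> bool"
  assumes "AE w in lborel. P (fst w) (snd w)"
  shows "AE v in (lborel :: (('a \<times> 'a) \<times> 'c) measure). P (fst (fst v)) (snd v) \<and> P (snd (fst v)) (snd v)"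
proof -
  obtain N where N: "N \<in> null_sets lborel" "\<And>w. w \<notin> N \<Longrightarrow> P (fst w) (snd w)" using AE_lborel_null_cover[OF assms] by blast
  have Nm: "N \<in> sets (borel \<Otimes>\<^sub>M borel)" using N(1) unfolding borel_prod by auto
  have "AE w in lborel. (fst w, snd w) \<notin> N" using AE_not_in[OF N(1)] by simp
  then have "AE t in lborel. AE x in lborel. (x, t) \<notin> N" by (rule AE_lborel_slices[where P = "\<lambda>x t. (x, t) \<notin> N"])
  then have "AE t in lborel. AE z in (lborel :: ('a \<times> 'a) measure). (fst z, t) \<notin> N \<and> (snd z, t) \<notin> N"
  proof eventually_elim
    case (elim t)
    show ?case using AE_lborel_fst[OF elim] AE_lborel_snd[OF elim] by eventually_elim simp
  qed
  moreover have "{v \<in> space ((borel :: ('a \<times> 'a) measure) \<Otimes>\<^sub>M (borel :: 'c measure)). (fst (fst v), snd v) \<notin> N \<and> (snd (fst v), snd v) \<notin> N}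
      \<in> sets (borel \<Otimes>\<^sub>M borel)"
    using Nm by measurable
  ultimately have "AE v in (lborel :: (('a \<times> 'a) \<times> 'c) measure). (fst (fst v), snd v) \<notin> N \<and> (snd (fst v), snd v) \<notin> N"
    using AE_pair_swap_lborel[of "\<lambda>z t. (fst z, t) \<notin> N \<and> (snd z, t) \<notin> N"] by simp
  then show ?thesis by eventually_elim (use N(2) in force)
qed

text \<open>The definition of the energy groups triples as (x, (y, t)), the Fubini arguments as ((x,
  y), t). Both product measures agree because the integral of an indicator unfolds to the same
  iterated integral.\<close>

lemma lborel_assoc:
  "(lborel :: ('a::euclidean_space \<times> 'b::euclidean_space \<times> 'c::euclidean_space) measure) =
    distr lborel borel (\<lambda>w :: ('a \<times> 'b) \<times> 'c. (fst (fst w), snd (fst w), snd w))"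
proof (rule measure_eqI)
  fix S :: "('a \<times> 'b \<times> 'c) set" assume "S \<in> sets lborel"
  then have S: "S \<in> sets borel" by simp
  have m: "(\<lambda>w :: ('a \<times> 'b) \<times> 'c. (fst (fst w), snd (fst w), snd w)) \<in> borel_measurable borel"
    by (intro borel_measurable_continuous_onI continuous_intros)
  have Sm: "(\<lambda>w. indicator S w :: ennreal) \<in> borel_measurable borel" using S by simp
  have "emeasure (distr lborel borel (\<lambda>w :: ('a \<times> 'b) \<times> 'c. (fst (fst w), snd (fst w), snd w))) S =
      (\<integral>\<^sup>+w. indicator S w \<partial>distr lborel borel (\<lambda>w :: ('a \<times> 'b) \<times> 'c. (fst (fst w), snd (fst w), snd w)))"
    using S by (intro nn_integral_indicator[symmetric]) simp
  also have "\<dots> = (\<integral>\<^sup>+w. indicator S (fst (fst w), snd (fst w), snd w) \<partial>lborel)"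
    by (rule nn_integral_distr) (use m S in simp_all)
  also have "\<dots> = (\<integral>\<^sup>+z. \<integral>\<^sup>+t. indicator S (fst z, snd z, t) \<partial>lborel \<partial>lborel)"
    by (rule nn_integral_lborel_Times(1)) (use measurable_compose[OF m Sm] in \<open>simp add: case_prod_beta'\<close>)
  also have "\<dots> = (\<integral>\<^sup>+x. \<integral>\<^sup>+y. \<integral>\<^sup>+t. indicator S (x, y, t) \<partial>lborel \<partial>lborel \<partial>lborel)"
  proof (rule nn_integral_lborel_Times(1))
    have "(\<lambda>(z, t). indicator S (fst z, snd z, t) :: ennreal) \<in> borel_measurable ((lborel :: ('a \<times> 'b) measure) \<Otimes>\<^sub>M (lborel :: 'c measure))"
      unfolding lborel_prod case_prod_beta' using measurable_compose[OF m Sm] by simp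
    from lborel.borel_measurable_nn_integral[OF this]
    show "(\<lambda>(x, y). \<integral>\<^sup>+t. indicator S (x, y, t) \<partial>lborel) \<in> borel_measurable borel"
      by (simp add: case_prod_beta')
  qed
  also have "\<dots> = (\<integral>\<^sup>+x. \<integral>\<^sup>+v. indicator S (x, v) \<partial>lborel \<partial>lborel)"
  proof (intro nn_integral_cong)
    fix x :: 'a
    have "(\<lambda>v. indicator S (x, fst v, snd v) :: ennreal) \<in> borel_measurable borel"
      using measurable_compose[of "\<lambda>v. (x, v)" borel borel, OF _ Sm]
      by (simp add: borel_measurable_continuous_onI continuous_intros)
    then show "(\<integral>\<^sup>+y. \<integral>\<^sup>+t. indicator S (x, y, t) \<partial>lborel \<partial>lborel) = (\<integral>\<^sup>+v. indicator S (x, v) \<partial>lborel)"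
      using nn_integral_lborel_Times(1)[of "\<lambda>y t. indicator S (x, y, t)"] by (simp add: case_prod_beta')
  qed
  also have "\<dots> = (\<integral>\<^sup>+w. indicator S (fst w, snd w) \<partial>lborel)"
    by (rule nn_integral_lborel_Times(1)[symmetric]) (use Sm in simp)
  also have "\<dots> = emeasure lborel S" using S by simp
  finally show "emeasure lborel S = emeasure (distr lborel borel (\<lambda>w :: ('a \<times> 'b) \<times> 'c. (fst (fst w), snd (fst w), snd w))) S" ..
qed simp

lemma measurable_assoc:
  "(\<lambda>w :: ('a::euclidean_space \<times> 'b::euclidean_space) \<times> 'c::euclidean_space. (fst (fst w), snd (fst w), snd w)) \<in> borel_measurable borel"
  by (intro borel_measurable_continuous_onI continuous_intros)

lemma AE_lborel_assoc:
  assumes "AE w in (lborel :: ('a::euclidean_space \<times> 'b::euclidean_space \<times> 'c::euclidean_space) measure). P w"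
  shows "AE w in (lborel :: (('a \<times> 'b) \<times> 'c) measure). P (fst (fst w), snd (fst w), snd w)"
proof -
  have "AE w in distr lborel borel (\<lambda>w :: ('a \<times> 'b) \<times> 'c. (fst (fst w), snd (fst w), snd w)). P w"
    using assms unfolding lborel_assoc .
  moreover have "(\<lambda>w :: ('a \<times> 'b) \<times> 'c. (fst (fst w), snd (fst w), snd w)) \<in> lborel \<rightarrow>\<^sub>M borel"
    by (simp only: measurable_lborel2 measurable_assoc)
  ultimately show ?thesis by (rule AE_distrD[rotated])
qed

section \<open>Borel versions and the transfer of integrals\<close>

lemma borel_measurable_completion_AE:
  fixes f :: "'a \<Rightarrow> 'b::topological_space"
  assumes f': "f' \<in> borel_measurable M" and eq: "AE x in M. f x = f' x"
  shows "f \<in> borel_measurable (completion M)"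
proof (rule measurableI)
  fix S :: "'b set" assume "S \<in> sets borel"
  with f' have "f' -` S \<inter> space M \<in> sets M" by (rule measurable_sets)
  then have m: "f' -` S \<inter> space M \<in> sets (completion M)" by (rule sets_completionI_sets)
  have ae: "AE x in completion M. x \<in> f' -` S \<inter> space M \<longleftrightarrow> x \<in> f -` S \<inter> space (completion M)"
    using AE_completion[OF eq]
  proof eventually_elim
    case (elim x)
    then show ?case by simp
  qed
  show "f -` S \<inter> space (completion M) \<in> sets (completion M)"
    by (rule completion.in_sets_AE[OF ae m]) blast
qed simp

lemma integral_lebesgue_on_AE:
  fixes f f' :: "'a::euclidean_space \<Rightarrow> real"
  assumes S: "S \<in> sets borel" and f': "f' \<in> borel_measurable borel" and eq: "AE x in lborel. x \<in> S \<longrightarrow> f x = f' x"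
  shows "(LINT x|lebesgue_on S. f x) = (LINT x|lborel. indicator S x * f' x)"
proof -
  have m: "(\<lambda>x. indicator S x * f' x) \<in> borel_measurable lborel" using S f' by simp
  have eq': "AE x in lborel. indicator S x *\<^sub>R f x = indicator S x * f' x"
    using eq by eventually_elim (auto simp: indicator_def)
  have "(LINT x|lebesgue_on S. f x) = (LINT x|lebesgue. indicator S x *\<^sub>R f x)"
    using S by (intro integral_restrict_space) auto
  also have "\<dots> = (LINT x|lebesgue. indicator S x * f' x)"
    by (rule integral_cong_AE[OF borel_measurable_completion_AE[OF m eq'] measurable_completion[OF m] AE_completion[OF eq']])
  also have "\<dots> = (LINT x|lborel. indicator S x * f' x)"
    by (rule integral_completion[OF m])
  finally show ?thesis .
qed

lemma borel_version:
  fixes f :: "'a::euclidean_space \<Rightarrow> real"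
  assumes S: "S \<in> sets borel" and f: "f \<in> borel_measurable (lebesgue_on S)"
  shows "\<exists>f'\<in>borel_measurable borel. AE x in lborel. x \<in> S \<longrightarrow> f x = f' x"
proof -
  have "(\<lambda>x. if x \<in> S then f x else 0) \<in> borel_measurable lebesgue"
    using S by (intro borel_measurable_if_I[OF f]) simp
  from completion_ex_borel_measurable_real[OF this]
  obtain f' where f': "f' \<in> borel_measurable lborel" "AE x in lborel. (if x \<in> S then f x else 0) = f' x"
    by (elim bexE)
  from f'(2) have "AE x in lborel. x \<in> S \<longrightarrow> f x = f' x"
  proof eventually_elim
    case (elim x)
    then show ?case by (simp split: if_splits)
  qed
  then show ?thesis by (rule bexI[OF _ f'(1)[unfolded measurable_lborel2]])
qed

lemma spacetime_borel:
  fixes S :: "'a::second_countable_topology set" and I :: "'b::second_countable_topology set"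
  shows "S \<in> sets borel \<Longrightarrow> I \<in> sets borel \<Longrightarrow> S \<times> I \<in> sets borel"
  unfolding borel_prod[symmetric] by (rule pair_measureI)

text \<open>A Borel version of \<open>u\<close> is clipped to [\<mu>, M]. Within the strip this
  changes it on a null set only, and it makes the bounds hold at every point and also at times
  outside (0, T). \<open>M\<close> is taken to be at least \<mu>, so that the clipping is
  consistent.\<close>

lemma bounded_borel_version:
  fixes u :: "real^'n \<Rightarrow> real \<Rightarrow> real"
  assumes u: "(\<lambda>(x, t). u x t) \<in> borel_measurable (lebesgue_on (UNIV \<times> {0<..<T}))"
    and sup: "esssup (lebesgue_on (UNIV \<times> {0<..<T})) (\<lambda>(x, t). ereal \<bar>u x t\<bar>) < \<infinity>"
    and inf: "ereal \<mu> \<le> essinf (lebesgue_on (UNIV \<times> {0<..<T})) (\<lambda>(x, t). ereal (u x t))"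
  shows "\<exists>U M. (\<lambda>(x, t). U x t) \<in> borel_measurable borel \<and> (\<forall>x t. \<mu> \<le> U x t \<and> U x t \<le> M) \<and>
    (AE w in lborel. snd w \<in> {0<..<T} \<longrightarrow> u (fst w) (snd w) = U (fst w) (snd w))"
proof -
  define S where "S = (UNIV :: (real^'n) set) \<times> {0<..<T}"
  have S: "S \<in> sets borel" unfolding S_def by (rule spacetime_borel) auto
  obtain m where m: "esssup (lebesgue_on S) (\<lambda>(x, t). ereal \<bar>u x t\<bar>) \<le> ereal m"
    using sup unfolding S_def[symmetric] by (cases "esssup (lebesgue_on S) (\<lambda>(x, t). ereal \<bar>u x t\<bar>)") auto
  have "AE w in lebesgue_on S. (case w of (x, t) \<Rightarrow> ereal \<bar>u x t\<bar>) \<le> esssup (lebesgue_on S) (\<lambda>(x, t). ereal \<bar>u x t\<bar>)"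
    by (rule esssup_AE)
  then have "AE w in lebesgue_on S. (case w of (x, t) \<Rightarrow> ereal \<bar>u x t\<bar>) \<le> ereal m"
    by eventually_elim (rule order_trans[OF _ m])
  then have up: "AE w in lborel. w \<in> S \<longrightarrow> u (fst w) (snd w) \<le> m"
    unfolding AE_lebesgue_on_iff[OF S] by eventually_elim (auto simp: case_prod_beta')
  have e: "esssup (lebesgue_on S) (\<lambda>w. - (case w of (x, t) \<Rightarrow> ereal (u x t))) \<le> - ereal \<mu>"
    using inf unfolding essinf_def S_def[symmetric] by (metis ereal_minus_le_minus ereal_uminus_uminus)
  have "AE w in lebesgue_on S. - (case w of (x, t) \<Rightarrow> ereal (u x t)) \<le> esssup (lebesgue_on S) (\<lambda>w. - (case w of (x, t) \<Rightarrow> ereal (u x t)))"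
    by (rule esssup_AE)
  then have "AE w in lebesgue_on S. - (case w of (x, t) \<Rightarrow> ereal (u x t)) \<le> - ereal \<mu>"
    by eventually_elim (rule order_trans[OF _ e])
  then have low: "AE w in lborel. w \<in> S \<longrightarrow> \<mu> \<le> u (fst w) (snd w)"
    unfolding AE_lebesgue_on_iff[OF S] by eventually_elim (auto simp: case_prod_beta')
  obtain f where f: "f \<in> borel_measurable borel" "AE w in lborel. w \<in> S \<longrightarrow> (case w of (x, t) \<Rightarrow> u x t) = f w"
    using borel_version[OF S u[folded S_def]] by blast
  define M where "M = max \<mu> m"
  define U where "U x t = max \<mu> (min M (f (x, t)))" for x t
  have "(\<lambda>(x, t). U x t) \<in> borel_measurable borel"
    unfolding U_def case_prod_beta' prod.collapse using f(1) by (intro borel_measurable_max borel_measurable_min) simp_all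
  moreover have "\<forall>x t. \<mu> \<le> U x t \<and> U x t \<le> M" unfolding U_def M_def by auto
  moreover have "AE w in lborel. snd w \<in> {0<..<T} \<longrightarrow> u (fst w) (snd w) = U (fst w) (snd w)"
    using up low f(2)
  proof eventually_elim
    case (elim w)
    show ?case
    proof
      assume "snd w \<in> {0<..<T}"
      then have "w \<in> S" by (auto simp: S_def mem_Times_iff)
      with elim show "u (fst w) (snd w) = U (fst w) (snd w)"
        unfolding U_def M_def by (simp add: case_prod_beta')
    qed
  qed
  ultimately show ?thesis by blast
qed

text \<open>The two-sided bound is given for each t off a null set of pairs depending on t, and no
  measurability of the joint exceptional set is part of it. Comparing the Borel function
  \<open>h\<close> with its clipped version \<kappa> instead makes the set of agreement Borel, so
  Fubini upgrades the slicewise statement to a joint one.\<close>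

lemma kernel_borel_version:
  fixes K :: "real^'n \<Rightarrow> real^'n \<Rightarrow> real \<Rightarrow> real"
  assumes K: "admissible_kernel p s \<Lambda> T K" and \<Lambda>: "1 \<le> \<Lambda>"
  shows "\<exists>\<kappa>. (\<lambda>(z, t). \<kappa> (fst z) (snd z) t) \<in> borel_measurable borel \<and>
    (\<forall>x y t. gkernel p s x y / \<Lambda> \<le> \<kappa> x y t \<and> \<kappa> x y t \<le> \<Lambda> * gkernel p s x y) \<and>
    (AE w in lborel. snd w \<in> {0<..<T} \<longrightarrow> K (fst (fst w)) (snd (fst w)) (snd w) = \<kappa> (fst (fst w)) (snd (fst w)) (snd w))"
proof -
  define S where "S = (UNIV :: (real^'n) set) \<times> (UNIV :: (real^'n) set) \<times> {0<..<T}"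
  have S: "S \<in> sets borel" unfolding S_def by (intro spacetime_borel) auto
  have Km: "(\<lambda>(x, y, t). K x y t) \<in> borel_measurable (lebesgue_on S)"
    using K unfolding admissible_kernel_def S_def by blast
  obtain f where f: "f \<in> borel_measurable borel" "AE w in lborel. w \<in> S \<longrightarrow> (case w of (x, y, t) \<Rightarrow> K x y t) = f w"
    using borel_version[OF S Km] by blast
  define h where "h z t = f (fst z, snd z, t)" for z t
  have hm: "(\<lambda>w. h (fst w) (snd w)) \<in> borel_measurable borel"
    unfolding h_def using measurable_compose[OF measurable_assoc f(1)] .
  have Kh: "AE w in lborel. snd w \<in> {0<..<T} \<longrightarrow> K (fst (fst w)) (snd (fst w)) (snd w) = h (fst w) (snd w)"
    using AE_lborel_assoc[OF f(2)] by eventually_elim (simp add: S_def h_def)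
  define \<kappa> where "\<kappa> x y t = max (gkernel p s x y / \<Lambda>) (min (\<Lambda> * gkernel p s x y) (h (x, y) t))" for x y t
  have gm: "(\<lambda>w :: ((real^'n) \<times> (real^'n)) \<times> real. gkernel p s (fst (fst w)) (snd (fst w))) \<in> borel_measurable borel"
    unfolding borel_prod[symmetric, where 'b = real] by measurable
  have \<kappa>m: "(\<lambda>w. \<kappa> (fst (fst w)) (snd (fst w)) (snd w)) \<in> borel_measurable borel"
    unfolding \<kappa>_def prod.collapse
    by (intro borel_measurable_max borel_measurable_min borel_measurable_divide borel_measurable_times borel_measurable_const gm hm)
  have bounds: "gkernel p s x y / \<Lambda> \<le> \<kappa> x y t \<and> \<kappa> x y t \<le> \<Lambda> * gkernel p s x y" for x y t
  proof -
    have g: "gkernel p s x y \<le> \<Lambda> * gkernel p s x y"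
      using mult_right_mono[OF \<Lambda> gkernel_nonneg[of p s x y]] by simp
    then have "gkernel p s x y / \<Lambda> \<le> gkernel p s x y" using \<Lambda> by (simp add: pos_divide_le_eq mult.commute)
    also note g
    finally show ?thesis unfolding \<kappa>_def by auto
  qed
  have "AE t in lborel. AE z in lborel. t \<in> {0<..<T} \<longrightarrow> h z t = \<kappa> (fst z) (snd z) t"
    using AE_lborel_slices[OF Kh]
  proof eventually_elim
    case (elim t)
    show ?case
    proof (cases "t \<in> {0<..<T}")
      case True
      have "AE (x, y) in lebesgue. inverse \<Lambda> / norm (x - y) powr (real CARD('n) + p * s) \<le> K x y t \<and>
          K x y t \<le> \<Lambda> / norm (x - y) powr (real CARD('n) + p * s)"
        using K True unfolding admissible_kernel_def by blast
      then have "AE z in lborel. gkernel p s (fst z) (snd z) / \<Lambda> \<le> K (fst z) (snd z) t \<and> K (fst z) (snd z) t \<le> \<Lambda> * gkernel p s (fst z) (snd z)"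
        unfolding AE_completion_iff by eventually_elim (auto simp: gkernel_def divide_inverse mult_ac)
      with elim show ?thesis
        by eventually_elim (use True in \<open>simp add: \<kappa>_def\<close>)
    next
      case False
      then show ?thesis by (intro always_eventually) blast
    qed
  qed
  moreover have "{w \<in> space (borel \<Otimes>\<^sub>M borel). snd w \<in> {0<..<T} \<longrightarrow> h (fst w) (snd w) = \<kappa> (fst (fst w)) (snd (fst w)) (snd w)} \<in> sets (borel \<Otimes>\<^sub>M borel)"
  proof -
    have [measurable]: "(\<lambda>w. h (fst w) (snd w)) \<in> borel_measurable (borel \<Otimes>\<^sub>M borel)"
      "(\<lambda>w. \<kappa> (fst (fst w)) (snd (fst w)) (snd w)) \<in> borel_measurable (borel \<Otimes>\<^sub>M borel)"
      using hm \<kappa>m unfolding borel_prod by auto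
    show ?thesis by measurable
  qed
  ultimately have "AE w in lborel. snd w \<in> {0<..<T} \<longrightarrow> h (fst w) (snd w) = \<kappa> (fst (fst w)) (snd (fst w)) (snd w)"
    using AE_pair_swap_lborel[of "\<lambda>z t. t \<in> {0<..<T} \<longrightarrow> h z t = \<kappa> (fst z) (snd z) t"] by blast
  with Kh have "AE w in lborel. snd w \<in> {0<..<T} \<longrightarrow> K (fst (fst w)) (snd (fst w)) (snd w) = \<kappa> (fst (fst w)) (snd (fst w)) (snd w)"
    by eventually_elim simp
  then show ?thesis using \<kappa>m bounds by (intro exI[of _ \<kappa>]) (simp add: case_prod_beta')
qed

text \<open>Only \<open>u\<close> and \<open>K\<close> are exchanged, almost everywhere and with
  \<open>u\<close> at both points at once, while \<phi> is kept as it is. Because \<phi> vanishes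
  outside [t1, t2], the integral extends to all times, and the triples can then be
  regrouped.\<close>

lemma energy_borel:
  fixes u U :: "real^'n \<Rightarrow> real \<Rightarrow> real"
  assumes Um: "(\<lambda>(x, t). U x t) \<in> borel_measurable borel" and uU: "AE w in lborel. snd w \<in> {0<..<T} \<longrightarrow> u (fst w) (snd w) = U (fst w) (snd w)"
    and \<kappa>m: "(\<lambda>(z, t). \<kappa> (fst z) (snd z) t) \<in> borel_measurable borel"
    and K\<kappa>: "AE w in lborel. snd w \<in> {0<..<T} \<longrightarrow> K (fst (fst w)) (snd (fst w)) (snd w) = \<kappa> (fst (fst w)) (snd (fst w)) (snd w)"
    and \<phi>m: "(\<lambda>(x, t). \<phi> x t) \<in> borel_measurable borel" and t12: "0 < t1" "t2 < T"
    and \<phi>0: "\<And>x t. t \<notin> {t1..t2} \<Longrightarrow> \<phi> x t = 0"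
  shows "energy p K u \<phi> t1 t2 = (LINT (z, t)|lborel. spow (p - 1) (U (fst z) t - U (snd z) t) * (\<phi> (fst z) t - \<phi> (snd z) t) * \<kappa> (fst z) (snd z) t)"
proof -
  define S where "S = (UNIV :: (real^'n) set) \<times> (UNIV :: (real^'n) set) \<times> {t1..t2}"
  have S: "S \<in> sets borel" unfolding S_def by (intro spacetime_borel) auto
  define F where "F w = (case w of (x, y, t) \<Rightarrow> spow (p - 1) (U x t - U y t) * (\<phi> x t - \<phi> y t) * \<kappa> x y t)" for w
  define a where "a w = (fst (fst w), snd (fst w), snd w)" for w :: "((real^'n) \<times> (real^'n)) \<times> real"
  have comp: "(\<lambda>w :: (real^'n) \<times> (real^'n) \<times> real. V (fst w) (snd (snd w))) \<in> borel_measurable borel"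
    "(\<lambda>w :: (real^'n) \<times> (real^'n) \<times> real. V (fst (snd w)) (snd (snd w))) \<in> borel_measurable borel"
    if V: "(\<lambda>(x, t). V x t) \<in> borel_measurable borel" for V :: "real^'n \<Rightarrow> real \<Rightarrow> real"
  proof -
    have "(\<lambda>w :: (real^'n) \<times> (real^'n) \<times> real. (fst w, snd (snd w))) \<in> borel_measurable borel"
      "(\<lambda>w :: (real^'n) \<times> (real^'n) \<times> real. (fst (snd w), snd (snd w))) \<in> borel_measurable borel"
      by (intro borel_measurable_continuous_onI continuous_intros)+
    from measurable_compose[OF this(1) V] measurable_compose[OF this(2) V]
    show "(\<lambda>w :: (real^'n) \<times> (real^'n) \<times> real. V (fst w) (snd (snd w))) \<in> borel_measurable borel"
      "(\<lambda>w :: (real^'n) \<times> (real^'n) \<times> real. V (fst (snd w)) (snd (snd w))) \<in> borel_measurable borel"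
      by (simp_all only: prod.case)
  qed
  have \<kappa>m': "(\<lambda>w. \<kappa> (fst w) (fst (snd w)) (snd (snd w))) \<in> borel_measurable borel"
  proof -
    have "(\<lambda>w :: (real^'n) \<times> (real^'n) \<times> real. ((fst w, fst (snd w)), snd (snd w))) \<in> borel_measurable borel"
      by (intro borel_measurable_continuous_onI continuous_intros)
    from measurable_compose[OF this \<kappa>m] show ?thesis by simp
  qed
  have Fm: "F \<in> borel_measurable borel"
    unfolding F_def case_prod_beta'
    by (rule borel_measurable_times[OF borel_measurable_times[OF
            measurable_compose[OF borel_measurable_diff[OF comp[OF Um]] borel_measurable_spow]
            borel_measurable_diff[OF comp[OF \<phi>m]]] \<kappa>m'])
  have eq: "AE w in lborel. w \<in> S \<longrightarrow> (case w of (x, y, t) \<Rightarrow> spow (p - 1) (u x t - u y t) * (\<phi> x t - \<phi> y t) * K x y t) = F w"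
  proof -
    have "AE v in (lborel :: (((real^'n) \<times> (real^'n)) \<times> real) measure).
        (snd v \<in> {0<..<T} \<longrightarrow> u (fst (fst v)) (snd v) = U (fst (fst v)) (snd v)) \<and> (snd v \<in> {0<..<T} \<longrightarrow> u (snd (fst v)) (snd v) = U (snd (fst v)) (snd v))"
      using AE_lborel_pair_slices[OF uU] .
    with K\<kappa> have "AE v in lborel. a v \<in> S \<longrightarrow> (case a v of (x, y, t) \<Rightarrow> spow (p - 1) (u x t - u y t) * (\<phi> x t - \<phi> y t) * K x y t) = F (a v)"
    proof eventually_elim
      case (elim v)
      then show ?case using t12 unfolding a_def F_def S_def by auto
    qed
    then obtain N where N: "N \<in> null_sets lborel" "\<And>v. v \<notin> N \<Longrightarrow> a v \<in> S \<longrightarrow> (case a v of (x, y, t) \<Rightarrow> spow (p - 1) (u x t - u y t) * (\<phi> x t - \<phi> y t) * K x y t) = F (a v)"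
      using AE_lborel_null_cover[of "\<lambda>v. a v \<in> S \<longrightarrow> (case a v of (x, y, t) \<Rightarrow> spow (p - 1) (u x t - u y t) * (\<phi> x t - \<phi> y t) * K x y t) = F (a v)"] by blast
    \<comment> \<open>The inverse of the regrouping map \<open>a\<close>. It describes the
      exceptional set in the other coordinates as a Borel preimage.\<close>
    define c where "c w = ((fst w, fst (snd w)), snd (snd w))" for w :: "(real^'n) \<times> (real^'n) \<times> real"
    have cm: "c \<in> borel_measurable borel"
      unfolding c_def by (intro borel_measurable_continuous_onI continuous_intros)
    have ac: "a (c w) = w" "c (a v) = v" for w v by (simp_all add: a_def c_def)
    have "{w. c w \<notin> N} \<in> sets borel"
      using measurable_sets[OF cm, of "- N"] N(1) by (auto simp: vimage_def)
    then have Nm: "{w. c w \<notin> N} \<in> sets lborel" by simp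
    have am: "a \<in> borel_measurable borel" unfolding a_def by (rule measurable_assoc)
    have "AE w in distr lborel borel a. c w \<notin> N"
      using AE_not_in[OF N(1)] Nm am by (subst AE_distr_iff) (simp_all add: ac)
    then have "AE w in lborel. c w \<notin> N" unfolding a_def[abs_def] lborel_assoc[symmetric] .
    then show ?thesis
    proof eventually_elim
      case (elim w)
      from N(2)[OF this] show ?case by (simp only: ac)
    qed
  qed
  have "energy p K u \<phi> t1 t2 = (LINT w|lborel. indicator S w * F w)"
    unfolding energy_def S_def[symmetric] by (rule integral_lebesgue_on_AE[OF S Fm eq])
  also have "\<dots> = (LINT w|lborel. F w)"
  proof (intro Bochner_Integration.integral_cong refl)
    show "indicator S w * F w = F w" for w
    proof (cases "snd (snd w) \<in> {t1..t2}")
      case True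
      then have "w \<in> S" by (auto simp: S_def mem_Times_iff)
      then show ?thesis by simp
    next
      case False
      then show ?thesis using \<phi>0 by (simp add: F_def case_prod_beta')
    qed
  qed
  also have "\<dots> = (LINT w|distr lborel borel a. F w)" unfolding a_def[abs_def] lborel_assoc[symmetric] ..
  also have "\<dots> = (LINT v|lborel. F (a v))"
    using Fm measurable_assoc unfolding a_def[abs_def] by (intro integral_distr) simp_all
  finally show ?thesis by (simp add: F_def a_def case_prod_beta')
qed

text \<open>The definition is applied on the larger interval [c/2, (d + T)/2]. The test function
  vanishes near both of its ends, so the one-sided averages are eventually zero, and by uniqueness
  of limits the boundary terms \<open>b1\<close> and \<open>b2\<close> are zero. Finiteness of the
  energy of \<open>U\<close> on D \<times> D is read off the local Sobolev norm of \<open>u\<close>,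
  slice by slice.\<close>

lemma weak_supersolution_borel:
  fixes u U :: "real^'n \<Rightarrow> real \<Rightarrow> real"
  assumes par: "1 < p" "0 < q" "0 < s" "1 \<le> \<Lambda>"
    and super: "weak_supersolution p q s \<Omega> T K u" and D: "compactly_inside D \<Omega>" "connected D" "bounded D"
    and Um: "(\<lambda>(x, t). U x t) \<in> borel_measurable borel" and Ub: "\<And>x t. \<mu> \<le> U x t" "\<And>x t. U x t \<le> M"
    and uU: "AE w in lborel. snd w \<in> {0<..<T} \<longrightarrow> u (fst w) (snd w) = U (fst w) (snd w)"
    and \<kappa>m: "(\<lambda>(z, t). \<kappa> (fst z) (snd z) t) \<in> borel_measurable borel"
    and \<kappa>b: "\<And>x y t. gkernel p s x y / \<Lambda> \<le> \<kappa> x y t" "\<And>x y t. \<kappa> x y t \<le> \<Lambda> * gkernel p s x y"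
    and K\<kappa>: "AE w in lborel. snd w \<in> {0<..<T} \<longrightarrow> K (fst (fst w)) (snd (fst w)) (snd w) = \<kappa> (fst (fst w)) (snd (fst w)) (snd w)"
  shows "borel_supersolution p q s \<Lambda> T \<mu> M D U \<kappa>"
proof
  show "open D" using D(1) by (simp add: compactly_inside_def)
  then have Dm: "D \<in> sets borel" by simp
  fix c d :: real assume cd: "0 < c" "c < d" "d < T"
  have LpWsp: "u \<in> LpWsp s p D {c..d}"
    using super D cd unfolding weak_supersolution_def by blast
  define f where "f z t = ennreal (\<bar>U (fst z) t - U (snd z) t\<bar> powr p * gkernel p s (fst z) (snd z)) * indicator (D \<times> D) z * indicator {c..d} t" for z t
  have DD: "D \<times> D \<in> sets borel" using Dm Dm by (rule spacetime_borel)
  have fm: "(\<lambda>(z, t). f z t) \<in> borel_measurable borel"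
  proof -
    have comp: "(\<lambda>w :: ((real^'n) \<times> (real^'n)) \<times> real. U (fst (fst w)) (snd w)) \<in> borel_measurable borel"
      "(\<lambda>w :: ((real^'n) \<times> (real^'n)) \<times> real. U (snd (fst w)) (snd w)) \<in> borel_measurable borel"
    proof -
      have "(\<lambda>w :: ((real^'n) \<times> (real^'n)) \<times> real. (fst (fst w), snd w)) \<in> borel_measurable borel"
        "(\<lambda>w :: ((real^'n) \<times> (real^'n)) \<times> real. (snd (fst w), snd w)) \<in> borel_measurable borel"
        by (intro borel_measurable_continuous_onI continuous_intros)+
      from measurable_compose[OF this(1) Um] measurable_compose[OF this(2) Um]
      show "(\<lambda>w :: ((real^'n) \<times> (real^'n)) \<times> real. U (fst (fst w)) (snd w)) \<in> borel_measurable borel"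
        "(\<lambda>w :: ((real^'n) \<times> (real^'n)) \<times> real. U (snd (fst w)) (snd w)) \<in> borel_measurable borel"
        by (simp_all only: prod.case)
    qed
    have [measurable]: "(\<lambda>w :: ((real^'n) \<times> (real^'n)) \<times> real. U (fst (fst w)) (snd w)) \<in> borel_measurable (borel \<Otimes>\<^sub>M borel)"
      "(\<lambda>w :: ((real^'n) \<times> (real^'n)) \<times> real. U (snd (fst w)) (snd w)) \<in> borel_measurable (borel \<Otimes>\<^sub>M borel)"
      using comp unfolding borel_prod by auto
    show ?thesis
      unfolding f_def case_prod_beta' borel_prod[symmetric, where 'b = real] using DD by measurable
  qed
  have "(\<integral>\<^sup>+z. \<integral>\<^sup>+t. f z t \<partial>lborel \<partial>lborel) = (\<integral>\<^sup>+t. \<integral>\<^sup>+z. f z t \<partial>lborel \<partial>lborel)"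
    using nn_integral_lborel_Times[OF fm] by simp
  also have "\<dots> \<le> (\<integral>\<^sup>+t. Wsp_norm_pow s p D (\<lambda>x. u x t) * indicator {c..d} t \<partial>lborel)"
  proof (rule nn_integral_mono_AE)
    show "AE t in lborel. (\<integral>\<^sup>+z. f z t \<partial>lborel) \<le> Wsp_norm_pow s p D (\<lambda>x. u x t) * indicator {c..d} t"
      using AE_lborel_slices[OF uU]
    proof eventually_elim
      case (elim t)
      show ?case
      proof (cases "t \<in> {c..d}")
        case True
        then have t: "t \<in> {0<..<T}" using cd by auto
        have "(\<integral>\<^sup>+z. f z t \<partial>lborel) = (\<integral>\<^sup>+z. (case z of (x, y) \<Rightarrow> ennreal (\<bar>u x t - u y t\<bar> powr p / norm (x - y) powr (real CARD('n) + p * s))) * indicator (D \<times> D) z \<partial>lborel)"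
        proof (rule nn_integral_cong_AE)
          show "AE z in lborel. f z t = (case z of (x, y) \<Rightarrow> ennreal (\<bar>u x t - u y t\<bar> powr p / norm (x - y) powr (real CARD('n) + p * s))) * indicator (D \<times> D) z"
            using AE_lborel_fst[OF elim] AE_lborel_snd[OF elim]
            by eventually_elim (use t True in \<open>simp add: f_def gkernel_def case_prod_beta'\<close>)
        qed
        also have "\<dots> = (\<integral>\<^sup>+(x, y). ennreal (\<bar>u x t - u y t\<bar> powr p / norm (x - y) powr (real CARD('n) + p * s)) \<partial>lebesgue_on (D \<times> D))"
          using DD by (subst nn_integral_restrict_space) (simp_all add: nn_integral_completion)
        also have "\<dots> \<le> Wsp_norm_pow s p D (\<lambda>x. u x t)"
          unfolding Wsp_norm_pow_def by (rule add_increasing) simp_all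
        finally show ?thesis using True by simp
      qed (simp add: f_def)
    qed
  qed
  also have "\<dots> = (\<integral>\<^sup>+t. Wsp_norm_pow s p D (\<lambda>x. u x t) \<partial>lebesgue_on {c..d})"
    by (subst nn_integral_restrict_space) (simp_all add: nn_integral_completion)
  also have "\<dots> < \<infinity>" using LpWsp unfolding LpWsp_def by blast
  finally show "(\<integral>\<^sup>+z. \<integral>\<^sup>+t. ennreal (\<bar>U (fst z) t - U (snd z) t\<bar> powr p * gkernel p s (fst z) (snd z)) * indicator (D \<times> D) z * indicator {c..d} t \<partial>lborel \<partial>lborel) < \<infinity>"
    unfolding f_def .
next
  fix \<phi> \<psi> c d
  assume test: "test_function p q s D T \<phi> \<psi>" and \<phi>m: "(\<lambda>(x, t). \<phi> x t) \<in> borel_measurable borel"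
    and \<psi>m: "(\<lambda>(x, t). \<psi> x t) \<in> borel_measurable borel" and cd: "0 < c" "c < d" "d < T"
    and zero: "\<And>x t. t \<notin> {c..d} \<Longrightarrow> \<phi> x t = 0 \<and> \<psi> x t = 0"
  have Dm: "D \<in> sets borel" using D(1) by (simp add: compactly_inside_def)
  define t1 where "t1 = c / 2"
  define t2 where "t2 = (d + T) / 2"
  have t12: "0 < t1" "t1 < c" "d < t2" "t2 < T" "t1 < t2" using cd by (auto simp: t1_def t2_def)
  have "\<forall>\<phi> \<psi>. test_function p q s D T \<phi> \<psi> \<longrightarrow> (\<exists>b1 b2.
      ((\<lambda>h. (1 / h) * (LINT (x, t)|lebesgue_on (D \<times> {t1..t1 + h}). spow q (u x t) * \<phi> x t)) \<longlongrightarrow> b1) (at_right 0) \<and>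
      ((\<lambda>h. (1 / h) * (LINT (x, t)|lebesgue_on (D \<times> {t2 - h..t2}). spow q (u x t) * \<phi> x t)) \<longlongrightarrow> b2) (at_right 0) \<and>
      energy p K u \<phi> t1 t2 - (LINT (x, t)|lebesgue_on (D \<times> {t1..t2}). spow q (u x t) * \<psi> x t) + b2 - b1 \<ge> 0)"
    using super D(1,2) t12 unfolding weak_supersolution_def by blast
  then obtain b1 b2 where
    b1: "((\<lambda>h. (1 / h) * (LINT (x, t)|lebesgue_on (D \<times> {t1..t1 + h}). spow q (u x t) * \<phi> x t)) \<longlongrightarrow> b1) (at_right 0)" and
    b2: "((\<lambda>h. (1 / h) * (LINT (x, t)|lebesgue_on (D \<times> {t2 - h..t2}). spow q (u x t) * \<phi> x t)) \<longlongrightarrow> b2) (at_right 0)" and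
    ineq: "energy p K u \<phi> t1 t2 - (LINT (x, t)|lebesgue_on (D \<times> {t1..t2}). spow q (u x t) * \<psi> x t) + b2 - b1 \<ge> 0"
    using test by blast
  have vanish: "(LINT (x, t)|lebesgue_on (D \<times> I). spow q (u x t) * \<phi> x t) = 0" if "I \<inter> {c..d} = {}" for I
  proof -
    have "(LINT (x, t)|lebesgue_on (D \<times> I). spow q (u x t) * \<phi> x t) = (LINT w|lebesgue_on (D \<times> I). 0)"
    proof (rule Bochner_Integration.integral_cong[OF refl])
      fix w assume "w \<in> space (lebesgue_on (D \<times> I))"
      then have "snd w \<notin> {c..d}" using that by auto
      then show "(case w of (x, t) \<Rightarrow> spow q (u x t) * \<phi> x t) = 0" using zero by (simp add: case_prod_beta')
    qed
    then show ?thesis by simp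
  qed
  have "\<forall>\<^sub>F h in at_right 0. (1 / h) * (LINT (x, t)|lebesgue_on (D \<times> {t1..t1 + h}). spow q (u x t) * \<phi> x t) = 0"
  proof -
    have "\<forall>\<^sub>F h in at_right (0::real). h \<in> {0<..<c - t1}" using t12 by (intro eventually_at_right_real) auto
    then show ?thesis
    proof eventually_elim
      case (elim h)
      then have "{t1..t1 + h} \<inter> {c..d} = {}" by auto
      then show ?case using vanish by simp
    qed
  qed
  then have "((\<lambda>h. (1 / h) * (LINT (x, t)|lebesgue_on (D \<times> {t1..t1 + h}). spow q (u x t) * \<phi> x t)) \<longlongrightarrow> 0) (at_right 0)"
    by (rule tendsto_eventually)
  with b1 have b10: "b1 = 0" by (intro tendsto_unique[OF trivial_limit_at_right_real])
  have "\<forall>\<^sub>F h in at_right 0. (1 / h) * (LINT (x, t)|lebesgue_on (D \<times> {t2 - h..t2}). spow q (u x t) * \<phi> x t) = 0"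
  proof -
    have "\<forall>\<^sub>F h in at_right (0::real). h \<in> {0<..<t2 - d}" using t12 by (intro eventually_at_right_real) auto
    then show ?thesis
    proof eventually_elim
      case (elim h)
      then have "{t2 - h..t2} \<inter> {c..d} = {}" by auto
      then show ?case using vanish by simp
    qed
  qed
  then have "((\<lambda>h. (1 / h) * (LINT (x, t)|lebesgue_on (D \<times> {t2 - h..t2}). spow q (u x t) * \<phi> x t)) \<longlongrightarrow> 0) (at_right 0)"
    by (rule tendsto_eventually)
  with b2 have b20: "b2 = 0" by (intro tendsto_unique[OF trivial_limit_at_right_real])
  have en: "energy p K u \<phi> t1 t2 = (LINT (z, t)|lborel. spow (p - 1) (U (fst z) t - U (snd z) t) * (\<phi> (fst z) t - \<phi> (snd z) t) * \<kappa> (fst z) (snd z) t)"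
  proof (rule energy_borel[OF Um uU \<kappa>m K\<kappa> \<phi>m t12(1,4)])
    show "\<phi> x t = 0" if "t \<notin> {t1..t2}" for x t
    proof -
      have "t \<notin> {c..d}" using that t12 by auto
      then show ?thesis using zero by blast
    qed
  qed
  have "(LINT (x, t)|lebesgue_on (D \<times> {t1..t2}). spow q (u x t) * \<psi> x t) =
      (LINT w|lborel. indicator (D \<times> {t1..t2}) w * (spow q (U (fst w) (snd w)) * \<psi> (fst w) (snd w)))"
  proof (rule integral_lebesgue_on_AE)
    show "D \<times> {t1..t2} \<in> sets borel" using Dm by (intro spacetime_borel) auto
    have "(\<lambda>w. U (fst w) (snd w)) \<in> borel_measurable borel" "(\<lambda>w. \<psi> (fst w) (snd w)) \<in> borel_measurable borel"
      using Um \<psi>m by (simp_all add: case_prod_beta')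
    then show "(\<lambda>w. spow q (U (fst w) (snd w)) * \<psi> (fst w) (snd w)) \<in> borel_measurable borel"
      by (intro borel_measurable_times measurable_compose[OF _ borel_measurable_spow])
    show "AE w in lborel. w \<in> D \<times> {t1..t2} \<longrightarrow> (case w of (x, t) \<Rightarrow> spow q (u x t) * \<psi> x t) = spow q (U (fst w) (snd w)) * \<psi> (fst w) (snd w)"
      using uU by eventually_elim (use t12 in \<open>auto simp: case_prod_beta'\<close>)
  qed
  also have "\<dots> = (LINT (x, t)|lborel. indicator D x * (spow q (U x t) * \<psi> x t))"
  proof (intro Bochner_Integration.integral_cong refl)
    fix w :: "(real^'n) \<times> real"
    show "indicator (D \<times> {t1..t2}) w * (spow q (U (fst w) (snd w)) * \<psi> (fst w) (snd w)) = (case w of (x, t) \<Rightarrow> indicator D x * (spow q (U x t) * \<psi> x t))"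
    proof (cases "snd w \<in> {t1..t2}")
      case True
      then show ?thesis by (cases w) (simp add: indicator_def)
    next
      case False
      then have "snd w \<notin> {c..d}" using t12 by auto
      then show ?thesis using zero by (simp add: case_prod_beta')
    qed
  qed
  finally show "0 \<le> (LINT (z, t)|lborel. spow (p - 1) (U (fst z) t - U (snd z) t) * (\<phi> (fst z) t - \<phi> (snd z) t) * \<kappa> (fst z) (snd z) t)
        - (LINT (x, t)|lborel. indicator D x * (spow q (U x t) * \<psi> x t))"
    using ineq unfolding b10 b20 en by simp
qed (use par D Um Ub \<kappa>m \<kappa>b in auto)

text \<open>The slice of \<open>U\<close> at \<open>t0\<close> carries no information, since a
  single time is a null set. The initial bound is therefore transported through averages in time:
  u(., t0) has a Borel version \<open>v\<close> with v \<ge> L0 almost everywhere on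
  \<open>D\<close>, hence max 0 (L0 - U) \<le> |U - v| there, and the averages of |U - v| tend to
  zero at a Lebesgue instant.\<close>

lemma lebesgue_instant_borel:
  fixes u U :: "real^'n \<Rightarrow> real \<Rightarrow> real"
  assumes inst: "lebesgue_instant \<Omega> T u t0" and D: "compactly_inside D \<Omega>" "bounded D"
    and Um: "(\<lambda>(x, t). U x t) \<in> borel_measurable borel" and Ub: "\<And>x t. \<mu> \<le> U x t" "\<And>x t. U x t \<le> M"
    and uU: "AE w in lborel. snd w \<in> {0<..<T} \<longrightarrow> u (fst w) (snd w) = U (fst w) (snd w)"
    and low: "AE x in lborel. x \<in> D \<longrightarrow> L0 \<le> u x t0"
  shows "((\<lambda>e. (LINT t|lborel. indicator {t0..t0 + e} t * (LINT x|lborel. indicator D x * max 0 (L0 - U x t))) / e) \<longlongrightarrow> 0) (at_right 0)"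
proof -
  have Dm: "D \<in> sets borel" using D(1) by (simp add: compactly_inside_def)
  have t0: "0 < t0" "t0 < T" using inst by (auto simp: lebesgue_instant_def)
  have ui: "integrable (lebesgue_on D) (\<lambda>x. u x t0)"
    and lim: "((\<lambda>h. (1 / (2 * h)) * (LINT (x, t)|lebesgue_on (D \<times> {t0 - h..t0 + h}). \<bar>u x t - u x t0\<bar>)) \<longlongrightarrow> 0) (at_right 0)"
    using inst D(1) unfolding lebesgue_instant_def by blast+
  obtain v where v: "v \<in> borel_measurable borel" "AE x in lborel. x \<in> D \<longrightarrow> u x t0 = v x"
    using borel_version[OF Dm borel_measurable_integrable[OF ui]] by blast
  have vi: "integrable lborel (\<lambda>x. indicator D x * v x)"
  proof -
    have m: "(\<lambda>x. indicator D x * v x) \<in> borel_measurable lborel"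
      using v(1) Dm by (intro borel_measurable_times borel_measurable_indicator) simp_all
    have "integrable lebesgue (\<lambda>x. indicator D x *\<^sub>R u x t0)"
      using ui Dm by (subst (asm) integrable_restrict_space) simp_all
    moreover have "AE x in lborel. indicator D x *\<^sub>R u x t0 = indicator D x * v x"
      using v(2) by eventually_elim (simp add: indicator_def)
    ultimately have "integrable lebesgue (\<lambda>x. indicator D x * v x)"
      by (intro integrable_cong_AE_imp[OF _ measurable_completion[OF m]])
        (auto intro!: AE_completion elim: eventually_mono)
    then show ?thesis using integrable_completion[OF m] by simp
  qed
  define I where "I e = {t0 - e..t0 + e}" for e
  define a where "a e w = indicator (D \<times> I e) w * \<bar>U (fst w) (snd w) - v (fst w)\<bar>" for e and w :: "(real^'n) \<times> real"
  define b where "b e x t = indicator {t0..t0 + e} t * (indicator D x * max 0 (L0 - U x t))" for e x t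
  have Um': "(\<lambda>w. U (fst w) (snd w)) \<in> borel_measurable (borel \<Otimes>\<^sub>M borel)"
    using Um unfolding borel_prod by (simp add: case_prod_beta')
  note [measurable] = Um' v(1) Dm
  have Wm: "(\<lambda>w. \<bar>U (fst w) (snd w) - v (fst w)\<bar>) \<in> borel_measurable borel"
    unfolding borel_prod[symmetric] by measurable
  have Im: "D \<times> I e \<in> sets borel" for e unfolding I_def using Dm by (intro spacetime_borel) auto
  have am: "a e \<in> borel_measurable lborel" for e
    unfolding a_def using Wm Im by (intro borel_measurable_times borel_measurable_indicator) simp_all
  have bm: "(\<lambda>(x, t). b e x t) \<in> borel_measurable borel" for e
    unfolding b_def case_prod_beta' borel_prod[symmetric] by measurable
  define C where "C = \<bar>\<mu>\<bar> + \<bar>M\<bar>"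
  have UC: "\<bar>U x t\<bar> \<le> C" for x t using Ub(1)[of x t] Ub(2)[of x t] unfolding C_def by linarith
  \<comment> \<open>The version \<open>v\<close> is known to be integrable on \<open>D\<close> but
    not to be bounded, so the domination is by C + |v|.\<close>
  have ai: "integrable lborel (a e)" if e: "0 < e" for e
  proof -
    define g where "g x = indicator D x * (C + \<bar>v x\<bar>)" for x
    have gi: "integrable lborel g"
    proof -
      have "integrable lborel (\<lambda>x. indicator D x * C + \<bar>indicator D x * v x\<bar>)"
        using vi emeasure_bounded_finite[OF D(2)] Dm
        by (intro Bochner_Integration.integrable_add integrable_abs integrable_mult_left integrable_real_indicator) simp_all
      moreover have "(\<lambda>x. indicator D x * C + \<bar>indicator D x * v x\<bar>) = g"
        by (auto simp: g_def indicator_def)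
      ultimately show ?thesis by simp
    qed
    have "integrable (lborel \<Otimes>\<^sub>M lborel) (\<lambda>(x, t). g x * indicator (I e) t)"
    proof (rule lborel_pair.Fubini_integrable)
      show "(\<lambda>(x, t). g x * indicator (I e) t) \<in> borel_measurable (lborel \<Otimes>\<^sub>M lborel)"
        unfolding g_def I_def case_prod_beta' by measurable
      have eq: "(LINT t|lborel. norm (case (x, t) of (x, t) \<Rightarrow> g x * indicator (I e) t)) = \<bar>g x\<bar> * (2 * e)" for x
        using e by (simp add: abs_mult I_def)
      show "integrable lborel (\<lambda>x. LINT t|lborel. norm (case (x, t) of (x, t) \<Rightarrow> g x * indicator (I e) t))"
        unfolding eq using gi by (intro integrable_mult_left integrable_abs)
      show "AE x in lborel. integrable lborel (\<lambda>t. case (x, t) of (x, t) \<Rightarrow> g x * indicator (I e) t)"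
        by (intro always_eventually allI) (auto simp: I_def emeasure_lborel_Icc_eq intro!: integrable_mult_right integrable_real_indicator)
    qed
    then have "integrable lborel (\<lambda>(x, t). g x * indicator (I e) t)" by (simp only: lborel_prod)
    then show ?thesis
    proof (rule Bochner_Integration.integrable_bound[OF _ am])
      show "AE w in lborel. norm (a e w) \<le> norm (case w of (x, t) \<Rightarrow> g x * indicator (I e) t)"
      proof (intro always_eventually allI)
        fix w :: "(real^'n) \<times> real"
        have "\<bar>U (fst w) (snd w) - v (fst w)\<bar> \<le> \<bar>C + \<bar>v (fst w)\<bar>\<bar>"
          using UC[of "fst w" "snd w"] by linarith
        then show "norm (a e w) \<le> norm (case w of (x, t) \<Rightarrow> g x * indicator (I e) t)"
          by (cases w) (simp add: a_def g_def indicator_def)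
      qed
    qed
  qed
  have bi: "integrable lborel (\<lambda>(x, t). b e x t)" for e
  proof (rule integrable_bounded_finite_support[where B = "\<bar>L0\<bar> + C" and S = "D \<times> {t0..t0 + e}"])
    show "(\<lambda>(x, t). b e x t) \<in> borel_measurable lborel" using bm by simp
    show "\<bar>case w of (x, t) \<Rightarrow> b e x t\<bar> \<le> \<bar>L0\<bar> + C" for w
      using UC[of "fst w" "snd w"] by (cases w) (auto simp: b_def indicator_def max_def)
    show "(case w of (x, t) \<Rightarrow> b e x t) = 0" if "w \<notin> D \<times> {t0..t0 + e}" for w
      using that by (cases w) (auto simp: b_def)
    show "D \<times> {t0..t0 + e} \<in> sets lborel" unfolding sets_lborel using Dm by (intro spacetime_borel) auto
    show "emeasure lborel (D \<times> {t0..t0 + e}) < \<infinity>"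
      using D(2) by (intro emeasure_bounded_finite bounded_Times) auto
  qed
  have vD: "AE w in (lborel :: ((real^'n) \<times> real) measure). fst w \<in> D \<longrightarrow> u (fst w) t0 = v (fst w) \<and> L0 \<le> v (fst w)"
  proof (rule AE_lborel_fst)
    show "AE x in lborel. x \<in> D \<longrightarrow> u x t0 = v x \<and> L0 \<le> v x"
      using v(2) low by eventually_elim auto
  qed
  have "\<forall>\<^sub>F e in at_right (0::real). e \<in> {0<..<min t0 (T - t0)}"
    using t0 by (intro eventually_at_right_real) auto
  \<comment> \<open>The factor 2 compares the average over [t0, t0 + e] with the symmetric average
    over an interval of length 2e.\<close>
  then have "\<forall>\<^sub>F e in at_right 0. norm ((LINT t|lborel. indicator {t0..t0 + e} t * (LINT x|lborel. indicator D x * max 0 (L0 - U x t))) / e) \<le>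
      2 * ((1 / (2 * e)) * (LINT (x, t)|lebesgue_on (D \<times> {t0 - e..t0 + e}). \<bar>u x t - u x t0\<bar>))"
  proof eventually_elim
    case (elim e)
    then have e: "0 < e" "e < t0" "e < T - t0" by auto
    have A: "(LINT (x, t)|lebesgue_on (D \<times> {t0 - e..t0 + e}). \<bar>u x t - u x t0\<bar>) = (LINT w|lborel. a e w)"
      unfolding a_def I_def[symmetric]
    proof (rule integral_lebesgue_on_AE[OF Im Wm])
      show "AE w in lborel. w \<in> D \<times> I e \<longrightarrow> (case w of (x, t) \<Rightarrow> \<bar>u x t - u x t0\<bar>) = \<bar>U (fst w) (snd w) - v (fst w)\<bar>"
        using uU vD
      proof eventually_elim
        case (elim w)
        then show ?case using e by (cases w) (auto simp: I_def)
      qed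
    qed
    have inner: "(LINT x|lborel. b e x t) = indicator {t0..t0 + e} t * (LINT x|lborel. indicator D x * max 0 (L0 - U x t))" for t
      unfolding b_def by (rule integral_mult_right_zero)
    have B: "(LINT t|lborel. indicator {t0..t0 + e} t * (LINT x|lborel. indicator D x * max 0 (L0 - U x t))) = (LINT (x, t)|lborel. b e x t)"
      unfolding integral_lborel_Times(2)[OF bi] inner ..
    have "(LINT (x, t)|lborel. b e x t) \<le> (LINT w|lborel. a e w)"
    proof (rule integral_mono_AE[OF bi ai[OF e(1)]])
      show "AE w in lborel. (case w of (x, t) \<Rightarrow> b e x t) \<le> a e w"
        using vD
      proof eventually_elim
        case (elim w)
        show ?case
        proof (cases "fst w \<in> D \<and> snd w \<in> {t0..t0 + e}")
          case True
          then have "w \<in> D \<times> I e" using e(1) by (auto simp: I_def mem_Times_iff)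
          moreover have "max 0 (L0 - U (fst w) (snd w)) \<le> \<bar>U (fst w) (snd w) - v (fst w)\<bar>"
            using elim True by auto
          ultimately show ?thesis using True by (simp add: b_def a_def case_prod_beta')
        next
          case False
          then have "b e (fst w) (snd w) = 0" by (auto simp: b_def)
          then show ?thesis by (simp add: case_prod_beta' a_def)
        qed
      qed
    qed
    moreover have "0 \<le> (LINT (x, t)|lborel. b e x t)"
      by (rule Bochner_Integration.integral_nonneg) (simp add: b_def case_prod_beta')
    ultimately show ?case unfolding B A using e(1) by (simp add: divide_right_mono)
  qed
  moreover have "((\<lambda>e. 2 * ((1 / (2 * e)) * (LINT (x, t)|lebesgue_on (D \<times> {t0 - e..t0 + e}). \<bar>u x t - u x t0\<bar>))) \<longlongrightarrow> 0) (at_right 0)"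
    by (rule tendsto_mult_right_zero[OF lim])
  ultimately show ?thesis by (rule Lim_null_comparison)
qed

text \<open>The dependence of \<theta> is expressed by the order of quantifiers: it is chosen before
  the domain, the final time, the kernel, the solution and the cylinder. Since \<theta> times the
  power of the radius may exceed the time left until \<open>T\<close>, the conclusion is stated on
  the part of the cylinder inside the strip.\<close>

theorem lemma4p4:
  fixes p q s \<Lambda> L a \<mu> :: real
  assumes "1 < p" and "0 < q" and "0 < s" and "s < 1" and "1 \<le> \<Lambda>"
    and "0 < L" and "0 < a" and "a < 1"
  shows "\<exists>\<theta>>0. \<forall>(\<Omega> :: (real^'n) set) T K u.
    bounded_domain \<Omega> \<longrightarrow> 0 < T \<longrightarrow> admissible_kernel p s \<Lambda> T K \<longrightarrow>
    weak_supersolution p q s \<Omega> T K u \<longrightarrow>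
    ereal \<mu> \<le> essinf (lebesgue_on (UNIV \<times> {0<..<T})) (\<lambda>(x, t). ereal (u x t)) \<longrightarrow>
    (\<forall>x0 t0 r. 0 < r \<longrightarrow> ball x0 r \<subseteq> \<Omega> \<longrightarrow> lebesgue_instant \<Omega> T u t0 \<longrightarrow>
      (AE x in lebesgue_on (ball x0 r). u x t0 \<ge> \<mu> + L) \<longrightarrow>
      (AE (x, t) in lebesgue_on (cylinder_plus s p x0 t0 (3 * r / 4) \<theta> \<inter> (UNIV \<times> {0<..<T})).
        u x t \<ge> \<mu> + a * L))"
proof -
  obtain \<theta> where \<theta>: "0 < \<theta>" and main: "\<forall>T M (x0 :: real^'n) r t0 U \<kappa>. 0 < r \<longrightarrow> 0 < t0 \<longrightarrow> t0 < T \<longrightarrow>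
    borel_supersolution p q s \<Lambda> T \<mu> M (ball x0 (7 * r / 8)) U \<kappa> \<longrightarrow>
    ((\<lambda>e. (LINT t|lborel. indicator {t0..t0 + e} t *
        (LINT x|lborel. indicator (ball x0 (7 * r / 8)) x * max 0 (\<mu> + L - U x t))) / e) \<longlongrightarrow> 0) (at_right 0) \<longrightarrow>
    (AE w in lborel. fst w \<in> ball x0 (3 * r / 4) \<and> t0 < snd w \<and> snd w < t0 + \<theta> * r powr (s * p) \<and> snd w < T \<longrightarrow>
      \<mu> + a * L \<le> U (fst w) (snd w))"
    using expansion_of_positivity_borel[where 'n = 'n and \<mu> = \<mu>, OF assms] by (elim exE conjE)
  show ?thesis
  proof (intro exI[of _ \<theta>] conjI \<theta> allI impI)
    fix \<Omega> :: "(real^'n) set" and T K u x0 t0 r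
    assume K: "admissible_kernel p s \<Lambda> T K" and super: "weak_supersolution p q s \<Omega> T K u"
      and inf: "ereal \<mu> \<le> essinf (lebesgue_on (UNIV \<times> {0<..<T})) (\<lambda>(x, t). ereal (u x t))"
      and r: "0 < r" and ball: "ball x0 r \<subseteq> \<Omega>" and inst: "lebesgue_instant \<Omega> T u t0"
      and low: "AE x in lebesgue_on (ball x0 r). u x t0 \<ge> \<mu> + L"
    have t0: "0 < t0" "t0 < T" using inst by (auto simp: lebesgue_instant_def)
    have "(\<lambda>(x, t). u x t) \<in> borel_measurable (lebesgue_on (UNIV \<times> {0<..<T}))"
      "esssup (lebesgue_on (UNIV \<times> {0<..<T})) (\<lambda>(x, t). ereal \<bar>u x t\<bar>) < \<infinity>"
      using super unfolding weak_supersolution_def by blast+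
    from bounded_borel_version[OF this inf] obtain U M where
      Um: "(\<lambda>(x, t). U x t) \<in> borel_measurable borel" and Ub: "\<And>x t. \<mu> \<le> U x t" "\<And>x t. U x t \<le> M" and
      uU: "AE w in lborel. snd w \<in> {0<..<T} \<longrightarrow> u (fst w) (snd w) = U (fst w) (snd w)"
      by blast
    from kernel_borel_version[OF K \<open>1 \<le> \<Lambda>\<close>] obtain \<kappa> where
      \<kappa>m: "(\<lambda>(z, t). \<kappa> (fst z) (snd z) t) \<in> borel_measurable borel" and
      \<kappa>b: "\<And>x y t. gkernel p s x y / \<Lambda> \<le> \<kappa> x y t" "\<And>x y t. \<kappa> x y t \<le> \<Lambda> * gkernel p s x y" and
      K\<kappa>: "AE w in lborel. snd w \<in> {0<..<T} \<longrightarrow> K (fst (fst w)) (snd (fst w)) (snd w) = \<kappa> (fst (fst w)) (snd (fst w)) (snd w)"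
      by blast
    \<comment> \<open>\<open>ball x0 r\<close> itself need not be compactly inside \<open>\<Omega>\<close>.\<close>
    define D where "D = ball x0 (7 * r / 8)"
    have D_ball: "D \<subseteq> ball x0 r" unfolding D_def using r by (intro subset_ball) simp
    have D: "compactly_inside D \<Omega>" "connected D" "bounded D"
    proof -
      have "cball x0 (7 * r / 8) \<subseteq> ball x0 r" using r by auto
      then show "compactly_inside D \<Omega>"
        unfolding compactly_inside_def D_def using r ball by (simp add: closure_ball)
      show "connected D" "bounded D" unfolding D_def by (simp_all add: connected_ball)
    qed
    have S: "borel_supersolution p q s \<Lambda> T \<mu> M D U \<kappa>"
      by (rule weak_supersolution_borel[OF assms(1,2,3,5) super D Um Ub uU \<kappa>m \<kappa>b K\<kappa>])
    have lowD: "AE x in lborel. x \<in> D \<longrightarrow> \<mu> + L \<le> u x t0"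
    proof -
      have "ball x0 r \<in> sets borel" by simp
      from low[unfolded AE_lebesgue_on_iff[OF this]] show ?thesis
        by eventually_elim (use D_ball in blast)
    qed
    \<comment> \<open>The Borel statement reaches the height \<theta> r^(s p), while the cylinder
      scales with its own radius 3r/4 and is shorter.\<close>
    have scale: "b < t0 + \<theta> * r powr (s * p)" if "b < t0 + \<theta> * (3 * r / 4) powr (s * p)" for b
    proof -
      have "\<theta> * (3 * r / 4) powr (s * p) \<le> \<theta> * r powr (s * p)"
        using \<theta> r assms by (intro mult_left_mono powr_mono2) auto
      with that show ?thesis by linarith
    qed
    have "AE w in lborel. fst w \<in> ball x0 (3 * r / 4) \<and> t0 < snd w \<and> snd w < t0 + \<theta> * r powr (s * p) \<and> snd w < T \<longrightarrow>
        \<mu> + a * L \<le> U (fst w) (snd w)"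
      by (rule main[rule_format, OF r t0 S[unfolded D_def] lebesgue_instant_borel[OF inst D(1,3) Um Ub uU lowD, unfolded D_def]])
    moreover have "AE w in (lborel :: ((real^'n) \<times> real) measure). snd w \<noteq> t0"
      by (rule AE_lborel_snd[OF AE_lborel_singleton])
    moreover note uU
    ultimately have "AE w in lborel. w \<in> cylinder_plus s p x0 t0 (3 * r / 4) \<theta> \<inter> (UNIV \<times> {0<..<T}) \<longrightarrow> (case w of (x, t) \<Rightarrow> \<mu> + a * L \<le> u x t)"
      by eventually_elim (auto simp: cylinder_plus_def mem_Times_iff case_prod_beta' dest: scale)
    moreover have "cylinder_plus s p x0 t0 (3 * r / 4) \<theta> \<inter> (UNIV \<times> {0<..<T}) \<in> sets borel"
      unfolding cylinder_plus_def by (intro sets.Int spacetime_borel) auto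
    ultimately show "AE (x, t) in lebesgue_on (cylinder_plus s p x0 t0 (3 * r / 4) \<theta> \<inter> (UNIV \<times> {0<..<T})). u x t \<ge> \<mu> + a * L"
      by (simp only: AE_lebesgue_on_iff)
  qed
qed

end
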